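(* Let $\sigma\in I_F$. Write $\mathbf a_F(\sigma)=(\zeta_0(\sigma),\lambda_0(\sigma))\in\mathbb F_q^\times\times\mathbb F_q$ and $\mathbf a_E(\sigma)=(\zeta(\sigma),\lambda(\sigma))\in\mathbb F_{q^2}^\times\times\mathbb F_{q^2}$. Under the right action of inertia: - $\sigma$ acts on the set $\pi_0(\mathbf Y_{2,2})$ of geometric connected components by $$i=(\zeta,\tilde\mu)\mapsto i\sigma=(\zeta_0(\sigma)^{-1}\zeta,\ \tilde\mu-\lambda_0(\sigma));$$ - $\sigma$ maps $\mathcal S^i_{00}$ to $\mathcal S^{i\sigma}_{00}$ by $$j=(x_0,y_0)\mapsto j\sigma=(\zeta(\sigma)^{-1}x_0,\ \zeta(\sigma)^{-1}y_0);$$ - $\sigma$ acts on the curves $X^i_j$, $i=(\zeta,\tilde\mu)$, $j\in\mathcal S_{00}^i$, by $$\sigma:X^i_j\to X^{i\sigma}_{j\sigma},\qquad(a,z_1)\mapsto\bigl(\zeta(\sigma)^{-(q+1)}(a+\lambda(\sigma)\zeta),\ z_1\bigr).$$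
   Context: **Lubin–Tate space.** $F$ is a non-archimedean local field with ring of integers $\mathcal O_F$, uniformizer $\pi$, residue field $\mathbb F_q$ of characteristic $p\ne2$; $\mathbf C$ is the completion of an algebraic closure of $F$, with ring of integers $\mathcal O_{\mathbf C}$, residue field $k^{\rm ac}$ and valuation $v$, $v(\pi)=1$; a bar denotes reduction. If ${\rm char}\,F=0$ let $f(X)=\sum_{k\ge 0}b_kX^{q^k}\in F[[u,X]]$ with $b_0=1$, $b_{-1}=0$, $\pi b_k=b_{k-1}u^{q^{k-1}}+b_{k-2}$ ($k\ge1$), and $X+_uY=f^{-1}(f(X)+f(Y))$, $[a]_u(X)=f^{-1}(af(X))$ (coefficients in $\mathcal O_F[[u]]$). If ${\rm char}\,F=p$, $F=\mathbb F_q((\pi))$, let $X+_uY=X+Y$, $[\zeta]_u(X)=\zeta X$ ($\zeta\in\mathbb F_q$), $[\pi]_u(X)=\pi X+uX^q+X^{q^2}$. For $u\in\mathbf C$, $v(u)>0$, this gives a formal $\mathcal O_F$-module $\mathcal F_u$ over $\mathcal O_{\mathbf C}$. $\mathcal X(\pi^2)$ is the Lubin–Tate curve whose $\mathbf C$-points are triples $(X_2,Y_2,u)$ with $v(u)>0$ and $(X_2,Y_2)$ a basis of the free $\mathcal O_F/\pi^2$-module $\mathcal F_u[\pi^2]$. The reduction of an affinoid over $\mathbf C$ is ${\rm Spec}$ of power-bounded functions modulo topologically nilpotent ones. **Inertia.** $I_F$ is the inertia group. Its right action on reductions is the one induced by $P\mapsto\sigma^{-1}(P)$ on $\mathbf C$-points,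 i.e. $\overline{\sigma^{-1}(P)}=\overline P\cdot\sigma$. For $L=F$ or the unramified quadratic extension $L=E$, with residue field $k_L$, $\mathbf a_L:I_F=I_L\to\mathcal O_L^\times\to(\mathcal O_L/\pi^2)^\times\simeq k_L^\times\times k_L$ is induced by the reciprocity map normalized so that geometric Frobenius elements go to uniformizers; the last isomorphism is $a_0+a_1\pi\mapsto(\bar a_0,\bar a_1/\bar a_0)$ with $a_0,a_1$ Teichmüller representatives ($a_1$ possibly $0$). **The curves $X^i_j$.** $\mathbf Y_{2,2}=\{v(u)\ge q/(q+1)\}$. Fix $\kappa_1$ with $\kappa_1^{q^3(q^2-1)}=\pi$; put $\kappa=\kappa_1^q$, $\gamma=\kappa^{(q-1)(q^2-1)}$ (fractional powers of $\gamma$ being the corresponding powers of $\kappa_1$), $x=X_2/\kappa$, $y=Y_2/\kappa$. Fix $\gamma_0,\tilde\gamma_0,\tilde\gamma_1$ with $\gamma_0^q-\gamma^q\gamma_0=1$, $\tilde\gamma_0^q=\gamma_0$, $\tilde\gamma_1^q+\tilde\gamma_0+\gamma^{1/q}\tilde\gamma_1=0$. For $i=(\zeta,\tilde\mu)\in\mathbb F_q^\times\times\mathbb F_q\simeq(\mathcal O_F/\pi^2)^\times$ write $[\zeta]\in\mu_{q-1}(\mathcal O_F)$ for the Teichmüller lift. The geometric connected component $\mathbf Y^i_{2,2}$ is the one on which $x^qy-xy^q$ reduces to $\zeta$ and, with $\mathcal Z=(x^qy-xy^q)^q-\gamma(x^{q^3}y-xy^{q^3})$ and $f_1(X,Y)=(X^q-Y^q-(X-Y)^q)/\pi$,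 the function $\gamma^{-q/(q-1)}([\zeta]\gamma_0-\mathcal Z)+f_1(x^{q^2}y^q,x^qy^{q^2})$ reduces to $\tilde\mu\zeta$. $\mathcal S^i_{00}=\{(x_0,y_0)\in((k^{\rm ac})^\times)^2:x_0^qy_0-x_0y_0^q=\zeta,\ x_0^{q^2-1}=y_0^{q^2-1}=-1\}$. For $j=(x_0,y_0)\in\mathcal S^i_{00}$ let $\hat y_0$ be the lift of $y_0$ with $\hat y_0^{q^2-1}=-\tilde\gamma_0^{q-1}$, $w=\gamma^{1/(q(q-1))}$, $w_1=\hat y_0^q\gamma^{1/(q^2-1)}$, and let $\mathbf X^i_j$ be the affinoid of points of $\mathbf Y^i_{2,2}$ with $(\bar x,\bar y)=j$ and $v(y-\hat y_0)\ge v(w_1)=\frac1{q^2(q+1)}$. On it define functions $Z_1,a,z_1$ by $x^qy-xy^q=[\zeta]\tilde\gamma_0+\gamma^{1/q}Z_1$, $Z_1=[\zeta]\tilde\gamma_1+wa$, $y=\hat y_0+w_1z_1$. $X^i_j$ is the reduction of $\mathbf X^i_j$; it is the curve with coordinates (the reductions of) $a,z_1$ and equation $a^q+a=\zeta z_1^{q+1}-c_0$ with $c_0=\tilde\mu\zeta-\bar f_1(x_0^{q^2}y_0^q,x_0^qy_0^{q^2})$. The same conventions define coordinates on $X^{i\sigma}_{j\sigma}$. *)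

theory Defs
  imports
    "HOL-Library.Extended_Real"
    "HOL-Library.FuncSet"
    "HOL-Computational_Algebra.Computational_Algebra"
    "HOL-Algebra.QuotRing"
begin

section \<open>The ground data\<close>

text \<open>
  The type 'c carries the field C and the type 'k its residue field.  The field F is the
  subset base of C, and redn is the reduction map from the valuation ring of C onto its
  residue field (its values outside the valuation ring are irrelevant).
  The last four components are the auxiliary choices
  \<^emph>\<open>kappa_1, gamma_0, tilde gamma_0, tilde gamma_1\<close>.
\<close>

record ('c, 'k) lt_data =
  base :: "'c set"
  val :: "'c \<Rightarrow> ereal"
  unif :: 'c
  redn :: "'c \<Rightarrow> 'k"
  kap1 :: 'c
  gam0 :: 'c
  tgam0 :: 'c
  tgam1 :: 'c

definition tends_to :: "('c::field, 'k::field) lt_data \<Rightarrow> (nat \<Rightarrow> 'c) \<Rightarrow> 'c \<Rightarrow> bool" where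
  "tends_to D s l \<longleftrightarrow> (\<forall>B::real. \<forall>\<^sub>F n in sequentially. ereal B \<le> val D (s n - l))"

definition cauchy_seq :: "('c::field, 'k::field) lt_data \<Rightarrow> (nat \<Rightarrow> 'c) \<Rightarrow> bool" where
  "cauchy_seq D s \<longleftrightarrow> (\<forall>B::real. \<exists>N. \<forall>m\<ge>N. \<forall>n\<ge>N. ereal B \<le> val D (s m - s n))"

definition vsum :: "('c::field, 'k::field) lt_data \<Rightarrow> (nat \<Rightarrow> 'c) \<Rightarrow> 'c" where
  "vsum D s = (THE l. tends_to D (\<lambda>n. \<Sum>k<n. s k) l)"

definition is_subfield :: "'c::field set \<Rightarrow> bool" where
  "is_subfield K \<longleftrightarrow> 0 \<in> K \<and> 1 \<in> K \<and> (\<forall>x\<in>K. \<forall>y\<in>K. x + y \<in> K \<and> x * y \<in> K)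
     \<and> (\<forall>x\<in>K. - x \<in> K \<and> inverse x \<in> K)"

definition algebraic_over :: "'c::field set \<Rightarrow> 'c set" where
  "algebraic_over K = {x. \<exists>p. p \<noteq> 0 \<and> range (coeff p) \<subseteq> K \<and> poly p x = 0}"

definition ints :: "('c::field, 'k::field) lt_data \<Rightarrow> 'c set \<Rightarrow> 'c set" where
  "ints D L = {x \<in> L. 0 \<le> val D x}"

definition resfield :: "('c::field, 'k::field) lt_data \<Rightarrow> 'c set \<Rightarrow> 'k set" where
  "resfield D L = redn D ` ints D L"

definition resq :: "('c::field, 'k::field) lt_data \<Rightarrow> nat" where
  "resq D = card (resfield D (base D))"

definition reduces_to :: "('c::field, 'k::field) lt_data \<Rightarrow> 'c \<Rightarrow> 'k \<Rightarrow> bool" where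
  "reduces_to D x c \<longleftrightarrow> 0 \<le> val D x \<and> redn D x = c"

text \<open>
  F is a non-archimedean local field of residue characteristic different from 2, and C is the
  completion of an algebraic closure of F: C is complete, and the elements of C that are
  algebraic over F form an algebraically closed dense subfield.
\<close>

locale local_field_setting =
  fixes D :: "('c::field, 'k::field) lt_data"
  assumes val_infinity: "val D x = \<infinity> \<longleftrightarrow> x = 0"
    and val_not_minus_infinity: "val D x \<noteq> - \<infinity>"
    and val_mult: "val D (x * y) = val D x + val D y"
    and val_add: "min (val D x) (val D y) \<le> val D (x + y)"
    and complete: "cauchy_seq D s \<Longrightarrow> \<exists>l. tends_to D s l"
    and base_subfield: "is_subfield (base D)"
    and base_complete: "cauchy_seq D s \<Longrightarrow> range s \<subseteq> base D \<Longrightarrow> \<exists>l\<in>base D. tends_to D s l"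
    and unif_base: "unif D \<in> base D" and val_unif: "val D (unif D) = 1"
    and base_discrete: "x \<in> base D \<Longrightarrow> x \<noteq> 0 \<Longrightarrow> \<exists>n::int. val D x = ereal (of_int n)"
    and alg_closed: "range (coeff p) \<subseteq> algebraic_over (base D) \<Longrightarrow> 0 < degree p \<Longrightarrow>
           \<exists>x\<in>algebraic_over (base D). poly p x = 0"
    and alg_dense: "\<exists>y\<in>algebraic_over (base D). ereal B \<le> val D (x - y)"
    and redn_one: "redn D 1 = 1"
    and redn_add: "0 \<le> val D x \<Longrightarrow> 0 \<le> val D y \<Longrightarrow> redn D (x + y) = redn D x + redn D y"
    and redn_mult: "0 \<le> val D x \<Longrightarrow> 0 \<le> val D y \<Longrightarrow> redn D (x * y) = redn D x * redn D y"
    and redn_kernel: "0 \<le> val D x \<Longrightarrow> redn D x = 0 \<longleftrightarrow> 0 < val D x"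
    and redn_surj: "redn D ` {x. 0 \<le> val D x} = UNIV"
    and resfield_finite: "finite (resfield D (base D))"
    and residue_char: "(2::'k) \<noteq> 0"

section \<open>Inertia and the reciprocity map\<close>

definition field_aut :: "('c::field \<Rightarrow> 'c) \<Rightarrow> bool" where
  "field_aut \<sigma> \<longleftrightarrow> bij \<sigma> \<and> (\<forall>x y. \<sigma> (x + y) = \<sigma> x + \<sigma> y) \<and> (\<forall>x y. \<sigma> (x * y) = \<sigma> x * \<sigma> y)"

text \<open>
  The absolute Galois group of a subfield L algebraic over F is identified with the group of
  isometric automorphisms of C over L (the continuous extensions of the automorphisms over L
  of the algebraic closure of F).
\<close>

definition galois_C :: "('c::field, 'k::field) lt_data \<Rightarrow> 'c set \<Rightarrow> ('c \<Rightarrow> 'c) set" where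
  "galois_C D L = {\<sigma>. field_aut \<sigma> \<and> (\<forall>x\<in>L. \<sigma> x = x) \<and> (\<forall>x. val D (\<sigma> x) = val D x)}"

definition inertia :: "('c::field, 'k::field) lt_data \<Rightarrow> 'c set \<Rightarrow> ('c \<Rightarrow> 'c) set" where
  "inertia D L = {\<sigma> \<in> galois_C D L. \<forall>x. 0 \<le> val D x \<longrightarrow> redn D (\<sigma> x) = redn D x}"

definition geom_frobenius :: "('c::field, 'k::field) lt_data \<Rightarrow> 'c set \<Rightarrow> ('c \<Rightarrow> 'c) set" where
  "geom_frobenius D L = {\<sigma> \<in> galois_C D L.
     \<forall>x. 0 \<le> val D x \<longrightarrow> redn D (\<sigma> x) ^ card (resfield D L) = redn D x}"

definition weil_group :: "('c::field, 'k::field) lt_data \<Rightarrow> 'c set \<Rightarrow> ('c \<Rightarrow> 'c) set" where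
  "weil_group D L = {\<sigma> \<in> galois_C D L. \<exists>n::nat.
     (\<forall>x. 0 \<le> val D x \<longrightarrow> redn D (\<sigma> x) = redn D x ^ (card (resfield D L) ^ n)) \<or>
     (\<forall>x. 0 \<le> val D x \<longrightarrow> redn D (\<sigma> x) ^ (card (resfield D L) ^ n) = redn D x)}"

definition finite_extension :: "'c::field set \<Rightarrow> 'c set \<Rightarrow> bool" where
  "finite_extension L M \<longleftrightarrow> is_subfield M \<and> L \<subseteq> M \<and>
     (\<exists>B. finite B \<and> M = {\<Sum>b\<in>B. c b * b | c. \<forall>b\<in>B. c b \<in> L})"

definition gal :: "'c::field set \<Rightarrow> 'c set \<Rightarrow> ('c \<Rightarrow> 'c) set" where
  "gal L M = {\<tau> \<in> extensional M. bij_betw \<tau> M M \<and> (\<forall>x\<in>L. \<tau> x = x) \<and>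
     (\<forall>x\<in>M. \<forall>y\<in>M. \<tau> (x + y) = \<tau> x + \<tau> y \<and> \<tau> (x * y) = \<tau> x * \<tau> y)}"

definition finite_abelian_extension :: "'c::field set \<Rightarrow> 'c set \<Rightarrow> bool" where
  "finite_abelian_extension L M \<longleftrightarrow> finite_extension L M \<and>
     {x \<in> M. \<forall>\<tau>\<in>gal L M. \<tau> x = x} = L \<and>
     (\<forall>\<tau>\<in>gal L M. \<forall>\<tau>'\<in>gal L M. \<forall>x\<in>M. \<tau> (\<tau>' x) = \<tau>' (\<tau> x))"

definition norm_group :: "'c::field set \<Rightarrow> 'c set \<Rightarrow> 'c set" where
  "norm_group L M = (\<lambda>x. \<Prod>\<tau>\<in>gal L M. \<tau> x) ` (M - {0})"

definition uniformizer :: "('c::field, 'k::field) lt_data \<Rightarrow> 'c set \<Rightarrow> 'c \<Rightarrow> bool" where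
  "uniformizer D L t \<longleftrightarrow> t \<in> L \<and> t \<noteq> 0 \<and> 0 < val D t \<and> (\<forall>y\<in>L. 0 < val D y \<longrightarrow> val D t \<le> val D y)"

text \<open>
  The predicate below is the defining property of the reciprocity map of local class field
  theory, as a map from the Weil group of L to the multiplicative group of L: it is a surjective
  homomorphism whose kernel consists of the elements acting trivially on the maximal abelian
  extension, it is compatible with norm groups of finite abelian extensions, and geometric
  Frobenius elements go to uniformizers.  By local class field theory there is exactly one such
  map on the Weil group.
\<close>

definition reciprocity_map ::
    "('c::field, 'k::field) lt_data \<Rightarrow> 'c set \<Rightarrow> (('c \<Rightarrow> 'c) \<Rightarrow> 'c) \<Rightarrow> bool" where
  "reciprocity_map D L r \<longleftrightarrow>
     r ` weil_group D L = L - {0} \<and>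
     (\<forall>\<sigma>\<in>weil_group D L. \<forall>\<tau>\<in>weil_group D L. r (\<sigma> \<circ> \<tau>) = r \<sigma> * r \<tau>) \<and>
     (\<forall>\<sigma>\<in>weil_group D L. r \<sigma> = 1 \<longleftrightarrow> (\<forall>M. finite_abelian_extension L M \<longrightarrow> (\<forall>x\<in>M. \<sigma> x = x))) \<and>
     (\<forall>M. finite_abelian_extension L M \<longrightarrow>
        (\<forall>\<sigma>\<in>weil_group D L. (\<forall>x\<in>M. \<sigma> x = x) \<longleftrightarrow> r \<sigma> \<in> norm_group L M)) \<and>
     (\<forall>\<sigma>\<in>geom_frobenius D L. uniformizer D L (r \<sigma>))"

definition unramified_quadratic :: "('c::field, 'k::field) lt_data \<Rightarrow> 'c set \<Rightarrow> bool" where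
  "unramified_quadratic D E \<longleftrightarrow> is_subfield E \<and> base D \<subseteq> E \<and>
     (\<exists>b. b \<notin> base D \<and> E = {x + y * b | x y. x \<in> base D \<and> y \<in> base D}) \<and>
     card (resfield D E) = card (resfield D (base D)) ^ 2"

text \<open>
  Teichmueller representatives in L (0 included) are the solutions in L of X^{card k_L} = X.
\<close>

definition teich_reps :: "('c::field, 'k::field) lt_data \<Rightarrow> 'c set \<Rightarrow> 'c set" where
  "teich_reps D L = {t \<in> L. t ^ card (resfield D L) = t}"

text \<open>
  For a unit t of the ring of integers of L, congruent to a0 + a1 pi modulo pi^2 with Teichmueller
  representatives a0, a1, the pair of the reductions of a0 and of a1 divided by a0.
\<close>

definition unit_coords ::
    "('c::field, 'k::field) lt_data \<Rightarrow> 'c set \<Rightarrow> 'c \<Rightarrow> 'k \<times> 'k" where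
  "unit_coords D L t = (THE c. \<exists>a0\<in>teich_reps D L. \<exists>a1\<in>teich_reps D L.
     2 \<le> val D (t - (a0 + a1 * unif D)) \<and> c = (redn D a0, redn D a1 / redn D a0))"

section \<open>Formal modules and the Lubin--Tate curve\<close>

fun b_coeff :: "('c::field, 'k::field) lt_data \<Rightarrow> 'c \<Rightarrow> nat \<Rightarrow> 'c" where
  "b_coeff D u 0 = 1"
| "b_coeff D u (Suc 0) = u / unif D"
| "b_coeff D u (Suc (Suc k)) =
     (b_coeff D u (Suc k) * u ^ (resq D ^ Suc k) + b_coeff D u k) / unif D"

definition lt_log :: "('c::field, 'k::field) lt_data \<Rightarrow> 'c \<Rightarrow> 'c fps" where
  "lt_log D u = Abs_fps (\<lambda>n. if \<exists>k. n = resq D ^ k then b_coeff D u (THE k. n = resq D ^ k) else 0)"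

definition fps_val :: "('c::field, 'k::field) lt_data \<Rightarrow> 'c fps \<Rightarrow> 'c \<Rightarrow> 'c" where
  "fps_val D g x = vsum D (\<lambda>n. fps_nth g n * x ^ n)"

definition teich_lift :: "('c::field, 'k::field) lt_data \<Rightarrow> 'k \<Rightarrow> 'c" where
  "teich_lift D c = (THE t. t \<in> teich_reps D (base D) \<and> redn D t = c)"

text \<open>Coefficients a_k of the expansion of a in O_F as a sum of a_k pi^k, a_k Teichmueller.\<close>

fun teich_rem :: "('c::field, 'k::field) lt_data \<Rightarrow> 'c \<Rightarrow> nat \<Rightarrow> 'c" where
  "teich_rem D a 0 = a"
| "teich_rem D a (Suc k) =
     (teich_rem D a k - teich_lift D (redn D (teich_rem D a k))) / unif D"

definition teich_digit :: "('c::field, 'k::field) lt_data \<Rightarrow> 'c \<Rightarrow> nat \<Rightarrow> 'c" where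
  "teich_digit D a k = teich_lift D (redn D (teich_rem D a k))"

definition pi_mult :: "('c::field, 'k::field) lt_data \<Rightarrow> 'c \<Rightarrow> 'c \<Rightarrow> 'c" where
  "pi_mult D u X = unif D * X + u * X ^ resq D + X ^ (resq D ^ 2)"

text \<open>
  Addition and scalar multiplication of the formal module, evaluated at X, Y of positive valuation.
  In characteristic 0 the power series in two variables giving the addition is summed by total
  degree: the coefficient of T^n in the series below, which is f^{-1}(f(XT) + f(YT)), is the
  homogeneous part of degree n evaluated at (X, Y).  In characteristic p the series
  [a]_u is the sum of the a_k [pi]_u^k.
\<close>

definition formal_add :: "('c::field, 'k::field) lt_data \<Rightarrow> 'c \<Rightarrow> 'c \<Rightarrow> 'c \<Rightarrow> 'c" where
  "formal_add D u X Y =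
    (if CHAR('c) = 0 then
       vsum D (fps_nth (fps_compose (fps_inv (lt_log D u))
         (fps_compose (lt_log D u) (fps_const X * fps_X) +
          fps_compose (lt_log D u) (fps_const Y * fps_X))))
     else X + Y)"

definition formal_mult :: "('c::field, 'k::field) lt_data \<Rightarrow> 'c \<Rightarrow> 'c \<Rightarrow> 'c \<Rightarrow> 'c" where
  "formal_mult D u a X =
    (if CHAR('c) = 0 then
       fps_val D (fps_compose (fps_inv (lt_log D u)) (fps_const a * lt_log D u)) X
     else vsum D (\<lambda>k. teich_digit D a k * (pi_mult D u ^^ k) X))"

definition pi2_torsion :: "('c::field, 'k::field) lt_data \<Rightarrow> 'c \<Rightarrow> 'c set" where
  "pi2_torsion D u = {X. 0 < val D X \<and> formal_mult D u (unif D ^ 2) X = 0}"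

text \<open>
  A basis over O_F/pi^2: the coefficients run through representatives in O_F, and
  vanishing modulo pi^2 means valuation at least 2.
\<close>

definition is_basis :: "('c::field, 'k::field) lt_data \<Rightarrow> 'c \<Rightarrow> 'c \<Rightarrow> 'c \<Rightarrow> bool" where
  "is_basis D u X Y \<longleftrightarrow> X \<in> pi2_torsion D u \<and> Y \<in> pi2_torsion D u \<and>
     (\<forall>Z\<in>pi2_torsion D u. \<exists>a\<in>ints D (base D). \<exists>b\<in>ints D (base D).
        Z = formal_add D u (formal_mult D u a X) (formal_mult D u b Y)) \<and>
     (\<forall>a\<in>ints D (base D). \<forall>b\<in>ints D (base D).
        formal_add D u (formal_mult D u a X) (formal_mult D u b Y) = 0 \<longrightarrow>
        2 \<le> val D a \<and> 2 \<le> val D b)"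

text \<open>Points are triples (X_2, Y_2, u).\<close>

type_synonym 'c pt = "'c \<times> 'c \<times> 'c"

definition lubin_tate_curve :: "('c::field, 'k::field) lt_data \<Rightarrow> 'c pt set" where
  "lubin_tate_curve D = {(X, Y, u). 0 < val D u \<and> is_basis D u X Y}"

definition Y22 :: "('c::field, 'k::field) lt_data \<Rightarrow> 'c pt set" where
  "Y22 D = {(X, Y, u) \<in> lubin_tate_curve D. ereal (real (resq D) / real (resq D + 1)) \<le> val D u}"

section \<open>Affinoids, their components and their reductions\<close>

inductive_set poly_funs :: "('c::field pt \<Rightarrow> 'c) set" where
  const: "(\<lambda>_. c) \<in> poly_funs"
| coord1: "(\<lambda>(X, Y, u). X) \<in> poly_funs"
| coord2: "(\<lambda>(X, Y, u). Y) \<in> poly_funs"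
| coord3: "(\<lambda>(X, Y, u). u) \<in> poly_funs"
| add: "f \<in> poly_funs \<Longrightarrow> g \<in> poly_funs \<Longrightarrow> (\<lambda>P. f P + g P) \<in> poly_funs"
| mult: "f \<in> poly_funs \<Longrightarrow> g \<in> poly_funs \<Longrightarrow> (\<lambda>P. f P * g P) \<in> poly_funs"

text \<open>
  The functions on an affinoid S, as functions on its C-points: uniform limits on S of rational
  functions in the coordinates without poles on S.  All affinoids considered are reduced subspaces
  of a closed polydisc in the coordinates (X_2, Y_2, u), so this is the affinoid algebra and its
  topology is given by the supremum norm.  Functions are extended by undefined outside S.
\<close>

definition affinoid_functions ::
    "('c::field, 'k::field) lt_data \<Rightarrow> 'c pt set \<Rightarrow> ('c pt \<Rightarrow> 'c) set" where
  "affinoid_functions D S = {f \<in> extensional S. \<forall>B::real. \<exists>g\<in>poly_funs. \<exists>h\<in>poly_funs.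
     \<forall>P\<in>S. h P \<noteq> 0 \<and> ereal B \<le> val D (f P - g P / h P)}"

text \<open>
  Connected components, through idempotents: a subset of S is open and closed in S iff its
  indicator function is a function on the affinoid S.
\<close>

definition clopen_part :: "('c::field, 'k::field) lt_data \<Rightarrow> 'c pt set \<Rightarrow> 'c pt set \<Rightarrow> bool" where
  "clopen_part D S T \<longleftrightarrow> T \<subseteq> S \<and> (\<lambda>P\<in>S. if P \<in> T then 1 else 0) \<in> affinoid_functions D S"

definition components :: "('c::field, 'k::field) lt_data \<Rightarrow> 'c pt set \<Rightarrow> 'c pt set set" where
  "components D S = {T. clopen_part D S T \<and> T \<noteq> {} \<and>
     (\<forall>T'. clopen_part D S T' \<and> T' \<subseteq> T \<longrightarrow> T' = {} \<or> T' = T)}"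

definition power_bounded ::
    "('c::field, 'k::field) lt_data \<Rightarrow> 'c pt set \<Rightarrow> ('c pt \<Rightarrow> 'c) set" where
  "power_bounded D S = {f \<in> affinoid_functions D S.
     \<exists>B::real. \<forall>n. \<forall>P\<in>S. ereal B \<le> val D (f P ^ n)}"

definition top_nilpotent ::
    "('c::field, 'k::field) lt_data \<Rightarrow> 'c pt set \<Rightarrow> ('c pt \<Rightarrow> 'c) set" where
  "top_nilpotent D S = {f \<in> affinoid_functions D S.
     \<forall>B::real. \<forall>\<^sub>F n in sequentially. \<forall>P\<in>S. ereal B \<le> val D (f P ^ n)}"

definition power_bounded_ring ::
    "('c::field, 'k::field) lt_data \<Rightarrow> 'c pt set \<Rightarrow> ('c pt \<Rightarrow> 'c) ring" where
  "power_bounded_ring D S =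
     \<lparr> carrier = power_bounded D S,
       monoid.mult = (\<lambda>f g. \<lambda>P\<in>S. f P * g P), one = (\<lambda>P\<in>S. 1),
       zero = (\<lambda>P\<in>S. 0), add = (\<lambda>f g. \<lambda>P\<in>S. f P + g P) \<rparr>"

definition reduction_ring ::
    "('c::field, 'k::field) lt_data \<Rightarrow> 'c pt set \<Rightarrow> ('c pt \<Rightarrow> 'c) set ring" where
  "reduction_ring D S = power_bounded_ring D S Quot top_nilpotent D S"

definition red_class ::
    "('c::field, 'k::field) lt_data \<Rightarrow> 'c pt set \<Rightarrow> ('c pt \<Rightarrow> 'c) \<Rightarrow> ('c pt \<Rightarrow> 'c) set" where
  "red_class D S f = top_nilpotent D S +>\<^bsub>power_bounded_ring D S\<^esub> (\<lambda>P\<in>S. f P)"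

text \<open>
  The structure map of the reduction as an algebra over the residue field: a constant c goes to
  the class of the constant function with value any lift of c.
\<close>

definition red_const ::
    "('c::field, 'k::field) lt_data \<Rightarrow> 'c pt set \<Rightarrow> 'k \<Rightarrow> ('c pt \<Rightarrow> 'c) set" where
  "red_const D S c = red_class D S (\<lambda>_. SOME t. reduces_to D t c)"

text \<open>
  The point of the reduction below the C-point P of S, as the homomorphism from the coordinate
  ring of the reduction to the residue field.
\<close>

definition reduced_point ::
    "('c::field, 'k::field) lt_data \<Rightarrow> 'c pt \<Rightarrow> ('c pt \<Rightarrow> 'c) set \<Rightarrow> 'k" where
  "reduced_point D P X = (THE c. \<forall>f\<in>X. redn D (f P) = c)"

text \<open>The action on C-points underlying the right action: P goes to sigma^{-1}(P).\<close>

definition pt_act :: "('c \<Rightarrow> 'c) \<Rightarrow> 'c pt \<Rightarrow> 'c pt" where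
  "pt_act \<sigma> = (\<lambda>(X, Y, u). (inv_into UNIV \<sigma> X, inv_into UNIV \<sigma> Y, inv_into UNIV \<sigma> u))"

text \<open>
  The right action of sigma as a morphism from the reduction of S to the reduction of
  S' = sigma^{-1}(S), given by its map on coordinate rings: a function f on S' goes to
  P \<mapsto> sigma (f (sigma^{-1} P)).  The outer sigma makes this a function on the affinoid S; it has
  no effect on reductions, since sigma in the inertia group acts trivially on the residue field.
\<close>

definition red_act ::
    "('c \<Rightarrow> 'c) \<Rightarrow> 'c pt set \<Rightarrow> ('c pt \<Rightarrow> 'c) set \<Rightarrow> ('c pt \<Rightarrow> 'c) set" where
  "red_act \<sigma> S X = (\<lambda>f. \<lambda>P\<in>S. \<sigma> (f (pt_act \<sigma> P))) ` X"

section \<open>The components of Y22 and the affinoids X\<close>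

definition kap :: "('c::field, 'k::field) lt_data \<Rightarrow> 'c" where
  "kap D = kap1 D ^ resq D"

text \<open>
  Since gamma = kappa_1^(q (q-1) (q^2-1)), the fractional powers of gamma in use are
  gamma^(1/q) = kappa_1^((q-1) (q^2-1)), gamma^(1/(q (q-1))) = kappa_1^(q^2-1),
  gamma^(1/(q^2-1)) = kappa_1^(q (q-1)) and gamma^(q/(q-1)) = kappa_1^(q^2 (q^2-1)).
\<close>

definition gam :: "('c::field, 'k::field) lt_data \<Rightarrow> 'c" where
  "gam D = kap D ^ ((resq D - 1) * (resq D ^ 2 - 1))"

definition gam_q :: "('c::field, 'k::field) lt_data \<Rightarrow> 'c" where
  "gam_q D = kap1 D ^ ((resq D - 1) * (resq D ^ 2 - 1))"

locale lubin_tate_setting = local_field_setting D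
  for D :: "('c::field, 'k::field) lt_data" +
  assumes kap1: "kap1 D ^ (resq D ^ 3 * (resq D ^ 2 - 1)) = unif D"
    and gam0: "gam0 D ^ resq D - gam D ^ resq D * gam0 D = 1"
    and tgam0: "tgam0 D ^ resq D = gam0 D"
    and tgam1: "tgam1 D ^ resq D + tgam0 D + gam_q D * tgam1 D = 0"

definition x_co :: "('c::field, 'k::field) lt_data \<Rightarrow> 'c pt \<Rightarrow> 'c" where
  "x_co D = (\<lambda>(X, Y, u). X / kap D)"

definition y_co :: "('c::field, 'k::field) lt_data \<Rightarrow> 'c pt \<Rightarrow> 'c" where
  "y_co D = (\<lambda>(X, Y, u). Y / kap D)"

definition det_co :: "('c::field, 'k::field) lt_data \<Rightarrow> 'c pt \<Rightarrow> 'c" where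
  "det_co D P = x_co D P ^ resq D * y_co D P - x_co D P * y_co D P ^ resq D"

definition Z_co :: "('c::field, 'k::field) lt_data \<Rightarrow> 'c pt \<Rightarrow> 'c" where
  "Z_co D P = det_co D P ^ resq D
     - gam D * (x_co D P ^ (resq D ^ 3) * y_co D P - x_co D P * y_co D P ^ (resq D ^ 3))"

definition f1 :: "('c::field, 'k::field) lt_data \<Rightarrow> 'c \<Rightarrow> 'c \<Rightarrow> 'c" where
  "f1 D X Y = (X ^ resq D - Y ^ resq D - (X - Y) ^ resq D) / unif D"

definition second_co :: "('c::field, 'k::field) lt_data \<Rightarrow> 'k \<Rightarrow> 'c pt \<Rightarrow> 'c" where
  "second_co D \<zeta> P = (teich_lift D \<zeta> * gam0 D - Z_co D P) / kap1 D ^ (resq D ^ 2 * (resq D ^ 2 - 1))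
     + f1 D (x_co D P ^ (resq D ^ 2) * y_co D P ^ resq D) (x_co D P ^ resq D * y_co D P ^ (resq D ^ 2))"

text \<open>
  S is a geometric connected component of Y22 and i = (zeta, mu) is its index.  The index is a
  relation between i and S, so that no claim on the number of components enters the definition.
\<close>

definition component_of_index ::
    "('c::field, 'k::field) lt_data \<Rightarrow> 'k \<times> 'k \<Rightarrow> 'c pt set \<Rightarrow> bool" where
  "component_of_index D i S \<longleftrightarrow> (case i of (\<zeta>, \<mu>) \<Rightarrow>
     \<zeta> \<in> resfield D (base D) - {0} \<and> \<mu> \<in> resfield D (base D) \<and>
     S \<in> components D (Y22 D) \<and>
     (\<forall>P\<in>S. reduces_to D (det_co D P) \<zeta> \<and> reduces_to D (second_co D \<zeta> P) (\<mu> * \<zeta>)))"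

definition S00 :: "('c::field, 'k::field) lt_data \<Rightarrow> 'k \<times> 'k \<Rightarrow> ('k \<times> 'k) set" where
  "S00 D i = {(x0, y0). x0 \<noteq> 0 \<and> y0 \<noteq> 0 \<and> x0 ^ resq D * y0 - x0 * y0 ^ resq D = fst i \<and>
     x0 ^ (resq D ^ 2 - 1) = - 1 \<and> y0 ^ (resq D ^ 2 - 1) = - 1}"

definition y0_hat :: "('c::field, 'k::field) lt_data \<Rightarrow> 'k \<times> 'k \<Rightarrow> 'c" where
  "y0_hat D j = (THE t. reduces_to D t (snd j) \<and>
     t ^ (resq D ^ 2 - 1) = - (tgam0 D ^ (resq D - 1)))"

definition w_par :: "('c::field, 'k::field) lt_data \<Rightarrow> 'c" where
  "w_par D = kap1 D ^ (resq D ^ 2 - 1)"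

definition w1_par :: "('c::field, 'k::field) lt_data \<Rightarrow> 'k \<times> 'k \<Rightarrow> 'c" where
  "w1_par D j = y0_hat D j ^ resq D * kap1 D ^ (resq D * (resq D - 1))"

text \<open>The affinoid inside the component S attached to the pair j in S00.\<close>

definition X_affinoid ::
    "('c::field, 'k::field) lt_data \<Rightarrow> 'c pt set \<Rightarrow> 'k \<times> 'k \<Rightarrow> 'c pt set" where
  "X_affinoid D S j = {P \<in> S. reduces_to D (x_co D P) (fst j) \<and> reduces_to D (y_co D P) (snd j) \<and>
     val D (w1_par D j) \<le> val D (y_co D P - y0_hat D j)}"

definition Z1_co :: "('c::field, 'k::field) lt_data \<Rightarrow> 'k \<times> 'k \<Rightarrow> 'c pt \<Rightarrow> 'c" where
  "Z1_co D i P = (det_co D P - teich_lift D (fst i) * tgam0 D) / gam_q D"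

definition a_co :: "('c::field, 'k::field) lt_data \<Rightarrow> 'k \<times> 'k \<Rightarrow> 'c pt \<Rightarrow> 'c" where
  "a_co D i P = (Z1_co D i P - teich_lift D (fst i) * tgam1 D) / w_par D"

definition z1_co :: "('c::field, 'k::field) lt_data \<Rightarrow> 'k \<times> 'k \<Rightarrow> 'c pt \<Rightarrow> 'c" where
  "z1_co D j P = (y_co D P - y0_hat D j) / w1_par D j"

end

theory Submission
  imports Defs
begin

text \<open>
  The heart of the proof is an explicit form of Lubin--Tate theory at level two.  Let L be F or E, with
  residue field of cardinality Q and reciprocity map r.  If y^(Q-1) = -pi and pi z + z^Q = y, then
  sigma(z) - [zeta] (z + [lambda] y) has larger valuation than y, where (zeta, lambda) are the
  coordinates of r(sigma).  This only uses the characterization of r: an element tau with r(tau) = pi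
  is a geometric Frobenius element and fixes z, because pi is a norm from L(z), and likewise sigma tau
  fixes the point z' attached to the uniformizer r(sigma) pi, which is close to a combination of z and y
  with explicit coefficients.

  Up to explicit factors, gam0 and beta = tgam0 + gam^(1/q) tgam1 are points z of this kind for F and E,
  respectively, so sigma is known on all constants to the needed precision.  On points, sigma only
  scales x and y by kappa / sigma(kappa), and the formulas for the indices, for a and for z1 follow.
  That sigma preserves Y22 requires the convergence of the formal group law, which is a consequence of
  Hazewinkel's functional equation lemma.
\<close>

section \<open>Valuation calculus\<close>

text \<open>The reciprocity map enters through norm groups, so each use of it needs an abelian
  extension built inside C together with an explicit norm. Both the totally ramified and the
  unramified extensions are generated by one element whose powers are orthogonal for the valuation:
  this yields independence, completeness and control of automorphisms, and approximate roots can be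
  improved to exact ones inside the same field. Inertia elements do not go to uniformizers, so sigma
  is studied through sigma tau with tau a geometric Frobenius fixing z.

  The precision is dictated by the coordinates. The second index function divides
  \<open>gam0 D\<close> by \<open>\<delta>\<close> = gamma^(q/(q-1)), and a divides beta by
  \<open>\<kappa>\<close> = gamma^(1/(q-1)). An error beyond v(y) in the Lubin-Tate formula becomes,
  after division by a power of \<open>kap D\<close>, an error beyond exactly
  v(\<open>\<delta>\<close>) for F and v(\<open>\<kappa>\<close>) for E, which is what fixes the
  residues. Functions are compared in the reduction, so errors must be uniform on the affinoid, and
  the integrality of a and z_1 has to be proved, as it is not part of their definition.\<close>

context local_field_setting
begin

text \<open>Real-valued, so that linear arithmetic applies; \<open>rv 0\<close> is the junk value 0.
  Estimates therefore use \<open>vge\<close> and \<open>vgt\<close>, which hold for 0 at every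
  bound.\<close>

definition rv :: "'c \<Rightarrow> real" where "rv x = real_of_ereal (val D x)"

definition vge :: "real \<Rightarrow> 'c \<Rightarrow> bool" where "vge r x \<longleftrightarrow> ereal r \<le> val D x"

definition vgt :: "real \<Rightarrow> 'c \<Rightarrow> bool" where "vgt r x \<longleftrightarrow> ereal r < val D x"

lemma val_zero [simp]: "val D 0 = \<infinity>"
  by (simp add: val_infinity)

lemma val_rv: "x \<noteq> 0 \<Longrightarrow> val D x = ereal (rv x)"
  unfolding rv_def using val_infinity[of x] val_not_minus_infinity[of x]
  by (cases "val D x") auto

lemma vge_iff: "vge r x \<longleftrightarrow> x = 0 \<or> r \<le> rv x"
  unfolding vge_def by (cases "x = 0") (auto simp: val_rv)

lemma vgt_iff: "vgt r x \<longleftrightarrow> x = 0 \<or> r < rv x"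
  unfolding vgt_def by (cases "x = 0") (auto simp: val_rv)

lemma rv_mult: "x \<noteq> 0 \<Longrightarrow> y \<noteq> 0 \<Longrightarrow> rv (x * y) = rv x + rv y"
  using val_mult[of x y] by (simp add: val_rv)

lemma rv_one [simp]: "rv 1 = 0"
  using rv_mult[of 1 1] by simp

lemma rv_power: "x \<noteq> 0 \<Longrightarrow> rv (x ^ n) = real n * rv x"
  by (induction n) (auto simp: rv_mult algebra_simps)

lemma rv_inverse: "x \<noteq> 0 \<Longrightarrow> rv (inverse x) = - rv x"
  using rv_mult[of x "inverse x"] by simp

lemma rv_divide: "x \<noteq> 0 \<Longrightarrow> y \<noteq> 0 \<Longrightarrow> rv (x / y) = rv x - rv y"
  by (simp add: divide_inverse rv_mult rv_inverse)

lemma rv_uminus [simp]: "rv (- x) = rv x"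
proof (cases "x = 0")
  case False
  have "2 * rv (-1) = rv ((-1) ^ 2)" by (subst rv_power) auto
  then have "rv (-1) = 0" by simp
  then show ?thesis using rv_mult[of "-1" x] False by simp
qed simp

lemma vge_0 [simp]: "vge r 0" and vgt_0 [simp]: "vgt r 0"
  by (auto simp: vge_iff vgt_iff)

lemma vge_uminus [simp]: "vge r (- x) \<longleftrightarrow> vge r x" and vgt_uminus [simp]: "vgt r (- x) \<longleftrightarrow> vgt r x"
  by (auto simp: vge_iff vgt_iff)

lemma vge_mono: "vge r x \<Longrightarrow> s \<le> r \<Longrightarrow> vge s x"
  by (auto simp: vge_iff)

lemma vgt_mono: "vgt r x \<Longrightarrow> s \<le> r \<Longrightarrow> vgt s x"
  by (auto simp: vgt_iff)

lemma vge_vgt: "vge r x \<Longrightarrow> s < r \<Longrightarrow> vgt s x"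
  by (auto simp: vge_iff vgt_iff)

lemma vgt_vge: "vgt r x \<Longrightarrow> s \<le> r \<Longrightarrow> vge s x"
  by (auto simp: vge_iff vgt_iff)

lemma vge_add: "vge r x \<Longrightarrow> vge r y \<Longrightarrow> vge r (x + y)"
  unfolding vge_def using val_add[of x y] by (auto simp: min_def split: if_splits)

lemma vgt_add: "vgt r x \<Longrightarrow> vgt r y \<Longrightarrow> vgt r (x + y)"
  unfolding vgt_def using val_add[of x y] by (auto simp: min_def split: if_splits)

lemma vge_diff: "vge r x \<Longrightarrow> vge r y \<Longrightarrow> vge r (x - y)"
  using vge_add[of r x "- y"] by simp

lemma vgt_diff: "vgt r x \<Longrightarrow> vgt r y \<Longrightarrow> vgt r (x - y)"
  using vgt_add[of r x "- y"] by simp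

lemma vge_diff_commute: "vge r (x - y) \<longleftrightarrow> vge r (y - x)"
  using vge_uminus[of r "x - y"] by simp

lemma vgt_diff_commute: "vgt r (x - y) \<longleftrightarrow> vgt r (y - x)"
  using vgt_uminus[of r "x - y"] by simp

lemma vge_trans: "vge r (x - y) \<Longrightarrow> vge r (y - z) \<Longrightarrow> vge r (x - z)"
  using vge_add[of r "x - y" "y - z"] by simp

lemma vgt_trans: "vgt r (x - y) \<Longrightarrow> vgt r (y - z) \<Longrightarrow> vgt r (x - z)"
  using vgt_add[of r "x - y" "y - z"] by simp

lemma vge_close: "vge r (x - y) \<Longrightarrow> vge r y \<Longrightarrow> vge r x"
  using vge_add[of r "x - y" y] by simp

lemma vge_sum: "(\<And>i. i \<in> A \<Longrightarrow> vge r (f i)) \<Longrightarrow> vge r (sum f A)"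
  by (induction A rule: infinite_finite_induct) (auto intro: vge_add)

lemma vgt_sum: "(\<And>i. i \<in> A \<Longrightarrow> vgt r (f i)) \<Longrightarrow> vgt r (sum f A)"
  by (induction A rule: infinite_finite_induct) (auto intro: vgt_add)

lemma vge_mult: "vge r x \<Longrightarrow> vge s y \<Longrightarrow> t \<le> r + s \<Longrightarrow> vge t (x * y)"
  by (cases "x = 0 \<or> y = 0") (auto simp: vge_iff rv_mult)

lemma vgt_mult: "vge r x \<Longrightarrow> vgt s y \<Longrightarrow> t \<le> r + s \<Longrightarrow> vgt t (x * y)"
  by (cases "x = 0 \<or> y = 0") (auto simp: vge_iff vgt_iff rv_mult)

lemma vgt_mult': "vgt r x \<Longrightarrow> vge s y \<Longrightarrow> t \<le> r + s \<Longrightarrow> vgt t (x * y)"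
  by (cases "x = 0 \<or> y = 0") (auto simp: vge_iff vgt_iff rv_mult)

lemma vge_mult_0: "vge 0 x \<Longrightarrow> vge 0 y \<Longrightarrow> vge 0 (x * y)"
  by (erule vge_mult) auto

lemma vge_1 [simp]: "vge 0 1"
  by (simp add: vge_iff)

lemma vge_power: "vge r x \<Longrightarrow> vge (real n * r) (x ^ n)"
proof (cases "x = 0")
  case True
  then show ?thesis by (cases n) auto
qed (auto simp: vge_iff rv_power mult_left_mono)

lemma vge_power_0: "vge 0 x \<Longrightarrow> vge 0 (x ^ n)"
  using vge_power[of 0 x n] by simp

lemma vge_power_iff: "0 < n \<Longrightarrow> vge r (x ^ n) \<longleftrightarrow> vge (r / real n) x"
  by (cases "x = 0") (auto simp: vge_iff rv_power field_simps)

lemma vgt_power_iff: "0 < n \<Longrightarrow> vgt r (x ^ n) \<longleftrightarrow> vgt (r / real n) x"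
  by (cases "x = 0") (auto simp: vgt_iff rv_power field_simps)

lemma vge_mult_iff: "y \<noteq> 0 \<Longrightarrow> vge r (y * x) \<longleftrightarrow> vge (r - rv y) x"
  by (cases "x = 0") (auto simp: vge_iff rv_mult)

lemma vgt_mult_iff: "y \<noteq> 0 \<Longrightarrow> vgt r (y * x) \<longleftrightarrow> vgt (r - rv y) x"
  by (cases "x = 0") (auto simp: vgt_iff rv_mult)

lemma vge_divide_iff: "y \<noteq> 0 \<Longrightarrow> vge r (x / y) \<longleftrightarrow> vge (r + rv y) x"
  by (cases "x = 0") (auto simp: vge_iff rv_divide)

lemma vgt_divide_iff: "y \<noteq> 0 \<Longrightarrow> vgt r (x / y) \<longleftrightarrow> vgt (r + rv y) x"
  by (cases "x = 0") (auto simp: vgt_iff rv_divide)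

lemma vge_of_nat [simp]: "vge 0 (of_nat n)"
  by (induction n) (auto intro: vge_add)

lemma vge_rv: "vge (rv x) x"
  by (simp add: vge_iff)

text \<open>The isosceles triangle principle: if y had larger valuation than x, then so would x = y
  - (y - x).\<close>

lemma rv_cong: "x \<noteq> 0 \<Longrightarrow> vgt (rv x) (y - x) \<Longrightarrow> y \<noteq> 0 \<and> rv y = rv x"
proof
  assume x: "x \<noteq> 0" and d: "vgt (rv x) (y - x)"
  show y: "y \<noteq> 0" using x d by (auto simp: vgt_iff)
  have "vge (rv x) y" using d by (rule vge_close[OF vgt_vge]) (auto simp: vge_rv)
  moreover have "\<not> vgt (rv x) y"
  proof
    assume "vgt (rv x) y"
    then have "vgt (rv x) (y - (y - x))" using d by (rule vgt_diff)
    then show False using x by (simp add: vgt_iff)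
  qed
  ultimately show "rv y = rv x" using y by (auto simp: vge_iff vgt_iff)
qed

lemma vge_all_imp_0: "(\<And>B. vge B x) \<Longrightarrow> x = 0"
  using vge_iff[of "rv x + 1" x] by auto

subsection \<open>Reduction\<close>

lemma val_ge_0_iff: "0 \<le> val D x \<longleftrightarrow> vge 0 x"
  by (simp add: vge_def zero_ereal_def)

lemma val_gt_0_iff: "0 < val D x \<longleftrightarrow> vgt 0 x"
  by (simp add: vgt_def zero_ereal_def)

lemma redn_0 [simp]: "redn D 0 = 0"
  using redn_kernel[of 0] by simp

lemma redn_eq_0_iff: "vge 0 x \<Longrightarrow> redn D x = 0 \<longleftrightarrow> vgt 0 x"
  using redn_kernel[of x] by (simp add: val_ge_0_iff val_gt_0_iff)

lemma redn_plus: "vge 0 x \<Longrightarrow> vge 0 y \<Longrightarrow> redn D (x + y) = redn D x + redn D y"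
  using redn_add by (simp add: val_ge_0_iff)

lemma redn_times: "vge 0 x \<Longrightarrow> vge 0 y \<Longrightarrow> redn D (x * y) = redn D x * redn D y"
  using redn_mult by (simp add: val_ge_0_iff)

lemma redn_uminus: "vge 0 x \<Longrightarrow> redn D (- x) = - redn D x"
  using redn_plus[of x "- x"] by (simp add: eq_neg_iff_add_eq_0 add.commute)

lemma redn_minus: "vge 0 x \<Longrightarrow> vge 0 y \<Longrightarrow> redn D (x - y) = redn D x - redn D y"
  using redn_plus[of x "- y"] by (simp add: redn_uminus)

lemma redn_power: "vge 0 x \<Longrightarrow> redn D (x ^ n) = redn D x ^ n"
  by (induction n) (auto simp: redn_one redn_times vge_power_0)

lemma redn_sum: "(\<And>i. i \<in> A \<Longrightarrow> vge 0 (f i)) \<Longrightarrow> redn D (sum f A) = (\<Sum>i\<in>A. redn D (f i))"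
  by (induction A rule: infinite_finite_induct) (auto simp: redn_plus vge_sum)

lemma redn_of_nat: "redn D (of_nat n) = of_nat n"
  by (induction n) (auto simp: redn_plus redn_one)

lemma redn_eq_iff: "vge 0 x \<Longrightarrow> vge 0 y \<Longrightarrow> redn D x = redn D y \<longleftrightarrow> vgt 0 (x - y)"
  using redn_eq_0_iff[of "x - y"] by (simp add: redn_minus vge_diff)

lemma redn_cong: "vge 0 y \<Longrightarrow> vgt 0 (x - y) \<Longrightarrow> vge 0 x \<and> redn D x = redn D y"
  using redn_eq_iff vgt_vge vge_close by blast

lemma redn_unit: "vge 0 x \<Longrightarrow> redn D x \<noteq> 0 \<Longrightarrow> x \<noteq> 0 \<and> rv x = 0"
  by (auto simp: redn_eq_0_iff vge_iff vgt_iff)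

lemma redn_nonzero: "x \<noteq> 0 \<Longrightarrow> rv x = 0 \<Longrightarrow> redn D x \<noteq> 0"
  using redn_eq_0_iff[of x] by (auto simp: vge_iff vgt_iff)

lemma redn_inverse:
  assumes "vge 0 x" "redn D x \<noteq> 0"
  shows "redn D (inverse x) = inverse (redn D x)"
proof -
  have x: "x \<noteq> 0" "rv x = 0" using redn_unit assms by auto
  then have "vge 0 (inverse x)" by (simp add: vge_iff rv_inverse)
  then have "redn D x * redn D (inverse x) = 1"
    using redn_times[of x "inverse x"] assms x by (simp add: redn_one)
  then show ?thesis using inverse_unique by metis
qed

lemma redn_divide:
  assumes "vge 0 x" "vge 0 y" "redn D y \<noteq> 0"
  shows "redn D (x / y) = redn D x / redn D y"
proof -
  have "y \<noteq> 0" "rv y = 0" using redn_unit assms by auto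
  then have "vge 0 (inverse y)" by (simp add: vge_iff rv_inverse)
  then show ?thesis using assms by (simp add: divide_inverse redn_times redn_inverse)
qed

lemma redn_lift: obtains x where "vge 0 x" "redn D x = c"
proof -
  have "c \<in> redn D ` {x. 0 \<le> val D x}" by (simp add: redn_surj)
  then show ?thesis using that by (auto simp: val_ge_0_iff)
qed

lemma reduces_to_iff: "reduces_to D x c \<longleftrightarrow> vge 0 x \<and> redn D x = c"
  by (simp add: reduces_to_def val_ge_0_iff)

lemma poly_integral:
  assumes "\<And>i. vge 0 (coeff p i)" "vge 0 x"
  shows "vge 0 (poly p x) \<and> redn D (poly p x) = poly (map_poly (redn D) p) (redn D x)"
  using assms(1)
proof (induction p)
  case (pCons a p)
  have a: "vge 0 a" using pCons.prems[of 0] by simp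
  have "vge 0 (coeff p i)" for i using pCons.prems[of "Suc i"] by simp
  then have "vge 0 (poly p x) \<and> redn D (poly p x) = poly (map_poly (redn D) p) (redn D x)"
    by (rule pCons.IH)
  then show ?case using a assms(2) by (simp add: map_poly_pCons redn_plus redn_times vge_add vge_mult_0)
qed simp

subsection \<open>Limits and contractions\<close>

lemma tends_to_iff: "tends_to D s l \<longleftrightarrow> (\<forall>B. \<exists>N. \<forall>n\<ge>N. vge B (s n - l))"
  by (simp add: tends_to_def vge_def eventually_sequentially)

lemma cauchy_seq_iff: "cauchy_seq D s \<longleftrightarrow> (\<forall>B. \<exists>N. \<forall>m\<ge>N. \<forall>n\<ge>N. vge B (s m - s n))"
  by (simp add: cauchy_seq_def vge_def)

lemma tends_to_unique:
  assumes "tends_to D s l" "tends_to D s l'"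
  shows "l = l'"
proof -
  have "vge B (l - l')" for B
  proof -
    obtain N N' where "\<forall>n\<ge>N. vge B (s n - l)" "\<forall>n\<ge>N'. vge B (s n - l')"
      using assms unfolding tends_to_iff by meson
    then have "vge B (s (max N N') - l)" "vge B (s (max N N') - l')" by auto
    then show ?thesis using vge_diff_commute vge_trans by blast
  qed
  then show ?thesis using vge_all_imp_0[of "l - l'"] by simp
qed

text \<open>In an ultrametric, bounds on consecutive differences bound all later ones. Linear growth
  of the bounds is what contractions and convergent power series produce.\<close>

lemma cauchy_seq_steps:
  assumes "0 < \<epsilon>" "\<And>n. vge (\<delta> + real n * \<epsilon>) (s (Suc n) - s n)"
  shows "cauchy_seq D s" "\<And>n m. n \<le> m \<Longrightarrow> vge (\<delta> + real n * \<epsilon>) (s m - s n)"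
proof -
  show le: "vge (\<delta> + real n * \<epsilon>) (s m - s n)" if "n \<le> m" for n m
    using that
  proof (induction m rule: dec_induct)
    case (step m)
    have "vge (\<delta> + real n * \<epsilon>) (s (Suc m) - s m)"
      using assms(2)[of m] by (rule vge_mono) (use step assms(1) in simp)
    then show ?case using step.IH by (rule vge_trans)
  qed simp
  show "cauchy_seq D s"
    unfolding cauchy_seq_iff
  proof
    fix B
    obtain N where N: "(B - \<delta>) / \<epsilon> \<le> real N" using real_arch_simple by blast
    have "vge B (s m - s N)" if "N \<le> m" for m
      using le[OF that] by (rule vge_mono) (use N assms(1) in \<open>simp add: field_simps\<close>)
    then show "\<exists>N. \<forall>m\<ge>N. \<forall>n\<ge>N. vge B (s m - s n)"
      using vge_diff_commute vge_trans by blast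
  qed
qed

text \<open>Relative to a subset, so that fixed points of contractions are found inside L or L(z)
  and not only in C.\<close>

definition complete_in :: "'c set \<Rightarrow> bool" where
  "complete_in K \<longleftrightarrow> (\<forall>s. cauchy_seq D s \<longrightarrow> range s \<subseteq> K \<longrightarrow> (\<exists>l\<in>K. tends_to D s l))"

lemma complete_in_UNIV: "complete_in UNIV"
  using complete by (auto simp: complete_in_def)

lemma complete_in_base: "complete_in (base D)"
  using base_complete by (auto simp: complete_in_def)

text \<open>Banach's fixed point theorem with an additive gain \<open>\<epsilon>\<close> in
  valuation, on the ball of radius \<open>\<delta>\<close> around the start; the start condition
  keeps all iterates in that ball. Teichmueller lifts, Hensel's lemma and Lubin-Tate points are
  instances.\<close>

lemma contraction_fixpoint:
  assumes K: "complete_in K" and s0: "s0 \<in> K" and eps: "0 < \<epsilon>"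
    and start: "vge \<delta> (\<phi> s0 - s0)"
    and closed: "\<And>x. x \<in> K \<Longrightarrow> vge \<delta> (x - s0) \<Longrightarrow> \<phi> x \<in> K"
    and contr: "\<And>x y r. x \<in> K \<Longrightarrow> y \<in> K \<Longrightarrow> vge \<delta> (x - s0) \<Longrightarrow> vge \<delta> (y - s0) \<Longrightarrow> \<delta> \<le> r \<Longrightarrow>
       vge r (x - y) \<Longrightarrow> vge (r + \<epsilon>) (\<phi> x - \<phi> y)"
  obtains l where "l \<in> K" "vge \<delta> (l - s0)" "\<phi> l = l"
proof -
  define s where "s n = (\<phi> ^^ n) s0" for n
  have s_Suc: "s (Suc n) = \<phi> (s n)" for n by (simp add: s_def)
  have inv: "s n \<in> K \<and> vge \<delta> (s n - s0) \<and> vge (\<delta> + real n * \<epsilon>) (s (Suc n) - s n)" for n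
  proof (induction n)
    case 0
    then show ?case using s0 start by (simp add: s_def)
  next
    case (Suc n)
    have "vge \<delta> (s (Suc n) - s n)" using Suc eps by (auto intro: vge_mono)
    then have near: "vge \<delta> (s (Suc n) - s0)" using Suc vge_trans by blast
    have mem: "s (Suc n) \<in> K" unfolding s_Suc using Suc closed by blast
    have "vge (\<delta> + real n * \<epsilon> + \<epsilon>) (s (Suc (Suc n)) - s (Suc n))"
      unfolding s_Suc[of "Suc n"] s_Suc[of n]
      by (rule contr) (use Suc mem near eps in \<open>auto simp: s_Suc\<close>)
    then show ?case using near mem by (auto simp: algebra_simps)
  qed
  have steps: "\<And>n. vge (\<delta> + real n * \<epsilon>) (s (Suc n) - s n)" using inv by blast
  have "cauchy_seq D s" by (rule cauchy_seq_steps(1)[OF eps steps])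
  moreover have "range s \<subseteq> K" using inv by blast
  ultimately obtain l where l: "l \<in> K" "tends_to D s l" using K unfolding complete_in_def by blast
  have lim: "\<exists>N. \<forall>n\<ge>N. vge B (s n - l)" for B using l(2) unfolding tends_to_iff by blast
  have near: "vge \<delta> (l - s0)"
  proof -
    obtain N where "vge \<delta> (s N - l)" using lim by blast
    then show ?thesis using inv[of N] vge_diff_commute vge_trans by blast
  qed
  have "vge B (\<phi> l - l)" for B
  proof -
    obtain N where N: "\<forall>n\<ge>N. vge (max B \<delta>) (s n - l)" using lim by blast
    have "vge (max B \<delta> + \<epsilon>) (\<phi> (s N) - \<phi> l)"
      by (rule contr) (use N inv l near in auto)
    then have "vge B (s (Suc N) - \<phi> l)" unfolding s_Suc by (rule vge_mono) (use eps in auto)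
    moreover have "vge B (s (Suc N) - l)"
      using N[rule_format, of "Suc N"] by (auto intro: vge_mono)
    ultimately show ?thesis using vge_diff_commute vge_trans by blast
  qed
  then have "\<phi> l = l" using vge_all_imp_0[of "\<phi> l - l"] by simp
  then show ?thesis using that l near by blast
qed

end

section \<open>Local subfields and Teichmueller representatives\<close>

text \<open>Treats F and its unramified quadratic extension E together. Integral valuations make pi
  a uniformizer of L as well, so one Lubin-Tate argument serves both.\<close>

locale local_subfield = local_field_setting D
  for D :: "('c::field, 'k::field) lt_data" +
  fixes L :: "'c set"
  assumes subfield: "is_subfield L"
    and base_sub: "base D \<subseteq> L"
    and complete_L: "complete_in L"
    and discrete: "x \<in> L \<Longrightarrow> x \<noteq> 0 \<Longrightarrow> \<exists>n::int. rv x = of_int n"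
    and fin_resfield: "finite (resfield D L)"
begin

abbreviation "\<pi> \<equiv> unif D"

definition Q :: nat where "Q = card (resfield D L)"

lemma L_0 [simp]: "0 \<in> L" and L_1 [simp]: "1 \<in> L"
  and L_add: "x \<in> L \<Longrightarrow> y \<in> L \<Longrightarrow> x + y \<in> L"
  and L_mult: "x \<in> L \<Longrightarrow> y \<in> L \<Longrightarrow> x * y \<in> L"
  and L_uminus: "x \<in> L \<Longrightarrow> - x \<in> L"
  and L_inverse: "x \<in> L \<Longrightarrow> inverse x \<in> L"
  using subfield by (auto simp: is_subfield_def)

lemma L_diff: "x \<in> L \<Longrightarrow> y \<in> L \<Longrightarrow> x - y \<in> L"
  using L_add[of x "- y"] L_uminus by simp

lemma L_divide: "x \<in> L \<Longrightarrow> y \<in> L \<Longrightarrow> x / y \<in> L"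
  by (simp add: divide_inverse L_mult L_inverse)

lemma L_power: "x \<in> L \<Longrightarrow> x ^ n \<in> L"
  by (induction n) (auto intro: L_mult)

lemma of_nat_base: "of_nat n \<in> base D"
  using base_subfield by (induction n) (auto simp: is_subfield_def)

lemma L_of_nat: "of_nat n \<in> L"
  using of_nat_base base_sub by blast

lemma L_pi [simp]: "\<pi> \<in> L"
  using unif_base base_sub by blast

lemma pi_nz [simp]: "\<pi> \<noteq> 0"
  using val_unif by (metis PInfty_neq_ereal(1) one_ereal_def val_infinity)

lemma rv_pi [simp]: "rv \<pi> = 1"
  using val_unif by (simp add: rv_def)

lemma vgt_L: "x \<in> L \<Longrightarrow> vgt (of_int n) x \<Longrightarrow> vge (of_int n + 1) x"
proof (cases "x = 0")
  assume x: "x \<in> L" "vgt (of_int n) x" "x \<noteq> 0"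
  then obtain m :: int where m: "rv x = of_int m" using discrete by blast
  then have "n < m" using x by (simp add: vgt_iff)
  then have "n + 1 \<le> m" by simp
  then have "real_of_int (n + 1) \<le> real_of_int m" by (simp only: of_int_le_iff)
  then show ?thesis using m by (simp add: vge_iff)
qed simp

lemma vgt0_L: "x \<in> L \<Longrightarrow> vgt 0 x \<Longrightarrow> vge 1 x"
  using vgt_L[of x 0] by simp

subsection \<open>The residue field\<close>

lemma resfield_iff: "c \<in> resfield D L \<longleftrightarrow> (\<exists>x\<in>L. vge 0 x \<and> redn D x = c)"
  by (auto simp: resfield_def ints_def val_ge_0_iff)

lemma redn_resfield: "x \<in> L \<Longrightarrow> vge 0 x \<Longrightarrow> redn D x \<in> resfield D L"
  by (auto simp: resfield_iff)

lemma resfield_0: "0 \<in> resfield D L" and resfield_1: "1 \<in> resfield D L"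
  using redn_resfield[of 0] redn_resfield[of 1] by (auto simp: redn_one)

lemma resfield_mult: "c \<in> resfield D L \<Longrightarrow> d \<in> resfield D L \<Longrightarrow> c * d \<in> resfield D L"
  unfolding resfield_iff by (metis L_mult redn_times vge_mult_0)

lemma resfield_add: "c \<in> resfield D L \<Longrightarrow> d \<in> resfield D L \<Longrightarrow> c + d \<in> resfield D L"
  unfolding resfield_iff by (metis L_add redn_plus vge_add)

lemma resfield_uminus: "c \<in> resfield D L \<Longrightarrow> - c \<in> resfield D L"
  unfolding resfield_iff by (metis L_uminus redn_uminus vge_uminus)

lemma Q_pos: "0 < Q"
  unfolding Q_def using fin_resfield resfield_0 card_gt_0_iff by blast

text \<open>Multiplication by a nonzero residue permutes the finite set of nonzero residues;
  comparing the products over this set gives c^(Q-1) = 1.\<close>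

lemma fermat: 
  assumes c: "c \<in> resfield D L"
  shows "c ^ Q = c"
proof (cases "c = 0")
  case True
  then show ?thesis using Q_pos by simp
next
  case False
  define S where "S = resfield D L - {0}"
  have fin: "finite S" using fin_resfield by (simp add: S_def)
  have inj: "inj_on (\<lambda>x. c * x) S" using False by (auto intro: inj_onI)
  have "(\<lambda>x. c * x) ` S \<subseteq> S" using c False by (auto simp: S_def resfield_mult)
  then have "(\<lambda>x. c * x) ` S = S" using endo_inj_surj[OF fin _ inj] by blast
  then have "prod id S = (\<Prod>x\<in>S. c * x)"
    using prod.reindex[OF inj, of id] by simp
  also have "\<dots> = c ^ card S * prod id S" by (simp add: prod.distrib)
  finally have "c ^ card S * prod id S = prod id S" by simp
  moreover have "prod id S \<noteq> 0" using fin by (simp add: S_def)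
  ultimately have "c ^ card S = 1" by simp
  moreover have "Q = Suc (card S)"
    unfolding Q_def S_def using fin_resfield resfield_0 by (metis card_Suc_Diff1)
  ultimately show ?thesis by simp
qed

text \<open>Residue characteristic different from 2 makes 0, 1 and -1 distinct. The bound gives Q r
  >= 2 r and more, the gain used in the contractions.\<close>

lemma Q_ge_3: "3 \<le> Q"
proof -
  have "(1::'k) \<noteq> - 1"
    using residue_char by (metis add.right_inverse one_add_one)
  then have "card {0, 1, -1::'k} = 3" by simp
  moreover have "{0, 1, -1} \<subseteq> resfield D L"
    using resfield_0 resfield_1 resfield_uminus[of 1] by auto
  ultimately show ?thesis unfolding Q_def using fin_resfield card_mono by metis
qed

lemma Q_ge_1: "1 < Q" "Q \<noteq> 0" using Q_ge_3 by auto

lemma odd_Q: "odd Q"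
proof
  assume "even Q"
  then have "(-1::'k) ^ Q = 1" by simp
  moreover have "(-1::'k) ^ Q = -1" using fermat resfield_1 resfield_uminus by blast
  ultimately have "(1::'k) + 1 = 0" by (metis add.right_inverse)
  then show False using residue_char by simp
qed

text \<open>X^Q - X has at most Q roots and the residue field already supplies Q of them. Membership
  in the residue field thus becomes an equation, visibly stable under inverses.\<close>

lemma frobenius_roots: "c ^ Q = c \<longleftrightarrow> c \<in> resfield D L"
proof
  assume c: "c ^ Q = c"
  define p :: "'k poly" where "p = monom 1 Q - monom 1 1"
  have deg: "degree p \<le> Q" unfolding p_def
    by (intro degree_diff_le) (use Q_ge_1 in \<open>auto simp: degree_monom_eq\<close>)
  have "coeff p Q = 1" using Q_ge_3 by (simp add: p_def)
  then have p: "p \<noteq> 0" by auto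
  have roots: "{x. poly p x = 0} = {x. x ^ Q = x}" by (auto simp: p_def poly_monom)
  have "card {x. poly p x = 0} \<le> Q" using card_poly_roots_bound[OF p] deg by simp
  moreover have "resfield D L \<subseteq> {x. poly p x = 0}" unfolding roots using fermat by auto
  moreover have "finite {x. poly p x = 0}" using p poly_roots_finite by blast
  ultimately have "resfield D L = {x. poly p x = 0}"
    by (intro card_seteq) (auto simp: Q_def)
  then show "c \<in> resfield D L" using c roots by auto
qed (rule fermat)

text \<open>The polynomial (X + 1)^Q - X^Q - 1 vanishes on the residue field, which has more elements
  than its degree.\<close>

lemma binomial_residue_0:
  assumes "0 < i" "i < Q"
  shows "of_nat (Q choose i) = (0::'k)"
proof -
  define p :: "'k poly" where "p = (\<Sum>j\<in>{1..<Q}. monom (of_nat (Q choose j)) j)"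
  have "poly p x = 0" if "x \<in> resfield D L" for x
  proof -
    have "(x + 1) ^ Q = (\<Sum>j\<le>Q. of_nat (Q choose j) * x ^ j)"
      using binomial_ring[of x 1 Q] by simp
    also have "{..Q} = insert 0 (insert Q {1..<Q})" using Q_ge_3 by auto
    also have "(\<Sum>j\<in>\<dots>. of_nat (Q choose j) * x ^ j) = 1 + x ^ Q + poly p x"
      using Q_ge_3 by (simp add: p_def poly_sum poly_monom)
    finally show ?thesis
      using fermat[OF that] fermat[of "x + 1"] resfield_add[OF that resfield_1] by simp
  qed
  then have sub: "resfield D L \<subseteq> {x. poly p x = 0}" by auto
  have "degree p \<le> Q - 1" unfolding p_def
    by (intro degree_sum_le) (auto intro: order.trans[OF degree_monom_le])
  then have deg: "degree p < Q" using Q_ge_3 by linarith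
  have "p = 0"
  proof (rule ccontr)
    assume p: "p \<noteq> 0"
    have "Q \<le> card {x. poly p x = 0}"
      unfolding Q_def using sub p by (intro card_mono poly_roots_finite) auto
    then show False using card_poly_roots_bound[OF p] deg by linarith
  qed
  then have "coeff p i = 0" by simp
  moreover have "coeff p i = of_nat (Q choose i)"
    unfolding p_def coeff_sum using assms by (simp add: sum.delta')
  ultimately show ?thesis by simp
qed

text \<open>A binomial coefficient vanishing in the residue field has positive valuation and lies in
  L, so discreteness raises the bound to 1. This covers mixed and equal characteristic
  alike.\<close>

lemma vge_binomial:
  assumes "0 < i" "i < Q"
  shows "vge 1 (of_nat (Q choose i))"
proof (rule vgt0_L)
  show "vgt 0 (of_nat (Q choose i))"
    using redn_of_nat[of "Q choose i"] binomial_residue_0[OF assms]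
    by (subst redn_eq_0_iff[symmetric]) auto
qed (rule L_of_nat)

lemma binomial_split:
  "(x + y) ^ Q = x ^ Q + y ^ Q + (\<Sum>j\<in>{1..<Q}. of_nat (Q choose j) * x ^ j * y ^ (Q - j))"
  for x y :: "'b::comm_ring_1"
proof -
  have "{..Q} = insert 0 (insert Q {1..<Q})" using Q_ge_3 by auto
  then show ?thesis using Q_ge_3 by (simp add: binomial_ring)
qed

lemma frob_add_residue: "(x + y) ^ Q = x ^ Q + (y::'k) ^ Q"
  using binomial_split[of x y] binomial_residue_0 by simp

lemma frob_uminus: "(- x) ^ Q = - ((x::'b::comm_ring_1) ^ Q)"
  using odd_Q by simp

lemma frob_diff_residue: "(x - y) ^ Q = x ^ Q - (y::'k) ^ Q"
  using frob_add_residue[of x "- y"] by (simp add: frob_uminus)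

lemma frob_inj_residue: "x ^ Q = (y::'k) ^ Q \<Longrightarrow> x = y"
  using frob_diff_residue[of x y] Q_pos by simp

lemma frob_pow_inj_residue: "x ^ (Q ^ n) = (y::'k) ^ (Q ^ n) \<Longrightarrow> x = y"
  by (induction n) (auto simp: power_mult mult.commute[of Q] dest: frob_inj_residue)

text \<open>Every mixed binomial term carries a coefficient of valuation at least 1, at least one
  factor x and at least one factor y.\<close>

lemma frob_add:
  assumes x: "vge \<alpha> x" and y: "vge \<beta> y" and "0 \<le> \<alpha>" "0 \<le> \<beta>"
  shows "vge (1 + \<alpha> + \<beta>) ((x + y) ^ Q - x ^ Q - y ^ Q)"
proof -
  have "vge (1 + \<alpha> + \<beta>) (of_nat (Q choose j) * x ^ j * y ^ (Q - j))" if "j \<in> {1..<Q}" for j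
  proof (rule vge_mult[OF vge_mult])
    show "vge 1 (of_nat (Q choose j))" using that by (intro vge_binomial) auto
    show "vge (real j * \<alpha>) (x ^ j)" "vge (real (Q - j) * \<beta>) (y ^ (Q - j))"
      using x y by (auto intro: vge_power)
    have "1 * \<alpha> \<le> real j * \<alpha>" "1 * \<beta> \<le> real (Q - j) * \<beta>"
      using that assms by (intro mult_right_mono; auto)+
    then show "1 + \<alpha> + \<beta> \<le> 1 + \<alpha> + real (Q - j) * \<beta>" "1 + \<alpha> \<le> 1 + real j * \<alpha>" by auto
  qed
  then have "vge (1 + \<alpha> + \<beta>) (\<Sum>j\<in>{1..<Q}. of_nat (Q choose j) * x ^ j * y ^ (Q - j))"
    by (rule vge_sum)
  then show ?thesis unfolding binomial_split by simp
qed

lemma frob_diff: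
  assumes "vge \<alpha> x" and "vge \<beta> y" and "0 \<le> \<alpha>" "0 \<le> \<beta>"
  shows "vge (1 + \<alpha> + \<beta>) ((x - y) ^ Q - x ^ Q + y ^ Q)"
  using frob_add[of \<alpha> x \<beta> "- y"] assms by (simp add: frob_uminus)

text \<open>Writing x as (x - y) + y, the pure power contributes Q r and the mixed terms 1 + r +
  \<open>\<beta>\<close>. This is the source of the gain in the contractions built from Q-th
  powers.\<close>

lemma frob_contr:
  assumes "vge \<beta> y" "vge r (x - y)" "0 \<le> \<beta>" "0 \<le> r"
  shows "vge (min (real Q * r) (1 + r + \<beta>)) (x ^ Q - y ^ Q)"
proof -
  have "vge (1 + r + \<beta>) ((x - y + y) ^ Q - (x - y) ^ Q - y ^ Q)"
    using assms by (intro frob_add) auto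
  moreover have "vge (real Q * r) ((x - y) ^ Q)" using assms by (intro vge_power)
  ultimately have "vge (min (real Q * r) (1 + r + \<beta>)) ((x - y + y) ^ Q - (x - y) ^ Q - y ^ Q + (x - y) ^ Q)"
    by (intro vge_add) (auto elim: vge_mono)
  then show ?thesis by simp
qed

lemma frob_cong_mod:
  assumes "vge 0 y" "vge r (x - y)" "0 \<le> r" "r \<le> 1"
  shows "vge r (x ^ Q - y ^ Q)"
proof -
  have "1 * r \<le> real Q * r" using Q_ge_3 assms by (intro mult_right_mono) auto
  then show ?thesis using frob_contr[OF assms(1,2)] assms by (auto elim!: vge_mono)
qed

text \<open>Frobenius is injective on residues, so t reduces to 1. With r = v(t - 1) > 0 the mixed
  terms in t^Q = 1 give v((t - 1)^Q) >= 1 + r > 1. It is applied later to the wild part of the root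
  of unity by which inertia changes \<open>kap D\<close>.\<close>

lemma root_of_unity_near_1:
  assumes "t ^ Q = 1"
  shows "vgt (1 / real Q) (t - 1)"
proof (cases "t = 1")
  case False
  have "t \<noteq> 0" using assms Q_pos by (auto simp: zero_power)
  then have "rv t = 0" using assms rv_power[of t Q] Q_pos by simp
  then have t: "vge 0 t" by (simp add: vge_iff)
  have "redn D t ^ Q = 1 ^ Q" using assms redn_power[OF t, of Q] by (simp add: redn_one)
  then have "redn D t = redn D 1" using frob_inj_residue redn_one by metis
  then have d: "vgt 0 (t - 1)" using redn_eq_iff t by simp
  then have pos: "0 < rv (t - 1)" using False by (simp add: vgt_iff)
  have "vge (1 + rv (t - 1) + 0) ((t - 1 + 1) ^ Q - (t - 1) ^ Q - 1 ^ Q)"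
    using pos by (intro frob_add) (auto simp: vge_rv)
  then have "vge (1 + rv (t - 1)) ((t - 1) ^ Q)" using assms by simp
  then have "vgt 1 ((t - 1) ^ Q)" by (rule vge_vgt) (use pos in simp)
  then show ?thesis using vgt_power_iff Q_pos by blast
qed simp

subsection \<open>Teichmueller representatives\<close>

lemma teich_integral: "t ^ Q = t \<Longrightarrow> vge 0 t"
  using rv_power[of t Q] Q_ge_3 by (cases "t = 0") (auto simp: vge_iff)

lemma teich_unit: "t ^ Q = t \<Longrightarrow> t \<noteq> 0 \<Longrightarrow> rv t = 0 \<and> t ^ (Q - 1) = 1 \<and> redn D t \<noteq> 0"
proof -
  assume t: "t ^ Q = t" "t \<noteq> 0"
  then have "rv t = 0" using rv_power[of t Q] Q_ge_3 by auto
  moreover have "t * t ^ (Q - 1) = t * 1" using t Q_pos by (metis mult.right_neutral power_eq_if neq0_conv)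
  ultimately show ?thesis using t redn_nonzero by simp
qed

text \<open>Taking Q-th powers strictly increases the valuation of a difference that is already
  positive, so two fixed points with the same residue coincide.\<close>

lemma teich_unique:
  assumes "t ^ Q = t" "s ^ Q = s" "redn D t = redn D s"
  shows "t = s"
proof (rule ccontr)
  assume ne: "t \<noteq> s"
  have int: "vge 0 t" "vge 0 s" using assms teich_integral by auto
  then have "vgt 0 (t - s)" using assms redn_eq_iff by blast
  then have pos: "0 < rv (t - s)" using ne by (simp add: vgt_iff)
  have "vge (min (real Q * rv (t - s)) (1 + rv (t - s) + 0)) (t ^ Q - s ^ Q)"
    using int pos by (intro frob_contr) (auto simp: vge_rv)
  moreover have "1 * rv (t - s) < real Q * rv (t - s)"
    using pos Q_ge_3 by (intro mult_strict_right_mono) auto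
  ultimately have "vgt (rv (t - s)) (t - s)" using assms by (auto elim!: vge_vgt)
  then show False using ne by (simp add: vgt_iff)
qed

text \<open>Iterates x -> x^Q from any lift: by \<open>fermat\<close> the first step moves it by
  valuation at least 1, and from there every step gains at least 1.\<close>

lemma teich_exists:
  assumes "c \<in> resfield D L"
  shows "\<exists>t\<in>L. t ^ Q = t \<and> redn D t = c"
proof -
  obtain s0 where s0: "s0 \<in> L" "vge 0 s0" "redn D s0 = c" using assms resfield_iff by blast
  have "redn D (s0 ^ Q) = redn D s0" using s0 fermat[OF assms] by (simp add: redn_power)
  then have start: "vge 1 (s0 ^ Q - s0)"
    using s0 redn_eq_iff[of "s0 ^ Q" s0] by (intro vgt0_L L_diff L_power) (auto simp: vge_power_0)
  obtain l where "l \<in> L" "vge 1 (l - s0)" "l ^ Q = l"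
  proof (rule contraction_fixpoint[where \<phi> = "\<lambda>x. x ^ Q", OF complete_L s0(1) zero_less_one start])
    fix x y r assume *: "vge 1 (x - s0)" "vge 1 (y - s0)" "1 \<le> r" "vge r (x - y)"
    have "vge 0 y" using *(2) s0(2) vge_mono[of 1 _ 0] vge_close[of 0 y s0] by simp
    then have "vge (min (real Q * r) (1 + r + 0)) (x ^ Q - y ^ Q)"
      using * by (intro frob_contr) auto
    moreover have "2 * r \<le> real Q * r" using * Q_ge_3 by (intro mult_right_mono) auto
    ultimately show "vge (r + 1) (x ^ Q - y ^ Q)" using * by (auto elim!: vge_mono)
  qed (auto intro: L_power)
  moreover from this have "redn D l = c" using redn_cong[OF s0(2)] s0(3) vge_vgt by (metis zero_less_one)
  ultimately show ?thesis by blast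
qed

definition teich :: "'k \<Rightarrow> 'c" where "teich c = (THE t. t \<in> teich_reps D L \<and> redn D t = c)"

lemma teich_reps_iff: "t \<in> teich_reps D L \<longleftrightarrow> t \<in> L \<and> t ^ Q = t"
  by (simp add: teich_reps_def Q_def)

lemma teich:
  assumes "c \<in> resfield D L"
  shows "teich c \<in> L" "teich c ^ Q = teich c" "redn D (teich c) = c" "vge 0 (teich c)"
proof -
  have "\<exists>!t. t \<in> teich_reps D L \<and> redn D t = c"
    using teich_exists[OF assms] teich_unique unfolding teich_reps_iff by metis
  then have *: "teich c \<in> teich_reps D L \<and> redn D (teich c) = c"
    unfolding teich_def by (rule theI')
  then show "teich c \<in> L" "teich c ^ Q = teich c" "redn D (teich c) = c"
    by (auto simp: teich_reps_iff)
  then show "vge 0 (teich c)" using teich_integral by blast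
qed

lemma teich_redn: "t \<in> L \<Longrightarrow> t ^ Q = t \<Longrightarrow> teich (redn D t) = t"
  using teich redn_resfield teich_integral teich_unique by metis

lemma teich_mult:
  "c \<in> resfield D L \<Longrightarrow> d \<in> resfield D L \<Longrightarrow> teich (c * d) = teich c * teich d"
  using teich_unique[of "teich (c * d)" "teich c * teich d"] teich
  by (simp add: resfield_mult redn_times power_mult_distrib)

lemma resfield_inverse: "c \<in> resfield D L \<Longrightarrow> inverse c \<in> resfield D L"
  by (simp add: frobenius_roots[symmetric] power_inverse)

lemma resfield_divide: "c \<in> resfield D L \<Longrightarrow> d \<in> resfield D L \<Longrightarrow> c / d \<in> resfield D L"
  using resfield_mult resfield_inverse by (simp add: divide_inverse)

lemma resfield_diff: "c \<in> resfield D L \<Longrightarrow> d \<in> resfield D L \<Longrightarrow> c - d \<in> resfield D L"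
  using resfield_add[of c "- d"] resfield_uminus by simp

lemma root_of_unity_L:
  assumes "t ^ (Q - 1) = 1"
  shows "t \<in> L" "t ^ Q = t"
proof -
  show tQ: "t ^ Q = t" using assms Q_pos by (metis mult.right_neutral power_eq_if neq0_conv)
  then have "redn D t \<in> resfield D L"
    using frobenius_roots teich_integral redn_power by metis
  then show "t \<in> L" using teich teich_unique tQ by metis
qed

text \<open>Peels off two Teichmueller digits of u and checks that u modulo pi^2 determines them,
  which resolves the \<open>THE\<close>. As the second coordinate is the ratio a1/a0, the sum a0 +
  a1 pi takes the multiplicative form [c0] (1 + [c1] pi) suited to Lubin-Tate theory.\<close>

lemma unit_coords_eq:
  assumes u: "u \<in> L" "vge 0 u" "redn D u \<noteq> 0" and uc: "unit_coords D L u = (c0, c1)"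
  shows "c0 = redn D u" "c1 \<in> resfield D L" "c0 \<in> resfield D L"
    "vge 2 (u - teich c0 * (1 + teich c1 * \<pi>))"
proof -
  define a0 where "a0 = teich (redn D u)"
  have r0: "redn D u \<in> resfield D L" using u redn_resfield by blast
  note a0 = teich[OF r0, folded a0_def]
  have "vgt 0 (u - a0)" using a0 u redn_eq_iff by metis
  then have d1: "vge 1 (u - a0)" using a0 u by (intro vgt0_L L_diff)
  define v where "v = (u - a0) / \<pi>"
  have v: "v \<in> L" "vge 0 v" using d1 a0 u by (auto simp: v_def vge_divide_iff intro!: L_divide L_diff)
  have r1: "redn D v \<in> resfield D L" using v redn_resfield by blast
  define a1 where "a1 = teich (redn D v)"
  note a1 = teich[OF r1, folded a1_def]
  have "vgt 0 (v - a1)" using a1 v redn_eq_iff by metis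
  then have "vge 1 (v - a1)" using a1 v by (intro vgt0_L L_diff)
  then have "vge 2 ((v - a1) * \<pi>)" by (rule vge_mult[OF _ vge_rv]) simp
  moreover have "v * \<pi> = u - a0" by (simp add: v_def)
  then have "(v - a1) * \<pi> = u - (a0 + a1 * \<pi>)" by (simp add: algebra_simps)
  ultimately have d2: "vge 2 (u - (a0 + a1 * \<pi>))" by simp
  have "unit_coords D L u = (redn D a0, redn D a1 / redn D a0)"
    unfolding unit_coords_def
  proof (rule the_equality)
    show "\<exists>b0\<in>teich_reps D L. \<exists>b1\<in>teich_reps D L. 2 \<le> val D (u - (b0 + b1 * \<pi>)) \<and>
        (redn D a0, redn D a1 / redn D a0) = (redn D b0, redn D b1 / redn D b0)"
      using d2 a0 a1 by (intro bexI[of _ a0] bexI[of _ a1]) (auto simp: teich_reps_iff vge_def)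
  next
    fix c assume "\<exists>b0\<in>teich_reps D L. \<exists>b1\<in>teich_reps D L. 2 \<le> val D (u - (b0 + b1 * \<pi>)) \<and>
        c = (redn D b0, redn D b1 / redn D b0)"
    then obtain b0 b1 where b: "b0 \<in> L" "b0 ^ Q = b0" "b1 \<in> L" "b1 ^ Q = b1"
      "vge 2 (u - (b0 + b1 * \<pi>))" "c = (redn D b0, redn D b1 / redn D b0)"
      by (auto simp: teich_reps_iff vge_def)
    have int: "vge 0 b0" "vge 0 b1" using b teich_integral by auto
    have e: "vge 2 ((a0 + a1 * \<pi>) - (b0 + b1 * \<pi>))" using d2 b(5) vge_trans vge_diff_commute by blast
    have "vge 1 ((b1 - a1) * \<pi>)" by (rule vge_mult[OF vge_diff vge_rv]) (use int a1 in auto)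
    then have "vge 1 ((a0 + a1 * \<pi>) - (b0 + b1 * \<pi>) + (b1 - a1) * \<pi>)"
      using e by (intro vge_add) (auto elim: vge_mono)
    then have "vgt 0 (a0 - b0)" by (intro vge_vgt[of 1]) (auto simp: algebra_simps)
    then have "redn D a0 = redn D b0" using redn_eq_iff a0 int by metis
    then have ab0: "a0 = b0" using teich_unique a0 b by metis
    then have "vge 2 (\<pi> * (a1 - b1))" using e by (simp add: algebra_simps)
    then have "vgt 0 (a1 - b1)" by (intro vge_vgt[of 1]) (auto simp: vge_mult_iff)
    then have "redn D a1 = redn D b1" using redn_eq_iff a1 int by metis
    then show "c = (redn D a0, redn D a1 / redn D a0)" using ab0 b by simp
  qed
  then have c: "c0 = redn D u" "c1 = redn D v / redn D u" using uc a0 a1 by auto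
  then show "c0 = redn D u" "c0 \<in> resfield D L" "c1 \<in> resfield D L"
    using r0 r1 resfield_divide by auto
  have "redn D v = c0 * c1" using c u by simp
  then have "a1 = teich c0 * teich c1"
    using teich_mult \<open>c0 \<in> resfield D L\<close> \<open>c1 \<in> resfield D L\<close> by (simp add: a1_def)
  moreover have "a0 = teich c0" using c by (simp add: a0_def)
  ultimately show "vge 2 (u - teich c0 * (1 + teich c1 * \<pi>))"
    using d2 by (simp add: algebra_simps)
qed

end

lemma (in local_field_setting) base_local_subfield: "local_subfield D (base D)"
proof unfold_locales
  show "\<exists>n::int. rv x = of_int n" if "x \<in> base D" "x \<noteq> 0" for x
    using base_discrete[OF that] that(2) by (auto simp: val_rv)
qed (auto simp: base_subfield complete_in_base resfield_finite)

section \<open>Simple Galois extensions\<close>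

definition polys_over :: "'c::field set \<Rightarrow> 'c poly set" where
  "polys_over L = {p. \<forall>i. coeff p i \<in> L}"

text \<open>Values of polynomials at the generator; that they form a field is derived in
  \<open>simple_minimal\<close>, where the generator is algebraic.\<close>

definition simple_ext :: "'c::field set \<Rightarrow> 'c \<Rightarrow> 'c set" where
  "simple_ext L \<xi> = {poly p \<xi> | p. p \<in> polys_over L}"

lemma polys_over_pCons_iff: "pCons a p \<in> polys_over L \<longleftrightarrow> a \<in> L \<and> p \<in> polys_over L"
  by (force simp: polys_over_def coeff_pCons split: nat.splits)

locale field_subset =
  fixes L :: "'c::field set"
  assumes subfield_L: "is_subfield L"
begin

lemma L0 [simp]: "0 \<in> L" and L1 [simp]: "1 \<in> L"
  and Ladd: "x \<in> L \<Longrightarrow> y \<in> L \<Longrightarrow> x + y \<in> L"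
  and Lmult: "x \<in> L \<Longrightarrow> y \<in> L \<Longrightarrow> x * y \<in> L"
  and Luminus: "x \<in> L \<Longrightarrow> - x \<in> L"
  and Linverse: "x \<in> L \<Longrightarrow> inverse x \<in> L"
  using subfield_L by (auto simp: is_subfield_def)

lemma Lsum: "(\<And>i. i \<in> A \<Longrightarrow> f i \<in> L) \<Longrightarrow> sum f A \<in> L"
  by (induction A rule: infinite_finite_induct) (auto intro: Ladd)

lemma polys_0 [simp]: "0 \<in> polys_over L" and polys_1 [simp]: "1 \<in> polys_over L"
  and polys_add: "p \<in> polys_over L \<Longrightarrow> q \<in> polys_over L \<Longrightarrow> p + q \<in> polys_over L"
  and polys_uminus: "p \<in> polys_over L \<Longrightarrow> - p \<in> polys_over L"
  and polys_mult: "p \<in> polys_over L \<Longrightarrow> q \<in> polys_over L \<Longrightarrow> p * q \<in> polys_over L"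
  and polys_monom: "c \<in> L \<Longrightarrow> monom c n \<in> polys_over L"
  and polys_const: "c \<in> L \<Longrightarrow> [:c:] \<in> polys_over L"
  and polys_X: "[:0, 1:] \<in> polys_over L"
  by (auto simp: polys_over_def Ladd Luminus coeff_mult coeff_1 coeff_pCons split: nat.split intro!: Lsum Lmult)

lemma polys_diff: "p \<in> polys_over L \<Longrightarrow> q \<in> polys_over L \<Longrightarrow> p - q \<in> polys_over L"
  using polys_add[of p "- q"] polys_uminus by simp

text \<open>Euclidean division with control of the coefficients: the polynomials have type over C,
  while quotient and remainder must stay over the subset L.\<close>

lemma polys_division:
  assumes h: "h \<in> polys_over L" "h \<noteq> 0" and p: "p \<in> polys_over L"
  shows "\<exists>s\<in>polys_over L. \<exists>r\<in>polys_over L. p = h * s + r \<and> (r = 0 \<or> degree r < degree h)"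
  using p
proof (induction "degree p" arbitrary: p rule: less_induct)
  case less
  show ?case
  proof (cases "p = 0 \<or> degree p < degree h")
    case True
    then show ?thesis using less.prems by (intro bexI[of _ 0] bexI[of _ p]) auto
  next
    case False
    then have ph: "p \<noteq> 0" "degree h \<le> degree p" by auto
    define c where "c = lead_coeff p * inverse (lead_coeff h)"
    define m where "m = monom c (degree p - degree h)"
    have cL: "c \<in> L" using less.prems h by (auto simp: c_def polys_over_def intro!: Lmult Linverse)
    have c0: "c \<noteq> 0" using ph h by (simp add: c_def)
    have m: "m \<in> polys_over L" using cL by (simp add: m_def polys_monom)
    define p' where "p' = p - h * m"
    have p': "p' \<in> polys_over L" using less.prems h m by (auto simp: p'_def intro!: polys_diff polys_mult)
    have m0: "m \<noteq> 0" using c0 by (simp add: m_def monom_eq_0_iff)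
    have dm: "degree m = degree p - degree h" using c0 by (simp add: m_def degree_monom_eq)
    have dhm: "degree (h * m) = degree p" using h m0 ph dm by (simp add: degree_mult_eq)
    have "lead_coeff (h * m) = lead_coeff p"
      using h c0 by (simp add: lead_coeff_mult) (simp add: m_def degree_monom_eq c_def)
    then have "coeff p' (degree p) = 0" using dhm by (simp add: p'_def)
    moreover have "degree p' \<le> degree p" using dhm by (simp add: p'_def degree_diff_le)
    ultimately have *: "p' = 0 \<or> degree p' < degree p"
      by (metis leading_coeff_0_iff order_le_less)
    have "\<exists>s\<in>polys_over L. \<exists>r\<in>polys_over L. p' = h * s + r \<and> (r = 0 \<or> degree r < degree h)"
    proof (cases "p' = 0")
      case True
      then show ?thesis by (intro bexI[of _ 0]) auto
    qed (use * less.hyps p' in blast)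
    then obtain s r where sr: "s \<in> polys_over L" "r \<in> polys_over L" "p' = h * s + r"
      "r = 0 \<or> degree r < degree h" by blast
    have "p = h * (s + m) + r" using sr(3) by (simp add: p'_def algebra_simps)
    then show ?thesis using sr m polys_add by blast
  qed
qed

lemma simple_ext_closed:
  shows "L \<subseteq> simple_ext L \<xi>" "\<xi> \<in> simple_ext L \<xi>"
    "x \<in> simple_ext L \<xi> \<Longrightarrow> y \<in> simple_ext L \<xi> \<Longrightarrow> x + y \<in> simple_ext L \<xi>"
    "x \<in> simple_ext L \<xi> \<Longrightarrow> y \<in> simple_ext L \<xi> \<Longrightarrow> x * y \<in> simple_ext L \<xi>"
    "x \<in> simple_ext L \<xi> \<Longrightarrow> - x \<in> simple_ext L \<xi>"
    "p \<in> polys_over L \<Longrightarrow> poly p \<xi> \<in> simple_ext L \<xi>"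
proof -
  show "L \<subseteq> simple_ext L \<xi>"
    by (auto simp: simple_ext_def) (metis poly_const_conv polys_const)
  show "\<xi> \<in> simple_ext L \<xi>" unfolding simple_ext_def using polys_X by force
  show "p \<in> polys_over L \<Longrightarrow> poly p \<xi> \<in> simple_ext L \<xi>" by (auto simp: simple_ext_def)
  show "x \<in> simple_ext L \<xi> \<Longrightarrow> - x \<in> simple_ext L \<xi>"
    by (auto simp: simple_ext_def) (metis poly_minus polys_uminus)
  show "x \<in> simple_ext L \<xi> \<Longrightarrow> y \<in> simple_ext L \<xi> \<Longrightarrow> x + y \<in> simple_ext L \<xi>"
    by (auto simp: simple_ext_def) (metis poly_add polys_add)
  show "x \<in> simple_ext L \<xi> \<Longrightarrow> y \<in> simple_ext L \<xi> \<Longrightarrow> x * y \<in> simple_ext L \<xi>"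
    by (auto simp: simple_ext_def) (metis poly_mult polys_mult)
qed

end

text \<open>Minimality is phrased as independence of the powers of the generator below the degree of
  g, because this is what valuations verify directly, through
  \<open>orthogonal_independent\<close>.\<close>

locale simple_minimal = field_subset L for L :: "'c::field set" +
  fixes \<xi> :: 'c and g :: "'c poly"
  assumes g_over: "g \<in> polys_over L" and g_monic: "lead_coeff g = 1" and g_root: "poly g \<xi> = 0"
    and g_minimal: "p \<in> polys_over L \<Longrightarrow> degree p < degree g \<Longrightarrow> poly p \<xi> = 0 \<Longrightarrow> p = 0"
begin

abbreviation "M \<equiv> simple_ext L \<xi>"
abbreviation "R \<equiv> {r. poly g r = 0}"

lemma g_nz: "g \<noteq> 0" using g_monic by auto

lemma degree_g: "0 < degree g"
proof (rule ccontr)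
  assume "\<not> 0 < degree g"
  then obtain c where "g = [:c:]" by (metis degree_eq_zeroE gr0I)
  then show False using g_monic g_root by simp
qed

text \<open>The remainder of p modulo g vanishes at the generator, hence is 0. So every relation
  over L satisfied by the generator holds at all roots of g.\<close>

lemma g_dvd: "p \<in> polys_over L \<Longrightarrow> poly p \<xi> = 0 \<Longrightarrow> poly g r = 0 \<Longrightarrow> poly p r = 0"
proof -
  assume p: "p \<in> polys_over L" "poly p \<xi> = 0" "poly g r = 0"
  obtain s q where *: "s \<in> polys_over L" "q \<in> polys_over L" "p = g * s + q" "q = 0 \<or> degree q < degree g"
    using polys_division[OF g_over g_nz p(1)] by blast
  then have "q = 0" using g_minimal[of q] p g_root by auto
  then show ?thesis using * p by simp
qed

lemma M_rep: "x \<in> M \<Longrightarrow> \<exists>p\<in>polys_over L. degree p < degree g \<and> x = poly p \<xi>"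
proof -
  assume "x \<in> M"
  then obtain p where p: "p \<in> polys_over L" "x = poly p \<xi>" by (auto simp: simple_ext_def)
  obtain s q where *: "s \<in> polys_over L" "q \<in> polys_over L" "p = g * s + q" "q = 0 \<or> degree q < degree g"
    using polys_division[OF g_over g_nz p(1)] by blast
  then have "x = poly q \<xi>" "degree q < degree g" using p g_root degree_g by auto
  then show ?thesis using * by blast
qed

text \<open>Euclid's algorithm as an induction: from g = p s + q the value of p times that of s is
  minus the value of q, so an inverse for q, of smaller degree, gives one for p.\<close>

lemma poly_inverse_exists:
  assumes "p \<in> polys_over L" "p \<noteq> 0" "degree p < degree g"
  shows "\<exists>y\<in>M. poly p \<xi> * y = 1"
  using assms
proof (induction "degree p" arbitrary: p rule: less_induct)
  case less
  have nz: "poly p \<xi> \<noteq> 0" using g_minimal less.prems by blast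
  obtain s q where *: "s \<in> polys_over L" "q \<in> polys_over L" "g = p * s + q" "q = 0 \<or> degree q < degree p"
    using polys_division[OF less.prems(1,2) g_over] by blast
  show ?case
  proof (cases "degree p = 0")
    case True
    then obtain c where c: "p = [:c:]" by (metis degree_eq_zeroE)
    then have "c \<in> L" "c \<noteq> 0" using less.prems by (auto simp: polys_over_def dest: spec[of _ 0])
    then show ?thesis using c simple_ext_closed(1) Linverse by (intro bexI[of _ "inverse c"]) auto
  next
    case False
    have "poly p \<xi> * poly s \<xi> + poly q \<xi> = 0" using g_root * by (metis poly_add poly_mult)
    \<comment> \<open>A vanishing remainder would make s a nonzero polynomial of degree below that
      of g that kills the generator.\<close>
    moreover have "q \<noteq> 0"
    proof
      assume q: "q = 0"
      have s0: "s \<noteq> 0" using * q g_nz by auto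
      then have "degree g = degree p + degree s" using * q less.prems by (simp add: degree_mult_eq)
      then have "degree s < degree g" using False by simp
      then have "poly s \<xi> \<noteq> 0" using g_minimal * s0 by blast
      then show False using calculation q nz by simp
    qed
    moreover from this have "degree q < degree p" using * by simp
    ultimately obtain y where y: "y \<in> M" "poly q \<xi> * y = 1"
      using less.hyps[of q] * less.prems by fastforce
    have "poly p \<xi> * (- (poly s \<xi> * y)) = (poly p \<xi> * poly s \<xi>) * (- y)" by simp
    also have "poly p \<xi> * poly s \<xi> = - poly q \<xi>"
      using \<open>poly p \<xi> * poly s \<xi> + poly q \<xi> = 0\<close> by (simp add: eq_neg_iff_add_eq_0)
    finally have "poly p \<xi> * (- (poly s \<xi> * y)) = 1" using y by simp
    moreover have "- (poly s \<xi> * y) \<in> M"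
      by (intro simple_ext_closed(4,5) simple_ext_closed(6)[OF *(1)] y(1))
    ultimately show ?thesis by blast
  qed
qed

lemma M_subfield: "is_subfield M"
  unfolding is_subfield_def
proof (intro conjI ballI)
  fix x assume x: "x \<in> M"
  show "inverse x \<in> M"
  proof (cases "x = 0")
    case True
    then show ?thesis using x by simp
  next
    case False
    obtain p where "p \<in> polys_over L" "degree p < degree g" "x = poly p \<xi>"
      using M_rep[OF x] by blast
    moreover from this have "p \<noteq> 0" using False by auto
    ultimately obtain y where "y \<in> M" "x * y = 1" using poly_inverse_exists by blast
    then show ?thesis using inverse_unique by metis
  qed
qed (simp_all add: simple_ext_closed(3-5) subsetD[OF simple_ext_closed(1)])

lemma poly_as_sum:
  "degree p < n \<Longrightarrow> poly p (x::'c) = (\<Sum>i<n. coeff p i * x ^ i)"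
  unfolding poly_altdef
  by (rule sum.mono_neutral_left) (auto simp: coeff_eq_0)

text \<open>The basis consists of powers of the generator. They are pairwise distinct by minimality,
  which matters because \<open>finite_extension\<close> sums over a set of elements.\<close>

lemma M_finite: "finite_extension L M"
proof -
  define B where "B = (\<lambda>i. \<xi> ^ i) ` {..<degree g}"
  have inj: "inj_on (\<lambda>i. \<xi> ^ i) {..<degree g}"
  proof (rule inj_onI)
    fix i j assume ij: "i \<in> {..<degree g}" "j \<in> {..<degree g}" "\<xi> ^ i = \<xi> ^ j"
    define p :: "'c poly" where "p = monom 1 i - monom 1 j"
    have "p \<in> polys_over L" unfolding p_def by (intro polys_diff polys_monom) auto
    moreover have "degree p < degree g" unfolding p_def
      by (rule degree_diff_less) (use ij in \<open>auto simp: degree_monom_eq\<close>)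
    moreover have "poly p \<xi> = 0" using ij by (simp add: p_def poly_monom)
    ultimately have "p = 0" using g_minimal by blast
    then have "coeff p i = 0" by simp
    then show "i = j" by (simp add: p_def split: if_splits)
  qed
  have B_sum: "(\<Sum>b\<in>B. c b * b) = (\<Sum>i<degree g. c (\<xi> ^ i) * \<xi> ^ i)" for c
    unfolding B_def by (simp add: sum.reindex[OF inj])
  have "M = {\<Sum>b\<in>B. c b * b | c. \<forall>b\<in>B. c b \<in> L}"
  proof (intro equalityI subsetI)
    fix x assume "x \<in> M"
    then obtain p where p: "p \<in> polys_over L" "degree p < degree g" "x = poly p \<xi>" using M_rep by blast
    define c where "c b = coeff p (the_inv_into {..<degree g} (\<lambda>i. \<xi> ^ i) b)" for b
    have "c (\<xi> ^ i) = coeff p i" if "i < degree g" for i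
      unfolding c_def using the_inv_into_f_f[OF inj, of i] that by simp
    then have "x = (\<Sum>b\<in>B. c b * b)" using p by (simp add: B_sum poly_as_sum)
    moreover have "\<forall>b\<in>B. c b \<in> L" using p by (simp add: c_def polys_over_def)
    ultimately show "x \<in> {\<Sum>b\<in>B. c b * b | c. \<forall>b\<in>B. c b \<in> L}" by blast
  next
    fix x assume "x \<in> {\<Sum>b\<in>B. c b * b | c. \<forall>b\<in>B. c b \<in> L}"
    then obtain c where c: "x = (\<Sum>i<degree g. c (\<xi> ^ i) * \<xi> ^ i)" "\<And>i. i < degree g \<Longrightarrow> c (\<xi> ^ i) \<in> L"
      unfolding B_sum by (auto simp: B_def)
    define p where "p = (\<Sum>i<degree g. monom (c (\<xi> ^ i)) i)"
    have "p \<in> polys_over L"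
      unfolding p_def polys_over_def using c(2) by (auto simp: coeff_sum intro!: Lsum)
    moreover have "x = poly p \<xi>" using c(1) by (simp add: p_def poly_sum poly_monom)
    ultimately show "x \<in> M" by (auto simp: simple_ext_def)
  qed
  moreover have "finite B" by (simp add: B_def)
  ultimately show ?thesis
    unfolding finite_extension_def using M_subfield simple_ext_closed(1) by blast
qed

end

section \<open>Automorphisms, fixed field and norm of the generator\<close>

locale simple_galois = simple_minimal +
  assumes g_roots: "{r. poly g r = 0} \<subseteq> simple_ext L \<xi>" "card {r. poly g r = 0} = degree g"
begin

lemma fin_R: "finite R" using poly_roots_finite g_nz by blast

lemma gal_poly:
  assumes \<tau>: "\<tau> \<in> gal L M" and p: "p \<in> polys_over L" and x: "x \<in> M"
  shows "\<tau> (poly p x) = poly p (\<tau> x)" "poly p x \<in> M"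
proof -
  have add: "\<tau> (a + b) = \<tau> a + \<tau> b" and mult: "\<tau> (a * b) = \<tau> a * \<tau> b" if "a \<in> M" "b \<in> M" for a b
    using \<tau> that by (auto simp: gal_def)
  have fix_L: "\<tau> a = a" "a \<in> M" if "a \<in> L" for a
    using \<tau> that simple_ext_closed(1) by (auto simp: gal_def)
  have "\<tau> (poly p x) = poly p (\<tau> x) \<and> poly p x \<in> M"
    using p
  proof (induction p)
    case (pCons a p)
    have "a \<in> L" "p \<in> polys_over L" using pCons.prems by (auto simp: polys_over_pCons_iff)
    then show ?case
      using pCons.IH fix_L[of a] x mult add simple_ext_closed(3,4)[of _ \<xi>] by simp
  qed (use fix_L in auto)
  then show "\<tau> (poly p x) = poly p (\<tau> x)" "poly p x \<in> M" by auto
qed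

lemma gal_root: "\<tau> \<in> gal L M \<Longrightarrow> poly g (\<tau> \<xi>) = 0"
  using gal_poly(1)[of \<tau> g \<xi>] g_over g_root simple_ext_closed(2) subfield_L
  by (auto simp: gal_def is_subfield_def)

lemma gal_eqI:
  assumes "\<tau> \<in> gal L M" "\<tau>' \<in> gal L M" "\<tau> \<xi> = \<tau>' \<xi>"
  shows "\<tau> = \<tau>'"
proof (rule extensionalityI[of _ M])
  fix x assume "x \<in> M"
  then obtain p where "p \<in> polys_over L" "x = poly p \<xi>" by (auto simp: simple_ext_def)
  then show "\<tau> x = \<tau>' x" using assms gal_poly(1) simple_ext_closed(2) by metis
qed (use assms in \<open>auto simp: gal_def\<close>)

text \<open>The automorphism sends p(\<open>\<xi>\<close>) to p(r). By \<open>g_dvd\<close> the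
  result is independent of the chosen polynomial p.\<close>

lemma gal_exists:
  assumes r: "poly g r = 0"
  shows "\<exists>\<tau>\<in>gal L M. \<tau> \<xi> = r"
proof -
  have rM: "r \<in> M" using r g_roots by blast
  define rep where "rep x = (SOME p. p \<in> polys_over L \<and> x = poly p \<xi>)" for x
  define \<tau> where "\<tau> = (\<lambda>x\<in>M. poly (rep x) r)"
  have rep: "rep x \<in> polys_over L" "x = poly (rep x) \<xi>" if "x \<in> M" for x
    using someI_ex[of "\<lambda>p. p \<in> polys_over L \<and> x = poly p \<xi>"] that
    by (auto simp: simple_ext_def rep_def)
  have \<tau>: "\<tau> (poly p \<xi>) = poly p r" if p: "p \<in> polys_over L" for p
  proof -
    have m: "poly p \<xi> \<in> M" using p by (rule simple_ext_closed)
    have "poly (rep (poly p \<xi>) - p) \<xi> = 0" using rep(2)[OF m] by simp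
    then have "poly (rep (poly p \<xi>) - p) r = 0" using g_dvd r polys_diff rep(1)[OF m] p by blast
    then show ?thesis using m by (simp add: \<tau>_def)
  qed
  have hom: "\<tau> (x + y) = \<tau> x + \<tau> y \<and> \<tau> (x * y) = \<tau> x * \<tau> y" if xy: "x \<in> M" "y \<in> M" for x y
  proof -
    obtain p p' where p: "p \<in> polys_over L" "x = poly p \<xi>" "p' \<in> polys_over L" "y = poly p' \<xi>"
      using xy by (auto simp: simple_ext_def)
    have "\<tau> (x + y) = poly (p + p') r" using \<tau>[of "p + p'"] p polys_add by simp
    moreover have "\<tau> (x * y) = poly (p * p') r" using \<tau>[of "p * p'"] p polys_mult by simp
    ultimately show ?thesis using \<tau> p by simp
  qed
  have fix_L: "\<tau> x = x" if "x \<in> L" for x using \<tau>[of "[:x:]"] that polys_const by simp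
  have sub: "is_subfield M" by (rule M_subfield)
  have maps: "\<tau> x \<in> M" if "x \<in> M" for x
  proof -
    have "poly p r \<in> M" if "p \<in> polys_over L" for p
      using that
    proof (induction p)
      case (pCons a p)
      have "a \<in> M" "p \<in> polys_over L" using pCons.prems simple_ext_closed(1) by (auto simp: polys_over_pCons_iff)
      then show ?case using pCons.IH rM by (simp add: simple_ext_closed)
    qed (use sub in \<open>auto simp: is_subfield_def\<close>)
    then show ?thesis using that rep \<tau>_def by simp
  qed
  have inj: "inj_on \<tau> M"
  proof (rule inj_onI, rule ccontr)
    fix x y assume xy: "x \<in> M" "y \<in> M" "\<tau> x = \<tau> y" "x \<noteq> y"
    have d: "x - y \<in> M" "inverse (x - y) \<in> M"
      using sub xy unfolding is_subfield_def by (metis diff_conv_add_uminus)+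
    have "\<tau> x = \<tau> ((x - y) + y)" by simp
    also have "\<dots> = \<tau> (x - y) + \<tau> y" using hom d xy by blast
    finally have "\<tau> (x - y) = 0" using xy by simp
    then have "\<tau> ((x - y) * inverse (x - y)) = 0" using hom d by simp
    then show False using xy fix_L[of 1] by simp
  qed
  \<comment> \<open>Towards surjectivity. A root s = p(\<open>\<xi>\<close>) goes to p(r), and g
    composed with p vanishes at \<open>\<xi>\<close>, hence at r. An injective map of the finite set
    of roots to itself attains \<open>\<xi>\<close>, and with it all polynomial values.\<close>
  have "\<tau> ` R \<subseteq> R"
  proof clarify
    fix s assume s: "poly g s = 0"
    then have "s \<in> M" using g_roots by blast
    then obtain p where p: "p \<in> polys_over L" "s = poly p \<xi>" by (auto simp: simple_ext_def)
    have pc: "pcompose g p \<in> polys_over L"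
    proof -
      have "pcompose h p \<in> polys_over L" if "h \<in> polys_over L" for h
        using that
      proof (induction h)
        case (pCons a h)
        have "a \<in> L" "h \<in> polys_over L" using pCons.prems by (auto simp: polys_over_pCons_iff)
        then show ?case using pCons.IH p
          by (auto simp: pcompose_pCons intro!: polys_add polys_mult polys_const)
      qed simp
      then show ?thesis using g_over by blast
    qed
    have "poly (pcompose g p) r = 0"
      by (rule g_dvd[OF pc _ r]) (use s p in \<open>simp add: poly_pcompose\<close>)
    then show "poly g (\<tau> s) = 0" using \<tau>[OF p(1)] p by (simp add: poly_pcompose)
  qed
  then have "\<tau> ` R = R"
    using endo_inj_surj[OF fin_R] inj_on_subset[OF inj g_roots(1)] by blast
  then obtain s where s: "s \<in> R" "\<tau> s = \<xi>" using g_root by (metis (mono_tags) imageE mem_Collect_eq)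
  have surj: "\<tau> ` M = M"
  proof (intro equalityI subsetI)
    fix x assume "x \<in> M"
    then obtain p where p: "p \<in> polys_over L" "x = poly p \<xi>" by (auto simp: simple_ext_def)
    have "\<tau> (poly p s) = poly p (\<tau> s) \<and> poly p s \<in> M"
      using p(1)
    proof (induction p)
      case (pCons a p)
      have "a \<in> L" "p \<in> polys_over L" using pCons.prems by (auto simp: polys_over_pCons_iff)
      note a = this(1) and p = this(2)
      have sM: "s \<in> M" using s g_roots by blast
      have aM: "a \<in> M" using a simple_ext_closed(1) by blast
      note IH = pCons.IH[OF p]
      have m: "s * poly p s \<in> M" using simple_ext_closed(4)[OF sM] IH by blast
      have "\<tau> (a + s * poly p s) = a + \<tau> s * poly p (\<tau> s)"
        using hom[OF aM m] hom[OF sM, of "poly p s"] IH fix_L[OF a] by simp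
      then show ?case using simple_ext_closed(3)[OF aM m] by simp
    qed (use sub fix_L[of 0] in \<open>auto simp: is_subfield_def\<close>)
    then show "x \<in> \<tau> ` M" using s p by (metis imageI)
  qed (use maps in auto)
  have "\<tau> \<in> gal L M"
    unfolding gal_def bij_betw_def using inj surj hom fix_L by (auto simp: \<tau>_def)
  moreover have "\<tau> \<xi> = r" using \<tau>[OF polys_X] by simp
  ultimately show ?thesis by blast
qed

lemma bij_gal_roots: "bij_betw (\<lambda>\<tau>. \<tau> \<xi>) (gal L M) R"
  unfolding bij_betw_def inj_on_def using gal_eqI gal_exists gal_root by fast

text \<open>If p(\<open>\<xi>\<close>) = x is fixed and deg p < deg g, then p - x vanishes at all
  deg g roots of g, so p is the constant x.\<close>

lemma fixed_field: "{x \<in> M. \<forall>\<tau>\<in>gal L M. \<tau> x = x} = L"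
proof (intro equalityI subsetI)
  fix x assume x: "x \<in> {x \<in> M. \<forall>\<tau>\<in>gal L M. \<tau> x = x}"
  then obtain p where p: "p \<in> polys_over L" "degree p < degree g" "x = poly p \<xi>" using M_rep by blast
  have "poly (p - [:x:]) r = 0" if r: "poly g r = 0" for r
  proof -
    obtain \<tau> where \<tau>: "\<tau> \<in> gal L M" "\<tau> \<xi> = r" using gal_exists r by blast
    have "poly p r = \<tau> x" using gal_poly(1)[OF \<tau>(1) p(1) simple_ext_closed(2)] \<tau>(2) p by simp
    also have "\<dots> = x" using x \<tau> by blast
    finally show ?thesis by simp
  qed
  then have sub: "R \<subseteq> {r. poly (p - [:x:]) r = 0}" by blast
  have "p - [:x:] = 0"
  proof (rule ccontr)
    assume ne: "p - [:x:] \<noteq> 0"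
    have "degree g \<le> card {r. poly (p - [:x:]) r = 0}"
      unfolding g_roots(2)[symmetric] by (rule card_mono[OF poly_roots_finite[OF ne] sub])
    also have "\<dots> \<le> degree (p - [:x:])" using card_poly_roots_bound[OF ne] .
    also have "\<dots> < degree g" using p degree_g by (intro degree_diff_less) auto
    finally show False by simp
  qed
  then have "coeff p 0 = x" by simp
  then show "x \<in> L" using p(1) unfolding polys_over_def by (metis mem_Collect_eq)
qed (use simple_ext_closed(1) in \<open>auto simp: gal_def\<close>)

lemma abelianI:
  assumes "\<And>\<tau> \<tau>'. \<tau> \<in> gal L M \<Longrightarrow> \<tau>' \<in> gal L M \<Longrightarrow> \<tau> (\<tau>' \<xi>) = \<tau>' (\<tau> \<xi>)"
  shows "finite_abelian_extension L M"
  unfolding finite_abelian_extension_def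
proof (intro conjI ballI)
  fix \<tau> \<tau>' x assume \<tau>: "\<tau> \<in> gal L M" "\<tau>' \<in> gal L M" and "x \<in> M"
  then obtain p where p: "p \<in> polys_over L" "x = poly p \<xi>" by (auto simp: simple_ext_def)
  have "\<tau> \<xi> \<in> M" "\<tau>' \<xi> \<in> M" using gal_root \<tau> g_roots by auto
  then show "\<tau> (\<tau>' x) = \<tau>' (\<tau> x)"
    using gal_poly(1) \<tau> p simple_ext_closed(2) assms by metis
qed (use M_finite fixed_field in auto)

text \<open>Vieta's formula: the product of the linear factors of the roots divides g, with the same
  degree and leading coefficient, so the two are equal.\<close>

lemma prod_roots: "(\<Prod>\<tau>\<in>gal L M. \<tau> \<xi>) = (-1) ^ degree g * coeff g 0"
proof -
  have "(\<Prod>\<tau>\<in>gal L M. \<tau> \<xi>) = \<Prod>R"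
    using prod.reindex_bij_betw[OF bij_gal_roots, of "\<lambda>x. x"] by simp
  have dvd: "(\<Prod>r\<in>S. [:- r, 1:]) dvd g" if "finite S" "S \<subseteq> R" for S
    using that
  proof (induction S)
    case (insert a S)
    then have "(\<Prod>r\<in>S. [:- r, 1:]) dvd g" by simp
    then obtain h where h: "g = (\<Prod>r\<in>S. [:- r, 1:]) * h" by (rule dvdE)
    have "poly g a = 0" using insert by simp
    moreover have "poly (\<Prod>r\<in>S. [:- r, 1:]) a \<noteq> 0" using insert by (auto simp: poly_prod)
    ultimately have "poly h a = 0" using h by simp
    then obtain h' where "h = [:- a, 1:] * h'" by (auto simp: poly_eq_0_iff_dvd elim: dvdE)
    then have "g = (\<Prod>r\<in>insert a S. [:- r, 1:]) * h'"
      using h insert.hyps by (simp only: prod.insert mult.assoc mult.left_commute not_False_eq_True)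
    then show ?case by (rule dvdI)
  qed simp
  define P where "P = (\<Prod>r\<in>R. [:- r, 1:])"
  obtain h where h: "g = P * h" using dvd[OF fin_R] P_def by (auto elim: dvdE)
  have lcP: "lead_coeff P = 1" by (simp add: P_def lead_coeff_prod)
  then have P0: "P \<noteq> 0" by auto
  have degP: "degree P = card R" unfolding P_def using fin_R by (subst degree_prod_eq_sum_degree) auto
  have "h \<noteq> 0" using g_nz h by auto
  then have "degree h = 0" using h P0 degP g_roots(2) by (simp add: degree_mult_eq)
  moreover have "lead_coeff h = 1" using g_monic lcP h by (simp add: lead_coeff_mult)
  ultimately have "h = 1" by (metis degree_eq_zeroE lead_coeff_pCons(2) pCons_one)
  then have "g = P" using h by simp
  then have "coeff g 0 = poly P 0" by (simp add: poly_0_coeff_0)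
  also have "\<dots> = (\<Prod>r\<in>R. - r)" by (simp add: P_def poly_prod)
  also have "\<dots> = (-1) ^ degree g * \<Prod>R"
    using prod.distrib[of "\<lambda>_. -1" "\<lambda>r. r" R] g_roots(2) by simp
  finally show ?thesis using \<open>(\<Prod>\<tau>\<in>gal L M. \<tau> \<xi>) = \<Prod>R\<close>
    by (simp add: mult.assoc[symmetric] power_mult_distrib[symmetric])
qed

text \<open>The source of explicit norms: the constant coefficient of the minimal polynomial is, up
  to sign, the norm of the generator.\<close>

lemma const_norm: "\<xi> \<noteq> 0 \<Longrightarrow> (-1) ^ degree g * coeff g 0 \<in> norm_group L M"
  unfolding norm_group_def prod_roots[symmetric] using simple_ext_closed(2) by blast

end

section \<open>Lubin--Tate extensions of level two\<close>

context local_field_setting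
begin

text \<open>Trades a strict bound for a slightly larger non-strict one, the form in which
  contractions and uniform bounds on affinoids are stated.\<close>

lemma vgt_obtain: "vgt r x \<Longrightarrow> (\<And>s. r < s \<Longrightarrow> vge s x \<Longrightarrow> thesis) \<Longrightarrow> thesis"
proof (cases "x = 0")
  case True
  then show "(\<And>s. r < s \<Longrightarrow> vge s x \<Longrightarrow> thesis) \<Longrightarrow> thesis" using vge_0[of "r + 1"] by (metis less_add_one)
next
  case False
  then show "vgt r x \<Longrightarrow> (\<And>s. r < s \<Longrightarrow> vge s x \<Longrightarrow> thesis) \<Longrightarrow> thesis"
    using vge_rv[of x] by (auto simp: vgt_iff)
qed

text \<open>When the nonzero terms have distinct valuations, the smallest one dominates and is the
  valuation of the sum, so a bound on the sum passes to each term.\<close>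

lemma vge_summands:
  assumes "finite A" "i \<in> A" "vge r (sum t A)"
    and distinct: "\<And>i j. i \<in> A \<Longrightarrow> j \<in> A \<Longrightarrow> i \<noteq> j \<Longrightarrow> t i \<noteq> 0 \<Longrightarrow> t j \<noteq> 0 \<Longrightarrow> rv (t i) \<noteq> rv (t j)"
  shows "vge r (t i)"
proof (cases "\<forall>i\<in>A. t i = 0")
  case False
  define A' where "A' = {i \<in> A. t i \<noteq> 0}"
  have A': "finite A'" "A' \<noteq> {}" using assms False by (auto simp: A'_def)
  define m where "m = Min ((\<lambda>i. rv (t i)) ` A')"
  have "m \<in> (\<lambda>i. rv (t i)) ` A'" unfolding m_def using A' by (intro Min_in) auto
  then obtain i0 where i0: "i0 \<in> A" "t i0 \<noteq> 0" "rv (t i0) = m" by (auto simp: A'_def)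
  have le: "m \<le> rv (t j)" if "j \<in> A" "t j \<noteq> 0" for j
    unfolding m_def using that A' by (intro Min_le) (auto simp: A'_def)
  have "vgt m (t j)" if "j \<in> A - {i0}" for j
    using that le[of j] distinct[of j i0] i0 by (cases "t j = 0") (auto simp: vgt_iff)
  then have "vgt m (sum t (A - {i0}))" by (rule vgt_sum)
  moreover have "sum t A - t i0 = sum t (A - {i0})" using assms(1) i0 by (simp add: sum_diff1)
  ultimately have "sum t A \<noteq> 0 \<and> rv (sum t A) = m"
    using rv_cong[of "t i0" "sum t A"] i0 by simp
  then have "r \<le> m" using assms(3) by (simp add: vge_iff)
  then show ?thesis using le[of i] assms(2) by (cases "t i = 0") (auto simp: vge_iff)
qed (use assms in auto)

lemma poly_vge:
  assumes "\<And>i. vge (r - real i * s) (coeff p i)" "vge s x"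
  shows "vge r (poly p x)"
  unfolding poly_altdef
  by (intro vge_sum vge_mult[OF assms(1) vge_power[OF assms(2)]]) auto

text \<open>Non-archimedean orthogonality of the powers of \<open>\<xi>\<close> below d: no
  cancellation occurs in a linear combination over L. It implies independence, completeness of
  L(\<open>\<xi>\<close>), and bounds for automorphisms.\<close>

definition orthogonal_basis :: "'c set \<Rightarrow> 'c \<Rightarrow> nat \<Rightarrow> bool" where
  "orthogonal_basis L \<xi> d \<longleftrightarrow> (\<forall>p\<in>polys_over L. degree p < d \<longrightarrow>
     (\<forall>r i. vge r (poly p \<xi>) \<longrightarrow> vge (r - real i * rv \<xi>) (coeff p i)))"

lemma orthogonal_independent:
  assumes "orthogonal_basis L \<xi> d" "p \<in> polys_over L" "degree p < d" "poly p \<xi> = 0"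
  shows "p = 0"
proof (rule poly_eqI)
  fix i
  have "vge B (coeff p i)" for B
    using assms unfolding orthogonal_basis_def
    by (metis add_diff_cancel vge_0)
  then show "coeff p i = coeff 0 i" using vge_all_imp_0 by simp
qed

end

context local_subfield
begin

lemma field_subset_L: "field_subset L"
  by unfold_locales (rule subfield)

interpretation LF: field_subset L by (rule field_subset_L)

text \<open>By orthogonality the coefficients of a Cauchy sequence are Cauchy sequences in L, and
  their limits assemble to the limit.\<close>

lemma complete_simple_ext:
  assumes orth: "orthogonal_basis L \<xi> d"
    and rep: "\<And>x. x \<in> simple_ext L \<xi> \<Longrightarrow> \<exists>p\<in>polys_over L. degree p < d \<and> x = poly p \<xi>"
  shows "complete_in (simple_ext L \<xi>)"
  unfolding complete_in_def
proof (intro allI impI)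
  fix s :: "nat \<Rightarrow> 'c" assume s: "cauchy_seq D s" "range s \<subseteq> simple_ext L \<xi>"
  have "\<forall>n. \<exists>p. p \<in> polys_over L \<and> degree p < d \<and> s n = poly p \<xi>" using rep s(2) by blast
  then obtain p where p: "\<And>n. p n \<in> polys_over L" "\<And>n. degree (p n) < d" "\<And>n. s n = poly (p n) \<xi>"
    by metis
  have orthd: "vge (B - real i * rv \<xi>) (coeff (p m) i - coeff (p n) i)" if "vge B (s m - s n)" for B m n i
  proof -
    have "p m - p n \<in> polys_over L" using p LF.polys_diff by blast
    moreover have "degree (p m - p n) < d" using p by (intro degree_diff_less)
    moreover have "vge B (poly (p m - p n) \<xi>)" using that p by simp
    ultimately show ?thesis using orth unfolding orthogonal_basis_def by (metis coeff_diff)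
  qed
  have "\<exists>l\<in>L. tends_to D (\<lambda>n. coeff (p n) i) l" for i
  proof -
    have "cauchy_seq D (\<lambda>n. coeff (p n) i)"
      unfolding cauchy_seq_iff
    proof
      fix B
      obtain N where "\<forall>m\<ge>N. \<forall>n\<ge>N. vge (B + real i * rv \<xi>) (s m - s n)"
        using s(1) unfolding cauchy_seq_iff by blast
      moreover have "vge B (coeff (p m) i - coeff (p n) i)" if "vge (B + real i * rv \<xi>) (s m - s n)" for m n
        using orthd[OF that, of i] by simp
      ultimately show "\<exists>N. \<forall>m\<ge>N. \<forall>n\<ge>N. vge B (coeff (p m) i - coeff (p n) i)" by blast
    qed
    moreover have "range (\<lambda>n. coeff (p n) i) \<subseteq> L" using p by (auto simp: polys_over_def)
    ultimately show ?thesis using complete_L unfolding complete_in_def by blast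
  qed
  then obtain c where c: "\<And>i. c i \<in> L" "\<And>i. tends_to D (\<lambda>n. coeff (p n) i) (c i)" by metis
  define l where "l = (\<Sum>i<d. c i * \<xi> ^ i)"
  have "l = poly (\<Sum>i<d. monom (c i) i) \<xi>" by (simp add: l_def poly_sum poly_monom)
  moreover have "(\<Sum>i<d. monom (c i) i) \<in> polys_over L"
    using c by (auto simp: polys_over_def coeff_sum)
  ultimately have "l \<in> simple_ext L \<xi>" by (auto simp: simple_ext_def)
  moreover have "tends_to D s l"
    unfolding tends_to_iff
  proof
    fix B
    have "\<forall>i. \<exists>N. \<forall>n\<ge>N. vge (B - real i * rv \<xi>) (coeff (p n) i - c i)"
      using c(2) unfolding tends_to_iff by blast
    then obtain N where N: "\<And>i n. N i \<le> n \<Longrightarrow> vge (B - real i * rv \<xi>) (coeff (p n) i - c i)" by metis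
    have "vge B (s n - l)" if n: "Max (N ` {..d}) \<le> n" for n
    proof -
      have pn: "s n = (\<Sum>i<d. coeff (p n) i * \<xi> ^ i)"
        using p unfolding p(3) poly_altdef
        by (intro sum.mono_neutral_left) (auto simp: coeff_eq_0 le_less_trans)
      have "s n - l = (\<Sum>i<d. (coeff (p n) i - c i) * \<xi> ^ i)"
        unfolding pn l_def by (simp add: sum_subtractf left_diff_distrib)
      moreover have "vge B ((coeff (p n) i - c i) * \<xi> ^ i)" if "i < d" for i
      proof -
        have "N i \<le> Max (N ` {..d})" using that by (intro Max_ge) auto
        then show ?thesis using N[of i n] n
          by (intro vge_mult[OF _ vge_power[OF vge_rv], of "B - real i * rv \<xi>"]) auto
      qed
      ultimately show ?thesis by (auto intro: vge_sum)
    qed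
    then show "\<exists>N. \<forall>n\<ge>N. vge B (s n - l)" by blast
  qed
  ultimately show "\<exists>l\<in>simple_ext L \<xi>. tends_to D s l" by blast
qed

lemma real_Q_minus_1: "real (Q - Suc 0) = real Q - 1"
  using Q_pos by (simp add: of_nat_diff)

text \<open>The valuation of a point of level one, from y^(Q-1) = -omega with v(omega) = 1.\<close>

definition \<mu> :: real where "\<mu> = 1 / (real Q - 1)"

lemma \<mu>: "0 < \<mu>" "\<mu> < 1" "real Q * \<mu> = 1 + \<mu>" "(real Q - 1) * \<mu> = 1"
  using Q_ge_3 by (auto simp: \<mu>_def field_simps)

text \<open>Solves for the linear term: r = (y - r^Q) / omega. For displacements
  \<open>\<delta>\<close> > \<open>\<mu>\<close> the Q-th power gains (Q - 1)
  \<open>\<delta>\<close> > 1, which pays for the division by omega.\<close>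

lemma approximate_root:
  assumes K: "complete_in K" "is_subfield K" and w: "\<omega> \<in> K" "\<omega> \<noteq> 0" "rv \<omega> = 1"
    and y: "y \<in> K" and r0: "r0 \<in> K" "vgt 0 r0" and err: "vgt (1 + \<mu>) (\<omega> * r0 + r0 ^ Q - y)"
  obtains r where "r \<in> K" "\<omega> * r + r ^ Q = y" "vgt \<mu> (r - r0)"
proof -
  obtain \<delta>' where d': "1 + \<mu> < \<delta>'" "vge \<delta>' (\<omega> * r0 + r0 ^ Q - y)" using err by (rule vgt_obtain)
  define \<delta> where "\<delta> = \<delta>' - 1"
  have d: "\<mu> < \<delta>" using d' by (simp add: \<delta>_def)
  obtain \<beta>' where b': "0 < \<beta>'" "vge \<beta>' r0" using r0(2) by (rule vgt_obtain)
  define \<beta> where "\<beta> = min \<beta>' \<delta>"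
  have b: "0 < \<beta>" "vge \<beta> r0" "\<beta> \<le> \<delta>" using b' d \<mu>(1) by (auto simp: \<beta>_def elim: vge_mono)
  \<comment> \<open>The gain is limited by the pure Q-th power, which gives (Q - 1)
    \<open>\<delta>\<close> - 1, and by the mixed binomial terms, which give
    \<open>\<beta>\<close>.\<close>
  define \<epsilon> where "\<epsilon> = min ((real Q - 1) * \<delta> - 1) \<beta>"
  have "(real Q - 1) * \<mu> < (real Q - 1) * \<delta>" using d Q_ge_3 by (intro mult_strict_left_mono) auto
  then have eps: "0 < \<epsilon>" using b \<mu>(4) by (simp add: \<epsilon>_def)
  define \<phi> where "\<phi> r = (y - r ^ Q) / \<omega>" for r
  have start: "vge \<delta> (\<phi> r0 - r0)"
  proof -
    have "\<phi> r0 - r0 = - (\<omega> * r0 + r0 ^ Q - y) / \<omega>" using w by (simp add: \<phi>_def field_simps)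
    then show ?thesis using d'(2) w by (simp add: vge_divide_iff \<delta>_def vge_diff_commute[of _ y] del: minus_diff_eq)
  qed
  have K_closed: "\<phi> x \<in> K" if "x \<in> K" for x
  proof -
    have "x ^ n \<in> K" for n using K(2) that by (induction n) (auto simp: is_subfield_def)
    then show ?thesis using K(2) w y unfolding \<phi>_def is_subfield_def
      by (metis diff_conv_add_uminus divide_inverse)
  qed
  have contr: "vge (r + \<epsilon>) (\<phi> x - \<phi> x')"
    if "vge \<delta> (x - r0)" "vge \<delta> (x' - r0)" "\<delta> \<le> r" "vge r (x - x')" for x x' r
  proof -
    have "vge \<beta> x'" using that(2) b vge_close vge_mono by blast
    then have "vge (min (real Q * r) (1 + r + \<beta>)) (x ^ Q - x' ^ Q)"
      using that b d \<mu>(1) by (intro frob_contr) auto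
    moreover have "1 + r + \<epsilon> \<le> min (real Q * r) (1 + r + \<beta>)"
    proof -
      have "(real Q - 1) * \<delta> \<le> (real Q - 1) * r" using that Q_ge_3 by (intro mult_left_mono) auto
      then show ?thesis unfolding \<epsilon>_def by (simp add: algebra_simps min_def)
    qed
    ultimately have "vge (1 + r + \<epsilon>) (x ^ Q - x' ^ Q)" by (rule vge_mono)
    moreover have "\<phi> x - \<phi> x' = - (x ^ Q - x' ^ Q) / \<omega>" using w by (simp add: \<phi>_def field_simps)
    ultimately show ?thesis using w by (simp add: vge_divide_iff algebra_simps vge_diff_commute[of _ "x' ^ Q"])
  qed
  obtain l where l: "l \<in> K" "vge \<delta> (l - r0)" "\<phi> l = l"
    by (rule contraction_fixpoint[where \<phi> = \<phi>, OF K(1) r0(1) eps start])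
      (use K_closed contr in auto)
  have "\<omega> * l + l ^ Q = y" using l(3) w by (simp add: \<phi>_def field_simps)
  then show ?thesis using that l vge_vgt[OF l(2) d] by blast
qed

end

text \<open>The polynomial omega X + X^Q is a Lubin-Tate series for the uniformizer omega, and z is
  a point of exact level two above the point y of level one. The parameter omega stays general
  because pi and r(sigma) pi both occur.\<close>

locale lt_extension = local_subfield D L
  for D :: "('c::field, 'k::field) lt_data" and L +
  fixes \<omega> z :: 'c
  assumes w_L: "\<omega> \<in> L" and w_nz: "\<omega> \<noteq> 0" and rv_w: "rv \<omega> = 1"
    and z_eq: "(\<omega> * z + z ^ Q) ^ (Q - 1) = - \<omega>"
begin

interpretation LF: field_subset L by (rule field_subset_L)

definition "y = \<omega> * z + z ^ Q"

lemma y_eq: "y ^ (Q - 1) = - \<omega>" "y ^ Q = - \<omega> * y"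
proof -
  show *: "y ^ (Q - 1) = - \<omega>" using z_eq by (simp add: y_def)
  have "y ^ Q = y * y ^ (Q - 1)" using Q_pos by (metis power_eq_if neq0_conv)
  then show "y ^ Q = - \<omega> * y" using * by simp
qed

lemma rv_y: "y \<noteq> 0" "rv y = \<mu>"
proof -
  show y: "y \<noteq> 0" using y_eq w_nz Q_ge_3 by (auto simp: zero_power)
  have "real (Q - 1) * rv y = rv (- \<omega>)" using rv_power[OF y, of "Q - 1"] y_eq(1) by metis
  then have "real (Q - 1) * rv y = 1" by (simp only: rv_uminus rv_w)
  then have "(real Q - 1) * rv y = 1" by (simp only: One_nat_def real_Q_minus_1)
  then show "rv y = \<mu>" using Q_ge_3 by (simp add: \<mu>_def field_simps)
qed

text \<open>A Newton polygon argument: if omega z were not dominated by z^Q, then v(y) would be at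
  least 1 + v(z), which forces v(z) < 0 and contradicts that very comparison.\<close>

lemma rv_z: "z \<noteq> 0" "real Q * rv z = \<mu>" "0 < rv z"
proof -
  show z: "z \<noteq> 0" using rv_y Q_ge_3 by (auto simp: y_def zero_power)
  have r1: "rv (\<omega> * z) = 1 + rv z" "\<omega> * z \<noteq> 0" using z w_nz rv_w by (auto simp: rv_mult)
  have r2: "rv (z ^ Q) = real Q * rv z" "z ^ Q \<noteq> 0" using z by (auto simp: rv_power)
  have "1 + rv z > real Q * rv z"
  proof (rule ccontr)
    assume "\<not> 1 + rv z > real Q * rv z"
    then have le: "1 + rv z \<le> real Q * rv z" by simp
    have "vge (1 + rv z) y" unfolding y_def using r1 r2 le by (intro vge_add) (auto simp: vge_iff)
    then have "1 + rv z \<le> \<mu>" using rv_y by (auto simp: vge_iff)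
    then have "rv z < 0" using \<mu>(2) by simp
    then have "real Q * rv z \<le> 1 * rv z" using Q_ge_3 by (intro mult_right_mono_neg) auto
    then show False using le by simp
  qed
  then have "vgt (real Q * rv z) (y - z ^ Q)" using r1 by (auto simp: y_def vgt_iff)
  then have "rv y = real Q * rv z" using rv_cong[of "z ^ Q" y] r2 by simp
  then show "real Q * rv z = \<mu>" using rv_y by simp
  then show "0 < rv z" using \<mu>(1) Q_pos by (metis of_nat_0_less_iff zero_less_mult_pos)
qed

text \<open>The Eisenstein polynomial whose roots are the points of exact level two for omega; its
  constant coefficient omega will be the norm of z.\<close>

definition g :: "'c poly" where "g = (monom \<omega> 1 + monom 1 Q) ^ (Q - 1) + [:\<omega>:]"

abbreviation "d \<equiv> Q * (Q - 1)"

lemma d_pos: "0 < d" using Q_ge_3 by simp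

lemma poly_g: "poly g x = (\<omega> * x + x ^ Q) ^ (Q - 1) + \<omega>"
  by (simp add: g_def poly_monom)

lemma g_props: "g \<in> polys_over L" "degree g = d" "lead_coeff g = 1" "coeff g 0 = \<omega>"
proof -
  define h where "h = monom \<omega> 1 + monom (1::'c) Q"
  have dh: "degree h = Q" unfolding h_def
    by (subst degree_add_eq_right) (use Q_ge_3 in \<open>auto simp: degree_monom_eq intro: le_less_trans[OF degree_monom_le]\<close>)
  have lh: "lead_coeff h = 1" unfolding dh using Q_ge_3 by (simp add: h_def)
  have h0: "h \<noteq> 0" using lh by auto
  have hL: "h \<in> polys_over L" unfolding h_def by (intro LF.polys_add LF.polys_monom w_L L_1)
  have "h ^ n \<in> polys_over L" for n by (induction n) (auto intro: LF.polys_mult hL)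
  then show "g \<in> polys_over L" unfolding g_def h_def[symmetric] by (intro LF.polys_add LF.polys_const w_L)
  have dg: "degree (h ^ (Q - 1)) = d" using h0 by (simp add: degree_power_eq dh)
  then show "degree g = d" unfolding g_def h_def[symmetric] using d_pos by (subst degree_add_eq_left) auto
  moreover have "lead_coeff (h ^ (Q - 1)) = 1" by (simp add: lead_coeff_power lh)
  ultimately show "lead_coeff g = 1" unfolding g_def h_def[symmetric] using dg d_pos
    by (simp add: coeff_pCons split: nat.split)
  show "coeff g 0 = \<omega>" using poly_g[of 0] Q_ge_3 by (simp add: poly_0_coeff_0 zero_power)
qed

lemma rv_root:
  assumes "poly g r = 0" shows "r \<noteq> 0" "rv r = 1 / real d" "rv r = rv z"
proof -
  have *: "rv x = 1 / real d" if "real Q * rv x = \<mu>" for x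
    using that Q_ge_3 by (simp add: \<mu>_def field_simps real_Q_minus_1)
  interpret r: lt_extension D L \<omega> r
    using assms by unfold_locales (auto simp: w_L w_nz rv_w poly_g eq_neg_iff_add_eq_0)
  show "r \<noteq> 0" "rv r = 1 / real d" "rv r = rv z" using r.rv_z(1) *[OF r.rv_z(2)] *[OF rv_z(2)] by auto
qed

lemma g_root: "poly g z = 0"
  using z_eq by (simp add: poly_g)

text \<open>Coefficients in L have integral valuation and v(z) = 1/d, so the terms a_i z^i with i <
  d have valuations in distinct classes modulo 1.\<close>

lemma orthogonal: "orthogonal_basis L z d"
  unfolding orthogonal_basis_def
proof (intro ballI allI impI)
  fix p r i assume p: "p \<in> polys_over L" "degree p < d" and v: "vge r (poly p z)"
  have "vge r (coeff p i * z ^ i)"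
  proof (cases "i \<le> degree p")
    case True
    have "rv (coeff p i * z ^ i) \<noteq> rv (coeff p j * z ^ j)"
      if ij: "i \<in> {..degree p}" "j \<in> {..degree p}" "i \<noteq> j" "coeff p i * z ^ i \<noteq> 0" "coeff p j * z ^ j \<noteq> 0" for i j
    proof
      assume eq: "rv (coeff p i * z ^ i) = rv (coeff p j * z ^ j)"
      obtain m n :: int where mn: "rv (coeff p i) = of_int m" "rv (coeff p j) = of_int n"
        using ij p discrete[of "coeff p i"] discrete[of "coeff p j"] by (auto simp: polys_over_def)
      have "of_int m + real i / real d = of_int n + real j / real d"
        using eq ij mn rv_z(1) rv_root[OF g_root] by (simp add: rv_mult rv_power)
      then have "real_of_int (m - n) * real d = real j - real i"
        using d_pos by (simp add: field_simps)
      then have "of_int ((m - n) * int d) = real_of_int (int j - int i)" by simp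
      then have "(m - n) * int d = int j - int i" by (simp only: of_int_eq_iff)
      moreover have "\<bar>int j - int i\<bar> < int n" if "i < n" "j < n" for n using that by linarith
      then have "\<bar>int j - int i\<bar> < int d" by this (use ij p(2) in auto)
      ultimately have "\<bar>m - n\<bar> * int d < 1 * int d" by (metis abs_mult abs_of_nat mult_1)
      then have "m = n" using d_pos by simp
      then show False using \<open>(m - n) * int d = int j - int i\<close> ij by simp
    qed
    then show ?thesis
      using vge_summands[of "{..degree p}" i r "\<lambda>i. coeff p i * z ^ i"] v True
      unfolding poly_altdef by blast
  qed (simp add: coeff_eq_0)
  then show "vge (r - real i * rv z) (coeff p i)"
    using vge_mult_iff[of "z ^ i"] rv_z(1) by (simp add: mult.commute rv_power)
qed

lemma simple_minimal: "simple_minimal L z g"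
  using g_props g_root orthogonal_independent[OF orthogonal] by unfold_locales auto

interpretation SM: simple_minimal L z g by (rule simple_minimal)

lemma complete_M: "complete_in (simple_ext L z)"
  using complete_simple_ext[OF orthogonal] SM.M_rep g_props(2) by simp

text \<open>The element [alpha] (z + [beta] y) approximates the conjugate of z under the unit
  [alpha] (1 + [beta] omega). Completeness of L(z) lets the approximation be corrected inside
  L(z).\<close>

lemma root_exists:
  assumes "\<alpha> \<in> resfield D L" "\<alpha> \<noteq> 0" "\<beta> \<in> resfield D L"
  shows "\<exists>r\<in>simple_ext L z. \<omega> * r + r ^ Q = teich \<alpha> * y \<and> vgt \<mu> (r - teich \<alpha> * (z + teich \<beta> * y))"
proof -
  note a = teich[OF assms(1)] and b = teich[OF assms(3)]
  define r0 where "r0 = teich \<alpha> * (z + teich \<beta> * y)"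
  define E where "E = (z + teich \<beta> * y) ^ Q - z ^ Q - (teich \<beta> * y) ^ Q"
  have LM: "L \<subseteq> simple_ext L z" and zM: "z \<in> simple_ext L z" by (rule LF.simple_ext_closed)+
  note clo = LF.simple_ext_closed(3,4)
  have yM: "y \<in> simple_ext L z"
  proof -
    have "y = poly (monom \<omega> 1 + monom 1 Q) z" by (simp add: y_def poly_monom)
    then show ?thesis using w_L by (simp add: LF.simple_ext_closed LF.polys_add LF.polys_monom del: poly_add)
  qed
  have r0M: "r0 \<in> simple_ext L z" unfolding r0_def using a b LM zM yM by (intro clo) auto
  have bY: "vge \<mu> (teich \<beta> * y)" using vge_mult[OF b(4), of \<mu> y \<mu>] rv_y vge_rv[of y] by simp
  have "vge (1 + rv z + \<mu>) E"
    unfolding E_def using bY rv_z \<mu> by (intro frob_add) (auto simp: vge_rv)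
  then have E: "vgt (1 + \<mu>) E" by (rule vge_vgt) (use rv_z in simp)
  have "r0 ^ Q = teich \<alpha> * (z ^ Q + teich \<beta> * y ^ Q + E)"
    using a(2) b(2) by (simp add: r0_def power_mult_distrib E_def)
  \<comment> \<open>The contributions omega [beta] y and [beta] y^Q cancel because y^Q = -omega y,
    so only the mixed binomial terms E remain.\<close>
  then have "\<omega> * r0 + r0 ^ Q - teich \<alpha> * y = teich \<alpha> * E"
    by (simp add: r0_def y_eq(2)) (simp add: y_def algebra_simps)
  then have err: "vgt (1 + \<mu>) (\<omega> * r0 + r0 ^ Q - teich \<alpha> * y)"
    using vgt_mult[OF a(4) E] by simp
  have "vgt 0 (z + teich \<beta> * y)"
    using bY rv_z \<mu>(1) by (intro vgt_add) (auto simp: vgt_iff[of _ z] intro: vge_vgt)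
  then have "vgt 0 r0" unfolding r0_def using vgt_mult[OF a(4)] by simp
  then obtain r where "r \<in> simple_ext L z" "\<omega> * r + r ^ Q = teich \<alpha> * y" "vgt \<mu> (r - r0)"
    using approximate_root[OF complete_M SM.M_subfield _ w_nz rv_w _ r0M _ err] w_L LM yM a clo by blast
  then show ?thesis unfolding r0_def by blast
qed

definition root :: "'k \<Rightarrow> 'k \<Rightarrow> 'c" where
  "root \<alpha> \<beta> = (SOME r. r \<in> simple_ext L z \<and> \<omega> * r + r ^ Q = teich \<alpha> * y \<and>
     vgt \<mu> (r - teich \<alpha> * (z + teich \<beta> * y)))"

abbreviation "idx \<equiv> (resfield D L - {0}) \<times> resfield D L"

lemma root:
  assumes "\<alpha> \<in> resfield D L" "\<alpha> \<noteq> 0" "\<beta> \<in> resfield D L"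
  shows "root \<alpha> \<beta> \<in> simple_ext L z" "\<omega> * root \<alpha> \<beta> + root \<alpha> \<beta> ^ Q = teich \<alpha> * y"
    "vgt \<mu> (root \<alpha> \<beta> - teich \<alpha> * (z + teich \<beta> * y))" "poly g (root \<alpha> \<beta>) = 0"
proof -
  have "\<exists>r. r \<in> simple_ext L z \<and> \<omega> * r + r ^ Q = teich \<alpha> * y \<and>
     vgt \<mu> (r - teich \<alpha> * (z + teich \<beta> * y))" using root_exists[OF assms] by blast
  from someI_ex[OF this]
  show *: "root \<alpha> \<beta> \<in> simple_ext L z" "\<omega> * root \<alpha> \<beta> + root \<alpha> \<beta> ^ Q = teich \<alpha> * y"
    "vgt \<mu> (root \<alpha> \<beta> - teich \<alpha> * (z + teich \<beta> * y))" unfolding root_def by auto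
  have "teich \<alpha> \<noteq> 0" using teich[OF assms(1)] assms(2) by auto
  then show "poly g (root \<alpha> \<beta>) = 0"
    using * teich_unit[of "teich \<alpha>"] teich[OF assms(1)] y_eq(1) by (simp add: poly_g power_mult_distrib)
qed

text \<open>Modulo \<open>\<mu>\<close> the term in z, of valuation below \<open>\<mu>\<close>,
  determines alpha; then the term in y, of valuation exactly \<open>\<mu>\<close>, determines
  beta.\<close>

lemma root_separated:
  assumes "(\<alpha>, \<beta>) \<in> idx" "(\<alpha>', \<beta>') \<in> idx" "vgt \<mu> (root \<alpha> \<beta> - root \<alpha>' \<beta>')"
  shows "\<alpha> = \<alpha>' \<and> \<beta> = \<beta>'"
proof -
  have m: "\<alpha> \<in> resfield D L" "\<alpha> \<noteq> 0" "\<beta> \<in> resfield D L" "\<alpha>' \<in> resfield D L" "\<alpha>' \<noteq> 0" "\<beta>' \<in> resfield D L"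
    using assms by auto
  note a = teich[OF m(1)] and b = teich[OF m(3)] and a' = teich[OF m(4)] and b' = teich[OF m(6)]
  have "vgt \<mu> (teich \<alpha> * (z + teich \<beta> * y) - teich \<alpha>' * (z + teich \<beta>' * y))"
    using assms(3) root(3)[OF m(1-3)] root(3)[OF m(4-6)] vgt_trans vgt_diff_commute by metis
  moreover have "vge \<mu> ((teich \<alpha> * teich \<beta> - teich \<alpha>' * teich \<beta>') * y)"
    using a b a' b' rv_y(2) by (intro vge_mult[OF vge_diff vge_rv]) (auto intro: vge_mult_0)
  ultimately have "vge \<mu> (teich \<alpha> * (z + teich \<beta> * y) - teich \<alpha>' * (z + teich \<beta>' * y)
      - (teich \<alpha> * teich \<beta> - teich \<alpha>' * teich \<beta>') * y)"
    using vge_diff[OF vgt_vge[OF _ order.refl]] by blast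
  then have "vge \<mu> (z * (teich \<alpha> - teich \<alpha>'))" by (simp add: algebra_simps)
  then have "vge (\<mu> - rv z) (teich \<alpha> - teich \<alpha>')" using rv_z vge_mult_iff by blast
  moreover have "1 * rv z < real Q * rv z" using rv_z(3) Q_ge_3 by (intro mult_strict_right_mono) auto
  ultimately have "vgt 0 (teich \<alpha> - teich \<alpha>')" using rv_z(2) by (auto elim: vge_vgt)
  then have eq: "\<alpha> = \<alpha>'" using redn_eq_iff a a' by metis
  have "teich \<alpha> * (z + teich \<beta> * y) - teich \<alpha> * (z + teich \<beta>' * y) = (teich \<alpha> * y) * (teich \<beta> - teich \<beta>')"
    by (simp add: algebra_simps)
  then have "vgt \<mu> ((teich \<alpha> * y) * (teich \<beta> - teich \<beta>'))"
    using \<open>vgt \<mu> (teich \<alpha> * (z + teich \<beta> * y) - teich \<alpha>' * (z + teich \<beta>' * y))\<close> eq by simp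
  moreover have "teich \<alpha> \<noteq> 0" using a(3) m(2) redn_0 by metis
  then have "teich \<alpha> * y \<noteq> 0" "rv (teich \<alpha> * y) = \<mu>"
    using rv_y teich_unit[OF a(2)] \<open>teich \<alpha> \<noteq> 0\<close> by (auto simp: rv_mult)
  ultimately have "vgt 0 (teich \<beta> - teich \<beta>')" using vgt_mult_iff by fastforce
  then show ?thesis using eq redn_eq_iff b b' by metis
qed

text \<open>The separated roots number (Q - 1) Q, which is the degree of g, so they exhaust its
  roots and g splits in L(z).\<close>

lemma all_roots: "{r. poly g r = 0} = (\<lambda>(\<alpha>, \<beta>). root \<alpha> \<beta>) ` idx" "card {r. poly g r = 0} = d"
proof -
  have fin: "finite {r. poly g r = 0}" using poly_roots_finite SM.g_nz by blast
  have inj: "inj_on (\<lambda>(\<alpha>, \<beta>). root \<alpha> \<beta>) idx"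
  proof (rule inj_onI)
    fix p p' assume *: "p \<in> idx" "p' \<in> idx" "(\<lambda>(\<alpha>, \<beta>). root \<alpha> \<beta>) p = (\<lambda>(\<alpha>, \<beta>). root \<alpha> \<beta>) p'"
    then have "vgt \<mu> (root (fst p) (snd p) - root (fst p') (snd p'))" by (simp add: case_prod_beta)
    then show "p = p'" using root_separated[of "fst p" "snd p" "fst p'" "snd p'"] * by (simp add: prod_eq_iff)
  qed
  have "card idx = (Q - 1) * Q"
    using resfield_0 fin_resfield by (simp add: card_cartesian_product Q_def card_Diff_singleton)
  then have c: "card ((\<lambda>(\<alpha>, \<beta>). root \<alpha> \<beta>) ` idx) = d" using card_image[OF inj] by simp
  have sub: "(\<lambda>(\<alpha>, \<beta>). root \<alpha> \<beta>) ` idx \<subseteq> {r. poly g r = 0}" using root(4) by auto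
  have le: "card {r. poly g r = 0} \<le> d" using card_poly_roots_bound[OF SM.g_nz] g_props(2) by simp
  then show "{r. poly g r = 0} = (\<lambda>(\<alpha>, \<beta>). root \<alpha> \<beta>) ` idx"
    using card_seteq[OF fin sub] c by simp
  then show "card {r. poly g r = 0} = d" using c by simp
qed

interpretation SG: simple_galois L z g
  using all_roots root(1) g_props(2) by unfold_locales auto

text \<open>Orthogonality bounds the coefficients of x in terms of v(x), and a conjugate of z has
  the same valuation as z.\<close>

lemma gal_isometry:
  assumes "\<tau> \<in> gal L (simple_ext L z)" "x \<in> simple_ext L z" "vgt r x"
  shows "vgt r (\<tau> x)"
proof -
  obtain s where s: "r < s" "vge s x" using assms(3) by (rule vgt_obtain)
  obtain p where p: "p \<in> polys_over L" "degree p < d" "x = poly p z"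
    using SM.M_rep[OF assms(2)] g_props(2) by auto
  have "vge (s - real i * rv z) (coeff p i)" for i
    using orthogonal p s(2) unfolding orthogonal_basis_def by blast
  moreover have "vge (rv z) (\<tau> z)" using rv_root[OF SG.gal_root[OF assms(1)]] vge_rv by metis
  ultimately have "vge s (poly p (\<tau> z))" by (rule poly_vge)
  then have "vge s (\<tau> x)" using SG.gal_poly(1)[OF assms(1) p(1)] p LF.simple_ext_closed(2) by simp
  then show ?thesis using s vge_vgt by blast
qed

text \<open>Both composites are given by one symmetric formula up to an error beyond
  \<open>\<mu>\<close>, and roots of g that close are equal.\<close>

lemma abelian: "finite_abelian_extension L (simple_ext L z)"
proof (rule SG.abelianI)
  fix \<tau> \<tau>' assume \<tau>: "\<tau> \<in> gal L (simple_ext L z)" "\<tau>' \<in> gal L (simple_ext L z)"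
  have zM: "z \<in> simple_ext L z" by (rule LF.simple_ext_closed)
  have yp: "y = poly (monom \<omega> 1 + monom 1 Q) z" "monom \<omega> 1 + monom 1 Q \<in> polys_over L"
    using w_L by (auto simp: y_def poly_monom intro!: LF.polys_add LF.polys_monom)
  have root_form: "\<exists>\<alpha> \<beta>. (\<alpha>, \<beta>) \<in> idx \<and> r = root \<alpha> \<beta>" if "poly g r = 0" for r
  proof -
    have "r \<in> (\<lambda>(\<alpha>, \<beta>). root \<alpha> \<beta>) ` idx" using that all_roots(1) by blast
    then show ?thesis by (auto elim!: imageE)
  qed
  obtain \<alpha> \<beta> where ab: "(\<alpha>, \<beta>) \<in> idx" "\<tau> z = root \<alpha> \<beta>" using root_form SG.gal_root[OF \<tau>(1)] by blast
  obtain \<alpha>' \<beta>' where ab': "(\<alpha>', \<beta>') \<in> idx" "\<tau>' z = root \<alpha>' \<beta>'" using root_form SG.gal_root[OF \<tau>(2)] by blast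
  \<comment> \<open>The first automorphism is applied to the approximation of the conjugate of z; it
    fixes the Teichmueller factors and sends y exactly to [alpha] y.\<close>
  have comp: "vgt \<mu> (\<tau> (\<tau>' z) - teich \<alpha>' * teich \<alpha> * (z + (teich \<beta> + teich \<beta>') * y))"
    if \<tau>: "\<tau> \<in> gal L (simple_ext L z)" "\<tau>' \<in> gal L (simple_ext L z)"
      and ab: "(\<alpha>, \<beta>) \<in> idx" "\<tau> z = root \<alpha> \<beta>" and ab': "(\<alpha>', \<beta>') \<in> idx" "\<tau>' z = root \<alpha>' \<beta>'"
    for \<tau> \<tau>' \<alpha> \<beta> \<alpha>' \<beta>'
  proof -
    have m: "\<alpha> \<in> resfield D L" "\<alpha> \<noteq> 0" "\<beta> \<in> resfield D L" "\<alpha>' \<in> resfield D L" "\<alpha>' \<noteq> 0" "\<beta>' \<in> resfield D L"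
      using ab ab' by auto
    define p where "p = [:teich \<alpha>':] * ([:0, 1:] + [:teich \<beta>':] * (monom \<omega> 1 + monom 1 Q))"
    have p: "p \<in> polys_over L"
      unfolding p_def using m teich yp by (intro LF.polys_mult LF.polys_add LF.polys_X LF.polys_const LF.polys_monom w_L) auto
    have pz: "poly p x = teich \<alpha>' * (x + teich \<beta>' * (\<omega> * x + x ^ Q))" for x
      by (simp add: p_def poly_monom)
    have r'M: "root \<alpha>' \<beta>' \<in> simple_ext L z" using root m by blast
    have pM: "poly p z \<in> simple_ext L z" using p LF.simple_ext_closed by blast
    have dM: "root \<alpha>' \<beta>' - poly p z \<in> simple_ext L z"
      using SM.M_subfield r'M pM unfolding is_subfield_def by (metis diff_conv_add_uminus)
    have hom: "\<tau> (a + b) = \<tau> a + \<tau> b" if "a \<in> simple_ext L z" "b \<in> simple_ext L z" for a b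
      using \<tau> that by (auto simp: gal_def)
    have "\<tau> (root \<alpha>' \<beta>') = \<tau> (root \<alpha>' \<beta>' - poly p z) + \<tau> (poly p z)"
      using hom[OF dM pM] by simp
    then have 1: "\<tau> (root \<alpha>' \<beta>') - \<tau> (poly p z) = \<tau> (root \<alpha>' \<beta>' - poly p z)" by simp
    have "vgt \<mu> (root \<alpha>' \<beta>' - poly p z)" using root(3)[OF m(4-6)] unfolding pz by (simp add: y_def)
    then have 2: "vgt \<mu> (\<tau> (root \<alpha>' \<beta>') - \<tau> (poly p z))"
      using gal_isometry[OF \<tau>(1) dM] 1 by simp
    have 3: "\<tau> (poly p z) = teich \<alpha>' * (root \<alpha> \<beta> + teich \<beta>' * (teich \<alpha> * y))"
      using SG.gal_poly(1)[OF \<tau>(1) p zM] ab root(2)[OF m(1-3)] by (simp add: pz)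
    have "vgt \<mu> (teich \<alpha>' * (root \<alpha> \<beta> - teich \<alpha> * (z + teich \<beta> * y)))"
      using root(3)[OF m(1-3)] teich(4)[OF m(4)] vgt_mult by fastforce
    then have "vgt \<mu> (\<tau> (poly p z) - teich \<alpha>' * teich \<alpha> * (z + (teich \<beta> + teich \<beta>') * y))"
      unfolding 3 by (simp add: algebra_simps)
    then show ?thesis using 2 vgt_trans ab' by metis
  qed
  have "vgt \<mu> (\<tau> (\<tau>' z) - \<tau>' (\<tau> z))"
  proof (rule vgt_trans)
    show "vgt \<mu> (\<tau> (\<tau>' z) - teich \<alpha>' * teich \<alpha> * (z + (teich \<beta> + teich \<beta>') * y))"
      by (rule comp[OF \<tau> ab ab'])
    show "vgt \<mu> (teich \<alpha>' * teich \<alpha> * (z + (teich \<beta> + teich \<beta>') * y) - \<tau>' (\<tau> z))"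
      using comp[OF \<tau>(2,1) ab' ab]
      by (subst vgt_diff_commute) (simp only: mult.commute[of "teich \<alpha>'"] add.commute[of "teich \<beta>"])
  qed
  moreover have "poly g (\<tau> (\<tau>' z)) = 0 \<and> poly g (\<tau>' (\<tau> z)) = 0"
  proof -
    have "poly g (\<sigma> (\<sigma>' z)) = 0" if \<sigma>: "\<sigma> \<in> gal L (simple_ext L z)" "\<sigma>' \<in> gal L (simple_ext L z)" for \<sigma> \<sigma>'
    proof -
      have r: "poly g (\<sigma>' z) = 0" using SG.gal_root \<sigma> by blast
      then have "\<sigma>' z \<in> simple_ext L z" using SG.g_roots by blast
      then have "\<sigma> (poly g (\<sigma>' z)) = poly g (\<sigma> (\<sigma>' z))" using SG.gal_poly(1) \<sigma> g_props by blast
      moreover have "\<sigma> 0 = 0" using \<sigma> L_0 by (auto simp: gal_def)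
      ultimately show ?thesis using r by simp
    qed
    then show ?thesis using \<tau> by blast
  qed
  moreover from this obtain a b a' b' where "(a, b) \<in> idx" "\<tau> (\<tau>' z) = root a b"
      "(a', b') \<in> idx" "\<tau>' (\<tau> z) = root a' b'"
    using root_form by meson
  ultimately show "\<tau> (\<tau>' z) = \<tau>' (\<tau> z)"
    using root_separated[of a b a' b'] by simp
qed

text \<open>The degree Q (Q - 1) is even, so the norm of z is omega itself, with no sign.\<close>

lemma norm_z: "\<omega> \<in> norm_group L (simple_ext L z)"
proof -
  have "even d" using odd_Q by simp
  then show ?thesis using SG.const_norm rv_z(1) g_props by simp
qed

end

section \<open>Hensel's lemma and unramified extensions\<close>

context local_field_setting
begin

lemma pCons_integral: "(\<And>i. vge 0 (coeff (pCons a p) i)) \<Longrightarrow> vge 0 a \<and> (\<forall>i. vge 0 (coeff p i))"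
  by (metis coeff_pCons_0 coeff_pCons_Suc)

lemma poly_vge_0: "(\<And>i. vge 0 (coeff p i)) \<Longrightarrow> vge 0 x \<Longrightarrow> vge 0 (poly p x)"
  using poly_integral by blast

lemma pderiv_integral: "(\<And>i. vge 0 (coeff p i)) \<Longrightarrow> vge 0 (coeff (pderiv p) i)"
  unfolding coeff_pderiv by (intro vge_mult_0 vge_of_nat)

lemma poly_diff_vge:
  assumes "\<And>i. vge 0 (coeff p i)" "vge 0 x" "vge 0 y" "vge r (x - y)"
  shows "vge r (poly p x - poly p y)"
  using assms(1)
proof (induction p)
  case (pCons a p)
  have p: "\<And>i. vge 0 (coeff p i)" using pCons_integral pCons.prems by blast
  have "poly (pCons a p) x - poly (pCons a p) y = (x - y) * poly p x + y * (poly p x - poly p y)"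
    by (simp add: algebra_simps)
  then show ?case
    using vge_mult[OF assms(4) poly_vge_0[OF p assms(2)], of r] vge_mult[OF assms(3) pCons.IH[OF p], of r]
    by (simp add: vge_add)
qed simp

text \<open>First-order Taylor expansion with the derivative frozen at x0. Freezing it makes the
  simplified Newton iteration a contraction of constant gain \<open>\<delta>\<close>.\<close>

lemma poly_taylor_vge:
  assumes "\<And>i. vge 0 (coeff p i)" "vge 0 x0" "vge \<delta> (x - x0)" "vge \<delta> (y - x0)" "0 \<le> \<delta>" "vge r (x - y)"
  shows "vge (r + \<delta>) (poly p x - poly p y - (x - y) * poly (pderiv p) x0)"
  using assms(1)
proof (induction p)
  case (pCons a p)
  have p: "\<And>i. vge 0 (coeff p i)" using pCons_integral pCons.prems by blast
  have x: "vge 0 x" and y: "vge 0 y"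
    using assms(2-5) vge_close vge_mono by blast+
  have "vge (r + \<delta>) (x * (poly p x - poly p y - (x - y) * poly (pderiv p) x0))"
    using x pCons.IH[OF p] by (rule vge_mult) simp
  moreover have "vge (r + \<delta>) ((x - y) * (poly p y - poly p x0))"
    by (rule vge_mult[OF assms(6) poly_diff_vge[OF p y assms(2,4)]]) simp
  moreover have "vge (r + \<delta>) ((x - y) * (x - x0) * poly (pderiv p) x0)"
    by (rule vge_mult[OF vge_mult[OF assms(6,3)] poly_vge_0[OF pderiv_integral[OF p] assms(2)]]) auto
  ultimately have "vge (r + \<delta>) (x * (poly p x - poly p y - (x - y) * poly (pderiv p) x0)
      + (x - y) * (poly p y - poly p x0) + (x - y) * (x - x0) * poly (pderiv p) x0)"
    by (intro vge_add)
  then show ?case by (simp add: pderiv_pCons algebra_simps)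
qed simp

text \<open>Simplified Newton iteration x - p(x)/e with e = p'(x0) a unit; all operations stay in K,
  so the root does too.\<close>

lemma hensel:
  assumes K: "complete_in K" "is_subfield K" and p: "p \<in> polys_over K" "\<And>i. vge 0 (coeff p i)"
    and x0: "x0 \<in> K" "vge 0 x0" and small: "vge \<delta> (poly p x0)" "0 < \<delta>"
    and simple: "redn D (poly (pderiv p) x0) \<noteq> 0"
  obtains x where "x \<in> K" "poly p x = 0" "vge \<delta> (x - x0)"
proof -
  interpret KF: field_subset K by unfold_locales (rule K(2))
  define e where "e = poly (pderiv p) x0"
  have e: "vge 0 e" "e \<noteq> 0" "rv e = 0"
    using poly_vge_0[OF pderiv_integral[OF p(2)] x0(2)] simple redn_unit by (auto simp: e_def)
  have poly_K: "poly q x \<in> K" if "q \<in> polys_over K" "x \<in> K" for q x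
    using that by (induction q) (auto simp: polys_over_pCons_iff intro: KF.Ladd KF.Lmult)
  have "pderiv p \<in> polys_over K"
    unfolding polys_over_def
  proof safe
    fix i
    have "of_nat n \<in> K" for n by (induction n) (auto intro: KF.Ladd)
    then show "coeff (pderiv p) i \<in> K"
      using p(1) by (auto simp: polys_over_def coeff_pderiv simp del: of_nat_Suc intro!: KF.Lmult)
  qed
  then have eK: "e \<in> K" unfolding e_def using x0 poly_K by blast
  define \<phi> where "\<phi> x = x - poly p x / e" for x
  have start: "vge \<delta> (\<phi> x0 - x0)" using small e by (simp add: \<phi>_def vge_divide_iff)
  have clo: "\<phi> x \<in> K" if "x \<in> K" for x
  proof -
    have "x + - (poly p x * inverse e) \<in> K" using that poly_K[OF p(1)] eK
      by (intro KF.Ladd KF.Luminus KF.Lmult KF.Linverse)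
    then show ?thesis by (simp add: \<phi>_def divide_inverse)
  qed
  have contr: "vge (r + \<delta>) (\<phi> x - \<phi> y)"
    if "vge \<delta> (x - x0)" "vge \<delta> (y - x0)" "vge r (x - y)" for x y r
  proof -
    have "vge (r + \<delta>) (poly p x - poly p y - (x - y) * e)"
      unfolding e_def using that small(2) by (intro poly_taylor_vge p x0) auto
    moreover have "\<phi> x - \<phi> y = - (poly p x - poly p y - (x - y) * e) / e"
      using e by (simp add: \<phi>_def field_simps)
    ultimately show ?thesis using e by (simp only: vge_divide_iff[OF e(2)] vge_uminus) simp
  qed
  obtain l where l: "l \<in> K" "vge \<delta> (l - x0)" "\<phi> l = l"
    by (rule contraction_fixpoint[where \<phi> = \<phi>, OF K(1) x0(1) small(2) start]) (use clo contr in auto)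
  then have "poly p l = 0" using e by (simp add: \<phi>_def)
  then show ?thesis using that l by blast
qed

lemma rv_prod:
  "finite A \<Longrightarrow> (\<And>a. a \<in> A \<Longrightarrow> f a \<noteq> 0 \<and> rv (f a) = s) \<Longrightarrow> rv (prod f A) = of_nat (card A) * s"
proof (induction A rule: finite_induct)
  case (insert a A)
  then have "prod f A \<noteq> 0" by auto
  then show ?case using insert by (simp add: rv_mult algebra_simps)
qed simp

lemma UNIV_subfield: "is_subfield UNIV"
  by (simp add: is_subfield_def)

end

text \<open>Produces an unramified extension of L from a residue c outside k_L with finite Frobenius
  period, by lifting the minimal polynomial of c. Its norms detect whether an element of valuation 1
  can belong to an automorphism with the wrong action on residues.\<close>

locale unramified_extension = local_subfield D L
  for D :: "('c::field, 'k::field) lt_data" and L +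
  fixes c :: 'k and n :: nat
  assumes n_pos: "0 < n" and c_period: "c ^ (Q ^ n) = c" and c_notin: "c \<notin> resfield D L"
begin

interpretation LF: field_subset L by (rule field_subset_L)

definition d :: nat where "d = (LEAST d. 0 < d \<and> c ^ (Q ^ d) = c)"

lemma d: "0 < d" "c ^ (Q ^ d) = c" "\<And>e. 0 < e \<Longrightarrow> e < d \<Longrightarrow> c ^ (Q ^ e) \<noteq> c"
  using LeastI[of "\<lambda>d. 0 < d \<and> c ^ (Q ^ d) = c" n] n_pos c_period not_less_Least
  unfolding d_def by blast+

lemma d_ge_2: "2 \<le> d"
proof -
  have "d \<noteq> 1" using d(2) c_notin frobenius_roots by (metis power_one_right)
  then show ?thesis using d(1) by linarith
qed

definition conj :: "nat \<Rightarrow> 'k" where "conj i = c ^ (Q ^ i)"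

lemma conj_0 [simp]: "conj 0 = c" and conj_Suc: "conj (Suc i) = conj i ^ Q" and conj_d: "conj d = c"
  using d(2) by (simp_all add: conj_def power_mult[symmetric] mult.commute)

lemma inj_conj: "inj_on conj {..<d}"
proof -
  have "conj i \<noteq> conj j" if "i < j" "j < d" for i j
  proof
    assume "conj i = conj j"
    moreover have "Q ^ j = Q ^ (j - i) * Q ^ i" using that by (simp flip: power_add)
    ultimately have "c ^ (Q ^ i) = (c ^ (Q ^ (j - i))) ^ (Q ^ i)" by (simp add: conj_def power_mult)
    then have "c ^ (Q ^ (j - i)) = c" using frob_pow_inj_residue by metis
    then show False using d(3)[of "j - i"] that by simp
  qed
  then show ?thesis unfolding inj_on_def by (metis lessThan_iff linorder_neqE_nat)
qed

text \<open>The minimal polynomial of c over k_L, written as the product over its Frobenius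
  conjugates.\<close>

definition P :: "'k poly" where "P = (\<Prod>i<d. [:- conj i, 1:])"

lemma P: "degree P = d" "lead_coeff P = 1" "\<And>i. i < d \<Longrightarrow> poly P (conj i) = 0"
    "\<And>i. i < d \<Longrightarrow> poly (pderiv P) (conj i) \<noteq> 0"
proof -
  show "degree P = d" unfolding P_def by (subst degree_prod_eq_sum_degree) auto
  show "lead_coeff P = 1" unfolding P_def by (simp add: lead_coeff_prod)
  fix i assume i: "i < d"
  then show "poly P (conj i) = 0" by (auto simp: P_def poly_prod)
  define R where "R = (\<Prod>j\<in>{..<d} - {i}. [:- conj j, 1:])"
  have P: "P = [:- conj i, 1:] * R" unfolding P_def R_def using i by (subst prod.remove[of _ i]) auto
  have "poly (pderiv P) (conj i) = poly R (conj i)"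
    unfolding P pderiv_mult poly_add poly_mult by (simp add: pderiv_pCons)
  moreover have "poly R (conj i) \<noteq> 0"
    using inj_conj i by (auto simp: R_def poly_prod inj_on_def)
  ultimately show "poly (pderiv P) (conj i) \<noteq> 0" by simp
qed

lemma frob_map_poly: "poly (map_poly (\<lambda>a. a ^ Q) p) (x ^ Q) = (poly p (x::'k)) ^ Q"
  using Q_pos by (induction p) (auto simp: map_poly_pCons frob_add_residue power_mult_distrib)

text \<open>The Frobenius twist of P is monic of degree d and has the same d roots, because
  Frobenius permutes the conjugates cyclically. Hence it equals P, and its coefficients lie in
  k_L.\<close>

lemma P_over: "coeff P i \<in> resfield D L"
proof -
  define S where "S = map_poly (\<lambda>a. a ^ Q) P"
  have coeff_S: "coeff S j = coeff P j ^ Q" for j using Q_pos by (simp add: S_def coeff_map_poly)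
  have "S = P"
  proof (rule ccontr)
    assume ne: "S \<noteq> P"
    have zero: "poly (S - P) (conj j) = 0" if "j < d" for j
    proof -
      obtain i where "i < d" "conj j = conj i ^ Q"
      proof (cases j)
        case 0
        then show ?thesis using conj_Suc[of "d - 1"] conj_d d(1) that by (intro that[of "d - 1"]) auto
      next
        case (Suc i)
        then show ?thesis using conj_Suc[of i] \<open>j < d\<close> by (intro that[of i]) auto
      qed
      then have "poly S (conj j) = 0" using P(3)[of i] frob_map_poly[of P "conj i"] Q_pos
        by (simp add: S_def)
      then show ?thesis using P(3)[OF that] by simp
    qed
    have "d = card (conj ` {..<d})" using card_image[OF inj_conj] by simp
    also have "\<dots> \<le> card {x. poly (S - P) x = 0}"
      using zero ne by (intro card_mono poly_roots_finite) auto
    also have "\<dots> \<le> degree (S - P)" using ne by (intro card_poly_roots_bound) simp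
    finally have "d \<le> degree (S - P)" .
    moreover have "degree (S - P) \<le> d"
      by (rule degree_diff_le) (auto simp: S_def P(1) intro: order.trans[OF map_poly_degree_leq])
    ultimately have "degree (S - P) = d" by simp
    moreover have "coeff (S - P) d = 0" using P coeff_S[of d] by simp
    ultimately show False using ne by (metis eq_iff_diff_eq_0 leading_coeff_0_iff)
  qed
  then show ?thesis using coeff_S frobenius_roots by metis
qed

lemma poly_conj:
  assumes "\<And>i. coeff p i \<in> resfield D L"
  shows "poly p (conj i) = (poly p c) ^ (Q ^ i)"
proof (induction i)
  case (Suc i)
  have "map_poly (\<lambda>a. a ^ Q) p = p"
    using assms frobenius_roots Q_pos by (intro poly_eqI) (simp add: coeff_map_poly)
  then have "poly p (conj (Suc i)) = (poly p (conj i)) ^ Q"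
    using frob_map_poly[of p "conj i"] by (simp add: conj_Suc)
  then show ?case using Suc by (simp add: power_mult[symmetric] mult.commute)
qed simp

text \<open>A polynomial over k_L that kills c kills all d distinct conjugates of c.\<close>

lemma c_independent:
  assumes "\<And>i. coeff p i \<in> resfield D L" "degree p < d" "poly p c = 0"
  shows "p = 0"
proof (rule ccontr)
  assume p: "p \<noteq> 0"
  have "d = card (conj ` {..<d})" using card_image[OF inj_conj] by simp
  also have "\<dots> \<le> card {x. poly p x = 0}"
    using poly_conj[OF assms(1)] assms(3) p Q_pos by (intro card_mono poly_roots_finite) auto
  also have "\<dots> \<le> degree p" using p by (intro card_poly_roots_bound)
  finally show False using assms by simp
qed

text \<open>Coefficientwise Teichmueller lift of P; as 0 and 1 lift to themselves, it is monic of
  the same degree.\<close>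

definition g :: "'c poly" where "g = (\<Sum>i\<le>d. monom (teich (coeff P i)) i)"

lemma teich_01: "teich 0 = 0" "teich 1 = 1"
  using teich_redn[of 0] teich_redn[of 1] Q_pos by (auto simp: redn_one)

lemma coeff_g: "coeff g i = teich (coeff P i)"
  unfolding g_def coeff_sum using P(1) by (auto simp: sum.delta' coeff_eq_0 teich_01)

lemma g: "g \<in> polys_over L" "\<And>i. vge 0 (coeff g i)" "map_poly (redn D) g = P"
    "degree g = d" "lead_coeff g = 1" "map_poly (redn D) (pderiv g) = pderiv P"
proof -
  note t = teich[OF P_over]
  show "g \<in> polys_over L" "\<And>i. vge 0 (coeff g i)" using t by (auto simp: polys_over_def coeff_g)
  show "map_poly (redn D) g = P" using t by (intro poly_eqI) (simp add: coeff_map_poly coeff_g)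
  show "map_poly (redn D) (pderiv g) = pderiv P"
    using t by (intro poly_eqI) (simp add: coeff_map_poly coeff_g coeff_pderiv redn_times redn_of_nat del: of_nat_Suc)
  have "degree g \<le> d" unfolding g_def by (intro degree_sum_le) (auto intro: order.trans[OF degree_monom_le])
  moreover have 1: "coeff g d = 1" using P(1,2) by (simp add: coeff_g teich_01)
  ultimately show "degree g = d" by (metis le_antisym le_degree zero_neq_one)
  then show "lead_coeff g = 1" using 1 by simp
qed

lemma root_lift:
  assumes K: "complete_in K" "is_subfield K" "L \<subseteq> K" and x0: "x0 \<in> K" "vge 0 x0" "redn D x0 = conj i" "i < d"
  shows "\<exists>r\<in>K. poly g r = 0 \<and> vge 0 r \<and> redn D r = conj i"
proof -
  have "redn D (poly g x0) = 0" using poly_integral[OF g(2) x0(2)] x0 P(3) g(3) by simp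
  then have "vgt 0 (poly g x0)" using redn_eq_0_iff poly_vge_0[OF g(2) x0(2)] by blast
  then obtain \<delta> where \<delta>: "0 < \<delta>" "vge \<delta> (poly g x0)" by (rule vgt_obtain)
  have "redn D (poly (pderiv g) x0) \<noteq> 0"
    using poly_integral[OF pderiv_integral[OF g(2)] x0(2)] x0 P(4) g(6) by simp
  moreover have "g \<in> polys_over K" using g(1) K(3) by (auto simp: polys_over_def)
  ultimately obtain r where r: "r \<in> K" "poly g r = 0" "vge \<delta> (r - x0)"
    using hensel[OF K(1,2) _ g(2) x0(1,2) \<delta>(2,1)] by blast
  then have "vge 0 r \<and> redn D r = redn D x0" using \<delta> x0(2) by (intro redn_cong) (auto elim: vge_vgt)
  then show ?thesis using r x0 by auto
qed

definition \<xi> :: 'c where "\<xi> = (SOME x. poly g x = 0 \<and> vge 0 x \<and> redn D x = c)"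

lemma \<xi>: "poly g \<xi> = 0" "vge 0 \<xi>" "redn D \<xi> = c" "\<xi> \<noteq> 0" "rv \<xi> = 0"
proof -
  obtain x0 where "vge 0 x0" "redn D x0 = c" by (rule redn_lift)
  then have "\<exists>x. poly g x = 0 \<and> vge 0 x \<and> redn D x = c"
    using root_lift[OF complete_in_UNIV UNIV_subfield, of x0 0] d(1) by auto
  from someI_ex[OF this] show *: "poly g \<xi> = 0" "vge 0 \<xi>" "redn D \<xi> = c" unfolding \<xi>_def by auto
  have "c \<noteq> 0" using c_notin resfield_0 by auto
  then show "\<xi> \<noteq> 0" "rv \<xi> = 0" using redn_unit * by auto
qed

text \<open>The Gauss norm: after division by a coefficient of least valuation the reduction is
  nonzero of degree below d, so it does not vanish at c and the rescaled value is a unit.\<close>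

lemma min_coeff:
  assumes p: "p \<in> polys_over L" "degree p < d" "p \<noteq> 0"
  shows "poly p \<xi> \<noteq> 0 \<and> (\<exists>i. coeff p i \<noteq> 0 \<and> rv (poly p \<xi>) = rv (coeff p i) \<and>
    (\<forall>j. vge (rv (poly p \<xi>)) (coeff p j)))"
proof -
  define A where "A = {i. coeff p i \<noteq> 0}"
  have "finite A" unfolding A_def by (rule finite_subset[of _ "{..degree p}"]) (auto intro: le_degree)
  moreover have "A \<noteq> {}" using p(3) leading_coeff_0_iff unfolding A_def by blast
  ultimately obtain i where i: "i \<in> A" "\<And>j. j \<in> A \<Longrightarrow> rv (coeff p i) \<le> rv (coeff p j)"
    using arg_min_if_finite[of A "\<lambda>i. rv (coeff p i)"] by (metis not_le)
  define a where "a = coeff p i"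
  have a: "a \<noteq> 0" "a \<in> L" using i p by (auto simp: a_def A_def polys_over_def)
  have min: "vge (rv a) (coeff p j)" for j using i(2)[of j] by (auto simp: vge_iff a_def A_def)
  define q where "q = smult (inverse a) p"
  have pq: "p = smult a q" using a by (simp add: q_def)
  have q: "vge 0 (coeff q j)" "coeff q j \<in> L" for j
    using min[of j] a p by (auto simp: q_def vge_mult_iff rv_inverse polys_over_def intro!: L_mult L_inverse)
  have "map_poly (redn D) q \<noteq> 0"
  proof
    assume "map_poly (redn D) q = 0"
    then have "redn D (coeff q i) = 0" by (metis coeff_0 coeff_map_poly redn_0)
    then show False using a by (simp add: q_def a_def redn_one)
  qed
  moreover have "degree (map_poly (redn D) q) < d" using p(2) a
    by (intro le_less_trans[OF map_poly_degree_leq]) (simp add: q_def)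
  moreover have "coeff (map_poly (redn D) q) j \<in> resfield D L" for j
    using q redn_resfield by (simp add: coeff_map_poly)
  ultimately have "redn D (poly q \<xi>) \<noteq> 0"
    using c_independent poly_integral[OF q(1) \<xi>(2)] \<xi>(3) by metis
  then have "poly q \<xi> \<noteq> 0" "rv (poly q \<xi>) = 0" using redn_unit poly_vge_0[OF q(1) \<xi>(2)] by auto
  then have "poly p \<xi> \<noteq> 0" "rv (poly p \<xi>) = rv a" using a by (auto simp: pq rv_mult)
  then show ?thesis using min a by (auto simp: a_def)
qed

lemma orthogonal: "orthogonal_basis L \<xi> d"
  unfolding orthogonal_basis_def
proof (intro ballI allI impI)
  fix p r i assume p: "p \<in> polys_over L" "degree p < d" "vge r (poly p \<xi>)"
  show "vge (r - real i * rv \<xi>) (coeff p i)"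
  proof (cases "p = 0")
    case False
    then have "poly p \<xi> \<noteq> 0" "vge (rv (poly p \<xi>)) (coeff p i)" using min_coeff p by auto
    then show ?thesis using p(3) \<xi>(5) by (auto simp: vge_iff)
  qed simp
qed

interpretation SM: simple_minimal L \<xi> g
  using g \<xi> orthogonal_independent[OF orthogonal] by unfold_locales auto

lemma complete_M: "complete_in (simple_ext L \<xi>)"
  using complete_simple_ext[OF orthogonal] SM.M_rep g(4) by simp

lemma roots_ex: "\<exists>\<rho>. \<forall>i<d. \<rho> i \<in> simple_ext L \<xi> \<and> poly g (\<rho> i) = 0 \<and> vge 0 (\<rho> i) \<and> redn D (\<rho> i) = conj i"
proof -
  have "\<forall>i<d. \<exists>r\<in>simple_ext L \<xi>. poly g r = 0 \<and> vge 0 r \<and> redn D r = conj i"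
  proof clarify
    fix i assume "i < d"
    moreover have "\<xi> ^ m \<in> simple_ext L \<xi>" for m
      using LF.simple_ext_closed(6)[of "monom 1 m" \<xi>] LF.polys_monom[of 1 m] by (simp add: poly_monom)
    ultimately show "\<exists>r\<in>simple_ext L \<xi>. poly g r = 0 \<and> vge 0 r \<and> redn D r = conj i"
      using \<xi> by (intro root_lift[OF complete_M SM.M_subfield LF.simple_ext_closed(1), of "\<xi> ^ (Q ^ i)"])
        (auto simp: vge_power_0 redn_power conj_def)
  qed
  then show ?thesis by metis
qed

definition \<rho> where
  "\<rho> = (SOME \<rho>. \<forall>i<d. \<rho> i \<in> simple_ext L \<xi> \<and> poly g (\<rho> i) = 0 \<and> vge 0 (\<rho> i) \<and> redn D (\<rho> i) = conj i)"

lemma \<rho>: "i < d \<Longrightarrow> \<rho> i \<in> simple_ext L \<xi>" "i < d \<Longrightarrow> poly g (\<rho> i) = 0" "i < d \<Longrightarrow> vge 0 (\<rho> i)"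
  "i < d \<Longrightarrow> redn D (\<rho> i) = conj i"
  using someI_ex[OF roots_ex] unfolding \<rho>_def by auto

lemma all_roots: "{r. poly g r = 0} = \<rho> ` {..<d}" "card {r. poly g r = 0} = d"
proof -
  have fin: "finite {r. poly g r = 0}" using poly_roots_finite SM.g_nz by blast
  have inj: "inj_on \<rho> {..<d}"
    using inj_conj \<rho>(4) unfolding inj_on_def by (metis lessThan_iff)
  have c: "card (\<rho> ` {..<d}) = d" using card_image[OF inj] by simp
  have sub: "\<rho> ` {..<d} \<subseteq> {r. poly g r = 0}" using \<rho>(2) by auto
  have le: "card {r. poly g r = 0} \<le> d" using card_poly_roots_bound[OF SM.g_nz] g(4) by simp
  then show "{r. poly g r = 0} = \<rho> ` {..<d}" using card_seteq[OF fin sub] c by simp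
  then show "card {r. poly g r = 0} = d" using c by simp
qed

lemma root_unique:
  assumes "poly g r = 0" "poly g r' = 0" "redn D r = redn D r'"
  shows "r = r'"
proof -
  obtain i j where "i < d" "r = \<rho> i" "j < d" "r' = \<rho> j" using all_roots(1) assms by blast
  moreover from this have "i = j" using assms(3) inj_conj \<rho>(4) unfolding inj_on_def by (metis lessThan_iff)
  ultimately show ?thesis by simp
qed

interpretation SG: simple_galois L \<xi> g
  using all_roots \<rho>(1) g(4) by unfold_locales auto

lemma gal_residue:
  assumes \<tau>: "\<tau> \<in> gal L (simple_ext L \<xi>)"
  obtains i where "\<And>x. x \<in> simple_ext L \<xi> \<Longrightarrow> vge 0 x \<Longrightarrow> vge 0 (\<tau> x) \<and> redn D (\<tau> x) = redn D x ^ (Q ^ i)"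
proof -
  obtain i where i: "i < d" "\<tau> \<xi> = \<rho> i" using SG.gal_root[OF \<tau>] all_roots(1) by blast
  have "vge 0 (\<tau> x) \<and> redn D (\<tau> x) = redn D x ^ (Q ^ i)" if x: "x \<in> simple_ext L \<xi>" "vge 0 x" for x
  proof -
    obtain p where p: "p \<in> polys_over L" "degree p < d" "x = poly p \<xi>" using SM.M_rep[OF x(1)] g(4) by auto
    have int: "vge 0 (coeff p j)" for j
      using orthogonal p x(2) \<xi>(5) unfolding orthogonal_basis_def by fastforce
    have \<tau>x: "\<tau> x = poly p (\<rho> i)" using SG.gal_poly(1)[OF \<tau> p(1) LF.simple_ext_closed(2)] p i by simp
    have "redn D (\<tau> x) = poly (map_poly (redn D) p) (conj i)" "vge 0 (\<tau> x)"
      using poly_integral[OF int \<rho>(3)[OF i(1)]] \<tau>x \<rho>(4) i by auto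
    moreover have "redn D x = poly (map_poly (redn D) p) c"
      using poly_integral[OF int \<xi>(2)] p \<xi>(3) by simp
    moreover have "coeff (map_poly (redn D) p) j \<in> resfield D L" for j
      using int p(1) redn_resfield by (auto simp: coeff_map_poly polys_over_def)
    ultimately show ?thesis using poly_conj by metis
  qed
  then show ?thesis using that by blast
qed

lemma gal_mem: "\<tau> \<in> gal L (simple_ext L \<xi>) \<Longrightarrow> x \<in> simple_ext L \<xi> \<Longrightarrow> \<tau> x \<in> simple_ext L \<xi>"
  by (auto simp: gal_def bij_betw_def)

text \<open>Automorphisms act on residues by powers of Frobenius, which commute, and a root of g is
  determined by its residue.\<close>

lemma abelian: "finite_abelian_extension L (simple_ext L \<xi>)"
proof (rule SG.abelianI)
  fix \<tau> \<tau>' assume \<tau>: "\<tau> \<in> gal L (simple_ext L \<xi>)" "\<tau>' \<in> gal L (simple_ext L \<xi>)"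
  have \<xi>M: "\<xi> \<in> simple_ext L \<xi>" by (rule LF.simple_ext_closed)
  obtain i where i: "\<And>x. x \<in> simple_ext L \<xi> \<Longrightarrow> vge 0 x \<Longrightarrow> vge 0 (\<tau> x) \<and> redn D (\<tau> x) = redn D x ^ (Q ^ i)"
    using gal_residue[OF \<tau>(1)] by blast
  obtain j where j: "\<And>x. x \<in> simple_ext L \<xi> \<Longrightarrow> vge 0 x \<Longrightarrow> vge 0 (\<tau>' x) \<and> redn D (\<tau>' x) = redn D x ^ (Q ^ j)"
    using gal_residue[OF \<tau>(2)] by blast
  have g0: "\<sigma> (poly g x) = poly g (\<sigma> x) \<and> \<sigma> 0 = 0"
    if "\<sigma> \<in> gal L (simple_ext L \<xi>)" "x \<in> simple_ext L \<xi>" for \<sigma> x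
    using SG.gal_poly(1)[OF that(1) g(1) that(2)] that(1) L_0 by (auto simp: gal_def)
  show "\<tau> (\<tau>' \<xi>) = \<tau>' (\<tau> \<xi>)"
  proof (rule root_unique)
    show "poly g (\<tau> (\<tau>' \<xi>)) = 0" "poly g (\<tau>' (\<tau> \<xi>)) = 0"
      using g0[OF \<tau>(1) gal_mem[OF \<tau>(2) \<xi>M]] g0[OF \<tau>(2) gal_mem[OF \<tau>(1) \<xi>M]] SG.gal_root \<tau> by auto
    show "redn D (\<tau> (\<tau>' \<xi>)) = redn D (\<tau>' (\<tau> \<xi>))"
      using i[OF gal_mem[OF \<tau>(2) \<xi>M]] j[OF gal_mem[OF \<tau>(1) \<xi>M]] i[OF \<xi>M \<xi>(2)] j[OF \<xi>M \<xi>(2)]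
      by (simp add: power_mult[symmetric] mult.commute)
  qed
qed

text \<open>All conjugates of x' have the same integral valuation m, so the norm has valuation d m
  with d at least 2.\<close>

lemma norm_not_uniformizer:
  assumes "x \<in> norm_group L (simple_ext L \<xi>)"
  shows "rv x \<noteq> 1"
proof -
  let ?M = "simple_ext L \<xi>"
  obtain x' where x': "x' \<in> ?M" "x' \<noteq> 0" "x = (\<Prod>\<tau>\<in>gal L ?M. \<tau> x')"
  proof -
    have "x \<in> (\<lambda>x. \<Prod>\<tau>\<in>gal L ?M. \<tau> x) ` (?M - {0})" using assms by (simp only: norm_group_def)
    then obtain x' where 1: "x = (\<Prod>\<tau>\<in>gal L ?M. \<tau> x')" and 2: "x' \<in> ?M - {0}" by (rule imageE)
    show ?thesis by (rule that[OF _ _ 1]) (use 2 in \<open>simp_all only: Diff_iff singleton_iff not_False_eq_True\<close>)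
  qed
  have int: "\<exists>m::int. rv t = of_int m" if t: "t \<in> ?M" "t \<noteq> 0" for t
  proof -
    obtain p where p: "p \<in> polys_over L" "degree p < d" "t = poly p \<xi>" using SM.M_rep[OF t(1)] g(4) by auto
    moreover from this have "p \<noteq> 0" using t by auto
    ultimately obtain i where "coeff p i \<noteq> 0" "rv t = rv (coeff p i)" using min_coeff by blast
    then show ?thesis using discrete p(1) by (auto simp: polys_over_def)
  qed
  obtain m :: int where m: "rv x' = of_int m" using int x' by blast
  define t where "t = x' / \<pi> powi m"
  have pim: "\<pi> powi m \<in> L" "\<pi> powi m \<noteq> 0" "rv (\<pi> powi m) = of_int m"
    by (auto simp: power_int_def rv_power rv_inverse L_power L_inverse)
  have inv_M: "inverse a \<in> ?M" if "a \<in> ?M" for a using SM.M_subfield that by (auto simp: is_subfield_def)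
  have t: "t \<in> ?M" "t \<noteq> 0" "rv t = 0"
  proof -
    have "inverse (\<pi> powi m) \<in> ?M" using inv_M pim(1) LF.simple_ext_closed(1) by blast
    then show "t \<in> ?M" using LF.simple_ext_closed(4)[OF x'(1)] by (simp add: t_def divide_inverse)
    show "t \<noteq> 0" "rv t = 0" using x'(2) pim m by (auto simp: t_def rv_divide)
  qed
  \<comment> \<open>With x' = t pi^m and t a unit, the residue of \<open>\<tau>\<close> t is a
    Frobenius power of a nonzero residue, so \<open>\<tau>\<close> t is again a unit.\<close>
  have vals: "\<tau> x' \<noteq> 0 \<and> rv (\<tau> x') = of_int m" if \<tau>: "\<tau> \<in> gal L ?M" for \<tau>
  proof -
    obtain i where i: "\<And>x. x \<in> ?M \<Longrightarrow> vge 0 x \<Longrightarrow> vge 0 (\<tau> x) \<and> redn D (\<tau> x) = redn D x ^ (Q ^ i)"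
      using gal_residue[OF \<tau>] by blast
    have "vge 0 (\<tau> t) \<and> redn D (\<tau> t) = redn D t ^ (Q ^ i)" using i[OF t(1)] t by (simp add: vge_iff)
    moreover have "redn D t \<noteq> 0" using t by (intro redn_nonzero)
    ultimately have "\<tau> t \<noteq> 0 \<and> rv (\<tau> t) = 0" by (intro redn_unit) auto
    moreover have "\<tau> x' = \<tau> t * \<pi> powi m"
    proof -
      have "\<tau> (t * \<pi> powi m) = \<tau> t * \<tau> (\<pi> powi m)" "\<tau> (\<pi> powi m) = \<pi> powi m"
        using \<tau> t(1) pim(1) subsetD[OF LF.simple_ext_closed(1) pim(1), of \<xi>] by (auto simp: gal_def)
      then show ?thesis using pim by (simp add: t_def)
    qed
    ultimately show ?thesis using pim by (simp add: rv_mult)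
  qed
  have "finite (gal L ?M)" using bij_betw_finite[OF SG.bij_gal_roots] SG.fin_R by blast
  then have "rv x = of_nat (card (gal L ?M)) * of_int m"
    unfolding x'(3) by (rule rv_prod) (rule vals)
  also have "card (gal L ?M) = d" using bij_betw_same_card[OF SG.bij_gal_roots] all_roots(2) by simp
  finally have rvx: "rv x = of_int (int d * m)" by simp
  have "int d * m \<noteq> 1" using d_ge_2 by (auto simp: zmult_eq_1_iff)
  then show ?thesis unfolding rvx of_int_eq_1_iff .
qed

text \<open>The image of the generator is a root of g with residue c, hence the generator
  itself.\<close>

lemma aut_fixes:
  assumes "field_aut w" "\<And>x. x \<in> L \<Longrightarrow> w x = x" "redn D (w \<xi>) = c"
  shows "\<forall>x\<in>simple_ext L \<xi>. w x = x"
proof -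
  have add: "w (x + y) = w x + w y" and mult: "w (x * y) = w x * w y" for x y
    using assms(1) by (auto simp: field_aut_def)
  have poly: "w (poly p x) = poly p (w x)" if "p \<in> polys_over L" for p x
    using that
  proof (induction p)
    case 0
    then show ?case using assms(2)[of 0] by simp
  next
    case (pCons a p)
    then have "a \<in> L" "p \<in> polys_over L" by (simp_all add: polys_over_pCons_iff)
    then show ?case using pCons.IH assms(2)[of a] by (simp add: add mult)
  qed
  have "poly g (w \<xi>) = w 0" using poly[OF g(1), of \<xi>] \<xi> by simp
  then have "poly g (w \<xi>) = 0" using assms(2)[of 0] by simp
  then have "w \<xi> = \<xi>" using root_unique \<xi> assms(3) by metis
  then show ?thesis using poly by (auto simp: simple_ext_def)
qed

end

section \<open>The reciprocity map on inertia\<close>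

lemma aut_simps:
  assumes "field_aut (w :: 'c::field \<Rightarrow> 'c)"
  shows "w 0 = 0" "w 1 = 1" "w (x + y) = w x + w y" "w (x * y) = w x * w y" "w (- x) = - w x"
    "w (x - y) = w x - w y" "w (x ^ n) = w x ^ n" "w (inverse x) = inverse (w x)" "w (x / y) = w x / w y"
    "w x = 0 \<longleftrightarrow> x = 0"
proof -
  have add: "w (x + y) = w x + w y" and mult: "w (x * y) = w x * w y" for x y
    using assms by (auto simp: field_aut_def)
  have inj: "inj w" using assms by (auto simp: field_aut_def bij_def)
  have "w 0 + w 0 = w 0 + 0" using add[of 0 0] by simp
  then show w0: "w 0 = 0" by (rule add_left_imp_eq)
  show eq0: "w x = 0 \<longleftrightarrow> x = 0" for x using inj w0 by (metis injD)
  show w1: "w 1 = 1" using mult[of 1 1] eq0[of 1] by simp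
  show minus: "w (- x) = - w x" for x using add[of x "- x"] w0 by (simp add: eq_neg_iff_add_eq_0 add.commute)
  show "w (x - y) = w x - w y" using add[of x "- y"] minus by simp
  show "w (x ^ n) = w x ^ n" by (induction n) (auto simp: mult w1)
  show inverse: "w (inverse x) = inverse (w x)" for x
    using mult[of x "inverse x"] w1 w0 by (cases "x = 0") (auto dest: inverse_unique)
  show "w (x / y) = w x / w y" by (simp add: divide_inverse mult inverse)
  show "w (x + y) = w x + w y" "w (x * y) = w x * w y" by (rule add mult)+
qed

context local_field_setting
begin

lemma galois_aut: "\<sigma> \<in> galois_C D L \<Longrightarrow> field_aut \<sigma>"
  and galois_fix: "\<sigma> \<in> galois_C D L \<Longrightarrow> x \<in> L \<Longrightarrow> \<sigma> x = x"
  and galois_vge: "\<sigma> \<in> galois_C D L \<Longrightarrow> vge r (\<sigma> x) \<longleftrightarrow> vge r x"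
  and galois_vgt: "\<sigma> \<in> galois_C D L \<Longrightarrow> vgt r (\<sigma> x) \<longleftrightarrow> vgt r x"
  and galois_rv: "\<sigma> \<in> galois_C D L \<Longrightarrow> rv (\<sigma> x) = rv x"
  by (auto simp: galois_C_def vge_def vgt_def rv_def)

lemma galois_comp: "\<sigma> \<in> galois_C D L \<Longrightarrow> \<tau> \<in> galois_C D L \<Longrightarrow> \<sigma> \<circ> \<tau> \<in> galois_C D L"
  by (auto simp: galois_C_def field_aut_def intro: bij_comp)

lemma galois_inv:
  assumes "\<sigma> \<in> galois_C D L" shows "inv_into UNIV \<sigma> \<in> galois_C D L"
proof -
  have b: "bij \<sigma>" and s: "\<And>x. \<sigma> (inv_into UNIV \<sigma> x) = x" and i: "\<And>x. inv_into UNIV \<sigma> (\<sigma> x) = x"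
    using assms by (auto simp: galois_C_def field_aut_def bij_def surj_f_inv_f)
  note h = aut_simps(3,4)[OF galois_aut[OF assms]]
  have "inv_into UNIV \<sigma> (x + y) = inv_into UNIV \<sigma> x + inv_into UNIV \<sigma> y" "inv_into UNIV \<sigma> (x * y) = inv_into UNIV \<sigma> x * inv_into UNIV \<sigma> y" for x y
    using h[of "inv_into UNIV \<sigma> x" "inv_into UNIV \<sigma> y"] i s by metis+
  moreover have "val D (inv_into UNIV \<sigma> x) = val D x" for x
    using assms s[of x] by (auto simp: galois_C_def) metis
  moreover have "inv_into UNIV \<sigma> x = x" if "x \<in> L" for x using i[of x] galois_fix[OF assms that] by simp
  ultimately show ?thesis using b by (auto simp: galois_C_def field_aut_def bij_imp_bij_inv)
qed

lemma inertia_galois: "\<sigma> \<in> inertia D L \<Longrightarrow> \<sigma> \<in> galois_C D L"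
  and inertia_redn: "\<sigma> \<in> inertia D L \<Longrightarrow> vge 0 x \<Longrightarrow> redn D (\<sigma> x) = redn D x"
  by (auto simp: inertia_def val_ge_0_iff)

lemma inertia_weil: "\<sigma> \<in> inertia D L \<Longrightarrow> \<sigma> \<in> weil_group D L"
  unfolding inertia_def weil_group_def by (auto intro!: exI[of _ 0])

lemma base_algebraic: "x \<in> base D \<Longrightarrow> x \<in> algebraic_over (base D)"
  using base_subfield unfolding algebraic_over_def is_subfield_def
  by (auto intro!: exI[of _ "[:- x, 1:]"] simp: coeff_pCons split: nat.splits)

end

section \<open>Residues outside k_L, geometric Frobenius elements and units\<close>

context local_subfield
begin

lemma teich_algebraic:
  assumes "t ^ Q = t" shows "t \<in> algebraic_over (base D)"
proof -
  interpret B: field_subset "base D" by unfold_locales (rule base_subfield)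
  define p :: "'c poly" where "p = monom 1 Q - monom 1 1"
  have "p \<in> polys_over (base D)" unfolding p_def by (intro B.polys_diff B.polys_monom) auto
  moreover have "coeff p Q = 1" using Q_ge_3 by (simp add: p_def)
  then have "p \<noteq> 0" by auto
  moreover have "poly p t = 0" using assms by (simp add: p_def poly_monom)
  ultimately show ?thesis by (auto simp: algebraic_over_def polys_over_def)
qed

text \<open>Algebraic closedness is available in characteristic of C, so the residue is obtained by
  reducing a root of unity x of order dividing Q^n - 1 that is chosen to avoid the order Q - 1 on
  residues.\<close>

lemma residue_not_in_resfield:
  assumes n: "2 \<le> n"
  shows "\<exists>c::'k. c ^ (Q ^ n) = c \<and> c \<notin> resfield D L"
proof -
  interpret B: field_subset "base D" by unfold_locales (rule base_subfield)
  \<comment> \<open>N = (Q^n - 1)/(Q - 1), so the polynomial p below is (X^(Q^n-1) - 1)/(X^(Q-1) -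
    1).\<close>
  define N where "N = (\<Sum>i<n. Q ^ i)"
  have "(Q - 1) * (\<Sum>i<m. Q ^ i) + 1 = Q ^ m" for m
  proof (induction m)
    case (Suc m)
    have "(Q - 1) * Q ^ m + Q ^ m = Q ^ Suc m" using Q_pos by (cases Q) auto
    then show ?case using Suc by (simp add: distrib_left)
  qed simp
  then have N: "(Q - 1) * N + 1 = Q ^ n" by (simp add: N_def)
  have "{..<n} = insert 0 (insert 1 {2..<n})" using n by auto
  then have N2: "2 \<le> N" using Q_pos n by (simp add: N_def)
  define p :: "'c poly" where "p = (\<Sum>j<N. monom 1 ((Q - 1) * j))"
  have "p \<in> polys_over (base D)"
    unfolding p_def polys_over_def by (auto simp: coeff_sum intro!: B.Lsum)
  then have pa: "range (coeff p) \<subseteq> algebraic_over (base D)"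
    by (auto simp: polys_over_def intro: base_algebraic)
  have "coeff p ((Q - 1) * (N - 1)) = (\<Sum>j<N. if j = N - 1 then 1 else 0)"
    unfolding p_def coeff_sum using Q_ge_3 by (intro sum.cong) auto
  then have "coeff p ((Q - 1) * (N - 1)) = 1" using N2 by simp
  then have "(Q - 1) * (N - 1) \<le> degree p" by (intro le_degree) simp
  moreover have "0 < (Q - 1) * (N - 1)" using N2 Q_ge_3 by simp
  ultimately have "0 < degree p" by linarith
  then obtain x where x: "poly p x = 0" using alg_closed pa by blast
  then have sum0: "(\<Sum>j<N. (x ^ (Q - 1)) ^ j) = 0" by (simp add: p_def poly_sum poly_monom power_mult)
  then have "(x ^ (Q - 1)) ^ N = 1" using power_diff_1_eq[of "x ^ (Q - 1)" N] by simp
  then have x1: "x ^ ((Q - 1) * N) = 1" by (simp add: power_mult)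
  then have x2: "x ^ (Q ^ n) = x" unfolding N[symmetric] by simp
  have "0 < (Q - 1) * N" using N2 Q_ge_3 by simp
  then have "x \<noteq> 0" using x1 by (auto simp: zero_power)
  then have "real ((Q - 1) * N) * rv x = 0" using rv_power[of x "(Q - 1) * N"] x1 by simp
  then have "rv x = 0" using \<open>0 < (Q - 1) * N\<close> by (metis mult_eq_0_iff of_nat_0_eq_iff less_irrefl)
  then have int: "vge 0 x" by (simp add: vge_iff)
  have c0: "redn D x \<noteq> 0" using \<open>x \<noteq> 0\<close> \<open>rv x = 0\<close> by (rule redn_nonzero)
  \<comment> \<open>Otherwise x^(Q-1) reduces to 1 and the vanishing geometric sum reduces to N; but
    N = 1 in the residue field, since every summand of N except the first is divisible by Q.\<close>
  have "redn D x \<notin> resfield D L"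
  proof
    assume "redn D x \<in> resfield D L"
    then have "redn D x ^ Q = redn D x" by (rule fermat)
    moreover have "redn D x ^ Q = redn D x * redn D x ^ (Q - 1)" using Q_pos by (metis power_eq_if neq0_conv)
    ultimately have 1: "redn D x ^ (Q - 1) = 1" using c0 by simp
    have "redn D (\<Sum>j<N. (x ^ (Q - 1)) ^ j) = (\<Sum>j<N. (redn D x ^ (Q - 1)) ^ j)"
      using int by (subst redn_sum) (auto simp: vge_power_0 redn_power)
    then have "of_nat N = (0::'k)" using sum0 1 by simp
    moreover have "of_nat Q = (0::'k)" using binomial_residue_0[of 1] Q_ge_3 by simp
    then have "of_nat (\<Sum>i<n. Q ^ i) = (1::'k)"
      using \<open>{..<n} = insert 0 (insert 1 {2..<n})\<close> by (auto simp: zero_power)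
    ultimately show False by (simp add: N_def)
  qed
  moreover have "redn D x ^ (Q ^ n) = redn D x" using redn_power[OF int, of "Q ^ n"] x2 by simp
  ultimately show ?thesis by blast
qed

text \<open>Otherwise w fixes a nontrivial unramified extension, whose norms have valuation in a proper
  subgroup of the integers, or its inverse is a geometric Frobenius sent to an element of negative
  valuation.\<close>

lemma geom_frobeniusI:
  assumes rec: "reciprocity_map D L r" and w: "w \<in> weil_group D L" and v: "rv (r w) = 1"
  shows "w \<in> geom_frobenius D L"
proof -
  have wg: "w \<in> galois_C D L" using w by (auto simp: weil_group_def)
  obtain n where n: "(\<forall>x. vge 0 x \<longrightarrow> redn D (w x) = redn D x ^ (Q ^ n)) \<or>
     (\<forall>x. vge 0 x \<longrightarrow> redn D (w x) ^ (Q ^ n) = redn D x)"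
    using w by (auto simp: weil_group_def Q_def val_ge_0_iff)
  have n1: "n = 1"
  proof (rule ccontr)
    assume "n \<noteq> 1"
    \<comment> \<open>For n = 0 the action on residues is trivial and any extension serves; the
      value 2 makes \<open>residue_not_in_resfield\<close> applicable.\<close>
    define m where "m = (if n = 0 then 2 else n)"
    have m: "2 \<le> m" using \<open>n \<noteq> 1\<close> by (auto simp: m_def)
    obtain c :: 'k where c: "c ^ (Q ^ m) = c" "c \<notin> resfield D L"
      using residue_not_in_resfield[OF m] by blast
    interpret U: unramified_extension D L c m using c m by unfold_locales auto
    have cn: "c ^ (Q ^ n) = c" using c by (cases "n = 0") (auto simp: m_def)
    have "redn D (w U.\<xi>) = c"
      using n
    proof
      assume "\<forall>x. vge 0 x \<longrightarrow> redn D (w x) = redn D x ^ (Q ^ n)"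
      then show ?thesis using U.\<xi> cn by simp
    next
      assume "\<forall>x. vge 0 x \<longrightarrow> redn D (w x) ^ (Q ^ n) = redn D x"
      then have "redn D (w U.\<xi>) ^ (Q ^ n) = c ^ (Q ^ n)" using U.\<xi> cn by simp
      then show ?thesis by (rule frob_pow_inj_residue)
    qed
    then have "\<forall>x\<in>simple_ext L U.\<xi>. w x = x"
      using U.aut_fixes[OF galois_aut[OF wg] galois_fix[OF wg]] by blast
    then have "r w \<in> norm_group L (simple_ext L U.\<xi>)"
      using rec w U.abelian by (simp add: reciprocity_map_def)
    then show False using U.norm_not_uniformizer v by blast
  qed
  from n show ?thesis
  proof
    assume "\<forall>x. vge 0 x \<longrightarrow> redn D (w x) ^ (Q ^ n) = redn D x"
    then show ?thesis using wg n1 by (auto simp: geom_frobenius_def Q_def val_ge_0_iff)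
  next
    assume a: "\<forall>x. vge 0 x \<longrightarrow> redn D (w x) = redn D x ^ (Q ^ n)"
    have ig: "inv_into UNIV w \<in> galois_C D L" using galois_inv[OF wg] .
    have sw: "w (inv_into UNIV w x) = x" for x using galois_aut[OF wg] by (simp add: field_aut_def bij_def surj_f_inv_f)
    have fr: "redn D (inv_into UNIV w x) ^ Q = redn D x" if "vge 0 x" for x
      using a[rule_format, of "inv_into UNIV w x"] that galois_vge[OF ig] sw n1 by simp
    then have ifr: "inv_into UNIV w \<in> geom_frobenius D L" using ig by (auto simp: geom_frobenius_def Q_def val_ge_0_iff)
    have iw: "inv_into UNIV w \<in> weil_group D L" unfolding weil_group_def
      using ig fr by (auto simp: Q_def val_ge_0_iff intro!: exI[of _ 1])
    have idw: "id \<in> weil_group D L"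
      unfolding weil_group_def galois_C_def field_aut_def by (auto intro!: exI[of _ 0])
    have mult: "r (\<sigma> \<circ> \<tau>) = r \<sigma> * r \<tau>" if "\<sigma> \<in> weil_group D L" "\<tau> \<in> weil_group D L" for \<sigma> \<tau>
      using rec that by (simp add: reciprocity_map_def)
    have nz: "r \<sigma> \<noteq> 0" if "\<sigma> \<in> weil_group D L" for \<sigma>
    proof -
      have "r ` weil_group D L = L - {0}" using rec by (simp add: reciprocity_map_def)
      then show ?thesis using imageI[OF that, of r] by simp
    qed
    have "r id = 1" using mult[OF idw idw] nz[OF idw] by simp
    moreover have "w \<circ> inv_into UNIV w = id" using sw by auto
    ultimately have "r w * r (inv_into UNIV w) = 1" using mult[OF w iw] by simp
    then have "rv (r w) + rv (r (inv_into UNIV w)) = 0" using rv_mult[OF nz[OF w] nz[OF iw]] by simp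
    then have "rv (r (inv_into UNIV w)) = -1" using v by simp
    moreover have "0 < val D (r (inv_into UNIV w))" using rec ifr by (simp add: reciprocity_map_def uniformizer_def)
    then have "vgt 0 (r (inv_into UNIV w))" by (simp add: val_gt_0_iff)
    ultimately show ?thesis using nz[OF iw] by (simp add: vgt_iff)
  qed
qed

text \<open>Surjectivity supplies tau with image pi, and \<open>geom_frobeniusI\<close> makes it a
  geometric Frobenius. Composing with inertia does not change the action on residues, so r(sigma) pi
  is again a uniformizer and r(sigma) a unit.\<close>

lemma inertia_unit:
  assumes rec: "reciprocity_map D L r" and \<sigma>: "\<sigma> \<in> inertia D L"
  shows "r \<sigma> \<in> L" "r \<sigma> \<noteq> 0" "rv (r \<sigma>) = 0"
    "\<exists>\<tau>. \<tau> \<in> geom_frobenius D L \<and> \<tau> \<in> weil_group D L \<and> r \<tau> = \<pi> \<and> \<sigma> \<circ> \<tau> \<in> geom_frobenius D L \<and>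
       \<sigma> \<circ> \<tau> \<in> weil_group D L \<and> r (\<sigma> \<circ> \<tau>) = r \<sigma> * \<pi>"
proof -
  have im: "r ` weil_group D L = L - {0}" using rec by (simp add: reciprocity_map_def)
  then show u: "r \<sigma> \<in> L" "r \<sigma> \<noteq> 0" using inertia_weil[OF \<sigma>] by auto
  have "\<pi> \<in> r ` weil_group D L" unfolding im by simp
  then obtain \<tau> where \<tau>: "\<tau> \<in> weil_group D L" "r \<tau> = \<pi>" by auto
  have \<tau>f: "\<tau> \<in> geom_frobenius D L" by (rule geom_frobeniusI[OF rec \<tau>(1)]) (simp add: \<tau>)
  then have \<tau>g: "\<tau> \<in> galois_C D L" by (simp add: geom_frobenius_def)
  have cg: "\<sigma> \<circ> \<tau> \<in> galois_C D L" using galois_comp[OF inertia_galois[OF \<sigma>] \<tau>g] .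
  have fr: "redn D (\<sigma> (\<tau> x)) ^ Q = redn D x" if "vge 0 x" for x
    using inertia_redn[OF \<sigma>, of "\<tau> x"] that galois_vge[OF \<tau>g] \<tau>f
    by (simp add: geom_frobenius_def Q_def val_ge_0_iff)
  have cf: "\<sigma> \<circ> \<tau> \<in> geom_frobenius D L" using fr cg by (auto simp: geom_frobenius_def Q_def val_ge_0_iff)
  have cw: "\<sigma> \<circ> \<tau> \<in> weil_group D L" unfolding weil_group_def
    using fr cg by (auto simp: Q_def val_ge_0_iff intro!: exI[of _ 1])
  have rc: "r (\<sigma> \<circ> \<tau>) = r \<sigma> * \<pi>" using rec inertia_weil[OF \<sigma>] \<tau> by (simp add: reciprocity_map_def)
  have "\<forall>\<sigma>\<in>geom_frobenius D L. uniformizer D L (r \<sigma>)" using rec by (simp add: reciprocity_map_def)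
  then have un: "uniformizer D L (r \<sigma> * \<pi>)" using cf rc by metis
  have nz: "r \<sigma> * \<pi> \<noteq> 0" using u by simp
  have "val D (r \<sigma> * \<pi>) \<le> val D \<pi>" "0 < val D (r \<sigma> * \<pi>)"
    using un L_pi by (auto simp: uniformizer_def val_unif dest!: bspec[OF _ L_pi])
  then have "rv (r \<sigma> * \<pi>) \<le> 1" "0 < rv (r \<sigma> * \<pi>)" using val_rv[OF nz] val_rv[OF pi_nz] by auto
  moreover obtain m :: int where m: "rv (r \<sigma> * \<pi>) = of_int m" using discrete[OF L_mult[OF u(1) L_pi] nz] by blast
  ultimately have "of_int m \<le> (1::real)" "(0::real) < of_int m" by auto
  then have "m = 1" by simp
  then show "rv (r \<sigma>) = 0" using m u by (simp add: rv_mult)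
  show "\<exists>\<tau>. \<tau> \<in> geom_frobenius D L \<and> \<tau> \<in> weil_group D L \<and> r \<tau> = \<pi> \<and> \<sigma> \<circ> \<tau> \<in> geom_frobenius D L \<and>
       \<sigma> \<circ> \<tau> \<in> weil_group D L \<and> r (\<sigma> \<circ> \<tau>) = r \<sigma> * \<pi>"
    using \<tau> \<tau>f cf cw rc by blast
qed

text \<open>Modulo pi one has Q - 1 = -1, so the root is 1 - nu modulo pi^2. It is the fixed point
  of T -> T^Q / (1 + nu), which contracts near 1 - nu.\<close>

lemma unit_root_exists:
  assumes "vge 1 \<nu>"
  shows "\<exists>T. vge 2 (T - (1 - \<nu>)) \<and> T ^ (Q - 1) = 1 + \<nu> \<and> T \<noteq> 0 \<and> rv T = 0 \<and> vgt 0 (T - 1)"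
proof -
  have "vgt (rv 1) (1 + \<nu> - 1)" using assms by (auto elim: vge_vgt)
  then have nu: "1 + \<nu> \<noteq> 0" "rv (1 + \<nu>) = 0" using rv_cong[of 1 "1 + \<nu>"] by auto
  define \<phi> where "\<phi> x = x ^ Q / (1 + \<nu>)" for x
  have "vge 2 ((1 + (- \<nu>)) ^ Q - 1 ^ Q - (- \<nu>) ^ Q)"
    using frob_add[of 0 1 1 "- \<nu>"] assms by simp
  moreover have "vge 2 ((- \<nu>) ^ Q)" using vge_power[of 1 "- \<nu>" Q] assms Q_ge_3 by (auto elim: vge_mono)
  moreover have "vge 2 (\<nu> * \<nu>)" by (rule vge_mult[OF assms assms]) simp
  ultimately have "vge 2 ((1 + (- \<nu>)) ^ Q - 1 ^ Q - (- \<nu>) ^ Q + (- \<nu>) ^ Q + \<nu> * \<nu>)" by (intro vge_add)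
  then have "vge 2 ((1 - \<nu>) ^ Q - (1 - \<nu>) * (1 + \<nu>))" by (simp add: algebra_simps)
  moreover have "\<phi> (1 - \<nu>) - (1 - \<nu>) = ((1 - \<nu>) ^ Q - (1 - \<nu>) * (1 + \<nu>)) / (1 + \<nu>)"
    using nu by (simp add: \<phi>_def diff_divide_distrib)
  ultimately have start: "vge 2 (\<phi> (1 - \<nu>) - (1 - \<nu>))" using nu by (simp add: vge_divide_iff)
  have int0: "vge 0 (1 - \<nu>)" using assms vge_mono by (intro vge_diff) auto
  have contr: "vge (r + 1) (\<phi> x - \<phi> y)"
    if "vge 2 (y - (1 - \<nu>))" "2 \<le> r" "vge r (x - y)" for x y r
  proof -
    have "vge 0 y" using that(1) int0 vge_mono[of 2 _ 0] vge_close[of 0 y "1 - \<nu>"] by simp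
    then have "vge (min (real Q * r) (1 + r + 0)) (x ^ Q - y ^ Q)"
      using that by (intro frob_contr) auto
    moreover have "2 * r \<le> real Q * r" using that Q_ge_3 by (intro mult_right_mono) auto
    ultimately have "vge (r + 1) (x ^ Q - y ^ Q)" using that by (auto elim!: vge_mono)
    moreover have "\<phi> x - \<phi> y = (x ^ Q - y ^ Q) / (1 + \<nu>)" by (simp add: \<phi>_def diff_divide_distrib)
    ultimately show ?thesis using nu by (simp add: vge_divide_iff)
  qed
  obtain T where T: "vge 2 (T - (1 - \<nu>))" "\<phi> T = T"
    by (rule contraction_fixpoint[where \<phi> = \<phi>, OF complete_in_UNIV _ zero_less_one start]) (use contr in auto)
  have "vge 1 (T - (1 - \<nu>) + - \<nu>)" using T(1) assms by (intro vge_add) (auto elim: vge_mono)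
  then have T1: "vgt 0 (T - 1)" by (intro vge_vgt[of 1]) auto
  then have Tu: "T \<noteq> 0" "rv T = 0" using rv_cong[of 1 T] by auto
  have "T ^ Q = (1 + \<nu>) * T" using T(2) nu by (simp add: \<phi>_def field_simps)
  moreover have "T ^ Q = T ^ (Q - 1) * T" using Q_pos by (metis power_minus_mult)
  ultimately have "T ^ (Q - 1) = 1 + \<nu>" using Tu by simp
  then show ?thesis using T T1 Tu by blast
qed

end

section \<open>Inertia on a point of level two\<close>

context local_subfield
begin

lemma inertia_lubin_tate:
  assumes rec: "reciprocity_map D L r" and \<sigma>: "\<sigma> \<in> inertia D L"
    and uc: "unit_coords D L (r \<sigma>) = (\<zeta>, \<eta>)"
    and z: "(\<pi> * z + z ^ Q) ^ (Q - 1) = - \<pi>"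
  shows "\<zeta> \<in> resfield D L" "\<zeta> \<noteq> 0" "\<eta> \<in> resfield D L"
    "vgt \<mu> (\<sigma> z - teich \<zeta> * (z + teich \<eta> * (\<pi> * z + z ^ Q)))"
proof -
  define u where "u = r \<sigma>"
  note u = inertia_unit(1-3)[OF rec \<sigma>, folded u_def]
  obtain \<tau> where \<tau>: "\<tau> \<in> geom_frobenius D L" "\<tau> \<in> weil_group D L" "r \<tau> = \<pi>"
    "\<sigma> \<circ> \<tau> \<in> geom_frobenius D L" "\<sigma> \<circ> \<tau> \<in> weil_group D L" "r (\<sigma> \<circ> \<tau>) = u * \<pi>"
    using inertia_unit(4)[OF rec \<sigma>] u_def by blast
  have ur: "vge 0 u" "redn D u \<noteq> 0" using u redn_nonzero by (auto simp: vge_iff)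
  note co = unit_coords_eq[OF u(1) ur uc[folded u_def]]
  show \<zeta>L: "\<zeta> \<in> resfield D L" and \<eta>L: "\<eta> \<in> resfield D L" using co by auto
  show \<zeta>0: "\<zeta> \<noteq> 0" using co ur by simp
  define t0 where "t0 = teich \<zeta>"
  define l where "l = teich \<eta>"
  note t0 = teich[OF \<zeta>L, folded t0_def] and l = teich[OF \<eta>L, folded l_def]
  have t0n: "t0 \<noteq> 0" using t0(3) \<zeta>0 redn_0 by metis
  note t0u = teich_unit[OF t0(2) t0n]
  interpret Z: lt_extension D L \<pi> z using z by unfold_locales auto
  define y where "y = \<pi> * z + z ^ Q"
  have yZ: "Z.y = y" by (simp add: Z.y_def y_def)
  have y: "y \<noteq> 0" "rv y = \<mu>" "y ^ Q = - \<pi> * y" "y ^ (Q - 1) = - \<pi>" using Z.rv_y Z.y_eq yZ by auto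
  define \<phi> where "\<phi> = \<sigma> \<circ> \<tau>"
  have \<phi>g: "\<phi> \<in> galois_C D L" and \<tau>g: "\<tau> \<in> galois_C D L"
    using \<tau> by (auto simp: geom_frobenius_def \<phi>_def)
  have \<phi>fr: "redn D (\<phi> x) ^ Q = redn D x" if "vge 0 x" for x
    using \<tau>(4) that by (auto simp: geom_frobenius_def Q_def \<phi>_def val_ge_0_iff)
  note \<phi>h = aut_simps[OF galois_aut[OF \<phi>g]]
  have fixes_M: "\<forall>x\<in>M. w x = x"
    if "finite_abelian_extension L M" "w \<in> weil_group D L" "r w \<in> norm_group L M" for w M
    using rec that by (auto simp: reciprocity_map_def)
  interpret LF: field_subset L by (rule field_subset_L)
  have "\<tau> z = z" using fixes_M[OF Z.abelian \<tau>(2)] Z.norm_z \<tau>(3) LF.simple_ext_closed(2) by auto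
  then have \<phi>z: "\<phi> z = \<sigma> z" by (simp add: \<phi>_def)

  text \<open>The constants e, b1 and T below are chosen so that a z + b y approximates a point of level
    two for the uniformizer u pi.\<close>
  have "\<exists>e. e ^ (Q - 1) = t0"
  proof -
    define p where "p = monom 1 (Q - 1) - [:t0:]"
    have "coeff p i \<in> algebraic_over (base D)" for i
    proof -
      have "coeff p i \<in> {0, 1, - t0}" using Q_ge_3 by (auto simp: p_def coeff_pCons split: nat.splits)
      moreover have "c ^ Q = c" if "c \<in> {0, 1, - t0}" for c
        using that t0(2) Q_pos by (auto simp: frob_uminus)
      ultimately show ?thesis using teich_algebraic by blast
    qed
    moreover have "0 < degree p"
    proof -
      have "coeff p (Q - 1) = 1" using Q_ge_3 by (auto simp: p_def coeff_pCons split: nat.splits)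
      then have "Q - 1 \<le> degree p" by (intro le_degree) simp
      then show ?thesis using Q_ge_3 by linarith
    qed
    ultimately obtain e where "poly p e = 0" using alg_closed[of p] by blast
    then show ?thesis by (intro exI[of _ e]) (simp add: p_def poly_monom)
  qed
  then obtain e where e: "e ^ (Q - 1) = t0" by blast
  have e0: "e \<noteq> 0" using e t0n Q_ge_3 by (auto simp: zero_power)
  have "real (Q - 1) * rv e = 0" using rv_power[OF e0, of "Q - 1"] e t0u by metis
  then have rve: "rv e = 0" using Q_ge_3 by simp
  have Qm: "x ^ Q = x * x ^ (Q - 1)" for x :: "'x::comm_ring_1" using Q_pos by (metis power_eq_if neq0_conv)
  have eQ: "e ^ Q = t0 * e" using Qm[of e] e by simp
  \<comment> \<open>In omega r0 + r0^Q, with z^Q = y - pi z, the terms in z cancel to first order if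
    u a = a^Q does; a^(Q-1) = t0 arranges this, and a^Q = e becomes the leading coefficient of
    y.\<close>
  define a where "a = e / t0"
  have a: "a \<noteq> 0" "rv a = 0" "vge 0 a" "a ^ Q = e" "a ^ (Q - 1) = t0"
    using e0 t0n rve t0u t0(2) eQ e by (auto simp: a_def rv_divide power_divide vge_iff)
  \<comment> \<open>The coefficient of pi y requires u b - b^Q + e l = 0 on residues. With b = e b1
    and e^Q = t0 e this is the Artin-Schreier equation b1^Q - b1 = l / t0.\<close>
  define s where "s = teich (\<eta> / \<zeta>)"
  note s = teich[OF resfield_divide[OF \<eta>L \<zeta>L], folded s_def]
  have "\<exists>b. b ^ Q - b = s"
  proof -
    define p where "p = monom 1 Q - monom 1 1 - [:s:]"
    have "coeff p i \<in> algebraic_over (base D)" for i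
    proof -
      have "coeff p i \<in> {0, 1, -1, - s}" using Q_ge_3 by (auto simp: p_def coeff_pCons split: nat.splits)
      moreover have "c ^ Q = c" if "c \<in> {0, 1, -1, - s}" for c
        using that s(2) Q_pos by (auto simp: frob_uminus)
      ultimately show ?thesis using teich_algebraic by blast
    qed
    moreover have "0 < degree p"
    proof -
      have "coeff p Q = 1" using Q_ge_3 by (auto simp: p_def coeff_pCons split: nat.splits)
      then have "Q \<le> degree p" by (intro le_degree) simp
      then show ?thesis using Q_ge_3 by linarith
    qed
    ultimately obtain b where "poly p b = 0" using alg_closed[of p] by blast
    then show ?thesis by (intro exI[of _ b]) (simp add: p_def poly_monom)
  qed
  then obtain b1 where b1: "b1 ^ Q - b1 = s" by blast
  have b1i: "vge 0 b1"
  proof (rule ccontr)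
    assume "\<not> vge 0 b1"
    then have b: "b1 \<noteq> 0" "rv b1 < 0" by (auto simp: vge_iff)
    have "vge (rv b1) (b1 + s)" using b s(4) by (intro vge_add vge_rv) (auto elim: vge_mono)
    moreover have "b1 + s = b1 ^ Q" unfolding b1[symmetric] by simp
    ultimately have "rv b1 \<le> real Q * rv b1" using b rv_power[of b1 Q] by (simp add: vge_iff)
    moreover have "real Q * rv b1 < 1 * rv b1" using b Q_ge_3 by (intro mult_strict_right_mono_neg) auto
    ultimately show False by simp
  qed
  define b where "b = e * b1"
  have ei: "vge 0 e" using rve by (simp add: vge_iff)
  have b: "vge 0 b" unfolding b_def using ei b1i by (rule vge_mult_0)
  define \<nu> where "\<nu> = u / t0 - 1"
  have u_eq: "u = t0 * (1 + \<nu>)" using t0n by (simp add: \<nu>_def)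
  have nul: "vge 2 (\<nu> - l * \<pi>)"
  proof -
    have "vge 2 (t0 * (\<nu> - l * \<pi>))"
      using co(4) unfolding t0_def[symmetric] l_def[symmetric] u_eq by (simp add: algebra_simps)
    then show ?thesis using t0n t0u by (simp add: vge_mult_iff)
  qed
  have "vge 1 (l * \<pi>)" using vge_mult[OF l(4), of 1 \<pi>] by (simp add: vge_iff)
  then have nu1: "vge 1 \<nu>" using nul vge_close[of 1 \<nu> "l * \<pi>"] vge_mono[of 2 "\<nu> - l * \<pi>" 1] by simp
  obtain T where T: "vge 2 (T - (1 - \<nu>))" "T ^ (Q - 1) = 1 + \<nu>" "T \<noteq> 0" "rv T = 0" "vgt 0 (T - 1)"
    using unit_root_exists[OF nu1] by blast
  \<comment> \<open>\<open>\<theta>\<close>^(Q-1) = u makes \<open>\<theta>\<close> y a point of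
    level one for u pi; T is the root of the principal unit u / t0 = 1 + nu.\<close>
  define \<theta> where "\<theta> = e * T"
  have th: "\<theta> \<noteq> 0" "rv \<theta> = 0" "\<theta> ^ (Q - 1) = u"
    using e0 rve T e by (auto simp: \<theta>_def rv_mult power_mult_distrib u_eq)
  define \<omega> where "\<omega> = u * \<pi>"
  have om: "\<omega> \<in> L" "\<omega> \<noteq> 0" "rv \<omega> = 1" using u by (auto simp: \<omega>_def rv_mult L_mult)
  define y' where "y' = \<theta> * y"
  have y'Q: "y' ^ (Q - 1) = - \<omega>" using th y by (simp add: y'_def power_mult_distrib \<omega>_def)
  define r0 where "r0 = a * z + b * y"
  define E where "E = (a * z + b * y) ^ Q - (a * z) ^ Q - (b * y) ^ Q"
  have az: "vge (rv z) (a * z)" using vge_mult[OF a(3) vge_rv[of z], of "rv z"] by simp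
  have bY: "vge \<mu> (b * y)" using vge_mult[OF b vge_rv[of y], of \<mu>] y by simp
  have zpos: "0 < rv z" using Z.rv_z by simp
  have E: "vgt (1 + \<mu>) E"
    unfolding E_def using frob_add[OF az bY] zpos \<mu>(1) by (auto elim!: vge_vgt)
  have zQ: "z ^ Q = y - \<pi> * z" by (simp add: y_def)
  have r0Q: "r0 ^ Q = e * (y - \<pi> * z) - b ^ Q * (\<pi> * y) + E"
    using a(4) y(3) zQ by (simp add: r0_def E_def power_mult_distrib)
  define \<epsilon> where "\<epsilon> = (\<nu> - l * \<pi>) - (T - (1 - \<nu>))"
  have eps: "vge 2 \<epsilon>" unfolding \<epsilon>_def using nul T(1) by (rule vge_diff)
  have ua: "u * a = e * (1 + \<nu>)" using t0n by (simp add: u_eq a_def)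
  have "\<omega> * r0 = \<pi> * (u * a) * z + \<pi> * y * (u * b)" by (simp add: r0_def \<omega>_def algebra_simps)
  then have om_r0: "\<omega> * r0 = \<pi> * (e * (1 + \<nu>)) * z + \<pi> * y * (u * b)" unfolding ua .
  \<comment> \<open>What remains beyond the cancellations: nu times z, the residue condition on b, T
    against 1 - l pi, and the mixed binomial terms E. Each exceeds 1 + \<open>\<mu>\<close>.\<close>
  have err_eq: "\<omega> * r0 + r0 ^ Q - y' = \<pi> * (e * \<nu>) * z + \<pi> * y * (u * b - b ^ Q + e * l) + e * y * \<epsilon> + E"
    unfolding r0Q om_r0 by (simp add: y'_def \<theta>_def \<epsilon>_def algebra_simps)
  have e1: "vgt (1 + \<mu>) (\<pi> * (e * \<nu>) * z)"
  proof -
    have "vge (2 + rv z) (\<pi> * (e * \<nu>) * z)"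
      by (rule vge_mult[OF vge_mult[OF vge_rv vge_mult[OF ei nu1]] vge_rv]) (auto simp: rv_pi)
    then show ?thesis using \<mu>(2) zpos by (auto elim: vge_vgt)
  qed
  define eb where "eb = redn D e"
  define bb where "bb = redn D b1"
  have ebb: "redn D b = eb * bb" using ei b1i by (simp add: b_def redn_times eb_def bb_def)
  have eb0: "eb \<noteq> 0" unfolding eb_def using e0 rve by (rule redn_nonzero)
  have ebQ: "eb ^ Q = \<zeta> * eb"
    using eQ redn_power[OF ei, of Q] ei t0 by (simp add: eb_def redn_times)
  have bbQ: "bb ^ Q - bb = \<eta> / \<zeta>"
    using b1 redn_minus[OF vge_power_0[OF b1i, of Q] b1i] redn_power[OF b1i, of Q] s by (simp add: bb_def)
  have e2: "vgt (1 + \<mu>) (\<pi> * y * (u * b - b ^ Q + e * l))"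
  proof -
    have i: "vge 0 (u * b - b ^ Q)" "vge 0 (e * l)" using ur b ei l by (auto intro!: vge_diff vge_mult_0 vge_power_0)
    have "redn D (u * b - b ^ Q + e * l) = \<zeta> * (eb * bb) - (eb * bb) ^ Q + eb * \<eta>"
      using i ur b ei l co(1) ebb
      by (simp add: redn_plus redn_minus redn_times redn_power vge_mult_0 vge_power_0 eb_def)
    also have "\<dots> = - (\<zeta> * eb * (bb ^ Q - bb)) + eb * \<eta>"
      using ebQ by (simp add: power_mult_distrib algebra_simps)
    also have "\<dots> = 0" using bbQ \<zeta>0 by simp
    finally have 1: "vgt 0 (u * b - b ^ Q + e * l)" using redn_eq_0_iff vge_add[OF i] by blast
    have "vge (1 + \<mu>) (\<pi> * y)" using y by (simp add: vge_iff rv_mult)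
    then show ?thesis using 1 by (rule vgt_mult) simp
  qed
  have e3: "vgt (1 + \<mu>) (e * y * \<epsilon>)"
  proof -
    have "vge (\<mu> + 2) (e * y * \<epsilon>)"
      by (rule vge_mult[OF vge_mult[OF ei vge_rv] eps]) (auto simp: y)
    then show ?thesis by (rule vge_vgt) simp
  qed
  have err: "vgt (1 + \<mu>) (\<omega> * r0 + r0 ^ Q - y')"
    unfolding err_eq using e1 e2 e3 E by (intro vgt_add)
  have "vgt 0 r0" unfolding r0_def using az bY zpos \<mu>(1) by (intro vgt_add) (auto elim: vge_vgt)
  then obtain z' where z': "\<omega> * z' + z' ^ Q = y'" "vgt \<mu> (z' - r0)"
    using approximate_root[OF complete_in_UNIV UNIV_subfield _ om(2,3) _ _ _ err] by blast
  interpret Z': lt_extension D L \<omega> z' using om z'(1) y'Q by unfold_locales auto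
  have \<phi>L: "\<phi> x = x" if "x \<in> L" for x using galois_fix[OF \<phi>g that] .
  have \<phi>z': "\<phi> z' = z'"
    using fixes_M[OF Z'.abelian \<tau>(5)] Z'.norm_z \<tau>(6) LF.simple_ext_closed(2)
    by (auto simp: \<omega>_def \<phi>_def)
  have \<phi>y': "\<phi> y' = y'" using \<phi>h \<phi>L[OF om(1)] \<phi>z' unfolding z'(1)[symmetric] by simp
  have "vgt \<mu> (\<phi> (z' - r0))" using z'(2) galois_vgt[OF \<phi>g] by blast
  then have "vgt \<mu> (z' - \<phi> r0)" using \<phi>h \<phi>z' by simp
  then have d0: "vgt \<mu> (\<phi> r0 - r0)" using z'(2) vgt_trans vgt_diff_commute by blast
  have \<phi>th: "\<phi> \<theta> \<noteq> 0" using \<phi>h th by simp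
  have \<phi>y: "\<phi> y = \<theta> * y / \<phi> \<theta>" using \<phi>y' \<phi>th \<phi>h by (simp add: y'_def field_simps)
  have \<phi>u: "vge 0 (\<phi> x)" "rv (\<phi> x) = 0" "\<phi> x \<noteq> 0" if "x \<noteq> 0" "rv x = 0" for x
    using that galois_rv[OF \<phi>g] \<phi>h by (auto simp: vge_iff)
  \<comment> \<open>a / \<open>\<phi>\<close> a is a (Q-1)-st root of unity, so its residue decides;
    and \<open>\<phi>\<close> undoes the Q-th power on residues.\<close>
  have \<phi>a: "\<phi> a = a / t0"
  proof -
    define \<rho> where "\<rho> = a / \<phi> a"
    have 1: "\<phi> a ^ (Q - 1) = t0" using a(5) \<phi>L[OF t0(1)] \<phi>h(7)[of a "Q - 1"] by simp
    note ga = \<phi>u[OF a(1,2)]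
    have "\<rho> ^ (Q - 1) = 1" using 1 a(5) t0n by (simp add: \<rho>_def power_divide)
    then have \<rho>Q: "\<rho> ^ Q = \<rho>" using Qm[of \<rho>] by simp
    have n0: "redn D (\<phi> a) \<noteq> 0" using redn_nonzero ga by blast
    have "redn D a = redn D (\<phi> a) * redn D (\<phi> a) ^ (Q - 1)" using \<phi>fr[OF a(3)] Qm[of "redn D (\<phi> a)"] by simp
    also have "redn D (\<phi> a) ^ (Q - 1) = \<zeta>" using 1 t0(3) redn_power[OF ga(1), of "Q - 1"] by simp
    finally have "redn D \<rho> = \<zeta>" using redn_divide[OF a(3) ga(1) n0] n0 by (simp add: \<rho>_def)
    then have "\<rho> = t0" using teich_unique[OF \<rho>Q t0(2)] t0(3) by simp
    then show ?thesis using ga t0n by (auto simp: \<rho>_def field_simps)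
  qed
  \<comment> \<open>Solving \<open>\<phi>\<close> r0 = r0 for sigma(z), up to an error beyond
    \<open>\<mu>\<close>, gives t0 z + w y. As v(y) = \<open>\<mu>\<close>, only the residue of w
    matters.\<close>
  define w where "w = (t0 / a) * (b - \<phi> b * \<theta> / \<phi> \<theta>)"
  have rw: "vge 0 w \<and> redn D w = \<zeta> * \<eta>"
  proof -
    define e' where "e' = redn D (\<phi> e)"
    define b' where "b' = redn D (\<phi> b1)"
    note ge = \<phi>u[OF e0 rve] and gT = \<phi>u[OF T(3,4)] and gth = \<phi>u[OF th(1,2)]
    have gb1: "vge 0 (\<phi> b1)" using b1i galois_vge[OF \<phi>g] by blast
    have e'Q: "e' ^ Q = eb" using \<phi>fr[OF ei] by (simp add: e'_def eb_def)
    have "\<phi> e ^ (Q - 1) = t0" using e \<phi>L[OF t0(1)] \<phi>h(7)[of e "Q - 1"] by simp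
    then have "e' ^ (Q - 1) = \<zeta>" using redn_power[OF ge(1), of "Q - 1"] t0(3) by (simp add: e'_def)
    then have ebe: "eb = \<zeta> * e'" using e'Q Qm[of e'] by (metis mult.commute)
    have e'0: "e' \<noteq> 0" using ebe eb0 by auto
    have b'Q: "b' ^ Q = bb" using \<phi>fr[OF b1i] by (simp add: b'_def bb_def)
    have "\<phi> b1 ^ Q - \<phi> b1 = s" using \<phi>L[OF s(1)] b1 \<phi>h(6,7) by metis
    then have "redn D (\<phi> b1 ^ Q - \<phi> b1) = \<eta> / \<zeta>" using s(3) by simp
    \<comment> \<open>The residue bb of b1 is b'^Q, so the Artin-Schreier equation for
      \<open>\<phi>\<close> b1 measures exactly how far \<open>\<phi>\<close> moves b1.\<close>
    then have bb': "bb - b' = \<eta> / \<zeta>"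
      using redn_minus[OF vge_power_0[OF gb1, of Q] gb1] redn_power[OF gb1, of Q] b'Q by (simp add: b'_def)
    have "vgt 0 (\<phi> T - 1)" using T(5) galois_vgt[OF \<phi>g, of 0 "T - 1"] \<phi>h by simp
    then have T'1: "redn D (\<phi> T) = 1" using redn_eq_iff[OF gT(1) vge_1] redn_one by simp
    have Ti: "vge 0 T" using T(4) by (simp add: vge_iff)
    have T1: "redn D T = 1" using redn_eq_iff[OF Ti vge_1] redn_one T(5) by simp
    have thi: "vge 0 \<theta>" using th by (simp add: vge_iff)
    have rth: "redn D \<theta> = eb" using ei Ti T1 by (simp add: \<theta>_def redn_times eb_def)
    have rth': "redn D (\<phi> \<theta>) = e'" using ge gT T'1 by (simp add: \<theta>_def \<phi>h redn_times e'_def)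
    have rb': "redn D (\<phi> b) = e' * b'" using ge gb1 by (simp add: b_def \<phi>h redn_times e'_def b'_def)
    have gb: "vge 0 (\<phi> b)" using b galois_vge[OF \<phi>g] by blast
    have ra: "redn D a = eb / \<zeta>" using redn_divide[OF ei t0(4)] t0(3) \<zeta>0 by (simp add: a_def eb_def)
    have ra0: "redn D a \<noteq> 0" using ra eb0 \<zeta>0 by simp
    have d1: "vge 0 (\<phi> b * \<theta> / \<phi> \<theta>)" "redn D (\<phi> b * \<theta> / \<phi> \<theta>) = e' * b' * eb / e'"
      using redn_divide[OF vge_mult_0[OF gb thi] gth(1)] rth rth' rb' e'0 gb thi gth
      by (auto simp: redn_times vge_divide_iff vge_mult_0)
    have d2: "vge 0 (t0 / a)" "redn D (t0 / a) = \<zeta> / (eb / \<zeta>)"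
      using redn_divide[OF t0(4) a(3) ra0] ra t0 a by (auto simp: vge_divide_iff)
    have "redn D w = \<zeta> / (eb / \<zeta>) * (eb * bb - e' * b' * eb / e')"
      unfolding w_def redn_times[OF d2(1) vge_diff[OF b d1(1)]] redn_minus[OF b d1(1)] d1(2) d2(2) ebb ..
    also have "\<dots> = \<zeta> * \<zeta> * (bb - b')" using eb0 e'0 \<zeta>0 by (simp add: field_simps)
    also have "\<dots> = \<zeta> * \<eta>" using bb' \<zeta>0 by simp
    finally have "redn D w = \<zeta> * \<eta>" .
    moreover have "vge 0 w" unfolding w_def by (rule vge_mult_0[OF d2(1) vge_diff[OF b d1(1)]])
    ultimately show ?thesis by blast
  qed
  have "vge 0 (t0 * l)" "redn D (t0 * l) = \<zeta> * \<eta>" using t0 l by (auto simp: redn_times vge_mult_0)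
  then have "vgt 0 (w - t0 * l)" using rw redn_eq_iff[of w "t0 * l"] by simp
  then have v1: "vgt \<mu> (y * (w - t0 * l))" by (rule vgt_mult[OF vge_rv]) (simp add: y)
  have "vge 0 (t0 / a)" using t0 a by (simp add: vge_divide_iff)
  then have v2: "vgt \<mu> ((t0 / a) * (\<phi> r0 - r0))" using d0 by (rule vgt_mult) simp
  have "\<phi> r0 = \<phi> a * \<phi> z + \<phi> b * \<phi> y" by (simp add: r0_def \<phi>h)
  then have "\<phi> r0 = (a / t0) * \<sigma> z + \<phi> b * (\<theta> * y / \<phi> \<theta>)" using \<phi>a \<phi>y \<phi>z by simp
  then have "(t0 / a) * (\<phi> r0 - r0) = \<sigma> z - t0 * z - y * w"
    unfolding w_def r0_def using a(1) t0n by (simp add: field_simps)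
  then have "vgt \<mu> (\<sigma> z - t0 * z - y * w + y * (w - t0 * l))"
    using v1 v2 by (simp only: vgt_add)
  then show "vgt \<mu> (\<sigma> z - teich \<zeta> * (z + teich \<eta> * (\<pi> * z + z ^ Q)))"
    unfolding t0_def[symmetric] l_def[symmetric] y_def[symmetric] by (simp add: algebra_simps)
qed

end

section \<open>The unramified quadratic extension\<close>

context local_field_setting
begin

interpretation B: local_subfield D "base D" by (rule base_local_subfield)

text \<open>1 and \<open>\<rho>\<close> are orthogonal over F: if v(y) <= v(x), division by y gives
  a unit because the residue of \<open>\<rho>\<close> is not in k_F; otherwise x dominates.\<close>

lemma quadratic_orthogonal:
  assumes r: "vge 0 \<rho>" "redn D \<rho> \<notin> resfield D (base D)" and xy: "x \<in> base D" "y \<in> base D"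
    and nz: "x + y * \<rho> \<noteq> 0"
  shows "vge (rv (x + y * \<rho>)) x \<and> vge (rv (x + y * \<rho>)) y \<and> (\<exists>n::int. rv (x + y * \<rho>) = of_int n)"
proof (cases "y = 0")
  case True
  then show ?thesis using nz B.discrete[OF xy(1)] by (auto simp: vge_rv)
next
  case y: False
  show ?thesis
  proof (cases "vge (rv y) x")
    case True
    have q: "x / y \<in> base D" "vge 0 (x / y)" using xy True y by (auto simp: vge_divide_iff B.L_divide)
    have "redn D (x / y + \<rho>) \<noteq> 0"
    proof
      assume "redn D (x / y + \<rho>) = 0"
      then have "redn D \<rho> = - redn D (x / y)"
        using redn_plus[OF q(2) r(1)] by (simp add: eq_neg_iff_add_eq_0 add.commute)
      then show False using r(2) B.resfield_uminus[OF B.redn_resfield[OF q]] by simp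
    qed
    then have "x / y + \<rho> \<noteq> 0" "rv (x / y + \<rho>) = 0" using redn_unit vge_add[OF q(2) r(1)] by auto
    moreover have "x + y * \<rho> = y * (x / y + \<rho>)" using y by (simp add: distrib_left)
    ultimately have "rv (x + y * \<rho>) = rv y" using y by (simp add: rv_mult)
    then show ?thesis using True B.discrete[OF xy(2) y] by (auto simp: vge_rv)
  next
    case False
    then have x: "x \<noteq> 0" "rv x < rv y" by (auto simp: vge_iff)
    have "vge (rv y) (y * \<rho>)" by (rule vge_mult[OF vge_rv r(1)]) simp
    then have "vgt (rv x) (x + y * \<rho> - x)" using x by (auto elim: vge_vgt)
    then have "rv (x + y * \<rho>) = rv x" using rv_cong[OF x(1)] by blast
    then show ?thesis using x B.discrete[OF xy(1) x(1)] by (auto simp: vge_iff)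
  qed
qed

lemma quadratic_span:
  assumes E: "unramified_quadratic D E" and r: "\<rho> \<in> E" "vge 0 \<rho>" "redn D \<rho> \<notin> resfield D (base D)"
  shows "E = {x + y * \<rho> | x y. x \<in> base D \<and> y \<in> base D}"
proof -
  obtain b where b: "E = {x + y * b | x y. x \<in> base D \<and> y \<in> base D}"
    using E by (auto simp: unramified_quadratic_def)
  obtain x0 y0 where \<rho>: "\<rho> = x0 + y0 * b" "x0 \<in> base D" "y0 \<in> base D" using r(1) unfolding b by blast
  have y0: "y0 \<noteq> 0" using \<rho> r B.redn_resfield by auto
  have sub: "is_subfield E" "base D \<subseteq> E" using E by (auto simp: unramified_quadratic_def)
  show ?thesis
  proof (intro equalityI subsetI)
    fix t assume "t \<in> E"
    then obtain x y where t: "t = x + y * b" "x \<in> base D" "y \<in> base D" unfolding b by blast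
    have "t = (x - y / y0 * x0) + (y / y0) * \<rho>" using y0 by (simp add: t \<rho>(1) field_simps)
    moreover have "x - y / y0 * x0 \<in> base D" "y / y0 \<in> base D"
      using t \<rho> by (auto intro!: B.L_diff B.L_mult B.L_divide)
    ultimately show "t \<in> {x + y * \<rho> | x y. x \<in> base D \<and> y \<in> base D}" by blast
  next
    fix t assume "t \<in> {x + y * \<rho> | x y. x \<in> base D \<and> y \<in> base D}"
    then obtain x y where "t = x + y * \<rho>" "x \<in> E" "y \<in> E" using sub(2) by blast
    then show "t \<in> E" using sub(1) r(1) by (simp add: is_subfield_def)
  qed
qed

text \<open>Counting residues yields an integral \<open>\<rho>\<close> in E with residue outside
  k_F. In the orthogonal basis 1, \<open>\<rho>\<close> completeness and integral valuations are
  inherited from F.\<close>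

lemma quadratic_local_subfield:
  assumes E: "unramified_quadratic D E"
  shows "local_subfield D E" "card (resfield D E) = resq D ^ 2"
    "\<exists>\<rho>\<in>E. vge 0 \<rho> \<and> redn D \<rho> \<notin> resfield D (base D)"
proof -
  have Qq: "B.Q = resq D" by (simp add: B.Q_def resq_def)
  show card: "card (resfield D E) = resq D ^ 2" using E by (simp add: unramified_quadratic_def resq_def)
  have q: "3 \<le> resq D" using B.Q_ge_3 Qq by simp
  then have "0 < card (resfield D E)" using card by simp
  then have fin: "finite (resfield D E)" by (rule card_ge_0_finite)
  have sub: "is_subfield E" "base D \<subseteq> E" using E by (auto simp: unramified_quadratic_def)
  have "\<not> resfield D E \<subseteq> resfield D (base D)"
  proof
    assume "resfield D E \<subseteq> resfield D (base D)"
    then have "resq D ^ 2 \<le> resq D" using card_mono[OF resfield_finite] card resq_def by metis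
    moreover have "resq D < resq D ^ 2" using q by (simp add: power2_eq_square)
    ultimately show False by simp
  qed
  then show ex: "\<exists>\<rho>\<in>E. vge 0 \<rho> \<and> redn D \<rho> \<notin> resfield D (base D)"
    by (auto simp: resfield_def ints_def val_ge_0_iff)
  then obtain \<rho> where r: "\<rho> \<in> E" "vge 0 \<rho>" "redn D \<rho> \<notin> resfield D (base D)" by blast
  note span = quadratic_span[OF E r]
  show "local_subfield D E"
  proof unfold_locales
    fix t assume t: "t \<in> E" "t \<noteq> 0"
    then obtain x y where "t = x + y * \<rho>" "x \<in> base D" "y \<in> base D" using span by blast
    then show "\<exists>n::int. rv t = of_int n" using quadratic_orthogonal[OF r(2,3)] t(2) by blast
  next
    show "complete_in E"
      unfolding complete_in_def
    proof (intro allI impI)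
      fix s :: "nat \<Rightarrow> 'c" assume s: "cauchy_seq D s" "range s \<subseteq> E"
      then have "\<forall>n. \<exists>x y. s n = x + y * \<rho> \<and> x \<in> base D \<and> y \<in> base D" using span by blast
      then obtain x y where xy: "\<And>n. s n = x n + y n * \<rho>" "\<And>n. x n \<in> base D" "\<And>n. y n \<in> base D"
        by metis
      have diff: "vge B (x m - x n) \<and> vge B (y m - y n)" if v: "vge B (s m - s n)" for B m n
      proof -
        have eq: "s m - s n = (x m - x n) + (y m - y n) * \<rho>" by (simp add: xy(1) algebra_simps)
        have mem: "x m - x n \<in> base D" "y m - y n \<in> base D" using xy B.L_diff by auto
        show ?thesis
        proof (cases "s m - s n = 0")
          case True
          have "y m - y n = 0"
          proof (rule ccontr)
            assume yn: "y m - y n \<noteq> 0"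
            then have "\<rho> = - ((x m - x n) / (y m - y n))" using True eq by (simp add: field_simps eq_neg_iff_add_eq_0)
            then have "\<rho> \<in> base D" using mem by (simp add: B.L_uminus B.L_divide)
            then show False using r B.redn_resfield by blast
          qed
          then show ?thesis using True eq by simp
        next
          case False
          then have "vge (rv (s m - s n)) (x m - x n)" "vge (rv (s m - s n)) (y m - y n)"
            using quadratic_orthogonal[OF r(2,3) mem] eq by auto
          moreover have "B \<le> rv (s m - s n)" using v False by (simp add: vge_iff)
          ultimately show ?thesis using vge_mono by blast
        qed
      qed
      have "cauchy_seq D x" "cauchy_seq D y"
        using s(1) diff unfolding cauchy_seq_iff by meson+
      moreover have "range x \<subseteq> base D" "range y \<subseteq> base D" using xy by auto
      ultimately obtain lx ly where l: "lx \<in> base D" "tends_to D x lx" "ly \<in> base D" "tends_to D y ly"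
        using base_complete by meson
      have "tends_to D s (lx + ly * \<rho>)"
        unfolding tends_to_iff
      proof
        fix B
        obtain N N' where N: "\<forall>n\<ge>N. vge B (x n - lx)" "\<forall>n\<ge>N'. vge B (y n - ly)"
          using l unfolding tends_to_iff by meson
        have "vge B (s n - (lx + ly * \<rho>))" if "max N N' \<le> n" for n
        proof -
          have "vge B ((x n - lx) + (y n - ly) * \<rho>)"
            using N that vge_mult[OF _ r(2), of B "y n - ly" B] by (intro vge_add) auto
          then show ?thesis by (simp add: xy(1) algebra_simps)
        qed
        then show "\<exists>N. \<forall>n\<ge>N. vge B (s n - (lx + ly * \<rho>))" by blast
      qed
      moreover have "lx + ly * \<rho> \<in> E" using span l by blast
      ultimately show "\<exists>l\<in>E. tends_to D s l" by blast
    qed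
  qed (use sub fin in auto)
qed

text \<open>E is generated over F by a Teichmueller representative, which inertia fixes because it
  fixes its residue.\<close>

lemma inertia_quadratic:
  assumes E: "unramified_quadratic D E" and \<sigma>: "\<sigma> \<in> inertia D (base D)"
  shows "\<sigma> \<in> inertia D E"
proof -
  interpret E: local_subfield D E by (rule quadratic_local_subfield[OF E])
  obtain \<rho> where r: "\<rho> \<in> E" "vge 0 \<rho>" "redn D \<rho> \<notin> resfield D (base D)"
    using quadratic_local_subfield(3)[OF E] by blast
  define t where "t = E.teich (redn D \<rho>)"
  note t = E.teich[OF E.redn_resfield[OF r(1,2)], folded t_def]
  have span: "E = {x + y * t | x y. x \<in> base D \<and> y \<in> base D}"
    by (rule quadratic_span[OF E t(1)]) (use t r in auto)
  note g = inertia_galois[OF \<sigma>]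
  note h = aut_simps[OF galois_aut[OF g]]
  have "\<sigma> t ^ E.Q = \<sigma> t" using t(2) h(7) by metis
  then have "\<sigma> t = t" using E.teich_unique t(2) inertia_redn[OF \<sigma> t(4)] by blast
  then have "\<sigma> x = x" if "x \<in> E" for x
    using that galois_fix[OF g] h(3,4) unfolding span by auto
  then show ?thesis using \<sigma> by (auto simp: inertia_def galois_C_def)
qed

end

section \<open>Roots of -1 and comparison of (Q-1)-st powers\<close>

context local_subfield
begin

text \<open>Adjusts a sign: suitable powers of \<open>kap D\<close> have (Q-1)-st power pi, whereas
  a point of level one needs -pi.\<close>

lemma minus_one_root_exists: "\<exists>\<eta>. \<eta> ^ (Q - 1) = - 1 \<and> \<eta> \<noteq> 0 \<and> rv \<eta> = 0"
proof -
  define p :: "'c poly" where "p = monom 1 (Q - 1) + [:1:]"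
  have "coeff p i \<in> algebraic_over (base D)" for i
  proof -
    have "coeff p i \<in> {0, 1}" using Q_ge_3 by (auto simp: p_def coeff_pCons split: nat.splits)
    moreover have "c ^ Q = c" if "c \<in> {0, 1}" for c :: 'c using that Q_pos by auto
    ultimately show ?thesis using teich_algebraic by blast
  qed
  moreover have "0 < degree p"
  proof -
    have "coeff p (Q - 1) = 1" using Q_ge_3 by (auto simp: p_def coeff_pCons split: nat.splits)
    then have "Q - 1 \<le> degree p" by (intro le_degree) simp
    then show ?thesis using Q_ge_3 by linarith
  qed
  ultimately obtain \<eta> where "poly p \<eta> = 0" using alg_closed[of p] by blast
  then have eta: "\<eta> ^ (Q - 1) = - 1" by (simp add: p_def poly_monom eq_neg_iff_add_eq_0)
  then have nz: "\<eta> \<noteq> 0" using Q_ge_3 by (auto simp: zero_power)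
  have "real (Q - 1) * rv \<eta> = rv (- 1)" using rv_power[OF nz, of "Q - 1"] eta by metis
  then have "real (Q - 1) * rv \<eta> = 0" by (simp only: rv_uminus rv_one)
  then have "rv \<eta> = 0" using Q_ge_3 by simp
  then show ?thesis using eta nz by blast
qed

text \<open>The quotient of the two is a (Q-1)-st root of unity with residue 1, hence 1 by
  \<open>teich_unique\<close>.\<close>

lemma inertia_fixes_root:
  assumes \<sigma>: "\<sigma> \<in> inertia D L" and \<eta>: "\<eta> ^ (Q - 1) = - 1" "\<eta> \<noteq> 0" "rv \<eta> = 0"
  shows "\<sigma> \<eta> = \<eta>"
proof -
  note g = inertia_galois[OF \<sigma>]
  note h = aut_simps[OF galois_aut[OF g]]
  define \<rho> where "\<rho> = \<sigma> \<eta> / \<eta>"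
  have "\<sigma> \<eta> ^ (Q - 1) = - 1" using \<eta>(1) h(2,5,7) by metis
  then have "\<rho> ^ (Q - 1) = 1" using \<eta> by (simp add: \<rho>_def power_divide)
  then have \<rho>Q: "\<rho> ^ Q = \<rho>" using Q_pos by (metis mult.right_neutral power_eq_if neq0_conv)
  have int: "vge 0 \<eta>" "vge 0 (\<sigma> \<eta>)" using \<eta> galois_vge[OF g] by (auto simp: vge_iff)
  have "redn D \<eta> \<noteq> 0" using redn_nonzero \<eta> by blast
  then have "redn D \<rho> = 1"
    using redn_divide[OF int(2,1)] inertia_redn[OF \<sigma> int(1)] by (simp add: \<rho>_def)
  then have "\<rho> = 1" using teich_unique[OF \<rho>Q, of 1] by (simp add: redn_one)
  then show ?thesis using \<eta> by (simp add: \<rho>_def)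
qed

text \<open>The cofactor of x - y reduces to (Q - 1) times a power of the common residue, that is to
  minus a nonzero residue, so it is a unit.\<close>

lemma power_diff_unit:
  assumes "vge 0 x" "vge 0 y" "redn D x = redn D y" "redn D y \<noteq> 0"
  shows "vge r (x ^ (Q - 1) - y ^ (Q - 1)) \<longleftrightarrow> vge r (x - y)"
    "vgt r (x ^ (Q - 1) - y ^ (Q - 1)) \<longleftrightarrow> vgt r (x - y)"
proof -
  define S where "S = (\<Sum>i<Q - 1. y ^ (Q - 1 - Suc i) * x ^ i)"
  have eq: "x ^ (Q - 1) - y ^ (Q - 1) = S * (x - y)"
    unfolding S_def by (simp add: power_diff_sumr2 mult.commute)
  have int: "vge 0 S" unfolding S_def using assms by (intro vge_sum vge_mult_0 vge_power_0)
  have "redn D S = (\<Sum>i<Q - 1. redn D y ^ (Q - 2))"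
    unfolding S_def
  proof (subst redn_sum)
    show "vge 0 (y ^ (Q - 1 - Suc i) * x ^ i)" for i using assms by (intro vge_mult_0 vge_power_0)
    have "redn D (y ^ (Q - 1 - Suc i) * x ^ i) = redn D y ^ (Q - 2)" if "i < Q - 1" for i
    proof -
      have "(Q - 1 - Suc i) + i = Q - 2" using that by simp
      then show ?thesis using assms by (simp add: redn_times vge_power_0 redn_power flip: power_add)
    qed
    then show "(\<Sum>i<Q - 1. redn D (y ^ (Q - 1 - Suc i) * x ^ i)) = (\<Sum>i<Q - 1. redn D y ^ (Q - 2))"
      by (intro sum.cong) auto
  qed
  also have "\<dots> = of_nat (Q - 1) * redn D y ^ (Q - 2)" by simp
  also have "of_nat (Q - 1) = (of_nat Q - 1 :: 'k)" using Q_pos by (simp add: of_nat_diff)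
  also have "of_nat Q = (0::'k)" using binomial_residue_0[of 1] Q_ge_3 by simp
  finally have "redn D S \<noteq> 0" using assms by simp
  then have "S \<noteq> 0" "rv S = 0" using redn_unit int by auto
  then show "vge r (x ^ (Q - 1) - y ^ (Q - 1)) \<longleftrightarrow> vge r (x - y)"
    "vgt r (x ^ (Q - 1) - y ^ (Q - 1)) \<longleftrightarrow> vgt r (x - y)"
    unfolding eq by (simp_all add: vge_mult_iff vgt_mult_iff)
qed

end

section \<open>Action of inertia on the auxiliary constants\<close>

context lubin_tate_setting
begin

sublocale F: local_subfield D "base D" by (rule base_local_subfield)

abbreviation "q \<equiv> resq D"
abbreviation "K \<equiv> kap D"
abbreviation "\<pi> \<equiv> unif D"

lemma FQ [simp]: "F.Q = q"
  by (simp add: F.Q_def resq_def)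

lemma q_ge_3: "3 \<le> q" and odd_q: "odd q"
  using F.Q_ge_3 F.odd_Q by auto

definition nq :: nat where "nq = q ^ 2 - 1"

lemma nq: "q ^ 2 = nq + 1" "8 \<le> nq" "nq = (q - 1) * (q + 1)" "real nq = real q ^ 2 - 1"
proof -
  have 1: "9 \<le> q ^ 2" using power_mono[OF q_ge_3, of 2] by simp
  then show a: "q ^ 2 = nq + 1" "8 \<le> nq" by (auto simp: nq_def)
  have "int (q ^ 2) = int (nq + 1)" using a by simp
  then show "real nq = real q ^ 2 - 1" by (metis add_diff_cancel_right' a(1) of_nat_add of_nat_1 of_nat_power)
  show "nq = (q - 1) * (q + 1)"
    using q_ge_3 by (cases q) (auto simp: nq_def power2_eq_square)
qed

lemma nq_pos: "0 < real nq" "0 < nq" "0 < real q" "0 < q"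
  using nq(2) q_ge_3 by auto

lemma nq_eq: "q ^ 2 - 1 = nq" "q ^ 2 - Suc 0 = nq"
  by (simp_all add: nq_def)

lemma K: "K \<noteq> 0" "K ^ (q ^ 2 * nq) = \<pi>" "real (q ^ 2 * nq) * rv K = 1"
proof -
  have "K ^ (q ^ 2 * nq) = kap1 D ^ (q ^ 3 * (q ^ 2 - 1))"
    by (simp add: kap_def nq_def power_mult[symmetric] power2_eq_square power3_eq_cube mult.assoc)
  then show p: "K ^ (q ^ 2 * nq) = \<pi>" using kap1 by simp
  show n: "K \<noteq> 0" using p nq q_ge_3 F.pi_nz by (auto simp: zero_power)
  show "real (q ^ 2 * nq) * rv K = 1" using rv_power[OF n, of "q ^ 2 * nq"] p F.rv_pi by metis
qed

lemma rv_K: "rv K = 1 / (real q ^ 2 * real nq)"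
  using K(3) nq_pos by (simp add: eq_divide_eq mult.commute)

lemma rv_K_power: "rv (K ^ n) = real n / (real q ^ 2 * real nq)"
  using K(1) by (simp add: rv_power rv_K)

text \<open>gamma^(q/(q-1)), the denominator in the second index function.\<close>

definition \<delta> :: 'c where "\<delta> = K ^ (q * nq)"

text \<open>gamma^(1/(q-1)) = gamma^(1/q) w, the total denominator of the coordinate a. It is not
  the kappa of the statement, which is \<open>K\<close>.\<close>

definition \<kappa> :: 'c where "\<kappa> = K ^ nq"

lemma gam_eq: "gam D = K ^ ((q - 1) * nq)"
  by (simp add: gam_def nq_def)

lemma gam_q_pow: "gam_q D ^ q = gam D"
  by (simp add: gam_q_def gam_def kap_def power_mult[symmetric] mult.commute mult.left_commute)

lemma gam_\<kappa>: "gam D * \<kappa> = \<delta>"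
proof -
  have "(q - 1) * nq + nq = q * nq" using q_ge_3 by (cases q) auto
  then show ?thesis by (simp add: gam_eq \<kappa>_def \<delta>_def flip: power_add)
qed

lemma \<kappa>_q: "\<kappa> ^ q = \<delta>"
  by (simp add: \<kappa>_def \<delta>_def power_mult[symmetric] mult.commute)

lemma gam_q_w: "gam_q D * w_par D = \<kappa>"
proof -
  have "(q - 1) * nq + nq = q * nq" using q_ge_3 by (cases q) auto
  then show ?thesis
    by (simp add: gam_q_def w_par_def \<kappa>_def kap_def nq_eq flip: power_mult power_add)
qed

lemma kap1_\<delta>: "kap1 D ^ (q ^ 2 * (q ^ 2 - 1)) = \<delta>"
  by (simp add: \<delta>_def kap_def nq_def power_mult[symmetric] power2_eq_square mult.assoc)

lemma nz: "\<delta> \<noteq> 0" "\<kappa> \<noteq> 0" "gam D \<noteq> 0" "gam_q D \<noteq> 0" "w_par D \<noteq> 0" "kap1 D \<noteq> 0"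
proof -
  show k: "kap1 D \<noteq> 0" using K(1) q_ge_3 by (auto simp: kap_def zero_power)
  then show "\<delta> \<noteq> 0" "\<kappa> \<noteq> 0" "gam D \<noteq> 0" "gam_q D \<noteq> 0" "w_par D \<noteq> 0"
    using K(1) by (auto simp: \<delta>_def \<kappa>_def gam_eq gam_q_def w_par_def)
qed

lemma rvs: "rv \<delta> = 1 / real q" "rv \<kappa> = 1 / real q ^ 2" "rv (gam D) = (real q - 1) / real q ^ 2"
  "rv (gam_q D) = (real q - 1) / real q ^ 3"
proof -
  show 1: "rv \<delta> = 1 / real q" "rv \<kappa> = 1 / real q ^ 2"
    using nq_pos by (simp_all add: \<delta>_def \<kappa>_def rv_K_power power2_eq_square)
  show g: "rv (gam D) = (real q - 1) / real q ^ 2"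
    using nq_pos F.real_Q_minus_1 by (simp add: gam_eq rv_K_power)
  have "rv (gam D) = real q * rv (gam_q D)" using rv_power[OF nz(4), of q] gam_q_pow by simp
  then show "rv (gam_q D) = (real q - 1) / real q ^ 3"
    using g q_ge_3 by (simp add: field_simps power2_eq_square power3_eq_cube)
qed

lemma rvs_pos: "0 < rv \<delta>" "0 < rv \<kappa>" "0 < rv (gam D)" "0 < rv (gam_q D)"
  using q_ge_3 by (auto simp: rvs)

lemma integral_root:
  assumes "x ^ q = a + c * x" "vge 0 a" "vge 0 c"
  shows "vge 0 x"
proof (rule ccontr)
  assume "\<not> vge 0 x"
  then have x: "x \<noteq> 0" "rv x < 0" by (auto simp: vge_iff)
  have "vge (rv x) (a + c * x)"
    using assms x vge_mult[OF assms(3) vge_rv[of x], of "rv x"] by (intro vge_add) (auto elim: vge_mono)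
  then have "rv x \<le> real q * rv x" using x assms(1) rv_power[of x q] by (metis power_not_zero vge_iff)
  moreover have "real q * rv x < 1 * rv x" using x q_ge_3 by (intro mult_strict_right_mono_neg) auto
  ultimately show False by simp
qed

lemma redn_root_1:
  assumes "x ^ q = y" "vge 0 y" "redn D y = 1"
  shows "vge 0 x" "redn D x = 1"
proof -
  show x: "vge 0 x" using integral_root[of x y 0] assms by simp
  then have "redn D x ^ q = 1 ^ q" using redn_power[OF x, of q] assms by simp
  then show "redn D x = 1" using F.frob_inj_residue by simp
qed

text \<open>\<open>gam0 D\<close> is 1 up to v(gamma): its q-th power differs from 1 by gamma^q
  times an integer, and additivity of Frobenius modulo pi allows a q-th root to be taken.\<close>

lemma gam0_int: "vge 0 (gam0 D)" "redn D (gam0 D) = 1" "vge (rv (gam D)) (gam0 D - 1)"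
proof -
  have eq: "gam0 D ^ q = 1 + gam D ^ q * gam0 D" using gam0 by (simp add: diff_eq_eq)
  have gq: "vge (real q * rv (gam D)) (gam D ^ q)" by (rule vge_power[OF vge_rv])
  have "0 < real q * rv (gam D)" using rvs_pos(3) q_ge_3 by simp
  then have "vge 0 (gam D ^ q)" using gq vge_mono by (meson less_imp_le)
  then show i: "vge 0 (gam0 D)" using integral_root[OF eq] by simp
  have d: "vge (real q * rv (gam D)) (gam0 D ^ q - 1)"
    unfolding eq using vge_mult[OF gq i] by simp
  then have "vgt 0 (gam0 D ^ q - 1)" using \<open>0 < real q * rv (gam D)\<close> by (rule vge_vgt)
  then have "redn D (gam0 D ^ q) = redn D 1" using redn_eq_iff[OF vge_power_0[OF i, of q] vge_1] by blast
  then show "redn D (gam0 D) = 1" using redn_root_1(2)[OF refl vge_power_0[OF i, of q]] by (simp add: redn_one)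
  have "vge 1 ((gam0 D - 1) ^ q - gam0 D ^ q + 1 ^ q)" using F.frob_diff[of 0 "gam0 D" 0 1] i by simp
  moreover have "real q * rv (gam D) \<le> 1" using q_ge_3 by (simp add: rvs field_simps power2_eq_square)
  ultimately have "vge (real q * rv (gam D)) ((gam0 D - 1) ^ q - gam0 D ^ q + 1 ^ q + (gam0 D ^ q - 1))"
    by (intro vge_add[OF vge_mono[of 1] d])
  then have "vge (real q * rv (gam D)) ((gam0 D - 1) ^ q)" by simp
  then show "vge (rv (gam D)) (gam0 D - 1)" using q_ge_3 by (simp add: vge_power_iff)
qed

lemma tgam0_int: "vge 0 (tgam0 D)" "redn D (tgam0 D) = 1" "vge (rv (gam_q D)) (tgam0 D - 1)"
proof -
  show i: "vge 0 (tgam0 D)" "redn D (tgam0 D) = 1" using redn_root_1[OF tgam0 gam0_int(1,2)] by auto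
  have "vge 1 ((tgam0 D - 1) ^ q - tgam0 D ^ q + 1 ^ q)" using F.frob_diff[of 0 "tgam0 D" 0 1] i by simp
  moreover have "1 * rv (gam D) \<le> real q * rv (gam D)" "real q * rv (gam D) \<le> 1"
    using q_ge_3 rvs_pos(3) by (intro mult_right_mono, simp_all) (simp add: rvs field_simps power2_eq_square)
  then have "rv (gam D) \<le> 1" by simp
  ultimately have "vge (rv (gam D)) ((tgam0 D - 1) ^ q - tgam0 D ^ q + 1 ^ q + (gam0 D - 1))"
    by (intro vge_add[OF vge_mono[of 1] gam0_int(3)])
  then have "vge (rv (gam D)) ((tgam0 D - 1) ^ q)" using tgam0 by simp
  moreover have "rv (gam D) / real q = rv (gam_q D)" by (simp add: rvs power2_eq_square power3_eq_cube)
  ultimately show "vge (rv (gam_q D)) (tgam0 D - 1)" using q_ge_3 by (simp add: vge_power_iff)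
qed

text \<open>Combines the centres of \<open>Z1_co\<close> and \<open>a_co\<close>: a is the quotient
  of det - [zeta] \<open>\<beta>\<close> by \<open>\<kappa>\<close>.\<close>

definition \<beta> :: 'c where "\<beta> = tgam0 D + gam_q D * tgam1 D"

lemma tgam1_int: "vge 0 (tgam1 D)" "tgam1 D ^ q = - \<beta>" "vge 0 \<beta>" "redn D \<beta> = 1"
proof -
  have g: "vge 0 (gam_q D)" using rvs_pos(4) by (simp add: vge_iff)
  have "tgam1 D ^ q + \<beta> = 0" using tgam1 by (simp add: \<beta>_def add.assoc)
  then show eq: "tgam1 D ^ q = - \<beta>" by (simp only: eq_neg_iff_add_eq_0)
  have "tgam1 D ^ q = - tgam0 D + (- gam_q D) * tgam1 D" unfolding eq \<beta>_def by simp
  then show i: "vge 0 (tgam1 D)" by (rule integral_root) (use tgam0_int g in auto)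
  have "vgt 0 (gam_q D * tgam1 D)" using rvs_pos(4) i by (intro vgt_mult'[of 0 _ 0]) (auto simp: vgt_iff)
  then have "vgt 0 (\<beta> - tgam0 D)" by (simp add: \<beta>_def)
  then show "vge 0 \<beta>" "redn D \<beta> = 1" using redn_cong[OF tgam0_int(1)] tgam0_int(2) by auto
qed

text \<open>Takes q-th powers in \<open>tgam0 D\<close> = \<open>\<beta>\<close> - gamma^(1/q)
  \<open>tgam1 D\<close>, where \<open>tgam1 D\<close>^q = -\<open>\<beta>\<close> by its defining
  equation.\<close>

lemma \<beta>_gam0: "vge (1 + rv (gam_q D)) (gam0 D - (\<beta> ^ q + gam D * \<beta>))"
proof -
  have v: "vge (rv (gam_q D)) (gam_q D * tgam1 D)" using vge_mult[OF vge_rv tgam1_int(1)] by simp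
  have "\<beta> - gam_q D * tgam1 D = tgam0 D" by (simp add: \<beta>_def)
  moreover have "(gam_q D * tgam1 D) ^ q = - (gam D * \<beta>)" by (simp add: power_mult_distrib gam_q_pow tgam1_int(2))
  moreover have "vge (1 + 0 + rv (gam_q D)) ((\<beta> - gam_q D * tgam1 D) ^ F.Q - \<beta> ^ F.Q + (gam_q D * tgam1 D) ^ F.Q)"
    using v tgam1_int(3) rvs_pos by (intro F.frob_diff) auto
  ultimately have "vge (1 + 0 + rv (gam_q D)) (gam0 D - \<beta> ^ q + - (gam D * \<beta>))"
    unfolding FQ by (simp only: tgam0)
  then show ?thesis by (simp add: algebra_simps)
qed

text \<open>Inserting \<open>\<beta>_gam0\<close> into gam0^q = 1 + gamma^q gam0, the terms gamma^q
  \<open>\<beta>\<close>^q on the two sides cancel. Up to a power of \<open>K\<close> this is the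
  level-two equation for E.\<close>

lemma \<beta>_approximate_root: "vgt 1 (\<beta> ^ (q ^ 2) - gam D ^ (q + 1) * \<beta> - 1)"
proof -
  define X where "X = \<beta> ^ q + gam D * \<beta>"
  define E where "E = gam0 D - X"
  define A where "A = gam0 D ^ q - X ^ q"
  define B where "B = X ^ q - (\<beta> ^ q) ^ q - (gam D * \<beta>) ^ q"
  have E: "vge (1 + rv (gam_q D)) E" unfolding E_def X_def by (rule \<beta>_gam0)
  have gb: "vge (rv (gam D)) (gam D * \<beta>)" using vge_mult[OF vge_rv tgam1_int(3)] by simp
  have "vge 0 X" unfolding X_def using gb rvs_pos(3) tgam1_int(3)
    by (intro vge_add vge_power_0) (auto elim: vge_mono)
  then have "vge (min (real F.Q * (1 + rv (gam_q D))) (1 + (1 + rv (gam_q D)) + 0)) (gam0 D ^ F.Q - X ^ F.Q)"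
    using E rvs_pos by (intro F.frob_contr) (auto simp: E_def)
  then have "vgt 1 (gam0 D ^ F.Q - X ^ F.Q)"
  proof (rule vge_vgt)
    have "1 < 1 * (1 + rv (gam_q D))" using rvs_pos(4) by simp
    also have "\<dots> \<le> real F.Q * (1 + rv (gam_q D))"
      using q_ge_3 rvs_pos(4) by (intro mult_right_mono) auto
    finally have "1 < real F.Q * (1 + rv (gam_q D))" .
    moreover have "1 < 1 + (1 + rv (gam_q D)) + 0" using rvs_pos(4) by simp
    ultimately show "1 < min (real F.Q * (1 + rv (gam_q D))) (1 + (1 + rv (gam_q D)) + 0)"
      by (simp only: min_less_iff_conj)
  qed
  then have A: "vgt 1 A" by (simp add: A_def)
  have "vge (1 + 0 + rv (gam D)) ((\<beta> ^ q + gam D * \<beta>) ^ F.Q - (\<beta> ^ q) ^ F.Q - (gam D * \<beta>) ^ F.Q)"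
    using gb tgam1_int(3) rvs_pos by (intro F.frob_add vge_power_0) auto
  then have B: "vgt 1 B" using rvs_pos(3) by (auto simp: B_def X_def elim: vge_vgt)
  have "vge 0 (gam D ^ q)" using rvs_pos(3) by (intro vge_power_0) (simp add: vge_iff)
  then have "vge (0 + (1 + rv (gam_q D))) (gam D ^ q * E)" using E by (rule vge_mult) simp
  then have C: "vgt 1 (gam D ^ q * E)" using rvs_pos(4) by (auto elim: vge_vgt)
  have "gam0 D ^ q = 1 + gam D ^ q * gam0 D" using gam0 by (simp add: diff_eq_eq)
  moreover have "gam0 D = \<beta> ^ q + gam D * \<beta> + E" by (simp add: E_def X_def)
  ultimately have "gam0 D ^ q = 1 + gam D ^ q * (\<beta> ^ q + gam D * \<beta> + E)" by metis
  then have "\<beta> ^ (q ^ 2) - gam D ^ (q + 1) * \<beta> - 1 = gam D ^ q * E - A - B"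
    by (simp add: A_def B_def power2_eq_square power_mult power_mult_distrib algebra_simps)
  then show ?thesis using A B C by (auto intro: vgt_diff)
qed

end

locale lubin_tate_quadratic = lubin_tate_setting D
  for D :: "('c::field, 'k::field) lt_data" +
  fixes E :: "'c set"
  assumes quadratic: "unramified_quadratic D E"
begin

sublocale E: local_subfield D E by (rule quadratic_local_subfield[OF quadratic])

lemma EQ [simp]: "E.Q = q ^ 2"
  using quadratic_local_subfield(2)[OF quadratic] by (simp add: E.Q_def)

end

locale inertia_action = lubin_tate_quadratic D E
  for D :: "('c::field, 'k::field) lt_data" and E +
  fixes rF rE :: "('c \<Rightarrow> 'c) \<Rightarrow> 'c" and \<sigma> :: "'c \<Rightarrow> 'c" and \<zeta>F \<eta>F \<zeta>E \<eta>E :: 'k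
  assumes rF: "reciprocity_map D (base D) rF" and rE: "reciprocity_map D E rE"
    and \<sigma>: "\<sigma> \<in> inertia D (base D)"
    and ucF: "unit_coords D (base D) (rF \<sigma>) = (\<zeta>F, \<eta>F)"
    and ucE: "unit_coords D E (rE \<sigma>) = (\<zeta>E, \<eta>E)"
begin

lemmas \<sigma>_galois = inertia_galois[OF \<sigma>]
lemmas \<sigma>_hom = aut_simps[OF galois_aut[OF \<sigma>_galois]]
lemmas \<sigma>_redn = inertia_redn[OF \<sigma>]
lemmas \<sigma>_vge = galois_vge[OF \<sigma>_galois]
lemmas \<sigma>_vgt = galois_vgt[OF \<sigma>_galois]
lemmas \<sigma>_rv = galois_rv[OF \<sigma>_galois]

text \<open>The root of unity that governs the whole action: \<open>K\<close> is divided by it under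
  sigma, so on points both x and y are multiplied by it.\<close>

definition s :: 'c where "s = K / \<sigma> K"

lemma \<sigma>K: "\<sigma> K = K / s" "s \<noteq> 0" "rv s = 0" "vge 0 s" "redn D s \<noteq> 0" "vge 0 (inverse s)"
proof -
  have n: "\<sigma> K \<noteq> 0" using \<sigma>_hom(10) K(1) by blast
  then show "\<sigma> K = K / s" "s \<noteq> 0" "rv s = 0" using K(1) \<sigma>_rv by (auto simp: s_def rv_divide)
  then show "vge 0 s" "redn D s \<noteq> 0" "vge 0 (inverse s)"
    using redn_nonzero by (auto simp: vge_iff rv_inverse)
qed

lemma \<sigma>_\<pi>: "\<sigma> \<pi> = \<pi>"
  using galois_fix[OF \<sigma>_galois unif_base] .

lemma \<sigma>_K_power: "\<sigma> (K ^ n) = K ^ n / s ^ n"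
  using \<sigma>_hom(7) \<sigma>K(1) by (simp add: power_divide)

lemma s_root: "s ^ (q ^ 2 * nq) = 1"
proof -
  have "\<pi> = \<pi> / s ^ (q ^ 2 * nq)" using \<sigma>_K_power[of "q ^ 2 * nq"] K(2) \<sigma>_\<pi> by simp
  then show ?thesis using F.pi_nz \<sigma>K(2) by (simp add: field_simps)
qed

definition tF :: 'c where "tF = F.teich \<zeta>F"
definition lF :: 'c where "lF = F.teich \<eta>F"
definition tE :: 'c where "tE = E.teich \<zeta>E"
definition lE :: 'c where "lE = E.teich \<eta>E"

text \<open>The point of level two for F is -eta gam0 K^(q(q+1)), where eta^(q-1) = -1.\<close>

lemma action_gam0:
  shows "\<zeta>F \<in> resfield D (base D)" "\<zeta>F \<noteq> 0" "\<eta>F \<in> resfield D (base D)"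
    "vgt (1 / real q) (\<sigma> (gam0 D) / s ^ (q * (q + 1)) - tF * (gam0 D - lF * \<delta>))"
proof -
  obtain \<eta> where eta: "\<eta> ^ (F.Q - 1) = - 1" "\<eta> \<noteq> 0" "rv \<eta> = 0" using F.minus_one_root_exists by blast
  have fx: "\<sigma> \<eta> = \<eta>" using F.inertia_fixes_root[OF \<sigma> eta] .
  define C where "C = - (K ^ (q * (q + 1)) * \<eta>)"
  have C: "C \<noteq> 0" "rv C = real (q * (q + 1)) / (real q ^ 2 * real nq)"
    using K(1) eta rv_K_power[of "q * (q + 1)"] by (auto simp: C_def rv_mult)
  define z where "z = C * gam0 D"
  define Y where "Y = K ^ (q ^ 2 * (q + 1)) * \<eta>"
  have etaq: "\<eta> ^ q = - \<eta>"
    using eta(1) q_ge_3 by (metis FQ mult_minus1_right power_eq_if F.Q_ge_1(2))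
  have e1: "q ^ 2 * nq + q * (q + 1) = q ^ 2 * (q + 1) + (q - 1) * nq * q"
  proof -
    obtain m where m: "q = Suc m" using q_ge_3 by (cases q) auto
    show ?thesis unfolding nq(3) unfolding m by (simp add: algebra_simps power2_eq_square)
  qed
  have "\<pi> * z = - (K ^ (q ^ 2 * nq) * K ^ (q * (q + 1)) * \<eta> * gam0 D)" by (simp add: z_def C_def K(2))
  also have "K ^ (q ^ 2 * nq) * K ^ (q * (q + 1)) = K ^ (q ^ 2 * (q + 1)) * gam D ^ q"
    by (simp only: gam_eq power_mult[symmetric] power_add[symmetric] e1)
  finally have piz: "\<pi> * z = - (Y * (gam D ^ q * gam0 D))" by (simp add: Y_def)
  have "z ^ q = - ((K ^ (q * (q + 1))) ^ q * \<eta> ^ q * gam0 D ^ q)"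
    using odd_q by (simp add: z_def C_def power_mult_distrib)
  also have "(K ^ (q * (q + 1))) ^ q = K ^ (q ^ 2 * (q + 1))"
    by (simp add: power_mult[symmetric] power2_eq_square mult.commute mult.left_commute)
  finally have zq: "z ^ q = Y * gam0 D ^ q" by (simp add: etaq Y_def)
  have sum: "\<pi> * z + z ^ q = Y"
  proof -
    have "\<pi> * z + z ^ q = Y * (gam0 D ^ q - gam D ^ q * gam0 D)" unfolding piz zq by (simp add: algebra_simps)
    then show ?thesis using gam0 by simp
  qed
  have "q ^ 2 * (q + 1) * (q - 1) = q ^ 2 * nq" by (simp only: nq(3) ac_simps)
  then have "Y ^ (q - 1) = K ^ (q ^ 2 * nq) * \<eta> ^ (q - 1)"
    by (simp only: Y_def power_mult_distrib power_mult[symmetric])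
  then have "Y ^ (q - 1) = K ^ (q ^ 2 * nq) * - 1" using eta(1) by simp
  then have "(\<pi> * z + z ^ F.Q) ^ (F.Q - 1) = - \<pi>" using sum K(2) by simp
  note lt = F.inertia_lubin_tate[OF rF \<sigma> ucF this]
  show "\<zeta>F \<in> resfield D (base D)" "\<zeta>F \<noteq> 0" "\<eta>F \<in> resfield D (base D)" using lt by auto
  have v: "vgt F.\<mu> (\<sigma> z - tF * (z + lF * Y))" using lt(4) sum by (simp add: tF_def lF_def)
  have "\<sigma> C = C / s ^ (q * (q + 1))" by (simp only: C_def \<sigma>_hom(4,5) \<sigma>_K_power fx) simp
  then have \<sigma>z: "\<sigma> z = C * (\<sigma> (gam0 D) / s ^ (q * (q + 1)))" by (simp add: z_def \<sigma>_hom)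
  have e2: "q * (q + 1) + q * nq = q ^ 2 * (q + 1)"
  proof -
    obtain m where m: "q = Suc m" using q_ge_3 by (cases q) auto
    show ?thesis unfolding nq(3) unfolding m by (simp add: algebra_simps power2_eq_square)
  qed
  have YC: "Y = - (C * \<delta>)"
    by (simp only: Y_def C_def \<delta>_def e2[symmetric] power_add) simp
  have "\<sigma> z - tF * (z + lF * Y) = C * (\<sigma> (gam0 D) / s ^ (q * (q + 1)) - tF * (gam0 D - lF * \<delta>))"
    unfolding \<sigma>z YC by (simp add: z_def algebra_simps)
  then have "vgt (F.\<mu> - rv C) (\<sigma> (gam0 D) / s ^ (q * (q + 1)) - tF * (gam0 D - lF * \<delta>))"
    using v vgt_mult_iff[OF C(1)] by simp
  \<comment> \<open>After division by C the precision of the Lubin-Tate formula is exactly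
    v(\<open>\<delta>\<close>).\<close>
  moreover have "F.\<mu> - rv C = 1 / real q"
  proof -
    have "rv C = 1 / (real q * (real q - 1))"
    proof -
      have x: "x * (x + 1) / (x\<^sup>2 * ((x - 1) * (x + 1))) = 1 / (x * (x - 1))" if "1 < x" for x :: real
        using that by (simp add: divide_simps power2_eq_square)
      have "real (q * (q + 1)) = real q * (real q + 1)" by (simp add: algebra_simps)
      moreover have "real nq = (real q - 1) * (real q + 1)" using nq(4) by (simp add: power2_eq_square algebra_simps)
      ultimately show ?thesis unfolding C(2) using x[of "real q"] q_ge_3 by simp
    qed
    then show ?thesis using q_ge_3 by (simp add: F.\<mu>_def field_simps)
  qed
  ultimately show "vgt (1 / real q) (\<sigma> (gam0 D) / s ^ (q * (q + 1)) - tF * (gam0 D - lF * \<delta>))" by simp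
qed

text \<open>The point of level two for E is close to -eta beta K, where eta^(q^2-1) = -1.\<close>

lemma action_\<beta>:
  shows "\<zeta>E \<in> resfield D E" "\<zeta>E \<noteq> 0" "\<eta>E \<in> resfield D E"
    "vgt (1 / real q ^ 2) (\<sigma> \<beta> / s - tE * (\<beta> - lE * \<kappa>))"
proof -
  have \<sigma>E: "\<sigma> \<in> inertia D E" using inertia_quadratic[OF quadratic \<sigma>] .
  obtain \<eta> where eta: "\<eta> ^ (E.Q - 1) = - 1" "\<eta> \<noteq> 0" "rv \<eta> = 0" using E.minus_one_root_exists by blast
  have fx: "\<sigma> \<eta> = \<eta>" using E.inertia_fixes_root[OF \<sigma>E eta] .
  define C where "C = - (K * \<eta>)"
  have C: "C \<noteq> 0" "rv C = 1 / (real q ^ 2 * real nq)"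
    using K(1) eta rv_K by (auto simp: C_def rv_mult)
  have Cpos: "0 < rv C" using C(2) nq q_ge_3 by simp
  define z0 where "z0 = C * \<beta>"
  define Y where "Y = K ^ (q ^ 2) * \<eta>"
  have Qm: "q ^ 2 - 1 = nq" by (simp add: nq_def)
  have eta': "\<eta> ^ nq = - 1" using eta(1) Qm by simp
  have etaq: "\<eta> ^ (q ^ 2) = - \<eta>" unfolding nq(1) using eta' by simp
  have oddq2: "odd (q ^ 2)" using odd_q by simp
  have e1: "q ^ 2 * nq + 1 = q ^ 2 + (q - 1) * nq * (q + 1)"
  proof -
    have "(q - 1) * nq * (q + 1) = nq * ((q - 1) * (q + 1))" by (simp only: ac_simps)
    then have "(q - 1) * nq * (q + 1) = nq * nq" by (simp only: nq(3)[symmetric])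
    then show ?thesis unfolding nq(1) by (simp add: algebra_simps)
  qed
  have "\<pi> * z0 = - (K ^ (q ^ 2 * nq + 1) * \<eta> * \<beta>)" by (simp add: z0_def C_def K(2))
  also have "K ^ (q ^ 2 * nq + 1) = K ^ (q ^ 2) * gam D ^ (q + 1)"
    by (simp only: gam_eq power_mult[symmetric] power_add[symmetric] e1)
  finally have piz: "\<pi> * z0 = - (Y * (gam D ^ (q + 1) * \<beta>))" by (simp add: Y_def)
  have "z0 ^ (q ^ 2) = - (K ^ (q ^ 2) * \<eta> ^ (q ^ 2) * \<beta> ^ (q ^ 2))"
    using oddq2 by (simp add: z0_def C_def power_mult_distrib)
  then have zq: "z0 ^ (q ^ 2) = Y * \<beta> ^ (q ^ 2)" by (simp add: etaq Y_def)
  have err_eq: "\<pi> * z0 + z0 ^ E.Q - Y = Y * (\<beta> ^ (q ^ 2) - gam D ^ (q + 1) * \<beta> - 1)"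
    unfolding EQ piz zq by (simp add: algebra_simps)
  have \<mu>: "E.\<mu> = 1 / real nq" using nq(4) by (simp add: E.\<mu>_def)
  have rvY: "rv Y = E.\<mu>" "Y \<noteq> 0"
    using K(1) eta q_ge_3 nq rv_K_power[of "q ^ 2"] by (auto simp: Y_def rv_mult \<mu>)
  have err: "vgt (1 + E.\<mu>) (\<pi> * z0 + z0 ^ E.Q - Y)"
    unfolding err_eq using \<beta>_approximate_root by (rule vgt_mult[OF vge_rv]) (simp add: rvY)
  have z0v: "vgt 0 z0" unfolding z0_def using Cpos tgam1_int(3)
    by (intro vgt_mult'[of 0 _ 0]) (auto simp: vgt_iff)
  \<comment> \<open>z0 solves the level-two equation only up to an error beyond 1 +
    \<open>\<mu>\<close>. The exact point differs from it by more than \<open>\<mu>\<close>, the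
    precision to which sigma(z) is known.\<close>
  obtain z where z: "\<pi> * z + z ^ E.Q = Y" "vgt E.\<mu> (z - z0)"
    using E.approximate_root[OF complete_in_UNIV UNIV_subfield _ F.pi_nz F.rv_pi _ _ z0v err] by blast
  have "Y ^ nq = K ^ (q ^ 2 * nq) * \<eta> ^ nq" by (simp add: Y_def power_mult_distrib power_mult[symmetric])
  then have "(\<pi> * z + z ^ E.Q) ^ (E.Q - 1) = - \<pi>" using K(2) eta' z(1) Qm by simp
  note lt = E.inertia_lubin_tate[OF rE \<sigma>E ucE this]
  show m: "\<zeta>E \<in> resfield D E" "\<zeta>E \<noteq> 0" "\<eta>E \<in> resfield D E" using lt by auto
  have v: "vgt E.\<mu> (\<sigma> z - tE * (z + lE * Y))" using lt(4) z(1) by (simp add: tE_def lE_def)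
  have "vgt E.\<mu> (\<sigma> (z - z0))" using z(2) \<sigma>_vgt by blast
  then have 1: "vgt E.\<mu> (\<sigma> z0 - \<sigma> z)" using vgt_diff_commute \<sigma>_hom(6) by metis
  have 2: "vgt E.\<mu> (tE * (z - z0))"
    using vgt_mult[OF E.teich(4)[OF m(1)] z(2)] by (simp add: tE_def)
  have "vgt E.\<mu> ((\<sigma> z0 - \<sigma> z) + (\<sigma> z - tE * (z + lE * Y)) + tE * (z - z0))"
    using 1 2 v by (intro vgt_add)
  then have v0: "vgt E.\<mu> (\<sigma> z0 - tE * (z0 + lE * Y))" by (simp add: algebra_simps)
  have "\<sigma> C = C / s" by (simp only: C_def \<sigma>_hom \<sigma>K(1) fx) simp
  then have \<sigma>z: "\<sigma> z0 = C * (\<sigma> \<beta> / s)" by (simp add: z0_def \<sigma>_hom)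
  have YC: "Y = - (C * \<kappa>)" by (simp add: Y_def C_def \<kappa>_def nq(1))
  have "\<sigma> z0 - tE * (z0 + lE * Y) = C * (\<sigma> \<beta> / s - tE * (\<beta> - lE * \<kappa>))"
    unfolding \<sigma>z YC by (simp add: z0_def algebra_simps)
  then have "vgt (E.\<mu> - rv C) (\<sigma> \<beta> / s - tE * (\<beta> - lE * \<kappa>))"
    using v0 vgt_mult_iff[OF C(1)] by simp
  moreover have "E.\<mu> - rv C = 1 / real q ^ 2"
  proof -
    have "real q ^ 2 = real nq + 1" using nq(4) by simp
    moreover have "0 < real nq + real nq * real nq" using nq_pos(1) by (intro add_pos_pos mult_pos_pos)
    ultimately show ?thesis unfolding C(2) \<mu> using nq_pos(1) by (simp add: field_simps)
  qed
  ultimately show "vgt (1 / real q ^ 2) (\<sigma> \<beta> / s - tE * (\<beta> - lE * \<kappa>))" by simp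
qed

lemmas tF = F.teich[OF action_gam0(1), folded tF_def] and lF = F.teich[OF action_gam0(3), folded lF_def]
  and tE = E.teich[OF action_\<beta>(1), folded tE_def] and lE = E.teich[OF action_\<beta>(3), folded lE_def]

lemma tF_unit: "tF \<noteq> 0" "rv tF = 0" "tF ^ (q - 1) = 1"
proof -
  show n: "tF \<noteq> 0" using tF(3) action_gam0(2) redn_0 by metis
  show "rv tF = 0" "tF ^ (q - 1) = 1" using F.teich_unit[OF tF(2) n] by auto
qed

text \<open>Both action formulas are reduced; \<open>gam0 D\<close> and \<open>\<beta>\<close> have
  residue 1, so each determines a power of the residue of s. Comparing them, with zeta_E^(q^2) =
  zeta_E, gives the norm relation between zeta_F and zeta_E.\<close>

lemma residues: "redn D s = inverse \<zeta>E" "\<zeta>F = \<zeta>E ^ (q + 1)" "\<zeta>E ^ nq = 1"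
proof -
  have zE: "\<zeta>E ^ (q ^ 2) = \<zeta>E" using E.fermat[OF action_\<beta>(1)] by simp
  then have "\<zeta>E ^ nq * \<zeta>E = \<zeta>E" unfolding nq(1) by (simp add: mult.commute)
  then show "\<zeta>E ^ nq = 1" using action_\<beta>(2) by simp
  have unit: "redn D (\<sigma> x / s ^ n) = 1 / redn D s ^ n \<and> vge 0 (\<sigma> x / s ^ n)" if "vge 0 x" "redn D x = 1" for x n
  proof -
    have "vge 0 (\<sigma> x)" "redn D (\<sigma> x) = 1" using that \<sigma>_vge \<sigma>_redn by auto
    then show ?thesis using redn_divide[of "\<sigma> x" "s ^ n"] \<sigma>K vge_power_0[OF \<sigma>K(4), of n]
      by (simp add: redn_power vge_divide_iff rv_power)
  qed
  have "vgt 0 (lE * \<kappa>)" using rvs_pos(2) lE(4) by (intro vgt_mult[of 0]) (auto simp: vgt_iff)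
  then have 1: "vge 0 (\<beta> - lE * \<kappa>) \<and> redn D (\<beta> - lE * \<kappa>) = 1"
    using redn_cong[OF tgam1_int(3), of "\<beta> - lE * \<kappa>"] tgam1_int(4) by simp
  have "vgt 0 (\<sigma> \<beta> / s - tE * (\<beta> - lE * \<kappa>))" using action_\<beta>(4) by (rule vgt_mono) simp
  then have "redn D (\<sigma> \<beta> / s) = redn D (tE * (\<beta> - lE * \<kappa>))"
    using redn_cong vge_mult_0 tE(4) 1 by blast
  then have "1 / redn D s = \<zeta>E" using unit[OF tgam1_int(3,4), of 1] tE 1 by (simp add: redn_times)
  then show rs: "redn D s = inverse \<zeta>E" by (simp add: inverse_eq_divide[symmetric])
      (metis inverse_inverse_eq)
  have "vgt 0 (lF * \<delta>)" using rvs_pos(1) lF(4) by (intro vgt_mult[of 0]) (auto simp: vgt_iff)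
  then have 2: "vge 0 (gam0 D - lF * \<delta>) \<and> redn D (gam0 D - lF * \<delta>) = 1"
    using redn_cong[OF gam0_int(1), of "gam0 D - lF * \<delta>"] gam0_int(2) by simp
  have "vgt 0 (\<sigma> (gam0 D) / s ^ (q * (q + 1)) - tF * (gam0 D - lF * \<delta>))"
    using action_gam0(4) by (rule vgt_mono) simp
  then have "redn D (\<sigma> (gam0 D) / s ^ (q * (q + 1))) = redn D (tF * (gam0 D - lF * \<delta>))"
    using redn_cong vge_mult_0 tF(4) 2 by blast
  then have "1 / redn D s ^ (q * (q + 1)) = \<zeta>F"
    using unit[OF gam0_int(1,2), of "q * (q + 1)"] tF 2 by (simp add: redn_times)
  then have zF: "\<zeta>F = \<zeta>E ^ (q * (q + 1))" unfolding rs
    by (simp only: power_inverse divide_inverse inverse_inverse_eq mult_1_left)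
  have "(q + 1) * q = q ^ 2 + q" by (simp add: power2_eq_square)
  then have "(\<zeta>E ^ (q + 1)) ^ q = \<zeta>E ^ (q ^ 2 + q)" by (simp only: power_mult[symmetric])
  also have "\<dots> = \<zeta>E ^ (q + 1)" using zE by (simp add: power_add mult.commute)
  finally have "(\<zeta>E ^ (q + 1)) ^ q = \<zeta>E ^ (q + 1)" .
  moreover have "\<zeta>F = (\<zeta>E ^ (q + 1)) ^ q" by (simp only: zF power_mult[symmetric] mult.commute[of q])
  ultimately show "\<zeta>F = \<zeta>E ^ (q + 1)" by simp
qed

end

section \<open>Integrality of the coordinates\<close>

context lubin_tate_quadratic
begin

text \<open>The valuation of w_1. The identity rw + q rw = v(\<open>\<kappa>\<close>) is what makes
  products R R^q small enough in \<open>delta3_small\<close>.\<close>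

definition rw :: real where "rw = 1 / (real q ^ 2 * (real q + 1))"

lemma rw: "0 < rw" "rw < rv (gam_q D)" "rw < 1 / real q ^ 2" "rw + real q * rw = 1 / real q ^ 2"
    "1 / real q ^ 2 \<le> real q * rw + rv (gam_q D)" "rv (K ^ (q - 1)) = rw"
proof -
  have q: "3 \<le> real q" using q_ge_3 by simp
  show "0 < rw" using nq_pos by (simp add: rw_def)
  have qq: "real q < real q * real q - 1"
  proof -
    have "3 * real q \<le> real q * real q" using q by (intro mult_right_mono) auto
    then show ?thesis using q by linarith
  qed
  then show 1: "rw < rv (gam_q D)" unfolding rvs rw_def using q
    by (simp add: divide_simps power2_eq_square power3_eq_cube) (simp add: algebra_simps)
  show "rw < 1 / real q ^ 2" using q by (simp add: rw_def divide_simps)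
  have "rw * (1 + real q) = 1 / real q ^ 2" using q by (simp add: rw_def divide_simps)
  then show e: "rw + real q * rw = 1 / real q ^ 2" by (simp add: algebra_simps)
  then show "1 / real q ^ 2 \<le> real q * rw + rv (gam_q D)" using 1 by linarith
  have "real nq = (real q - 1) * (real q + 1)" using nq(4) by (simp add: power2_eq_square algebra_simps)
  moreover have "real (q - 1) = real q - 1" using q_ge_3 by (simp add: of_nat_diff)
  ultimately show "rv (K ^ (q - 1)) = rw" using q by (simp add: rv_K_power rw_def)
qed

text \<open>Hensel's lemma applies because the derivative has residue -y0^(nq-1), as q^2 vanishes in
  the residue field. Uniqueness, needed for the \<open>THE\<close>, comes from
  \<open>power_diff_unit\<close>.\<close>

lemma y0_hat:
  assumes "y0 ^ nq = - 1"
  shows "vge 0 (y0_hat D (x0, y0))" "redn D (y0_hat D (x0, y0)) = y0"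
    "y0_hat D (x0, y0) ^ nq = - (tgam0 D ^ (q - 1))" "y0 \<noteq> 0"
proof -
  show y0n: "y0 \<noteq> 0" using assms nq_pos by (auto simp: zero_power)
  define c where "c = tgam0 D ^ (q - 1)"
  have c: "vge 0 c" "redn D c = 1" using tgam0_int by (auto simp: c_def vge_power_0 redn_power)
  define p where "p = monom 1 nq + [:c:]"
  have p: "vge 0 (coeff p i)" for i using c by (auto simp: p_def coeff_pCons vge_add split: nat.splits)
  obtain t0 where t0: "vge 0 t0" "redn D t0 = y0" by (rule redn_lift)
  have pt: "poly p x = x ^ nq + c" for x by (simp add: p_def poly_monom)
  have "redn D (poly p t0) = 0" using t0 c assms by (simp add: pt redn_plus redn_power vge_power_0)
  then have "vgt 0 (poly p t0)" using redn_eq_0_iff poly_vge_0[OF p t0(1)] by blast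
  then obtain e where e: "0 < e" "vge e (poly p t0)" by (rule vgt_obtain)
  have "pderiv p = monom (of_nat nq) (nq - 1)" by (simp add: p_def pderiv_add pderiv_monom pderiv_pCons)
  then have "redn D (poly (pderiv p) t0) = of_nat nq * y0 ^ (nq - 1)"
    using t0 by (simp add: poly_monom redn_times redn_power vge_power_0 redn_of_nat)
  also have "of_nat nq = (-1 :: 'k)"
  proof -
    have "of_nat E.Q = (0 :: 'k)" using E.binomial_residue_0[of 1] E.Q_ge_3 by simp
    then have "of_nat nq + (1 :: 'k) = 0" using nq(1) by (metis EQ of_nat_add of_nat_1)
    then show ?thesis by (simp add: eq_neg_iff_add_eq_0)
  qed
  finally have "redn D (poly (pderiv p) t0) \<noteq> 0" using y0n by simp
  moreover have "p \<in> polys_over UNIV" by (simp add: polys_over_def)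
  ultimately obtain t where t: "poly p t = 0" "vge e (t - t0)"
    using hensel[OF complete_in_UNIV UNIV_subfield _ p _ t0(1) e(2,1)] by blast
  have t': "vge 0 t \<and> redn D t = y0 \<and> t ^ nq = - c"
    using redn_cong[OF t0(1) vge_vgt[OF t(2) e(1)]] t0(2) t(1) by (auto simp: pt eq_neg_iff_add_eq_0)
  have "\<exists>!t. reduces_to D t (snd (x0, y0)) \<and> t ^ (resq D ^ 2 - 1) = - (tgam0 D ^ (resq D - 1))"
  proof (rule ex1I[of _ t])
    fix r assume r: "reduces_to D r (snd (x0, y0)) \<and> r ^ (resq D ^ 2 - 1) = - (tgam0 D ^ (resq D - 1))"
    then have r': "vge 0 r" "redn D r = redn D t" "r ^ (E.Q - 1) - t ^ (E.Q - 1) = 0"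
      using t' by (auto simp: reduces_to_iff c_def nq_eq)
    have "vge B (r - t)" for B
      using E.power_diff_unit(1)[OF r'(1) _ r'(2), of B] t' y0n r'(3) by simp
    then show "r = t" using vge_all_imp_0[of "r - t"] by simp
  qed (use t' in \<open>simp add: reduces_to_iff c_def nq_eq\<close>)
  from theI'[OF this, folded y0_hat_def]
  show "vge 0 (y0_hat D (x0, y0))" "redn D (y0_hat D (x0, y0)) = y0"
    "y0_hat D (x0, y0) ^ nq = - (tgam0 D ^ (q - 1))"
    by (auto simp: reduces_to_iff nq_eq)
qed

lemma tgam0_power: "vge (rv (gam_q D)) (tgam0 D ^ (q - 1) - 1)"
  using F.power_diff_unit(1)[of "tgam0 D" 1 "rv (gam_q D)"] tgam0_int by (simp add: redn_one)

lemma w1: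
  assumes "y0 ^ nq = - 1"
  shows "w1_par D (x0, y0) = y0_hat D (x0, y0) ^ q * K ^ (q - 1)" "w1_par D (x0, y0) \<noteq> 0"
    "rv (w1_par D (x0, y0)) = rw"
proof -
  note h = y0_hat[OF assms]
  have hu: "y0_hat D (x0, y0) \<noteq> 0" "rv (y0_hat D (x0, y0)) = 0" using redn_unit h by auto
  show eq: "w1_par D (x0, y0) = y0_hat D (x0, y0) ^ q * K ^ (q - 1)"
    by (simp add: w1_par_def kap_def power_mult)
  show "w1_par D (x0, y0) \<noteq> 0" "rv (w1_par D (x0, y0)) = rw"
    using hu K(1) rw(6) unfolding eq by (auto simp: rv_mult rv_power)
qed

lemma gam_le: "rv (gam D) \<le> rv \<delta>" "rv \<delta> \<le> 1"
proof -
  show "rv (gam D) \<le> rv \<delta>" using rv_mult[OF nz(3,2)] gam_\<kappa> rvs_pos(2) by simp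
  show "rv \<delta> \<le> 1" using q_ge_3 by (simp add: rvs(1))
qed

lemma teich_lift_eq: "teich_lift D c = F.teich c"
  by (simp add: teich_lift_def F.teich_def)

lemma a_co_eq: "a_co D (\<zeta>, \<mu>) P = (det_co D P - F.teich \<zeta> * \<beta>) / \<kappa>"
  unfolding a_co_def Z1_co_def gam_q_w[symmetric] \<beta>_def using nz(4,5)
  by (simp add: teich_lift_eq divide_simps) (simp add: algebra_simps)

lemma f1_integral: "vge 0 X \<Longrightarrow> vge 0 Y \<Longrightarrow> vge 0 (f1 D X Y)"
proof -
  assume "vge 0 X" "vge 0 Y"
  then have "vge 1 ((X - Y) ^ q - X ^ q + Y ^ q)" using F.frob_diff[of 0 X 0 Y] by simp
  then have "vge 1 (- ((X - Y) ^ q - X ^ q + Y ^ q))" by (simp only: vge_uminus)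
  then have "vge 1 (X ^ q - Y ^ q - (X - Y) ^ q)" by (simp add: algebra_simps)
  then show ?thesis by (simp add: f1_def vge_divide_iff)
qed

text \<open>With [i] denoting the q^i-th power, b1 b2 (x[3] y - x y[3]) is rewritten by applying Frobenius to
  det = x[1] y - x y[1]; this eliminates x and leaves the terms estimated at the end.\<close>

lemma delta3_small:
  fixes x y z :: 'c
  defines "d \<equiv> x ^ q * y - x * y ^ q"
  assumes x: "vge 0 x" and y: "vge 0 y" "redn D y \<noteq> 0" and R: "vge rw (y ^ nq + 1)"
    and z: "z ^ q = z" and d: "vge (rv (gam_q D)) (d - z)" and dq: "vge (rv (gam D)) (d ^ q - z)"
  shows "vge (1 / real q ^ 2) (d + (x ^ (q ^ 3) * y - x * y ^ (q ^ 3)))"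
proof -
  define a1 where "a1 = x ^ q"
  define a2 where "a2 = a1 ^ q"
  define a3 where "a3 = a2 ^ q"
  define b1 where "b1 = y ^ q"
  define b2 where "b2 = b1 ^ q"
  define b3 where "b3 = b2 ^ q"
  define R where "R = y ^ nq + 1"
  have int: "vge 0 a1" "vge 0 a2" "vge 0 a3" "vge 0 b1" "vge 0 b2" "vge 0 b3"
    using x y by (auto simp: a1_def a2_def a3_def b1_def b2_def b3_def vge_power_0)
  have d_eq: "d = a1 * y - x * b1" by (simp add: d_def a1_def b1_def)
  have di: "vge 0 d" unfolding d_eq using int x y by (intro vge_diff vge_mult_0)
  have zi: "vge 0 z" using F.teich_integral z by simp
  have frob: "vge 1 ((u * v - u' * v') ^ q - (u ^ q * v ^ q - u' ^ q * v' ^ q))"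
    if "vge 0 u" "vge 0 v" "vge 0 u'" "vge 0 v'" for u v u' v'
    using F.frob_diff[of 0 "u * v" 0 "u' * v'"] that by (simp add: vge_mult_0 power_mult_distrib algebra_simps)
  define e1 where "e1 = d ^ q - (a2 * b1 - a1 * b2)"
  have e1: "vge 1 e1"
    using frob[OF int(1) y(1) x int(4)] by (simp add: e1_def d_eq a2_def b1_def b2_def a1_def)
  define e2 where "e2 = (d ^ q) ^ q - (a3 * b2 - a2 * b3)"
  have e2: "vge 1 e2"
  proof -
    have "vge 1 ((d ^ q) ^ q - (a2 * b1 - a1 * b2) ^ q)"
      using F.frob_cong_mod[OF vge_diff[OF vge_mult_0[OF int(2,4)] vge_mult_0[OF int(1,5)]], of 1 "d ^ q"] e1
      by (simp add: e1_def)
    moreover have "vge 1 ((a2 * b1 - a1 * b2) ^ q - (a3 * b2 - a2 * b3))"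
      using frob[OF int(2,4,1,5)] by (simp add: a3_def a2_def b2_def b3_def)
    ultimately show ?thesis unfolding e2_def by (rule vge_trans)
  qed
  define e3 where "e3 = b3 - (b1 * R ^ q - b1)"
  have e3: "vge 1 e3"
  proof -
    have "b3 = b1 * (y ^ nq) ^ q"
    proof -
      have "q * (q * q) = q + nq * q" using nq(1) by (simp add: power2_eq_square algebra_simps)
      then have "y ^ (q * (q * q)) = y ^ (q + nq * q)" by simp
      then show ?thesis by (simp add: b3_def b2_def b1_def power_add power_mult)
    qed
    moreover have "vge 1 ((R - 1) ^ q - R ^ q + 1 ^ q)"
      using F.frob_diff[of 0 R 0 1] y by (simp add: R_def vge_add vge_power_0)
    then have "vge 1 (b1 * ((R - 1) ^ q - R ^ q + 1))" using int by (intro vge_mult[of 0]) auto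
    ultimately show ?thesis by (simp add: e3_def R_def algebra_simps)
  qed
  have b2: "b2 = y * (R - 1)"
  proof -
    have "q * q = 1 + nq" using nq(1) by (simp add: power2_eq_square)
    then show ?thesis by (simp add: b2_def b1_def R_def power_mult[symmetric])
  qed
  \<comment> \<open>The three main terms, each of valuation at least v(\<open>\<kappa>\<close>): in
    the first R R^q has valuation rw + q rw, in the second d^q - d meets R^q, and the third has at
    least v(gamma).\<close>
  define T where "T = d * R * R ^ q + (d ^ q - d) * R ^ q + ((d ^ q) ^ q - d ^ q)"
  have cube: "q ^ 3 = q * q * q" by (simp add: power3_eq_cube)
  have D3: "x ^ (q ^ 3) * y - x * y ^ (q ^ 3) = a3 * y - x * b3"
    by (simp add: a3_def a2_def a1_def b3_def b2_def b1_def cube power_mult)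
  have "b1 * b2 * (d + (a3 * y - x * b3)) =
      y * b1 * T + (d * b2 * e3 + d ^ q * y * e3 - b3 * y * e1 - y * b1 * e2)"
  proof -
    have 1: "a3 * b2 = (d ^ q) ^ q + a2 * b3 - e2" by (simp add: e2_def)
    have 2: "a2 * b1 = d ^ q + a1 * b2 - e1" by (simp add: e1_def)
    have "b1 * b2 * (d + (a3 * y - x * b3)) = b1 * b2 * d + b1 * y * (a3 * b2) - x * b1 * b2 * b3"
      by (simp add: algebra_simps)
    also have "\<dots> = b1 * b2 * d + b1 * y * (d ^ q) ^ q - b1 * y * e2 + y * b3 * (a2 * b1) - x * b1 * b2 * b3"
      unfolding 1 by (simp add: algebra_simps)
    also have "\<dots> = b1 * b2 * d + b1 * y * (d ^ q) ^ q - b1 * y * e2 + y * b3 * d ^ q - y * b3 * e1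
        + b2 * b3 * (a1 * y - x * b1)"
      unfolding 2 by (simp add: algebra_simps)
    also have "\<dots> = d * b2 * (b1 + b3) + d ^ q * y * b3 + (d ^ q) ^ q * y * b1 - b3 * y * e1 - y * b1 * e2"
      unfolding d_eq[symmetric] by (simp add: algebra_simps)
    also have "b1 + b3 = b1 * R ^ q + e3" by (simp add: e3_def)
    also have "d ^ q * y * b3 = d ^ q * y * (b1 * R ^ q - b1) + d ^ q * y * e3" by (simp add: e3_def algebra_simps)
    also have "d * b2 * (b1 * R ^ q + e3) = d * (y * (R - 1)) * (b1 * R ^ q) + d * b2 * e3"
      by (simp add: b2 algebra_simps)
    finally show ?thesis by (simp add: T_def algebra_simps)
  qed
  moreover have "vge (1 / real q ^ 2) T"
  proof -
    have Rv: "vge rw R" using R by (simp add: R_def)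
    have Rq: "vge (real q * rw) (R ^ q)" using Rv by (rule vge_power)
    have 1: "vge (1 / real q ^ 2) (d * R * R ^ q)"
      by (rule vge_mult[OF vge_mult[OF di Rv] Rq, of rw]) (auto simp: rw(4))
    have gg: "rv (gam_q D) \<le> rv (gam D)"
    proof -
      have "1 * rv (gam_q D) \<le> real q * rv (gam_q D)" using q_ge_3 rvs_pos(4) by (intro mult_right_mono) auto
      also have "\<dots> = rv (gam D)" using rv_power[OF nz(4), of q] gam_q_pow by simp
      finally show ?thesis by simp
    qed
    have "vge (rv (gam_q D)) (d ^ q - d)"
      using vge_trans[OF vge_mono[OF dq gg]] d vge_diff_commute by blast
    then have 2: "vge (1 / real q ^ 2) ((d ^ q - d) * R ^ q)" using Rq by (rule vge_mult) (use rw(5) in simp)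
    have g1: "rv (gam D) \<le> 1" using gam_le by simp
    have "vge (rv (gam D)) ((d ^ q) ^ q - z ^ q)"
      using F.frob_cong_mod[OF zi dq] rvs_pos(3) g1 by simp
    then have "vge (rv (gam D)) ((d ^ q) ^ q - d ^ q)"
      using z dq vge_trans vge_diff_commute by metis
    moreover have "1 / real q ^ 2 \<le> rv (gam D)" using q_ge_3 by (simp add: rvs divide_simps)
    ultimately have 3: "vge (1 / real q ^ 2) ((d ^ q) ^ q - d ^ q)" by (rule vge_mono)
    show ?thesis unfolding T_def using 1 2 3 by (intro vge_add)
  qed
  then have "vge (1 / real q ^ 2) (y * b1 * T)"
    by (rule vge_mult[OF vge_mult_0[OF y(1) int(4)]]) simp
  moreover have "vge (1 / real q ^ 2) (d * b2 * e3 + d ^ q * y * e3 - b3 * y * e1 - y * b1 * e2)"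
  proof (rule vge_mono[of 1])
    show "vge 1 (d * b2 * e3 + d ^ q * y * e3 - b3 * y * e1 - y * b1 * e2)"
      by (intro vge_add vge_diff vge_mult[OF vge_mult_0 e1, of _ _ 1] vge_mult[OF vge_mult_0 e2, of _ _ 1]
          vge_mult[OF vge_mult_0 e3, of _ _ 1] vge_power_0 di y int) auto
    show "1 / real q ^ 2 \<le> 1" using q_ge_3 by simp
  qed
  ultimately have v: "vge (1 / real q ^ 2) (b1 * b2 * (d + (a3 * y - x * b3)))" by (simp add: vge_add)
  have "y \<noteq> 0" "rv y = 0" using redn_unit y by auto
  then have "b1 * b2 \<noteq> 0" "rv (b1 * b2) = 0" by (auto simp: b1_def b2_def rv_mult rv_power)
  then show ?thesis using v unfolding D3 by (simp add: vge_mult_iff)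
qed

text \<open>Since \<open>\<delta>\<close> = \<open>\<kappa>\<close>^q = gamma
  \<open>\<kappa>\<close>, multiplying a^q + a by \<open>\<delta>\<close> gives an expression in d =
  det whose terms are all of valuation at least v(\<open>\<delta>\<close>). Hence a^q + a is
  integral and so is a; this is the computation behind the equation of the curve.\<close>

lemma coordinates_integral:
  assumes i: "component_of_index D (\<zeta>, \<mu>) S" and j: "(x0, y0) \<in> S00 D (\<zeta>, \<mu>)"
    and P: "P \<in> X_affinoid D S (x0, y0)"
  shows "vge 0 (a_co D (\<zeta>, \<mu>) P)" "vge 0 (z1_co D (x0, y0) P)"
proof -
  have y0: "y0 ^ nq = - 1" using j by (auto simp: S00_def nq_eq)
  note h = y0_hat[OF y0] and w = w1[OF y0, of x0]
  define x where "x = x_co D P"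
  define y where "y = y_co D P"
  define z where "z = F.teich \<zeta>"
  have PS: "P \<in> S" and xy: "vge 0 x" "vge 0 y" "redn D y = y0" and yh: "vge rw (y - y0_hat D (x0, y0))"
    using P w val_rv[OF w(2)] by (auto simp: X_affinoid_def reduces_to_iff x_def y_def vge_def)
  show "vge 0 (z1_co D (x0, y0) P)" using yh w by (simp add: z1_co_def vge_divide_iff y_def)
  have \<zeta>: "\<zeta> \<in> resfield D (base D)" and det: "vge 0 (det_co D P)" and sec: "vge 0 (second_co D \<zeta> P)"
    using i PS by (auto simp: component_of_index_def reduces_to_iff)
  note z = F.teich[OF \<zeta>, folded z_def, simplified]
  define d where "d = det_co D P"
  have d_eq: "d = x ^ q * y - x * y ^ q" by (simp add: d_def det_co_def x_def y_def)
  define D3 where "D3 = x ^ (q ^ 3) * y - x * y ^ (q ^ 3)"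
  define f where "f = f1 D (x ^ (q ^ 2) * y ^ q) (x ^ q * y ^ (q ^ 2))"
  have f: "vge 0 f" unfolding f_def using xy by (intro f1_integral vge_mult_0 vge_power_0)
  define A where "A = second_co D \<zeta> P - f"
  have A: "vge 0 A" unfolding A_def using sec f by (rule vge_diff)
  have "A = (z * gam0 D - Z_co D P) / \<delta>"
    unfolding A_def f_def second_co_def kap1_\<delta> teich_lift_eq z_def x_def y_def by simp
  then have Z: "Z_co D P = z * gam0 D - \<delta> * A" using nz(1) by (simp add: field_simps)
  have dq: "d ^ q = z * gam0 D - \<delta> * A + gam D * D3"
    unfolding Z[symmetric] by (simp add: Z_co_def d_def D3_def x_def y_def)
  have D3: "vge 0 D3" unfolding D3_def using xy by (intro vge_diff vge_mult_0 vge_power_0)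
  note gd = gam_le(1)
  have d1: "vge (rv (gam D)) (d ^ q - z)"
  proof -
    have "vge (rv (gam D)) (z * (gam0 D - 1))" by (rule vge_mult[OF z(4) gam0_int(3)]) simp
    moreover have "vge (rv (gam D)) (\<delta> * A)" by (rule vge_mult[OF vge_rv A]) (use gd in simp)
    moreover have "vge (rv (gam D)) (gam D * D3)" by (rule vge_mult[OF vge_rv D3]) simp
    ultimately have "vge (rv (gam D)) (z * (gam0 D - 1) - \<delta> * A + gam D * D3)" by (intro vge_add vge_diff)
    then show ?thesis unfolding dq by (simp add: algebra_simps)
  qed
  have di: "vge 0 d" using det by (simp add: d_def)
  have g1: "rv (gam D) \<le> 1" using gam_le by simp
  \<comment> \<open>Takes a q-th root of the congruence d^q = z, using z^q = z.\<close>
  have d2: "vge (rv (gam_q D)) (d - z)"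
  proof -
    have "vge 1 ((d - z) ^ q - d ^ q + z ^ q)" using F.frob_diff[of 0 d 0 z] di z by simp
    then have "vge (rv (gam D)) ((d - z) ^ q - d ^ q + z ^ q + (d ^ q - z))"
      by (intro vge_add[OF vge_mono[of 1] d1] g1)
    then have "vge (rv (gam D)) ((d - z) ^ q)" using z(2) by simp
    moreover have "rv (gam D) / real q = rv (gam_q D)" by (simp add: rvs power2_eq_square power3_eq_cube)
    ultimately show ?thesis using q_ge_3 by (simp add: vge_power_iff)
  qed
  have R: "vge rw (y ^ nq + 1)"
  proof -
    have "vge rw (y ^ (E.Q - 1) - y0_hat D (x0, y0) ^ (E.Q - 1))"
      using E.power_diff_unit(1)[OF xy(2) h(1)] xy(3) h(2,4) yh by simp
    then have "vge rw (y ^ nq + tgam0 D ^ (q - 1))" using h(3) by (simp add: nq_eq)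
    moreover have "vge rw (tgam0 D ^ (q - 1) - 1)" using tgam0_power rw(2) by (auto elim: vge_mono)
    ultimately have "vge rw (y ^ nq + tgam0 D ^ (q - 1) - (tgam0 D ^ (q - 1) - 1))" by (rule vge_diff)
    then show ?thesis by simp
  qed
  have small: "vge (1 / real q ^ 2) (d + D3)"
    unfolding d_eq D3_def
    by (rule delta3_small[OF xy(1,2) _ R z(2)]) (use xy(3) h(4) d1 d2 d_eq in auto)
  define a where "a = a_co D (\<zeta>, \<mu>) P"
  have ka: "\<kappa> * a = d - z * \<beta>" using nz(2) by (simp add: a_def a_co_eq d_def z_def)
  have zb: "vge 0 (z * \<beta>)" using z(4) tgam1_int(3) by (rule vge_mult_0)
  define e where "e = (d - z * \<beta>) ^ q - d ^ q + (z * \<beta>) ^ q"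
  have e: "vge 1 e" unfolding e_def using F.frob_diff[OF di zb] by simp
  define e' where "e' = gam0 D - (\<beta> ^ q + gam D * \<beta>)"
  have e': "vge 1 e'" unfolding e'_def using \<beta>_gam0 rvs_pos(4) by (auto elim: vge_mono)
  have "\<delta> * (a ^ q + a) = (\<kappa> * a) ^ q + gam D * (\<kappa> * a)"
    by (simp add: power_mult_distrib \<kappa>_q gam_\<kappa>[symmetric] algebra_simps)
  also have "\<dots> = e + d ^ q - z * \<beta> ^ q + gam D * (d - z * \<beta>)"
    unfolding ka using z(2) by (simp add: e_def power_mult_distrib)
  also have "\<dots> = e + z * e' + gam D * (d + D3) - \<delta> * A"
    unfolding dq by (simp add: e'_def algebra_simps)
  finally have eq: "\<delta> * (a ^ q + a) = e + z * e' + gam D * (d + D3) - \<delta> * A" .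
  have r1: "rv \<delta> \<le> 1" using q_ge_3 by (simp add: rvs)
  have "vge (rv \<delta>) e" using e r1 by (rule vge_mono)
  moreover have "vge (rv \<delta>) (z * e')" by (rule vge_mult[OF z(4) e']) (use r1 in simp)
  \<comment> \<open>v(gamma) + 1/q^2 is exactly v(\<open>\<delta>\<close>), so the bound from
    \<open>delta3_small\<close> just suffices.\<close>
  moreover have "vge (rv \<delta>) (gam D * (d + D3))"
    by (rule vge_mult[OF vge_rv small]) (use q_ge_3 in \<open>simp add: rvs divide_simps power2_eq_square\<close>)
  moreover have "vge (rv \<delta>) (\<delta> * A)" by (rule vge_mult[OF vge_rv A]) simp
  ultimately have "vge (rv \<delta>) (\<delta> * (a ^ q + a))" unfolding eq by (intro vge_add vge_diff)
  then have "vge 0 (a ^ q + a)" using nz(1) by (simp add: vge_mult_iff)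
  then have "vge 0 a" using integral_root[of a "a ^ q + a" "- 1"] by simp
  then show "vge 0 (a_co D (\<zeta>, \<mu>) P)" by (simp add: a_def)
qed

end

section \<open>Action of inertia on the coordinates\<close>

context inertia_action
begin

lemma \<sigma>_inv: "\<sigma> (inv_into UNIV \<sigma> x) = x" "inv_into UNIV \<sigma> (\<sigma> x) = x"
  using galois_aut[OF \<sigma>_galois] by (auto simp: field_aut_def bij_def surj_f_inv_f)

lemma \<sigma>_xy: "\<sigma> (x_co D (pt_act \<sigma> P)) = s * x_co D P" "\<sigma> (y_co D (pt_act \<sigma> P)) = s * y_co D P"
  using \<sigma>K(1) by (auto simp: x_co_def y_co_def pt_act_def \<sigma>_hom(9) \<sigma>_inv split: prod.splits)

lemma \<sigma>_det: "\<sigma> (det_co D (pt_act \<sigma> P)) = s ^ (q + 1) * det_co D P"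
  by (simp add: det_co_def \<sigma>_hom \<sigma>_xy power_mult_distrib algebra_simps)

definition c :: 'c where "c = s ^ (q * (q + 1))"

lemma c: "c \<noteq> 0" "rv c = 0" "vge 0 c" "redn D c = inverse \<zeta>F" "redn D (c ^ q) = inverse \<zeta>F"
proof -
  show "c \<noteq> 0" "rv c = 0" using \<sigma>K by (auto simp: c_def rv_power)
  then show v: "vge 0 c" by (simp add: vge_iff)
  have zF: "\<zeta>F ^ q = \<zeta>F" using F.fermat[OF action_gam0(1)] by simp
  have "c = (s ^ (q + 1)) ^ q" by (simp only: c_def power_mult[symmetric] mult.commute[of q])
  then have "redn D c = inverse \<zeta>F ^ q"
    by (simp only: redn_power[OF vge_power_0[OF \<sigma>K(4)]] redn_power[OF \<sigma>K(4)] residues(1,2) power_inverse)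
  then show r: "redn D c = inverse \<zeta>F" by (simp only: power_inverse zF)
  show "redn D (c ^ q) = inverse \<zeta>F" using v r \<open>\<zeta>F ^ q = \<zeta>F\<close> by (simp add: redn_power power_inverse)
qed

lemma exponent_identities:
  "q ^ 3 + 1 = (q - 1) * nq + q * (q + 1)" "q * nq + q * (q + 1) = q * (q + 1) * q"
  "q ^ 2 + q = q * (q + 1)"
proof -
  obtain m where m: "q = Suc m" using q_ge_3 by (cases q) auto
  show "q ^ 3 + 1 = (q - 1) * nq + q * (q + 1)" "q * nq + q * (q + 1) = q * (q + 1) * q"
    unfolding nq(3) unfolding m by (simp_all add: algebra_simps power3_eq_cube)
  show "q ^ 2 + q = q * (q + 1)" by (simp add: power2_eq_square)
qed

text \<open>Both terms of Z scale by the same factor: gamma contributes the exponent -(q - 1) nq,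
  which reduces q^3 + 1 to q (q + 1).\<close>

lemma \<sigma>_Z: "\<sigma> (Z_co D (pt_act \<sigma> P)) = c * Z_co D P"
proof -
  define x where "x = x_co D P"
  define y where "y = y_co D P"
  have "\<sigma> (Z_co D (pt_act \<sigma> P)) = (s ^ (q + 1) * det_co D P) ^ q
      - gam D / s ^ ((q - 1) * nq) * ((s * x) ^ (q ^ 3) * (s * y) - (s * x) * (s * y) ^ (q ^ 3))"
    unfolding Z_co_def by (simp only: \<sigma>_hom(3,4,6,7) \<sigma>_det \<sigma>_xy x_def y_def)
      (simp only: gam_eq \<sigma>_K_power)
  also have "(s * x) ^ (q ^ 3) * (s * y) - (s * x) * (s * y) ^ (q ^ 3) =
      s ^ (q ^ 3 + 1) * (x ^ (q ^ 3) * y - x * y ^ (q ^ 3))"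
    by (simp add: power_mult_distrib algebra_simps)
  also have "s ^ (q ^ 3 + 1) = s ^ ((q - 1) * nq) * c"
    unfolding exponent_identities(1) c_def by (rule power_add)
  also have "(s ^ (q + 1) * det_co D P) ^ q = c * det_co D P ^ q"
    unfolding power_mult_distrib by (simp only: power_mult[symmetric] c_def mult.commute[of q])
  finally show ?thesis using \<sigma>K(2) by (simp add: Z_co_def x_def y_def algebra_simps)
qed

lemma f1_scale: "f1 D (t * X) (t * Y) = t ^ q * f1 D X Y"
  by (simp add: f1_def power_mult_distrib right_diff_distrib[symmetric])

lemma \<sigma>_f1: "\<sigma> (f1 D X Y) = f1 D (\<sigma> X) (\<sigma> Y)"
  by (simp add: f1_def \<sigma>_hom \<sigma>_\<pi>)

lemma reduces_to_\<sigma>: "reduces_to D (\<sigma> t) r \<longleftrightarrow> reduces_to D t r"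
  using \<sigma>_vge \<sigma>_redn by (auto simp: reduces_to_iff)

lemma teich_quotient:
  assumes "\<zeta> \<in> resfield D (base D)"
  shows "inverse \<zeta>F * \<zeta> \<in> resfield D (base D)" "F.teich (inverse \<zeta>F * \<zeta>) = F.teich \<zeta> / tF"
proof -
  show m: "inverse \<zeta>F * \<zeta> \<in> resfield D (base D)"
    using F.resfield_mult[OF F.resfield_inverse[OF action_gam0(1)] assms] .
  have "\<zeta>F * (inverse \<zeta>F * \<zeta>) = \<zeta>" using action_gam0(2) by (simp flip: mult.assoc)
  then have "F.teich \<zeta> = tF * F.teich (inverse \<zeta>F * \<zeta>)"
    using F.teich_mult[OF action_gam0(1) m] by (metis tF_def)
  then show "F.teich (inverse \<zeta>F * \<zeta>) = F.teich \<zeta> / tF" using tF_unit(1) by (simp add: field_simps)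
qed

text \<open>The dependence of the second coordinate on the component comes from the term in gam0.\<close>

lemma \<sigma>_second:
  assumes \<zeta>: "\<zeta> \<in> resfield D (base D)"
  shows "\<sigma> (second_co D (inverse \<zeta>F * \<zeta>) (pt_act \<sigma> P)) =
    c ^ q * (second_co D \<zeta> P + F.teich \<zeta> * ((\<sigma> (gam0 D) / (c * tF) - gam0 D) / \<delta>))"
proof -
  define z where "z = F.teich \<zeta>"
  define x where "x = x_co D P"
  define y where "y = y_co D P"
  define f where "f = f1 D (x ^ (q ^ 2) * y ^ q) (x ^ q * y ^ (q ^ 2))"
  have \<sigma>z: "\<sigma> (z / tF) = z / tF"
    using galois_fix[OF \<sigma>_galois F.L_divide[OF F.teich(1)[OF \<zeta>] tF(1)]] by (simp add: z_def)
  have \<sigma>\<delta>: "\<sigma> \<delta> = \<delta> / s ^ (q * nq)" unfolding \<delta>_def by (rule \<sigma>_K_power)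
  have "(s * x) ^ (q ^ 2) * (s * y) ^ q = c * (x ^ (q ^ 2) * y ^ q)"
    "(s * x) ^ q * (s * y) ^ (q ^ 2) = c * (x ^ q * y ^ (q ^ 2))"
    unfolding c_def exponent_identities(3)[symmetric] by (simp_all add: power_mult_distrib power_add algebra_simps)
  then have f: "\<sigma> (f1 D (x_co D (pt_act \<sigma> P) ^ (q ^ 2) * y_co D (pt_act \<sigma> P) ^ q)
      (x_co D (pt_act \<sigma> P) ^ q * y_co D (pt_act \<sigma> P) ^ (q ^ 2))) = c ^ q * f"
    by (simp only: \<sigma>_f1 \<sigma>_hom(4,7) \<sigma>_xy x_def[symmetric] y_def[symmetric] f1_scale f_def)
  have "\<sigma> (second_co D (inverse \<zeta>F * \<zeta>) (pt_act \<sigma> P)) =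
      (z / tF * \<sigma> (gam0 D) - c * Z_co D P) / (\<delta> / s ^ (q * nq)) + c ^ q * f"
    unfolding second_co_def kap1_\<delta> teich_lift_eq teich_quotient(2)[OF \<zeta>] z_def[symmetric]
    by (simp only: \<sigma>_hom(3) f) (simp only: \<sigma>_hom(4,6,9) \<sigma>z[unfolded \<sigma>_hom(9)] \<sigma>_Z \<sigma>\<delta>)
  also have "(z / tF * \<sigma> (gam0 D) - c * Z_co D P) / (\<delta> / s ^ (q * nq)) =
      (s ^ (q * nq) * c) * ((z * gam0 D - Z_co D P) / \<delta> + z * ((\<sigma> (gam0 D) / (c * tF) - gam0 D) / \<delta>))"
    using nz(1) tF_unit(1) c(1) \<sigma>K(2) by (simp add: divide_simps) (simp add: algebra_simps)
  also have "s ^ (q * nq) * c = c ^ q"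
    unfolding c_def power_add[symmetric] power_mult[symmetric] exponent_identities(2) ..
  finally show ?thesis
    unfolding second_co_def kap1_\<delta> teich_lift_eq z_def[symmetric] x_def[symmetric] y_def[symmetric] f_def[symmetric]
    by (simp add: algebra_simps)
qed

text \<open>This is \<open>action_gam0\<close> divided by [zeta_F] \<open>\<delta>\<close>: the
  error beyond v(\<open>\<delta>\<close>) becomes positive, so the residue is determined.\<close>

lemma gam0_shift: "vge 0 ((\<sigma> (gam0 D) / (c * tF) - gam0 D) / \<delta>) \<and>
    redn D ((\<sigma> (gam0 D) / (c * tF) - gam0 D) / \<delta>) = - \<eta>F"
proof -
  define t where "t = (\<sigma> (gam0 D) / (c * tF) - gam0 D) / \<delta>"
  have "\<sigma> (gam0 D) / c - tF * (gam0 D - lF * \<delta>) = (tF * \<delta>) * (t + lF)"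
    using nz(1) tF_unit(1) c(1) by (simp add: t_def field_simps)
  then have "vgt (1 / real q) ((tF * \<delta>) * (t + lF))" using action_gam0(4) by (simp add: c_def)
  moreover have "tF * \<delta> \<noteq> 0" "rv (tF * \<delta>) = 1 / real q" using nz(1) tF_unit by (auto simp: rv_mult rvs)
  ultimately have "vgt 0 (t - (- lF))" by (simp add: vgt_mult_iff)
  then show ?thesis using redn_cong[of "- lF" t] lF by (simp add: redn_uminus t_def)
qed

lemma index_transfer:
  assumes \<zeta>: "\<zeta> \<in> resfield D (base D)"
    and det: "reduces_to D (det_co D P) \<zeta>" and sec: "reduces_to D (second_co D \<zeta> P) (\<mu> * \<zeta>)"
  shows "reduces_to D (det_co D (pt_act \<sigma> P)) (inverse \<zeta>F * \<zeta>)"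
    "reduces_to D (second_co D (inverse \<zeta>F * \<zeta>) (pt_act \<sigma> P)) ((\<mu> - \<eta>F) * (inverse \<zeta>F * \<zeta>))"
proof -
  note z = F.teich[OF \<zeta>]
  have "reduces_to D (\<sigma> (det_co D (pt_act \<sigma> P))) (inverse \<zeta>F * \<zeta>)"
    unfolding \<sigma>_det using det \<sigma>K(4) residues
    by (simp add: reduces_to_iff vge_mult_0 vge_power_0 redn_times redn_power power_inverse)
  then show "reduces_to D (det_co D (pt_act \<sigma> P)) (inverse \<zeta>F * \<zeta>)" by (simp only: reduces_to_\<sigma>)
  define t where "t = (\<sigma> (gam0 D) / (c * tF) - gam0 D) / \<delta>"
  have t: "vge 0 t" "redn D t = - \<eta>F" using gam0_shift by (auto simp: t_def)
  have s: "vge 0 (second_co D \<zeta> P)" "redn D (second_co D \<zeta> P) = \<mu> * \<zeta>" using sec by (auto simp: reduces_to_iff)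
  have zt: "vge 0 (F.teich \<zeta> * t)" "redn D (F.teich \<zeta> * t) = \<zeta> * - \<eta>F"
    using z t by (auto simp: vge_mult_0 redn_times)
  have "vge 0 (c ^ q * (second_co D \<zeta> P + F.teich \<zeta> * t))"
    "redn D (c ^ q * (second_co D \<zeta> P + F.teich \<zeta> * t)) = inverse \<zeta>F * (\<mu> * \<zeta> + \<zeta> * - \<eta>F)"
    using s zt c(3,5) by (auto simp only: redn_times redn_plus vge_add vge_mult_0 vge_power_0)
  then have "reduces_to D (\<sigma> (second_co D (inverse \<zeta>F * \<zeta>) (pt_act \<sigma> P))) ((\<mu> - \<eta>F) * (inverse \<zeta>F * \<zeta>))"
    unfolding \<sigma>_second[OF \<zeta>] t_def[symmetric] reduces_to_iff by (simp add: algebra_simps)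
  then show "reduces_to D (second_co D (inverse \<zeta>F * \<zeta>) (pt_act \<sigma> P)) ((\<mu> - \<eta>F) * (inverse \<zeta>F * \<zeta>))"
    by (simp only: reduces_to_\<sigma>)
qed

lemma xy_transfer:
  "reduces_to D (x_co D (pt_act \<sigma> P)) (inverse \<zeta>E * x0) \<longleftrightarrow> reduces_to D (x_co D P) x0"
  "reduces_to D (y_co D (pt_act \<sigma> P)) (inverse \<zeta>E * y0) \<longleftrightarrow> reduces_to D (y_co D P) y0"
proof -
  have *: "reduces_to D (s * t) (inverse \<zeta>E * r) \<longleftrightarrow> reduces_to D t r" for t r
    using \<sigma>K(2-5) residues(1) action_\<beta>(2)
    by (auto simp: reduces_to_iff vge_mult_iff redn_times)
  show "reduces_to D (x_co D (pt_act \<sigma> P)) (inverse \<zeta>E * x0) \<longleftrightarrow> reduces_to D (x_co D P) x0"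
    "reduces_to D (y_co D (pt_act \<sigma> P)) (inverse \<zeta>E * y0) \<longleftrightarrow> reduces_to D (y_co D P) y0"
    using *[of "x_co D P" x0] *[of "y_co D P" y0] unfolding \<sigma>_xy[symmetric] reduces_to_\<sigma> by auto
qed

text \<open>Scaling both coordinates by t multiplies the determinant by t^(q+1) and the (q^2-1)-st
  powers by 1; the inverse map scales by zeta_E.\<close>

lemma S00_transfer:
  "bij_betw (\<lambda>(x0, y0). (inverse \<zeta>E * x0, inverse \<zeta>E * y0))
     (S00 D (\<zeta>, \<mu>)) (S00 D (inverse \<zeta>F * \<zeta>, \<mu> - \<eta>F))"
proof (rule bij_betw_byWitness[where f' = "\<lambda>(x0, y0). (\<zeta>E * x0, \<zeta>E * y0)"])
  show "\<forall>a\<in>S00 D (\<zeta>, \<mu>). (case case a of (x0, y0) \<Rightarrow> (inverse \<zeta>E * x0, inverse \<zeta>E * y0) of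
      (x0, y0) \<Rightarrow> (\<zeta>E * x0, \<zeta>E * y0)) = a"
    "\<forall>a'\<in>S00 D (inverse \<zeta>F * \<zeta>, \<mu> - \<eta>F). (case case a' of (x0, y0) \<Rightarrow> (\<zeta>E * x0, \<zeta>E * y0) of
      (x0, y0) \<Rightarrow> (inverse \<zeta>E * x0, inverse \<zeta>E * y0)) = a'"
    using action_\<beta>(2) by auto
  have scale: "(t * x0, t * y0) \<in> S00 D (t * t ^ q * \<zeta>', \<mu>')"
    if "(x0, y0) \<in> S00 D (\<zeta>', \<mu>'')" "t \<noteq> 0" "t ^ nq = 1" for t x0 y0 \<zeta>' \<mu>' \<mu>''
  proof -
    have "(t * x0) ^ q * (t * y0) - t * x0 * (t * y0) ^ q = t * t ^ q * (x0 ^ q * y0 - x0 * y0 ^ q)"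
      by (simp add: power_mult_distrib algebra_simps)
    then show ?thesis using that unfolding S00_def nq_eq by (auto simp: power_mult_distrib)
  qed
  have e: "\<zeta>E * \<zeta>E ^ q = \<zeta>F" using residues(2) by simp
  have i: "inverse \<zeta>E ^ nq = 1" "inverse \<zeta>E * inverse \<zeta>E ^ q * \<zeta> = inverse \<zeta>F * \<zeta>"
    "\<zeta>E * \<zeta>E ^ q * (inverse \<zeta>F * \<zeta>) = \<zeta>"
  proof -
    show "inverse \<zeta>E ^ nq = 1" using residues(3) by (simp add: power_inverse)
    show "inverse \<zeta>E * inverse \<zeta>E ^ q * \<zeta> = inverse \<zeta>F * \<zeta>" by (simp add: e[symmetric] power_inverse)
    show "\<zeta>E * \<zeta>E ^ q * (inverse \<zeta>F * \<zeta>) = \<zeta>"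
      unfolding e using action_gam0(2) by (simp flip: mult.assoc)
  qed
  show "(\<lambda>(x0, y0). (inverse \<zeta>E * x0, inverse \<zeta>E * y0)) ` S00 D (\<zeta>, \<mu>) \<subseteq> S00 D (inverse \<zeta>F * \<zeta>, \<mu> - \<eta>F)"
    using scale[of _ _ \<zeta> \<mu> "inverse \<zeta>E" "\<mu> - \<eta>F"] i action_\<beta>(2) by auto
  show "(\<lambda>(x0, y0). (\<zeta>E * x0, \<zeta>E * y0)) ` S00 D (inverse \<zeta>F * \<zeta>, \<mu> - \<eta>F) \<subseteq> S00 D (\<zeta>, \<mu>)"
    using scale[of _ _ "inverse \<zeta>F * \<zeta>" "\<mu> - \<eta>F" \<zeta>E \<mu>] i(3) residues(3) action_\<beta>(2) by auto
qed

context
  fixes x0 y0 :: 'k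
  assumes y0: "y0 ^ nq = - 1"
begin

abbreviation "h \<equiv> y0_hat D (x0, y0)"
abbreviation "h' \<equiv> y0_hat D (inverse \<zeta>E * x0, inverse \<zeta>E * y0)"
abbreviation "w1 \<equiv> w1_par D (x0, y0)"
abbreviation "w1' \<equiv> w1_par D (inverse \<zeta>E * x0, inverse \<zeta>E * y0)"

lemma y0': "(inverse \<zeta>E * y0) ^ nq = - 1"
  using residues(3) y0 by (simp add: power_mult_distrib power_inverse)

text \<open>The two numbers have equal residues, so it suffices to compare nq-th powers. There s^nq
  is a q^2-th root of unity, within more than 1/q^2 of 1, and \<open>tgam0 D\<close>^(q-1) is close
  to 1 both before and after sigma.\<close>

lemma y0_hat_transfer: "vgt rw (s * h - \<sigma> h')"
proof -
  note h = y0_hat[OF y0] and h' = y0_hat[OF y0']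
  have sh: "vge 0 (s * h)" "redn D (s * h) = inverse \<zeta>E * y0"
    using \<sigma>K(4) residues(1) h by (auto simp: vge_mult_0 redn_times)
  have \<sigma>h: "vge 0 (\<sigma> h')" "redn D (\<sigma> h') = inverse \<zeta>E * y0" using h' \<sigma>_vge \<sigma>_redn by auto
  have "E.Q - 1 = nq" by (simp add: nq_eq)
  note pd = E.power_diff_unit(2)[OF sh(1) \<sigma>h(1), unfolded sh(2) \<sigma>h(2) this, OF refl h'(4), of rw]
  have "(s ^ nq) ^ E.Q = 1" using s_root by (simp add: power_mult[symmetric] mult.commute)
  then have "vgt (1 / real E.Q) (s ^ nq - 1)" by (rule E.root_of_unity_near_1)
  then have "vgt rw (s ^ nq - 1)" by (rule vgt_mono) (use rw(3) in simp)
  then have 1: "vgt rw ((s ^ nq - 1) * - (tgam0 D ^ (q - 1)))"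
    by (rule vgt_mult'[of _ _ 0]) (auto simp: tgam0_int vge_power_0)
  have 2: "vgt rw (tgam0 D ^ (q - 1) - 1)" using tgam0_power rw(2) by (rule vge_vgt)
  then have "vgt rw (\<sigma> (tgam0 D ^ (q - 1) - 1))" using \<sigma>_vgt by blast
  then have 3: "vgt rw (\<sigma> (tgam0 D ^ (q - 1)) - 1)" by (simp only: \<sigma>_hom)
  have "\<sigma> h' ^ nq = - \<sigma> (tgam0 D ^ (q - 1))" using h'(3) \<sigma>_hom(5,7) by metis
  then have "(s * h) ^ nq - \<sigma> h' ^ nq = (s ^ nq - 1) * - (tgam0 D ^ (q - 1))
      - (tgam0 D ^ (q - 1) - 1) + (\<sigma> (tgam0 D ^ (q - 1)) - 1)"
    using h(3) by (simp add: power_mult_distrib algebra_simps)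
  then have "vgt rw ((s * h) ^ nq - \<sigma> h' ^ nq)" using 1 2 3 by (simp only: vgt_add vgt_diff)
  then show ?thesis using pd by blast
qed

text \<open>The centre of the disc moves by more than its radius rw, so the disc condition is
  unchanged.\<close>

lemma X_transfer: "P \<in> S \<Longrightarrow> pt_act \<sigma> P \<in> X_affinoid D (pt_act \<sigma> ` S) (inverse \<zeta>E * x0, inverse \<zeta>E * y0) \<longleftrightarrow>
    P \<in> X_affinoid D S (x0, y0)"
proof -
  have w: "val D w1 = ereal rw" "val D w1' = ereal rw"
    using w1[OF y0] w1[OF y0'] val_rv by auto
  have "vge rw (y_co D (pt_act \<sigma> P) - h') \<longleftrightarrow> vge rw (\<sigma> (y_co D (pt_act \<sigma> P) - h'))" using \<sigma>_vge by simp
  also have "\<sigma> (y_co D (pt_act \<sigma> P) - h') = s * (y_co D P - h) + (s * h - \<sigma> h')"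
    by (simp add: \<sigma>_hom \<sigma>_xy algebra_simps)
  also have "vge rw \<dots> \<longleftrightarrow> vge rw (s * (y_co D P - h))"
    using y0_hat_transfer vge_add[of rw "s * (y_co D P - h)" "s * h - \<sigma> h'"]
      vge_diff[of rw "s * (y_co D P - h) + (s * h - \<sigma> h')" "s * h - \<sigma> h'"] vgt_vge[of rw _ rw] by auto
  also have "\<dots> \<longleftrightarrow> vge rw (y_co D P - h)" using \<sigma>K by (simp add: vge_mult_iff)
  finally show "P \<in> S \<Longrightarrow> ?thesis"
    using xy_transfer[of P] by (auto simp: X_affinoid_def w vge_def[symmetric])
qed

text \<open>The bound e is independent of P because topological nilpotence of the difference needs a
  uniform estimate.\<close>

lemma z1_transfer:
  "\<exists>e>0. \<forall>P. vge 0 (z1_co D (x0, y0) P) \<longrightarrow>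
     vge e (\<sigma> (z1_co D (inverse \<zeta>E * x0, inverse \<zeta>E * y0) (pt_act \<sigma> P)) - z1_co D (x0, y0) P)"
proof -
  note h = y0_hat[OF y0] and h' = y0_hat[OF y0']
  note w = w1[OF y0] and w' = w1[OF y0']
  have \<sigma>w: "\<sigma> w1' \<noteq> 0" "rv (\<sigma> w1') = rw" using w' \<sigma>_hom(10) \<sigma>_rv by auto
  have hu: "h \<noteq> 0" "rv h = 0" "h' \<noteq> 0" "rv h' = 0" using redn_unit h h' by auto
  have \<sigma>h: "\<sigma> h' \<noteq> 0" "rv (\<sigma> h') = 0" using hu \<sigma>_hom(10) \<sigma>_rv by auto
  \<comment> \<open>The ratio of s w_1 to the transported w_1'; its residue is 1, since the two
    lifts of y0 correspond up to s.\<close>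
  define \<theta> where "\<theta> = (s * h / \<sigma> h') ^ q"
  have "\<sigma> w1' = \<sigma> h' ^ q * (K ^ (q - 1) / s ^ (q - 1))"
    unfolding w'(1) \<sigma>_hom(4) \<sigma>_K_power by (simp only: \<sigma>_hom(7))
  moreover have "s ^ q = s * s ^ (q - 1)" using q_ge_3 by (metis F.Q_ge_1(2) FQ power_eq_if)
  ultimately have \<theta>: "s * w1 = \<theta> * \<sigma> w1'"
    using \<sigma>h(1) \<sigma>K(2) unfolding w(1) \<theta>_def by (simp add: power_mult_distrib power_divide field_simps)
  have sh: "vgt 0 (s * h - \<sigma> h')" using y0_hat_transfer by (rule vgt_mono) (use rw(1) in simp)
  have u: "vge 0 (s * h / \<sigma> h')" using \<sigma>h \<sigma>K(4) h(1) by (simp add: vge_divide_iff vge_mult_0)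
  have "s * h / \<sigma> h' - 1 = (s * h - \<sigma> h') / \<sigma> h'" using \<sigma>h(1) by (simp add: diff_divide_distrib)
  then have "vgt 0 (s * h / \<sigma> h' - 1)" using sh \<sigma>h by (simp add: vgt_divide_iff)
  then have "redn D (s * h / \<sigma> h') = 1" using redn_eq_iff[OF u vge_1] redn_one by simp
  then have "redn D \<theta> = redn D 1" using u by (simp add: \<theta>_def redn_power redn_one)
  then have "vgt 0 (\<theta> - 1)" using redn_eq_iff[of \<theta> 1] u by (simp add: \<theta>_def vge_power_0)
  then obtain e1 where e1: "0 < e1" "vge e1 (\<theta> - 1)" by (rule vgt_obtain)
  have "vgt 0 ((s * h - \<sigma> h') / \<sigma> w1')" using y0_hat_transfer \<sigma>w by (simp add: vgt_divide_iff)
  then obtain e2 where e2: "0 < e2" "vge e2 ((s * h - \<sigma> h') / \<sigma> w1')" by (rule vgt_obtain)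
  have "vge (min e1 e2) (\<sigma> (z1_co D (inverse \<zeta>E * x0, inverse \<zeta>E * y0) (pt_act \<sigma> P)) - z1_co D (x0, y0) P)"
    if z1: "vge 0 (z1_co D (x0, y0) P)" for P
  proof -
    have y: "y_co D P = h + w1 * z1_co D (x0, y0) P" using w(2) by (simp add: z1_co_def)
    have "\<sigma> (z1_co D (inverse \<zeta>E * x0, inverse \<zeta>E * y0) (pt_act \<sigma> P)) = (s * y_co D P - \<sigma> h') / \<sigma> w1'"
      by (simp add: z1_co_def \<sigma>_hom \<sigma>_xy)
    also have "s * y_co D P - \<sigma> h' = (s * w1) * z1_co D (x0, y0) P + (s * h - \<sigma> h')"
      unfolding y by (simp add: algebra_simps)
    also have "\<dots> / \<sigma> w1' = \<theta> * z1_co D (x0, y0) P + (s * h - \<sigma> h') / \<sigma> w1'"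
      unfolding \<theta> using \<sigma>w(1) by (simp add: add_divide_distrib)
    finally have "\<sigma> (z1_co D (inverse \<zeta>E * x0, inverse \<zeta>E * y0) (pt_act \<sigma> P)) - z1_co D (x0, y0) P =
        (\<theta> - 1) * z1_co D (x0, y0) P + (s * h - \<sigma> h') / \<sigma> w1'" by (simp add: algebra_simps)
    moreover have "vge (min e1 e2) ((\<theta> - 1) * z1_co D (x0, y0) P)"
      by (rule vge_mult[OF e1(2) z1]) simp
    moreover have "vge (min e1 e2) ((s * h - \<sigma> h') / \<sigma> w1')" using e2(2) by (rule vge_mono) simp
    ultimately show ?thesis by (simp only: vge_add)
  qed
  then show ?thesis using e1(1) e2(1) by (intro exI[of _ "min e1 e2"]) auto
qed

end

text \<open>Both s tE and s^q tF / tE are roots of unity of p-power order, hence close to 1.\<close>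

lemma tF_tE: "vgt (1 / real q ^ 2) (s ^ q * tF / tE - 1)" "tE \<noteq> 0" "rv tE = 0"
proof -
  have tEQ: "tE ^ (q ^ 2) = tE" using tE(2) by simp
  show tEn: "tE \<noteq> 0" using tE(3) action_\<beta>(2) redn_0 by metis
  then have tEu: "rv tE = 0" "tE ^ nq = 1" using E.teich_unit[OF tE(2)] by (auto simp: nq_eq)
  then show "rv tE = 0" by simp
  have tFE: "tF = tE ^ (q + 1)"
  proof (rule E.teich_unique)
    have "tF ^ q = tF" using tF(2) by simp
    then show "tF ^ E.Q = tF" by (simp add: power2_eq_square power_mult)
    have "(tE ^ (q + 1)) ^ (q ^ 2) = (tE ^ (q ^ 2)) ^ (q + 1)"
      by (simp only: power_mult[symmetric] mult.commute)
    then show "(tE ^ (q + 1)) ^ E.Q = tE ^ (q + 1)" by (simp only: EQ tEQ)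
    show "redn D tF = redn D (tE ^ (q + 1))" using tF(3) tE residues(2) by (simp only: redn_power)
  qed
  \<comment> \<open>The power q^2 removes the wild part of s; what remains is a (q^2-1)-st root of
    unity with residue 1, hence 1.\<close>
  define r where "r = (s * tE) ^ (q ^ 2)"
  have rn: "r ^ (E.Q - 1) = 1"
  proof -
    have "r ^ nq = s ^ (q ^ 2 * nq) * (tE ^ nq) ^ (q ^ 2)"
      by (simp only: r_def power_mult_distrib power_mult[symmetric] mult.commute)
    then show ?thesis using s_root tEu by (simp add: nq_eq)
  qed
  have st: "vge 0 (s * tE)" "redn D (s * tE) = 1"
    using \<sigma>K(4) tE residues(1) action_\<beta>(2) by (auto simp: vge_mult_0 redn_times)
  then have "redn D r = redn D 1" by (simp add: r_def redn_power redn_one)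
  then have r1: "r = 1" using E.teich_unique[OF E.root_of_unity_L(2)[OF rn], of 1] by simp
  have "s ^ q * tF / tE = (s * tE) ^ q" using tEn by (simp add: tFE power_mult_distrib)
  moreover have "((s * tE) ^ q) ^ F.Q = 1"
    using r1 by (simp add: r_def power_mult[symmetric] power2_eq_square)
  then have "vgt (1 / real F.Q) ((s * tE) ^ q - 1)" by (rule F.root_of_unity_near_1)
  ultimately have "vgt (1 / real q) (s ^ q * tF / tE - 1)" by simp
  then show "vgt (1 / real q ^ 2) (s ^ q * tF / tE - 1)"
    by (rule vgt_mono) (use q_ge_3 in \<open>simp add: divide_simps power2_eq_square\<close>)
qed

text \<open>A and B are arbitrary lifts of the two residues, because \<open>red_const\<close> picks
  a lift by choice. The scaling of a comes from det and \<open>\<kappa>\<close>, the translation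
  from the displacement of the centre \<open>\<beta>\<close>.\<close>

lemma a_transfer:
  assumes \<zeta>: "\<zeta> \<in> resfield D (base D)" and A: "reduces_to D A (inverse (\<zeta>E ^ (q + 1)))"
    and B: "reduces_to D B (\<eta>E * \<zeta>)"
  shows "\<exists>e>0. \<forall>P. vge 0 (a_co D (\<zeta>, \<mu>) P) \<longrightarrow>
     vge e (\<sigma> (a_co D (inverse \<zeta>F * \<zeta>, \<mu>') (pt_act \<sigma> P)) - A * (a_co D (\<zeta>, \<mu>) P + B))"
proof -
  define z where "z = F.teich \<zeta>"
  note z = F.teich[OF \<zeta>, folded z_def]
  \<comment> \<open>The constant term of the transported coordinate, produced by the displacement of
    [zeta] \<open>\<beta>\<close> relative to \<open>\<kappa>\<close>.\<close>
  define k where "k = s ^ nq * z * ((s ^ (q + 1) * \<beta> - \<sigma> \<beta> / tF) / \<kappa>)"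
  define t where "t = s ^ q * tF / tE"
  define v where "v = s * tE / tF"
  have vu: "v \<noteq> 0" "rv v = 0" "redn D v = inverse \<zeta>F"
  proof -
    show "v \<noteq> 0" "rv v = 0" using \<sigma>K tF_tE tF_unit by (auto simp: v_def rv_mult rv_divide)
    have "redn D (s * tE) = 1"
      using \<sigma>K(4) tE residues(1) action_\<beta>(2) by (auto simp: redn_times)
    then show "redn D v = inverse \<zeta>F"
      using redn_divide[OF vge_mult_0[OF \<sigma>K(4) tE(4)] tF(4)] tF(3) action_gam0(2)
      by (simp add: v_def inverse_eq_divide)
  qed
  have "vgt (1 / real q ^ 2) (- (s / tF) * (\<sigma> \<beta> / s - tE * (\<beta> - lE * \<kappa>)))"
    using action_\<beta>(4) by (rule vgt_mult[of 0, rotated]) (use \<sigma>K tF_unit in \<open>auto simp: vge_divide_iff\<close>)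
  moreover have "vgt (1 / real q ^ 2) (v * \<beta> * (t - 1))"
  proof -
    have "vge 0 (v * \<beta>)" using vu tgam1_int(3) by (intro vge_mult_0) (auto simp: vge_iff[of _ v])
    moreover have "vgt (1 / real q ^ 2) (t - 1)" using tF_tE(1) by (simp add: t_def)
    ultimately show ?thesis by (rule vgt_mult) simp
  qed
  ultimately have "vgt (1 / real q ^ 2) (- (s / tF) * (\<sigma> \<beta> / s - tE * (\<beta> - lE * \<kappa>)) + v * \<beta> * (t - 1))"
    by (rule vgt_add)
  \<comment> \<open>Uses s^(q+1) = v t: replacing sigma(\<open>\<beta>\<close>) by its approximation
    leaves v lE \<open>\<kappa>\<close> and the error v \<open>\<beta>\<close> (t - 1).\<close>
  also have "- (s / tF) * (\<sigma> \<beta> / s - tE * (\<beta> - lE * \<kappa>)) + v * \<beta> * (t - 1) =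
      \<kappa> * ((s ^ (q + 1) * \<beta> - \<sigma> \<beta> / tF) / \<kappa> - v * lE)"
    using \<sigma>K(2) tF_unit(1) tF_tE(2) nz(2) by (simp add: v_def t_def field_simps)
  finally have kv: "vgt 0 ((s ^ (q + 1) * \<beta> - \<sigma> \<beta> / tF) / \<kappa> - v * lE)"
    using nz(2) by (simp add: vgt_mult_iff rvs(2))
  have vl: "vge 0 (v * lE)" "redn D (v * lE) = inverse \<zeta>F * \<eta>E"
    using vu lE by (auto simp: redn_times vge_iff[of _ v] intro!: vge_mult_0)
  have k1: "vge 0 ((s ^ (q + 1) * \<beta> - \<sigma> \<beta> / tF) / \<kappa>)"
    "redn D ((s ^ (q + 1) * \<beta> - \<sigma> \<beta> / tF) / \<kappa>) = inverse \<zeta>F * \<eta>E"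
    using redn_cong[OF vl(1) kv] vl(2) by auto
  have sn: "vge 0 (s ^ n)" "redn D (s ^ n) = inverse \<zeta>E ^ n" for n
    using \<sigma>K(4) residues(1) by (auto simp: vge_power_0 redn_power)
  have sn1: "redn D (s ^ nq) = 1" using sn(2)[of nq] residues(3) by (simp add: power_inverse)
  have k: "vge 0 k" "redn D k = \<zeta> * (inverse \<zeta>F * \<eta>E)"
    unfolding k_def using sn(1)[of nq] sn1 z k1 by (simp_all only: redn_times vge_mult_0 mult_1_left)
  have A': "vge 0 A" "redn D A = inverse \<zeta>F" and B': "vge 0 B" "redn D B = \<eta>E * \<zeta>"
    using A B residues(2) by (auto simp: reduces_to_iff)
  have "redn D (s ^ nq * s ^ (q + 1)) = inverse \<zeta>F"
    using sn(1) sn1 sn(2)[of "q + 1"] residues(2) by (simp only: redn_times power_inverse mult_1_left)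
  then have "vgt 0 (s ^ nq * s ^ (q + 1) - A)"
    using redn_eq_iff[OF vge_mult_0[OF sn(1) sn(1)] A'(1), of nq "q + 1"] A'(2) by (simp only: simp_thms)
  then obtain e1 where e1: "0 < e1" "vge e1 (s ^ nq * s ^ (q + 1) - A)" by (rule vgt_obtain)
  have "vgt 0 (k - A * B)"
    using redn_eq_iff[OF k(1) vge_mult_0[OF A'(1) B'(1)]] A' B' k(2) by (simp add: redn_times mult.commute mult.left_commute)
  then obtain e2 where e2: "0 < e2" "vge e2 (k - A * B)" by (rule vgt_obtain)
  have \<sigma>z: "\<sigma> (z / tF) = z / tF" using galois_fix[OF \<sigma>_galois F.L_divide[OF z(1) tF(1)]] .
  have \<sigma>\<kappa>: "\<sigma> \<kappa> = \<kappa> / s ^ nq" unfolding \<kappa>_def by (rule \<sigma>_K_power)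
  have "vge (min e1 e2) (\<sigma> (a_co D (inverse \<zeta>F * \<zeta>, \<mu>') (pt_act \<sigma> P)) - A * (a_co D (\<zeta>, \<mu>) P + B))"
    if a: "vge 0 (a_co D (\<zeta>, \<mu>) P)" for P
  proof -
    have det: "det_co D P = \<kappa> * a_co D (\<zeta>, \<mu>) P + z * \<beta>" using nz(2) by (simp add: a_co_eq z_def)
    have "\<sigma> (a_co D (inverse \<zeta>F * \<zeta>, \<mu>') (pt_act \<sigma> P)) =
        (s ^ (q + 1) * det_co D P - z / tF * \<sigma> \<beta>) / (\<kappa> / s ^ nq)"
      unfolding a_co_eq teich_quotient(2)[OF \<zeta>] z_def[symmetric]
      by (simp only: \<sigma>_hom(9)[of "_ - _" \<kappa>] \<sigma>_hom(6) \<sigma>_det \<sigma>_hom(4) \<sigma>z \<sigma>\<kappa>)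
    also have "\<dots> = s ^ nq * s ^ (q + 1) * a_co D (\<zeta>, \<mu>) P + k"
      unfolding det k_def using nz(2) tF_unit(1) \<sigma>K(2) by (simp add: field_simps)
    finally have "\<sigma> (a_co D (inverse \<zeta>F * \<zeta>, \<mu>') (pt_act \<sigma> P)) - A * (a_co D (\<zeta>, \<mu>) P + B) =
        (s ^ nq * s ^ (q + 1) - A) * a_co D (\<zeta>, \<mu>) P + (k - A * B)" by (simp add: algebra_simps)
    moreover have "vge (min e1 e2) ((s ^ nq * s ^ (q + 1) - A) * a_co D (\<zeta>, \<mu>) P)"
      by (rule vge_mult[OF e1(2) a]) simp
    moreover have "vge (min e1 e2) (k - A * B)" using e2(2) by (rule vge_mono) simp
    ultimately show ?thesis by (simp only: vge_add)
  qed
  then show ?thesis using e1(1) e2(1) by (intro exI[of _ "min e1 e2"]) auto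
qed

end

section \<open>Transport of functions along automorphisms\<close>

lemma quotient_iso:
  fixes R S
  assumes I: "ideal I R" and J: "ideal J S"
    and \<phi>: "\<phi> \<in> ring_iso R S" and IJ: "\<phi> ` I = J"
  shows "(\<lambda>X. \<phi> ` X) \<in> ring_iso (R Quot I) (S Quot J)"
    "\<And>x. x \<in> carrier R \<Longrightarrow> \<phi> ` (I +>\<^bsub>R\<^esub> x) = J +>\<^bsub>S\<^esub> \<phi> x"
proof -
  interpret I: ideal I R by (rule I)
  interpret J: ideal J S by (rule J)
  note h = ring_iso_memE[OF \<phi>]
  have IR: "I \<subseteq> carrier R" by (rule I.a_subset)
  show coset: "\<phi> ` (I +>\<^bsub>R\<^esub> x) = J +>\<^bsub>S\<^esub> \<phi> x" if x: "x \<in> carrier R" for x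
  proof -
    have "\<phi> (i \<oplus>\<^bsub>R\<^esub> x) = \<phi> i \<oplus>\<^bsub>S\<^esub> \<phi> x" if "i \<in> I" for i using h(3) x IR that by blast
    then show ?thesis unfolding a_r_coset_def' IJ[symmetric] by (simp add: image_UN)
  qed
  have inj: "inj_on \<phi> (carrier R)" and surj: "\<phi> ` carrier R = carrier S"
    using h(5) by (auto simp: bij_betw_def)
  have car: "carrier (R Quot I) = (\<lambda>x. I +>\<^bsub>R\<^esub> x) ` carrier R" "carrier (S Quot J) = (\<lambda>x. J +>\<^bsub>S\<^esub> x) ` carrier S"
    by (auto simp: FactRing_def A_RCOSETS_def')
  have sub: "X \<subseteq> carrier R" if "X \<in> carrier (R Quot I)" for X
    using that I.a_r_coset_subset_G[OF IR] by (auto simp: car)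
  show "(\<lambda>X. \<phi> ` X) \<in> ring_iso (R Quot I) (S Quot J)"
  proof (rule ring_iso_memI)
    show "\<phi> ` X \<in> carrier (S Quot J)" if "X \<in> carrier (R Quot I)" for X
      using that coset h(1) by (auto simp: car)
    fix X Y assume "X \<in> carrier (R Quot I)" "Y \<in> carrier (R Quot I)"
    then obtain x y where xy: "X = I +>\<^bsub>R\<^esub> x" "Y = I +>\<^bsub>R\<^esub> y" "x \<in> carrier R" "y \<in> carrier R" by (auto simp: car)
    have "X \<otimes>\<^bsub>R Quot I\<^esub> Y = I +>\<^bsub>R\<^esub> (x \<otimes>\<^bsub>R\<^esub> y)" using xy by (simp add: FactRing_def I.rcoset_mult_add)
    then show "\<phi> ` (X \<otimes>\<^bsub>R Quot I\<^esub> Y) = \<phi> ` X \<otimes>\<^bsub>S Quot J\<^esub> \<phi> ` Y"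
      using xy h(1,2) by (simp add: coset) (simp add: FactRing_def J.rcoset_mult_add)
    have "X \<oplus>\<^bsub>R Quot I\<^esub> Y = I +>\<^bsub>R\<^esub> (x \<oplus>\<^bsub>R\<^esub> y)" using xy by (simp add: FactRing_def I.a_rcos_sum)
    then show "\<phi> ` (X \<oplus>\<^bsub>R Quot I\<^esub> Y) = \<phi> ` X \<oplus>\<^bsub>S Quot J\<^esub> \<phi> ` Y"
      using xy h(1,3) by (simp add: coset) (simp add: FactRing_def J.a_rcos_sum)
  next
    show "\<phi> ` \<one>\<^bsub>R Quot I\<^esub> = \<one>\<^bsub>S Quot J\<^esub>" using coset[of "\<one>\<^bsub>R\<^esub>"] h(4) by (simp add: FactRing_def)
    show "bij_betw (\<lambda>X. \<phi> ` X) (carrier (R Quot I)) (carrier (S Quot J))"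
      unfolding bij_betw_def
    proof
      show "inj_on (\<lambda>X. \<phi> ` X) (carrier (R Quot I))"
        using inj_on_image_eq_iff[OF inj] sub by (auto intro!: inj_onI)
      show "(\<lambda>X. \<phi> ` X) ` carrier (R Quot I) = carrier (S Quot J)"
        unfolding car image_image surj[symmetric] by (intro image_cong) (auto simp: coset)
    qed
  qed
qed

context local_field_setting
begin

text \<open>A value of negative valuation has unbounded powers, whatever the common bound B.\<close>

lemma power_bounded_iff: "f \<in> power_bounded D S \<longleftrightarrow> f \<in> affinoid_functions D S \<and> (\<forall>P\<in>S. vge 0 (f P))"
proof -
  have "vge 0 x" if "\<And>n. vge B (x ^ n)" for x B
  proof (rule ccontr)
    assume "\<not> vge 0 x"
    then have x: "x \<noteq> 0" "rv x < 0" by (auto simp: vge_iff)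
    obtain n where "B / rv x < real n" using reals_Archimedean2 by blast
    then have "real n * rv x < B" using x by (simp add: divide_less_eq)
    then show False using that[of n] x by (simp add: vge_iff rv_power)
  qed
  then show ?thesis unfolding power_bounded_def vge_def[symmetric]
    by (auto intro!: exI[of _ 0] vge_power_0)
qed

text \<open>One exponent that brings all values to valuation at least 1 gives a uniform gap, and
  conversely. Hence the uniform bounds e in the transfer lemmas.\<close>

lemma top_nilpotent_iff:
  "f \<in> top_nilpotent D S \<longleftrightarrow> f \<in> affinoid_functions D S \<and> (\<exists>e>0. \<forall>P\<in>S. vge e (f P))"
proof
  assume f: "f \<in> top_nilpotent D S"
  then obtain N where N: "\<forall>n\<ge>N. \<forall>P\<in>S. vge 1 (f P ^ n)"
    unfolding top_nilpotent_def vge_def eventually_sequentially by blast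
  have "vge (1 / real (Suc N)) (f P)" if "P \<in> S" for P
    using N[rule_format, of "Suc N" P] that vge_power_iff[of "Suc N" 1] by auto
  then show "f \<in> affinoid_functions D S \<and> (\<exists>e>0. \<forall>P\<in>S. vge e (f P))"
    using f by (auto simp: top_nilpotent_def intro!: exI[of _ "1 / real (Suc N)"])
next
  assume f: "f \<in> affinoid_functions D S \<and> (\<exists>e>0. \<forall>P\<in>S. vge e (f P))"
  then obtain e where e: "0 < e" "\<And>P. P \<in> S \<Longrightarrow> vge e (f P)" by blast
  have "\<forall>\<^sub>F n in sequentially. \<forall>P\<in>S. vge B (f P ^ n)" for B
    unfolding eventually_sequentially
  proof -
    obtain N where N: "B / e < real N" using reals_Archimedean2 by blast
    have "vge B (f P ^ n)" if "N \<le> n" "P \<in> S" for n P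
    proof (rule vge_mono[OF vge_power[OF e(2)[OF that(2)]]])
      have "B < real N * e" using N e(1) by (simp add: divide_less_eq)
      also have "\<dots> \<le> real n * e" using that e(1) by (intro mult_right_mono) auto
      finally show "B \<le> real n * e" by simp
    qed
    then show "\<exists>N. \<forall>n\<ge>N. \<forall>P\<in>S. vge B (f P ^ n)" by blast
  qed
  then show "f \<in> top_nilpotent D S" using f by (simp add: top_nilpotent_def vge_def)
qed

lemma affinoid_iff: "f \<in> affinoid_functions D S \<longleftrightarrow> f \<in> extensional S \<and>
    (\<forall>B. \<exists>g\<in>poly_funs. \<exists>h\<in>poly_funs. \<forall>P\<in>S. h P \<noteq> 0 \<and> vge B (f P - g P / h P))"
  by (simp add: affinoid_functions_def vge_def)

lemma affinoid_poly: "g \<in> poly_funs \<Longrightarrow> (\<lambda>P\<in>S. g P) \<in> affinoid_functions D S"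
  unfolding affinoid_iff
proof (intro conjI allI)
  fix B assume "g \<in> poly_funs"
  then show "\<exists>u\<in>poly_funs. \<exists>v\<in>poly_funs. \<forall>P\<in>S. v P \<noteq> 0 \<and> vge B ((\<lambda>P\<in>S. g P) P - u P / v P)"
    by (intro bexI[of _ g] bexI[of _ "\<lambda>_. 1"] poly_funs.const) auto
qed simp

lemma affinoid_add:
  assumes f: "f \<in> affinoid_functions D S" and g: "g \<in> affinoid_functions D S"
  shows "(\<lambda>P\<in>S. f P + g P) \<in> affinoid_functions D S"
  unfolding affinoid_iff
proof (intro conjI allI)
  fix B
  obtain f1 f2 where f12: "f1 \<in> poly_funs" "f2 \<in> poly_funs" "\<And>P. P \<in> S \<Longrightarrow> f2 P \<noteq> 0 \<and> vge B (f P - f1 P / f2 P)"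
    using f unfolding affinoid_iff by meson
  obtain g1 g2 where g12: "g1 \<in> poly_funs" "g2 \<in> poly_funs" "\<And>P. P \<in> S \<Longrightarrow> g2 P \<noteq> 0 \<and> vge B (g P - g1 P / g2 P)"
    using g unfolding affinoid_iff by meson
  have "f2 P * g2 P \<noteq> 0 \<and> vge B ((f P + g P) - (f1 P * g2 P + g1 P * f2 P) / (f2 P * g2 P))" if P: "P \<in> S" for P
  proof -
    have "vge B ((f P - f1 P / f2 P) + (g P - g1 P / g2 P))" using f12 g12 P by (intro vge_add) auto
    also have "(f P - f1 P / f2 P) + (g P - g1 P / g2 P) = (f P + g P) - (f1 P * g2 P + g1 P * f2 P) / (f2 P * g2 P)"
      using f12(3)[OF P] g12(3)[OF P] by (simp add: field_simps)
    finally show ?thesis using f12 g12 P by auto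
  qed
  then show "\<exists>u\<in>poly_funs. \<exists>v\<in>poly_funs. \<forall>P\<in>S. v P \<noteq> 0 \<and> vge B ((\<lambda>P\<in>S. f P + g P) P - u P / v P)"
    using f12 g12 by (intro bexI[of _ "\<lambda>P. f1 P * g2 P + g1 P * f2 P"] bexI[of _ "\<lambda>P. f2 P * g2 P"] poly_funs.intros) auto
qed simp

lemma affinoid_mult:
  assumes f: "f \<in> affinoid_functions D S" "\<And>P. P \<in> S \<Longrightarrow> vge 0 (f P)"
    and g: "g \<in> affinoid_functions D S" "\<And>P. P \<in> S \<Longrightarrow> vge 0 (g P)"
  shows "(\<lambda>P\<in>S. f P * g P) \<in> affinoid_functions D S"
  unfolding affinoid_iff
proof (intro conjI allI)
  fix B :: real
  \<comment> \<open>Precision at least 0 keeps the approximating quotients integral, as the product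
    estimate requires.\<close>
  define B' where "B' = max B 0"
  obtain f1 f2 where f12: "f1 \<in> poly_funs" "f2 \<in> poly_funs" "\<And>P. P \<in> S \<Longrightarrow> f2 P \<noteq> 0 \<and> vge B' (f P - f1 P / f2 P)"
    using f(1) unfolding affinoid_iff by meson
  obtain g1 g2 where g12: "g1 \<in> poly_funs" "g2 \<in> poly_funs" "\<And>P. P \<in> S \<Longrightarrow> g2 P \<noteq> 0 \<and> vge B' (g P - g1 P / g2 P)"
    using g(1) unfolding affinoid_iff by meson
  have "f2 P * g2 P \<noteq> 0 \<and> vge B (f P * g P - (f1 P * g1 P) / (f2 P * g2 P))" if P: "P \<in> S" for P
  proof -
    have v: "vge B (f P - f1 P / f2 P)" "vge B (g P - g1 P / g2 P)" "vge 0 (g P - g1 P / g2 P)"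
      using f12(3)[OF P] g12(3)[OF P] by (auto simp: B'_def elim: vge_mono)
    have "vge 0 (g P - (g P - g1 P / g2 P))" using g(2)[OF P] v(3) by (rule vge_diff)
    then have g0: "vge 0 (g1 P / g2 P)" by simp
    have "vge B (f P * (g P - g1 P / g2 P) + (f P - f1 P / f2 P) * (g1 P / g2 P))"
      by (intro vge_add vge_mult[OF f(2)[OF P] v(2)] vge_mult[OF v(1) g0]) auto
    also have "f P * (g P - g1 P / g2 P) + (f P - f1 P / f2 P) * (g1 P / g2 P) =
        f P * g P - (f1 P * g1 P) / (f2 P * g2 P)"
      by (simp add: algebra_simps)
    finally show ?thesis using f12 g12 P by auto
  qed
  then show "\<exists>u\<in>poly_funs. \<exists>v\<in>poly_funs. \<forall>P\<in>S. v P \<noteq> 0 \<and> vge B ((\<lambda>P\<in>S. f P * g P) P - u P / v P)"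
    using f12 g12 by (intro bexI[of _ "\<lambda>P. f1 P * g1 P"] bexI[of _ "\<lambda>P. f2 P * g2 P"] poly_funs.mult) auto
qed simp

lemma affinoid_extensional: "f \<in> affinoid_functions D S \<Longrightarrow> f \<in> extensional S"
  by (simp add: affinoid_iff)

lemma const_pb: "vge 0 x \<Longrightarrow> (\<lambda>P\<in>S. x) \<in> power_bounded D S"
  using affinoid_poly[OF poly_funs.const] by (auto simp: power_bounded_iff)

lemma pb_add: "f \<in> power_bounded D S \<Longrightarrow> g \<in> power_bounded D S \<Longrightarrow> (\<lambda>P\<in>S. f P + g P) \<in> power_bounded D S"
  by (auto simp: power_bounded_iff affinoid_add vge_add)

lemma pb_mult: "f \<in> power_bounded D S \<Longrightarrow> g \<in> power_bounded D S \<Longrightarrow> (\<lambda>P\<in>S. f P * g P) \<in> power_bounded D S"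
  by (auto simp: power_bounded_iff affinoid_mult vge_mult_0)

lemma pb_uminus:
  assumes "f \<in> power_bounded D S" shows "(\<lambda>P\<in>S. - f P) \<in> power_bounded D S"
proof -
  have "(\<lambda>P\<in>S. (\<lambda>P\<in>S. - 1) P * f P) \<in> power_bounded D S"
    by (rule pb_mult[OF const_pb assms]) simp
  moreover have "(\<lambda>P\<in>S. (\<lambda>P\<in>S. - 1) P * f P) = (\<lambda>P\<in>S. - f P)" by auto
  ultimately show ?thesis by simp
qed

lemma pbr_simps [simp]:
  "carrier (power_bounded_ring D S) = power_bounded D S"
  "f \<otimes>\<^bsub>power_bounded_ring D S\<^esub> g = (\<lambda>P\<in>S. f P * g P)"
  "f \<oplus>\<^bsub>power_bounded_ring D S\<^esub> g = (\<lambda>P\<in>S. f P + g P)"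
  "\<one>\<^bsub>power_bounded_ring D S\<^esub> = (\<lambda>P\<in>S. 1)" "\<zero>\<^bsub>power_bounded_ring D S\<^esub> = (\<lambda>P\<in>S. 0)"
  by (simp_all add: power_bounded_ring_def)

lemma pbr_cring: "cring (power_bounded_ring D S)"
proof (rule cringI)
  show "abelian_group (power_bounded_ring D S)"
  proof (rule abelian_groupI)
    fix f assume f: "f \<in> carrier (power_bounded_ring D S)"
    then show "\<exists>g\<in>carrier (power_bounded_ring D S). g \<oplus>\<^bsub>power_bounded_ring D S\<^esub> f = \<zero>\<^bsub>power_bounded_ring D S\<^esub>"
      using pb_uminus[of f S] by (intro bexI[of _ "\<lambda>P\<in>S. - f P"]) auto
  next
    fix f assume "f \<in> carrier (power_bounded_ring D S)"
    then show "\<zero>\<^bsub>power_bounded_ring D S\<^esub> \<oplus>\<^bsub>power_bounded_ring D S\<^esub> f = f"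
      by (intro extensionalityI[of _ S]) (auto simp: power_bounded_iff affinoid_extensional)
  qed (auto simp: pb_add const_pb add.assoc add.commute intro!: restrict_ext)
  show "Group.comm_monoid (power_bounded_ring D S)"
  proof (rule comm_monoidI)
    fix f assume "f \<in> carrier (power_bounded_ring D S)"
    then show "\<one>\<^bsub>power_bounded_ring D S\<^esub> \<otimes>\<^bsub>power_bounded_ring D S\<^esub> f = f"
      by (intro extensionalityI[of _ S]) (auto simp: power_bounded_iff affinoid_extensional)
  qed (auto simp: pb_mult const_pb mult.assoc mult.commute intro!: restrict_ext)
qed (auto simp: distrib_right intro!: restrict_ext)

lemma nilpotent_ideal: "ideal (top_nilpotent D S) (power_bounded_ring D S)"
proof -
  interpret R: cring "power_bounded_ring D S" by (rule pbr_cring)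
  have sub: "top_nilpotent D S \<subseteq> power_bounded D S"
    using vge_mono by (fastforce simp: top_nilpotent_iff power_bounded_iff)
  have neg: "\<ominus>\<^bsub>power_bounded_ring D S\<^esub> f = (\<lambda>P\<in>S. - f P)" if "f \<in> power_bounded D S" for f
    by (rule R.minus_equality) (use that pb_uminus[OF that] in auto)
  have mult: "(\<lambda>P\<in>S. f P * g P) \<in> top_nilpotent D S" if f: "f \<in> top_nilpotent D S" and g: "g \<in> power_bounded D S" for f g
  proof -
    obtain e where e: "0 < e" "\<And>P. P \<in> S \<Longrightarrow> vge e (f P)" using f by (auto simp: top_nilpotent_iff)
    have "vge e (f P * g P)" if "P \<in> S" for P
      by (rule vge_mult[OF e(2)[OF that]]) (use g that in \<open>auto simp: power_bounded_iff\<close>)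
    moreover have "(\<lambda>P\<in>S. f P * g P) \<in> power_bounded D S" using pb_mult sub f g by blast
    ultimately show ?thesis using e(1) by (auto simp: top_nilpotent_iff power_bounded_iff)
  qed
  show ?thesis
  proof (rule idealI)
    show "ring (power_bounded_ring D S)" by (rule R.ring_axioms)
    show "subgroup (top_nilpotent D S) (add_monoid (power_bounded_ring D S))"
    proof (rule R.add.subgroupI)
      show "top_nilpotent D S \<subseteq> carrier (power_bounded_ring D S)" using sub by simp
      have "(\<lambda>P\<in>S. 0) \<in> top_nilpotent D S"
        using const_pb[of 0 S] by (auto simp: top_nilpotent_iff power_bounded_iff intro!: exI[of _ 1])
      then show "top_nilpotent D S \<noteq> {}" by blast
    next
      fix f assume f: "f \<in> top_nilpotent D S"
      then have "f \<in> power_bounded D S" using sub by blast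
      moreover have "(\<lambda>P\<in>S. - f P) \<in> top_nilpotent D S"
        using f pb_uminus[OF \<open>f \<in> power_bounded D S\<close>] by (auto simp: top_nilpotent_iff power_bounded_iff)
      ultimately show "\<ominus>\<^bsub>power_bounded_ring D S\<^esub> f \<in> top_nilpotent D S"
        using neg by simp
    next
      fix f g assume f: "f \<in> top_nilpotent D S" and g: "g \<in> top_nilpotent D S"
      obtain e e' where e: "0 < e" "\<And>P. P \<in> S \<Longrightarrow> vge e (f P)" "0 < e'" "\<And>P. P \<in> S \<Longrightarrow> vge e' (g P)"
        using f g unfolding top_nilpotent_iff by blast
      have "vge (min e e') (f P + g P)" if "P \<in> S" for P
        by (intro vge_add vge_mono[OF e(2)[OF that]] vge_mono[OF e(4)[OF that]]) auto
      moreover have "(\<lambda>P\<in>S. f P + g P) \<in> power_bounded D S" using pb_add sub f g by blast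
      ultimately show "f \<oplus>\<^bsub>power_bounded_ring D S\<^esub> g \<in> top_nilpotent D S"
        using e(1,3) by (auto simp: top_nilpotent_iff power_bounded_iff intro!: exI[of _ "min e e'"])
    qed
  qed (use mult in \<open>auto simp: mult.commute\<close>)
qed

lemma red_class_carrier: "(\<lambda>P\<in>S. f P) \<in> power_bounded D S \<Longrightarrow> red_class D S f \<in> carrier (reduction_ring D S)"
  by (auto simp: red_class_def reduction_ring_def FactRing_def A_RCOSETS_def')

lemma red_class_cong:
  assumes f: "(\<lambda>P\<in>S. f P) \<in> power_bounded D S" and g: "(\<lambda>P\<in>S. g P) \<in> power_bounded D S"
    and e: "0 < e" "\<And>P. P \<in> S \<Longrightarrow> vge e (f P - g P)"
  shows "red_class D S f = red_class D S g"
proof -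
  interpret I: ideal "top_nilpotent D S" "power_bounded_ring D S" by (rule nilpotent_ideal)
  have "(\<lambda>P\<in>S. (\<lambda>P\<in>S. f P) P + (\<lambda>P\<in>S. - (\<lambda>P\<in>S. g P) P) P) \<in> power_bounded D S"
    using f g by (intro pb_add pb_uminus)
  moreover have "(\<lambda>P\<in>S. (\<lambda>P\<in>S. f P) P + (\<lambda>P\<in>S. - (\<lambda>P\<in>S. g P) P) P) = (\<lambda>P\<in>S. f P - g P)" by auto
  ultimately have "(\<lambda>P\<in>S. f P - g P) \<in> top_nilpotent D S"
    using e by (auto simp: top_nilpotent_iff power_bounded_iff)
  moreover have "(\<lambda>P\<in>S. f P) = (\<lambda>P\<in>S. f P - g P) \<oplus>\<^bsub>power_bounded_ring D S\<^esub> (\<lambda>P\<in>S. g P)" by auto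
  ultimately have "(\<lambda>P\<in>S. f P) \<in> top_nilpotent D S +>\<^bsub>power_bounded_ring D S\<^esub> (\<lambda>P\<in>S. g P)"
    unfolding a_r_coset_def' by blast
  then show ?thesis unfolding red_class_def
    using I.a_repr_independence[OF _ _ I.is_additive_subgroup[THEN additive_subgroup.a_subgroup]] g by simp
qed

lemma red_class_add:
  assumes "(\<lambda>P\<in>S. f P) \<in> power_bounded D S" "(\<lambda>P\<in>S. g P) \<in> power_bounded D S"
  shows "red_class D S f \<oplus>\<^bsub>reduction_ring D S\<^esub> red_class D S g = red_class D S (\<lambda>P. f P + g P)"
proof -
  interpret I: ideal "top_nilpotent D S" "power_bounded_ring D S" by (rule nilpotent_ideal)
  have "(\<lambda>P\<in>S. (\<lambda>P\<in>S. f P) P + (\<lambda>P\<in>S. g P) P) = (\<lambda>P\<in>S. f P + g P)" by auto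
  then show ?thesis using assms by (simp add: red_class_def reduction_ring_def FactRing_def I.a_rcos_sum)
qed

lemma red_class_mult:
  assumes "(\<lambda>P\<in>S. f P) \<in> power_bounded D S" "(\<lambda>P\<in>S. g P) \<in> power_bounded D S"
  shows "red_class D S f \<otimes>\<^bsub>reduction_ring D S\<^esub> red_class D S g = red_class D S (\<lambda>P. f P * g P)"
proof -
  interpret I: ideal "top_nilpotent D S" "power_bounded_ring D S" by (rule nilpotent_ideal)
  have "(\<lambda>P\<in>S. (\<lambda>P\<in>S. f P) P * (\<lambda>P\<in>S. g P) P) = (\<lambda>P\<in>S. f P * g P)" by auto
  then show ?thesis using assms by (simp add: red_class_def reduction_ring_def FactRing_def I.rcoset_mult_add)
qed

definition transport :: "('c \<Rightarrow> 'c) \<Rightarrow> 'c pt set \<Rightarrow> ('c pt \<Rightarrow> 'c) \<Rightarrow> 'c pt \<Rightarrow> 'c" where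
  "transport \<sigma> S f = (\<lambda>P\<in>S. \<sigma> (f (pt_act \<sigma> P)))"

lemma red_act_transport: "red_act \<sigma> S X = transport \<sigma> S ` X"
  by (simp add: red_act_def transport_def[abs_def])

context
  fixes \<sigma> :: "'c \<Rightarrow> 'c" and L :: "'c set"
  assumes \<sigma>: "\<sigma> \<in> galois_C D L"
begin

abbreviation "\<tau> \<equiv> inv_into UNIV \<sigma>"

lemma \<sigma>\<tau>: "\<sigma> (\<tau> x) = x" "\<tau> (\<sigma> x) = x" "inv_into UNIV \<tau> = \<sigma>"
  using galois_aut[OF \<sigma>] by (auto simp: field_aut_def bij_def surj_f_inv_f inv_inv_eq)

lemma pt_act_inv: "pt_act \<tau> (pt_act \<sigma> P) = P" "pt_act \<sigma> (pt_act \<tau> P) = P"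
  by (cases P; simp add: pt_act_def \<sigma>\<tau>)+

lemma pt_act_image: "pt_act \<tau> ` pt_act \<sigma> ` S = S"
  by (simp add: image_image pt_act_inv)

text \<open>On coordinate functions the outer sigma cancels the inverse inside
  \<open>pt_act\<close>; on constants it acts by sigma, so polynomial functions are
  preserved.\<close>

lemma transport_poly: "g \<in> poly_funs \<Longrightarrow> (\<lambda>P. \<sigma> (g (pt_act \<sigma> P))) \<in> poly_funs"
proof (induction rule: poly_funs.induct)
  case coord1
  have "(\<lambda>P. \<sigma> ((\<lambda>(X, Y, u). X) (pt_act \<sigma> P))) = (\<lambda>(X, Y, u). X)"
    by (auto simp: pt_act_def \<sigma>\<tau>)
  then show ?case by (simp only: poly_funs.coord1)
next
  case coord2
  have "(\<lambda>P. \<sigma> ((\<lambda>(X, Y, u). Y) (pt_act \<sigma> P))) = (\<lambda>(X, Y, u). Y)"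
    by (auto simp: pt_act_def \<sigma>\<tau>)
  then show ?case by (simp only: poly_funs.coord2)
next
  case coord3
  have "(\<lambda>P. \<sigma> ((\<lambda>(X, Y, u). u) (pt_act \<sigma> P))) = (\<lambda>(X, Y, u). u)"
    by (auto simp: pt_act_def \<sigma>\<tau>)
  then show ?case by (simp only: poly_funs.coord3)
qed (simp_all add: aut_simps[OF galois_aut[OF \<sigma>]] poly_funs.intros)

lemma transport_affinoid:
  assumes f: "f \<in> affinoid_functions D (pt_act \<sigma> ` S)"
  shows "transport \<sigma> S f \<in> affinoid_functions D S"
  unfolding affinoid_iff
proof (intro conjI allI)
  fix B
  obtain g h where gh: "g \<in> poly_funs" "h \<in> poly_funs"
    "\<And>P. P \<in> S \<Longrightarrow> h (pt_act \<sigma> P) \<noteq> 0 \<and> vge B (f (pt_act \<sigma> P) - g (pt_act \<sigma> P) / h (pt_act \<sigma> P))"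
    using f unfolding affinoid_iff by (meson imageI)
  note hom = aut_simps[OF galois_aut[OF \<sigma>]]
  have "\<sigma> (h (pt_act \<sigma> P)) \<noteq> 0 \<and>
      vge B (\<sigma> (f (pt_act \<sigma> P)) - \<sigma> (g (pt_act \<sigma> P)) / \<sigma> (h (pt_act \<sigma> P)))" if "P \<in> S" for P
    using gh(3)[OF that] galois_vge[OF \<sigma>, of B "f (pt_act \<sigma> P) - g (pt_act \<sigma> P) / h (pt_act \<sigma> P)"] hom by simp
  then show "\<exists>u\<in>poly_funs. \<exists>v\<in>poly_funs. \<forall>P\<in>S. v P \<noteq> 0 \<and> vge B (transport \<sigma> S f P - u P / v P)"
    by (intro bexI[OF _ transport_poly[OF gh(1)]] bexI[OF _ transport_poly[OF gh(2)]])
      (simp add: transport_def)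
qed (simp add: transport_def)

lemma transport_pb: "f \<in> power_bounded D (pt_act \<sigma> ` S) \<Longrightarrow> transport \<sigma> S f \<in> power_bounded D S"
  by (auto simp: power_bounded_iff transport_affinoid) (auto simp: transport_def galois_vge[OF \<sigma>])

lemma transport_nilpotent: "f \<in> top_nilpotent D (pt_act \<sigma> ` S) \<Longrightarrow> transport \<sigma> S f \<in> top_nilpotent D S"
  by (auto simp: top_nilpotent_iff transport_affinoid) (auto simp: transport_def galois_vge[OF \<sigma>])

lemma transport_inverse:
  "f \<in> extensional (pt_act \<sigma> ` S) \<Longrightarrow> transport \<tau> (pt_act \<sigma> ` S) (transport \<sigma> S f) = f"
  by (rule extensionalityI[of _ "pt_act \<sigma> ` S"]) (auto simp: transport_def pt_act_inv \<sigma>\<tau>)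

end

lemma transport_iso:
  assumes \<sigma>: "\<sigma> \<in> galois_C D L"
  shows "transport \<sigma> S \<in> ring_iso (power_bounded_ring D (pt_act \<sigma> ` S)) (power_bounded_ring D S)"
    "transport \<sigma> S ` top_nilpotent D (pt_act \<sigma> ` S) = top_nilpotent D S"
proof -
  define \<tau> where "\<tau> = inv_into UNIV \<sigma>"
  note \<tau> = galois_inv[OF \<sigma>, folded \<tau>_def]
  have im: "pt_act \<tau> ` pt_act \<sigma> ` S = S" unfolding \<tau>_def by (rule pt_act_image[OF \<sigma>])
  have \<tau>\<sigma>: "inv_into UNIV \<tau> = \<sigma>" unfolding \<tau>_def by (rule \<sigma>\<tau>(3)[OF \<sigma>])
  have inv1: "transport \<tau> (pt_act \<sigma> ` S) (transport \<sigma> S f) = f" if "f \<in> extensional (pt_act \<sigma> ` S)" for f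
    unfolding \<tau>_def by (rule transport_inverse[OF \<sigma> that])
  have inv2: "transport \<sigma> S (transport \<tau> (pt_act \<sigma> ` S) f) = f" if "f \<in> extensional S" for f
    using transport_inverse[OF \<tau>, of f "pt_act \<sigma> ` S"] that unfolding im \<tau>\<sigma> by simp
  have bk: "transport \<tau> (pt_act \<sigma> ` S) f \<in> power_bounded D (pt_act \<sigma> ` S)" if "f \<in> power_bounded D S" for f
    by (rule transport_pb[OF \<tau>]) (simp add: im that)
  have bk': "transport \<tau> (pt_act \<sigma> ` S) f \<in> top_nilpotent D (pt_act \<sigma> ` S)" if "f \<in> top_nilpotent D S" for f
    by (rule transport_nilpotent[OF \<tau>]) (simp add: im that)
  note hom = aut_simps[OF galois_aut[OF \<sigma>]]
  show "transport \<sigma> S \<in> ring_iso (power_bounded_ring D (pt_act \<sigma> ` S)) (power_bounded_ring D S)"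
  proof (rule ring_iso_memI)
    show "bij_betw (transport \<sigma> S) (carrier (power_bounded_ring D (pt_act \<sigma> ` S))) (carrier (power_bounded_ring D S))"
      by (rule bij_betw_byWitness[where f' = "transport \<tau> (pt_act \<sigma> ` S)"])
        (use inv1 inv2 bk transport_pb[OF \<sigma>] in \<open>auto simp: power_bounded_iff affinoid_extensional\<close>)
  qed (auto simp: transport_pb[OF \<sigma>], auto simp: transport_def hom intro!: restrict_ext)
  show "transport \<sigma> S ` top_nilpotent D (pt_act \<sigma> ` S) = top_nilpotent D S"
  proof (intro equalityI subsetI)
    fix f assume f: "f \<in> top_nilpotent D S"
    then have "f = transport \<sigma> S (transport \<tau> (pt_act \<sigma> ` S) f)"
      using inv2[of f] by (simp add: top_nilpotent_iff affinoid_extensional)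
    then show "f \<in> transport \<sigma> S ` top_nilpotent D (pt_act \<sigma> ` S)" using bk'[OF f] by blast
  qed (use transport_nilpotent[OF \<sigma>] in auto)
qed

lemma red_act_iso:
  assumes \<sigma>: "\<sigma> \<in> galois_C D L"
  shows "red_act \<sigma> S \<in> ring_iso (reduction_ring D (pt_act \<sigma> ` S)) (reduction_ring D S)"
    "(\<lambda>P\<in>pt_act \<sigma> ` S. f P) \<in> power_bounded D (pt_act \<sigma> ` S) \<Longrightarrow>
      red_act \<sigma> S (red_class D (pt_act \<sigma> ` S) f) = red_class D S (\<lambda>P. \<sigma> (f (pt_act \<sigma> P)))"
proof -
  note t = transport_iso[OF \<sigma>, of S]
  note q = quotient_iso[OF nilpotent_ideal nilpotent_ideal t]
  have "red_act \<sigma> S = (\<lambda>X. transport \<sigma> S ` X)" by (rule ext) (rule red_act_transport)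
  then show "red_act \<sigma> S \<in> ring_iso (reduction_ring D (pt_act \<sigma> ` S)) (reduction_ring D S)"
    using q(1) by (simp add: reduction_ring_def)
  assume f: "(\<lambda>P\<in>pt_act \<sigma> ` S. f P) \<in> power_bounded D (pt_act \<sigma> ` S)"
  have "transport \<sigma> S (\<lambda>P\<in>pt_act \<sigma> ` S. f P) = (\<lambda>P\<in>S. \<sigma> (f (pt_act \<sigma> P)))"
    unfolding transport_def by (intro restrict_ext) auto
  then show "red_act \<sigma> S (red_class D (pt_act \<sigma> ` S) f) = red_class D S (\<lambda>P. \<sigma> (f (pt_act \<sigma> P)))"
    using q(2)[of "\<lambda>P\<in>pt_act \<sigma> ` S. f P"] f by (simp add: red_act_transport red_class_def)
qed

lemma reduced_point_act:
  assumes \<sigma>: "\<sigma> \<in> inertia D L" and P: "P \<in> S" and r: "r \<in> carrier (reduction_ring D (pt_act \<sigma> ` S))"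
  shows "reduced_point D P (red_act \<sigma> S r) = reduced_point D (pt_act \<sigma> P) r"
proof -
  interpret I: ideal "top_nilpotent D (pt_act \<sigma> ` S)" "power_bounded_ring D (pt_act \<sigma> ` S)" by (rule nilpotent_ideal)
  have "r \<subseteq> power_bounded D (pt_act \<sigma> ` S)"
    using r I.a_r_coset_subset_G[OF I.a_subset] by (auto simp: reduction_ring_def FactRing_def A_RCOSETS_def')
  then have "vge 0 (f (pt_act \<sigma> P))" if "f \<in> r" for f using that P by (auto simp: power_bounded_iff)
  then have "redn D (\<sigma> (f (pt_act \<sigma> P))) = redn D (f (pt_act \<sigma> P))" if "f \<in> r" for f
    using that inertia_redn[OF \<sigma>] by blast
  then have "(\<forall>f\<in>red_act \<sigma> S r. redn D (f P) = c) \<longleftrightarrow> (\<forall>f\<in>r. redn D (f (pt_act \<sigma> P)) = c)" for c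
    using P by (simp add: red_act_def)
  then show ?thesis by (simp add: reduced_point_def)
qed

lemma components_act:
  assumes \<sigma>: "\<sigma> \<in> galois_C D L" and S: "pt_act \<sigma> ` S = S"
  shows "bij_betw (\<lambda>T. pt_act \<sigma> ` T) (components D S) (components D S)"
proof -
  have gen: "pt_act \<sigma> ` T \<in> components D S"
    if \<sigma>: "\<sigma> \<in> galois_C D L" and S: "pt_act \<sigma> ` S = S" and T: "T \<in> components D S" for \<sigma> T
  proof -
    define \<tau> where "\<tau> = inv_into UNIV \<sigma>"
    note \<tau> = galois_inv[OF \<sigma>, folded \<tau>_def]
    note inv = pt_act_inv[OF \<sigma>, folded \<tau>_def]
    have im: "pt_act \<tau> ` pt_act \<sigma> ` A = A" for A unfolding \<tau>_def by (rule pt_act_image[OF \<sigma>])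
    have S': "pt_act \<tau> ` S = S" using im[of S] S by simp
    have clopen: "clopen_part D S (pt_act \<rho> ` T)"
      if \<rho>: "\<rho> \<in> galois_C D L" "pt_act \<rho> ` S = S" and T: "clopen_part D S T" for \<rho> T
    proof -
      define \<theta> where "\<theta> = inv_into UNIV \<rho>"
      note \<theta> = galois_inv[OF \<rho>(1), folded \<theta>_def]
      note inv = pt_act_inv[OF \<rho>(1), folded \<theta>_def]
      have "pt_act \<theta> ` pt_act \<rho> ` S = S" unfolding \<theta>_def by (rule pt_act_image[OF \<rho>(1)])
      then have S': "pt_act \<theta> ` S = S" using \<rho>(2) by simp
      have "(\<lambda>P\<in>S. if P \<in> T then 1 else 0) \<in> affinoid_functions D (pt_act \<theta> ` S)"
        using T by (simp add: S' clopen_part_def)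
      then have "transport \<theta> S (\<lambda>P\<in>S. if P \<in> T then 1 else 0) \<in> affinoid_functions D S"
        by (rule transport_affinoid[OF \<theta>])
      also have "transport \<theta> S (\<lambda>P\<in>S. if P \<in> T then 1 else 0) = (\<lambda>P\<in>S. if P \<in> pt_act \<rho> ` T then 1 else 0)"
        unfolding transport_def
      proof (intro restrict_ext)
        fix P assume "P \<in> S"
        then have "pt_act \<theta> P \<in> S" using S' by blast
        moreover have "pt_act \<theta> P \<in> T \<longleftrightarrow> P \<in> pt_act \<rho> ` T" using inv by (metis imageE imageI)
        ultimately show "\<theta> ((\<lambda>P\<in>S. if P \<in> T then 1 else 0) (pt_act \<theta> P)) = (if P \<in> pt_act \<rho> ` T then 1 else 0)"
          using aut_simps(1,2)[OF galois_aut[OF \<theta>]] by simp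
      qed
      finally have "(\<lambda>P\<in>S. if P \<in> pt_act \<rho> ` T then 1 else 0) \<in> affinoid_functions D S" .
      moreover have "pt_act \<rho> ` T \<subseteq> S" using T \<rho>(2) unfolding clopen_part_def by blast
      ultimately show ?thesis unfolding clopen_part_def by blast
    qed
    have T': "clopen_part D S T" "T \<noteq> {}" "\<And>T'. clopen_part D S T' \<Longrightarrow> T' \<subseteq> T \<Longrightarrow> T' = {} \<or> T' = T"
      using T by (auto simp: components_def)
    have "A = {} \<or> A = pt_act \<sigma> ` T" if A: "clopen_part D S A" "A \<subseteq> pt_act \<sigma> ` T" for A
    proof -
      have "pt_act \<tau> ` A \<subseteq> T" using A(2) im[of T] by (metis image_mono)
      then have "pt_act \<tau> ` A = {} \<or> pt_act \<tau> ` A = T" using T'(3) clopen[OF \<tau> S' A(1)] by blast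
      moreover have "pt_act \<sigma> ` pt_act \<tau> ` A = A" by (simp add: image_image inv)
      ultimately show ?thesis by auto
    qed
    then show ?thesis using clopen[OF \<sigma> S T'(1)] T'(2) unfolding components_def by blast
  qed
  define \<tau> where "\<tau> = inv_into UNIV \<sigma>"
  note \<tau> = galois_inv[OF \<sigma>, folded \<tau>_def]
  have im: "pt_act \<tau> ` pt_act \<sigma> ` A = A" "pt_act \<sigma> ` pt_act \<tau> ` A = A" for A
    by (simp_all add: image_image pt_act_inv[OF \<sigma>, folded \<tau>_def])
  have S': "pt_act \<tau> ` S = S" using im(1)[of S] S by simp
  show ?thesis
    by (rule bij_betw_byWitness[where f' = "\<lambda>T. pt_act \<tau> ` T"]) (use im gen[OF \<sigma> S] gen[OF \<tau> S'] in auto)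
qed

end

section \<open>Integrality of the formal group law\<close>

text \<open>Polynomial functions in the variables e 0 = u, e 1 = X, e 2 = Y. Integrality is proved
  for these universal variables, where raising the variables to the q-th power is a lift of
  Frobenius, and then specialised to points of C.\<close>

inductive_set poly_ring :: "'c::field set \<Rightarrow> ((nat \<Rightarrow> 'c) \<Rightarrow> 'c) set" for A where
  const: "c \<in> A \<Longrightarrow> (\<lambda>_. c) \<in> poly_ring A"
| coord: "(\<lambda>e. e i) \<in> poly_ring A"
| add: "f \<in> poly_ring A \<Longrightarrow> g \<in> poly_ring A \<Longrightarrow> (\<lambda>e. f e + g e) \<in> poly_ring A"
| mult: "f \<in> poly_ring A \<Longrightarrow> g \<in> poly_ring A \<Longrightarrow> (\<lambda>e. f e * g e) \<in> poly_ring A"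

context lubin_tate_setting
begin

abbreviation "\<O> \<equiv> ints D (base D)"
abbreviation "PR \<equiv> poly_ring \<O>"

definition \<psi> :: "(nat \<Rightarrow> 'c) \<Rightarrow> nat \<Rightarrow> 'c" where "\<psi> e = (\<lambda>i. e i ^ q)"

lemma ints_iff: "x \<in> \<O> \<longleftrightarrow> x \<in> base D \<and> vge 0 x"
  by (simp add: ints_def val_ge_0_iff)

lemma PR_of_nat: "(\<lambda>_. of_nat n) \<in> PR"
  by (rule poly_ring.const) (simp add: ints_iff F.L_of_nat)

lemma PR_pi: "(\<lambda>_. \<pi>) \<in> PR"
  by (rule poly_ring.const) (use vge_rv[of \<pi>] in \<open>auto simp: ints_iff elim: vge_mono\<close>)

lemma PR_0: "(\<lambda>_. 0) \<in> PR" and PR_1: "(\<lambda>_. 1) \<in> PR"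
  using PR_of_nat[of 0] PR_of_nat[of 1] by simp_all

lemma PR_uminus: "f \<in> PR \<Longrightarrow> (\<lambda>e. - f e) \<in> PR"
  using poly_ring.mult[OF poly_ring.const[of "- 1" "\<O>"], of f] F.L_uminus[of 1] by (simp add: ints_iff)

lemma PR_diff: "f \<in> PR \<Longrightarrow> g \<in> PR \<Longrightarrow> (\<lambda>e. f e - g e) \<in> PR"
  using poly_ring.add[OF _ PR_uminus, of f g] by simp

lemma PR_power: "f \<in> PR \<Longrightarrow> (\<lambda>e. f e ^ n) \<in> PR"
  by (induction n) (auto intro: poly_ring.mult PR_1)

lemma PR_sum: "(\<And>i. i \<in> A \<Longrightarrow> f i \<in> PR) \<Longrightarrow> (\<lambda>e. \<Sum>i\<in>A. f i e) \<in> PR"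
  by (induction A rule: infinite_finite_induct) (auto intro: poly_ring.add PR_0)

lemma PR_integral: "f \<in> PR \<Longrightarrow> (\<And>i. vge 0 (e i)) \<Longrightarrow> vge 0 (f e)"
  by (induction rule: poly_ring.induct) (auto simp: ints_iff vge_add vge_mult_0)

lemma PR_const_div: "c \<in> base D \<Longrightarrow> vge 1 c \<Longrightarrow> (\<lambda>_. c / \<pi>) \<in> PR"
  by (rule poly_ring.const) (simp add: ints_iff F.L_divide vge_divide_iff)

text \<open>The map \<open>\<psi>\<close> lifts the q-power Frobenius modulo pi: on constants by
  Fermat in k_F, on sums by divisibility of the binomial coefficients, on products by
  telescoping.\<close>

lemma PR_frobenius:
  assumes "f \<in> PR"
  shows "(\<lambda>e. f (\<psi> e)) \<in> PR \<and> (\<lambda>e. (f e ^ q - f (\<psi> e)) / \<pi>) \<in> PR"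
  using assms
proof (induction rule: poly_ring.induct)
  case (const c)
  then have c: "c \<in> base D" "vge 0 c" by (auto simp: ints_iff)
  have "redn D (c ^ q) = redn D c" using F.fermat[OF F.redn_resfield[OF c]] c by (simp add: redn_power)
  then have "vge 1 (c ^ q - c)"
    using c by (intro F.vgt0_L F.L_diff F.L_power) (auto simp: vge_power_0 redn_eq_iff)
  then show ?case using const c by (auto intro!: poly_ring.const[of c] PR_const_div F.L_diff F.L_power)
next
  case (coord i)
  show ?case using PR_0 PR_power[OF poly_ring.coord] by (simp add: \<psi>_def)
next
  case (add f g)
  have "(f e + g e) ^ q - (f (\<psi> e) + g (\<psi> e)) = (f e ^ q - f (\<psi> e)) + (g e ^ q - g (\<psi> e))
      + (\<Sum>j\<in>{1..<q}. of_nat (q choose j) * f e ^ j * g e ^ (q - j))" for e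
    using F.binomial_split[of "f e" "g e"] by simp
  then have eq: "((f e + g e) ^ q - (f (\<psi> e) + g (\<psi> e))) / \<pi> = (f e ^ q - f (\<psi> e)) / \<pi> + (g e ^ q - g (\<psi> e)) / \<pi>
      + (\<Sum>j\<in>{1..<q}. of_nat (q choose j) / \<pi> * f e ^ j * g e ^ (q - j))" for e
    by (simp add: add_divide_distrib diff_divide_distrib sum_divide_distrib)
  have "(\<lambda>e. \<Sum>j\<in>{1..<q}. of_nat (q choose j) / \<pi> * f e ^ j * g e ^ (q - j)) \<in> PR"
    using add F.vge_binomial
    by (intro PR_sum poly_ring.mult PR_power PR_const_div) (auto simp: F.L_of_nat)
  then show ?case unfolding eq using add by (intro conjI poly_ring.add) auto
next
  case (mult f g)
  have eq: "((f e * g e) ^ q - f (\<psi> e) * g (\<psi> e)) / \<pi> =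
     (f e ^ q - f (\<psi> e)) / \<pi> * g e ^ q + f (\<psi> e) * ((g e ^ q - g (\<psi> e)) / \<pi>)" for e
    by (simp add: field_simps power_mult_distrib)
  show ?case unfolding eq using mult by (intro conjI poly_ring.add poly_ring.mult PR_power) auto
qed

text \<open>Families of power series with all coefficients divisible by pi^j in the ring of integral
  polynomial functions.\<close>

definition PS :: "nat \<Rightarrow> ((nat \<Rightarrow> 'c) \<Rightarrow> 'c fps) set" where
  "PS j = {A. \<forall>n. (\<lambda>e. A e $ n / \<pi> ^ j) \<in> PR}"

lemma PS_0_iff: "A \<in> PS 0 \<longleftrightarrow> (\<forall>n. (\<lambda>e. A e $ n) \<in> PR)"
  by (simp add: PS_def)

lemma PS_add: "A \<in> PS j \<Longrightarrow> B \<in> PS j \<Longrightarrow> (\<lambda>e. A e + B e) \<in> PS j"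
  by (simp add: PS_def add_divide_distrib poly_ring.add)

lemma PS_zero: "(\<lambda>e. 0) \<in> PS j" by (simp add: PS_def PR_0)

lemma PS_sum: "(\<And>i. i \<in> S \<Longrightarrow> A i \<in> PS j) \<Longrightarrow> (\<lambda>e. \<Sum>i\<in>S. A i e) \<in> PS j"
  by (induction S rule: infinite_finite_induct) (auto intro: PS_add PS_zero)

lemma PS_mult:
  assumes "A \<in> PS i" "B \<in> PS j" shows "(\<lambda>e. A e * B e) \<in> PS (i + j)"
  unfolding PS_def
proof (intro CollectI allI)
  fix n
  have "(A e * B e) $ n / \<pi> ^ (i + j) = (\<Sum>k\<in>{0..n}. (A e $ k / \<pi> ^ i) * (B e $ (n - k) / \<pi> ^ j))" for e
    by (simp add: fps_mult_nth sum_divide_distrib power_add)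
  then show "(\<lambda>e. (A e * B e) $ n / \<pi> ^ (i + j)) \<in> PR"
    using assms by (simp only:) (intro PR_sum poly_ring.mult, auto simp: PS_def)
qed

lemma PS_mono: "A \<in> PS i \<Longrightarrow> j \<le> i \<Longrightarrow> A \<in> PS j"
proof -
  assume a: "A \<in> PS i" "j \<le> i"
  have "A e $ n / \<pi> ^ j = \<pi> ^ (i - j) * (A e $ n / \<pi> ^ i)" for e n
    using a(2) by (simp add: power_diff)
  then show ?thesis using a unfolding PS_def
    by (simp only: mem_Collect_eq) (intro allI poly_ring.mult PR_power[OF PR_pi], auto)
qed

lemma PS_const: "(\<lambda>e. fps_const (c e)) \<in> PS j \<longleftrightarrow> (\<lambda>e. c e / \<pi> ^ j) \<in> PR"
proof -
  have "(\<lambda>e. fps_const (c e) $ n / \<pi> ^ j) = (if n = 0 then (\<lambda>e. c e / \<pi> ^ j) else (\<lambda>_. 0))" for n by auto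
  then show ?thesis unfolding PS_def using PR_0 by auto
qed

lemma PS_1: "(\<lambda>e. 1) \<in> PS 0"
  using PS_const[of "\<lambda>_. 1" 0] PR_1 by simp

lemma PS_power: "A \<in> PS 0 \<Longrightarrow> (\<lambda>e. A e ^ n) \<in> PS 0"
proof (induction n)
  case (Suc n)
  then show ?case using PS_mult[of A 0 "\<lambda>e. A e ^ n" 0] by simp
qed (simp add: PS_1)

lemma PS_power_pos: "A \<in> PS j \<Longrightarrow> 0 < n \<Longrightarrow> (\<lambda>e. A e ^ n) \<in> PS (n * j)"
proof (induction n)
  case (Suc n)
  then show ?case using PS_mult[of A j "\<lambda>e. A e ^ n" "n * j"] by (cases n) auto
qed simp

lemma PS_X_power: "(\<lambda>e. fps_X ^ n) \<in> PS 0"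
proof -
  have "(\<lambda>e. (fps_X ^ n :: 'c fps) $ m) = (if m = n then (\<lambda>_. 1) else (\<lambda>_. 0))" for m by auto
  then show ?thesis unfolding PS_0_iff using PR_0 PR_1 by auto
qed

lemma PS_binomial:
  assumes "j \<in> {1..<q}" "A \<in> PS i"
  shows "(\<lambda>e. of_nat (q choose j) * A e) \<in> PS (1 + i)"
proof -
  have "(\<lambda>e. fps_const (of_nat (q choose j))) \<in> PS 1"
    unfolding PS_const using assms F.vge_binomial[of j] by (auto intro!: PR_const_div F.L_of_nat)
  from PS_mult[OF this assms(2)] show ?thesis by (simp add: fps_of_nat)
qed

lemma PS_compose_X_power: "A \<in> PS j \<Longrightarrow> 0 < d \<Longrightarrow> (\<lambda>e. A e oo fps_X ^ d) \<in> PS j"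
proof -
  assume a: "A \<in> PS j" "0 < d"
  have "(\<lambda>e. (A e oo fps_X ^ d) $ n / \<pi> ^ j) = (if d dvd n then (\<lambda>e. A e $ (n div d) / \<pi> ^ j) else (\<lambda>_. 0))" for n
    by (auto simp: fps_nth_compose_X_power)
  then show ?thesis using a(1) PR_0 by (auto simp: PS_def)
qed

lemma PS_\<psi>: "A \<in> PS 0 \<Longrightarrow> (\<lambda>e. A (\<psi> e)) \<in> PS 0"
  unfolding PS_0_iff using PR_frobenius by blast

text \<open>Raising a congruence modulo pi^j to the q-th power improves it by one: the pure term has
  exponent q j >= j + 1 and the mixed terms gain a binomial coefficient.\<close>

lemma PS_cong_power:
  assumes A: "A \<in> PS 0" and B: "B \<in> PS 0" and AB: "(\<lambda>e. A e - B e) \<in> PS j" and j: "0 < j"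
  shows "(\<lambda>e. A e ^ q - B e ^ q) \<in> PS (j + 1)"
proof -
  have eq: "A e ^ q - B e ^ q = (A e - B e) ^ q
      + (\<Sum>i\<in>{1..<q}. of_nat (q choose i) * ((A e - B e) ^ i * B e ^ (q - i)))" for e
    using F.binomial_split[of "A e - B e" "B e"] by (simp add: mult.assoc)
  have "j + 1 \<le> q * j" using q_ge_3 j mult_le_mono[of 2 q j j] by linarith
  then have 1: "(\<lambda>e. (A e - B e) ^ q) \<in> PS (j + 1)"
    using PS_power_pos[OF AB, of q] q_ge_3 by (auto intro: PS_mono)
  have 2: "(\<lambda>e. of_nat (q choose i) * ((A e - B e) ^ i * B e ^ (q - i))) \<in> PS (j + 1)" if "i \<in> {1..<q}" for i
  proof -
    have "(\<lambda>e. (A e - B e) ^ i) \<in> PS j"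
      using PS_power_pos[OF AB, of i] that by (auto intro!: PS_mono[of _ "i * j" j])
    then have "(\<lambda>e. (A e - B e) ^ i * B e ^ (q - i)) \<in> PS (j + 0)"
      by (intro PS_mult PS_power B)
    from PS_binomial[OF that this] show ?thesis by simp
  qed
  show ?thesis unfolding eq by (intro PS_add PS_sum 1 2)
qed

lemma PS_cong_power_iter:
  assumes A: "A \<in> PS 0" and B: "B \<in> PS 0" and AB: "(\<lambda>e. A e - B e) \<in> PS j" and j: "0 < j"
  shows "(\<lambda>e. A e ^ (q ^ n) - B e ^ (q ^ n)) \<in> PS (j + n)"
proof (induction n)
  case (Suc n)
  have "(\<lambda>e. (A e ^ (q ^ n)) ^ q - (B e ^ (q ^ n)) ^ q) \<in> PS (j + n + 1)"
    using j by (intro PS_cong_power PS_power A B Suc) auto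
  then show ?case by (simp add: power_mult[symmetric] mult.commute)
qed (use AB in simp)

text \<open>A^q is congruent to the twist of A evaluated at X^q. The degree bound uniform in e
  permits an induction on the number of terms.\<close>

lemma PS_frobenius:
  assumes A: "A \<in> PS 0" and fin: "\<And>e n. m \<le> n \<Longrightarrow> A e $ n = 0"
  shows "(\<lambda>e. A e ^ q - (A (\<psi> e) oo fps_X ^ q)) \<in> PS 1"
proof -
  have q0: "(fps_X ^ q :: 'c fps) $ 0 = 0" using q_ge_3 by simp
  have good: "(\<lambda>e. (\<Sum>i<k. fps_const (A e $ i) * fps_X ^ i)) \<in> PS 0 \<and>
     (\<lambda>e. (\<Sum>i<k. fps_const (A e $ i) * fps_X ^ i) ^ q - ((\<Sum>i<k. fps_const (A (\<psi> e) $ i) * fps_X ^ i) oo fps_X ^ q)) \<in> PS 1" for k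
  proof (induction k)
    case 0
    show ?case using q_ge_3 by (simp add: PS_zero zero_power)
  next
    case (Suc k)
    define S where "S = (\<lambda>e. \<Sum>i<k. fps_const (A e $ i) * fps_X ^ i)"
    define M where "M = (\<lambda>e. fps_const (A e $ k) * fps_X ^ k)"
    have S: "S \<in> PS 0" "(\<lambda>e. S e ^ q - (S (\<psi> e) oo fps_X ^ q)) \<in> PS 1" using Suc by (simp_all add: S_def)
    have c: "(\<lambda>e. A e $ k) \<in> PR" using A by (simp add: PS_0_iff)
    then have "(\<lambda>e. fps_const (A e $ k)) \<in> PS 0" by (simp add: PS_const)
    from PS_mult[OF this PS_X_power] have M: "M \<in> PS 0" by (simp add: M_def)
    have "M e ^ q - (M (\<psi> e) oo fps_X ^ q) = fps_const ((A e $ k) ^ q - A (\<psi> e) $ k) * fps_X ^ (k * q)" for e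
      by (simp add: M_def fps_compose_mult_distrib[OF q0] fps_X_power_compose[OF q0] power_mult_distrib
          fps_const_power power_mult[symmetric] mult.commute[of q k] left_diff_distrib flip: fps_const_sub)
    moreover have "(\<lambda>e. fps_const ((A e $ k) ^ q - A (\<psi> e) $ k)) \<in> PS 1"
      unfolding PS_const using PR_frobenius[OF c] by simp
    ultimately have M1: "(\<lambda>e. M e ^ q - (M (\<psi> e) oo fps_X ^ q)) \<in> PS 1"
      using PS_mult[OF _ PS_X_power, of _ 1 "k * q"] by simp
    have eq: "(S e + M e) ^ q - ((S (\<psi> e) + M (\<psi> e)) oo fps_X ^ q) =
      (S e ^ q - (S (\<psi> e) oo fps_X ^ q)) + (M e ^ q - (M (\<psi> e) oo fps_X ^ q)) +
      (\<Sum>i\<in>{1..<q}. of_nat (q choose i) * (S e ^ i * M e ^ (q - i)))" for e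
      using F.binomial_split[of "S e" "M e"] by (simp add: fps_compose_add_distrib mult.assoc)
    have "(\<lambda>e. of_nat (q choose i) * (S e ^ i * M e ^ (q - i))) \<in> PS 1" if "i \<in> {1..<q}" for i
      using PS_binomial[OF that PS_mult[OF PS_power PS_power], OF S(1) M] by simp
    then have "(\<lambda>e. (S e + M e) ^ q - ((S (\<psi> e) + M (\<psi> e)) oo fps_X ^ q)) \<in> PS 1"
      unfolding eq by (intro PS_add PS_sum S M1)
    then show ?case using PS_add[OF S(1) M] by (simp add: S_def M_def)
  qed
  have "(\<Sum>i<m. fps_const (A e $ i) * fps_X ^ i) = A e" for e
  proof (rule fps_ext)
    fix n
    show "(\<Sum>i<m. fps_const (A e $ i) * fps_X ^ i) $ n = A e $ n"
      using fin[of n e] by (cases "n < m") (simp_all add: fps_sum_nth if_distrib sum.delta cong: if_cong)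
  qed
  then show ?thesis using good[of m] by simp
qed

end

section \<open>Coefficients of powers depend on lower coefficients\<close>

lemma fps_power_agree:
  fixes A B :: "'a::comm_ring_1 fps"
  assumes "\<And>n. n < m \<Longrightarrow> A $ n = B $ n" "m' < m"
  shows "(A ^ k) $ m' = (B ^ k) $ m'"
proof -
  have "(A ^ k - B ^ k) $ m' = 0"
    unfolding power_diff_sumr2[of A k B] fps_mult_nth using assms by (intro sum.neutral) auto
  then show ?thesis by simp
qed

text \<open>A^k - B^k is A - B, which starts in degree m at the earliest, times a series without
  constant term as k >= 2.\<close>

lemma fps_power_agree':
  fixes A B :: "'a::comm_ring_1 fps"
  assumes "\<And>n. n < m \<Longrightarrow> A $ n = B $ n" "A $ 0 = 0" "B $ 0 = 0" "2 \<le> k"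
  shows "(A ^ k) $ m = (B ^ k) $ m"
proof -
  have "(\<Sum>i<k. B ^ (k - Suc i) * A ^ i) $ 0 = 0"
    unfolding fps_sum_nth
  proof (intro sum.neutral ballI)
    fix i assume "i \<in> {..<k}"
    then have "0 < i \<or> 0 < k - Suc i" using assms(4) by auto
    then show "(B ^ (k - Suc i) * A ^ i) $ 0 = 0"
      using assms(2,3) by (auto simp: fps_mult_nth_0 fps_power_zeroth zero_power)
  qed
  then have "(A - B) $ i * (\<Sum>i<k. B ^ (k - Suc i) * A ^ i) $ (m - i) = 0" if "i \<le> m" for i
    using assms(1)[of i] that by (cases "i = m") auto
  then have "(A ^ k - B ^ k) $ m = 0"
    unfolding power_diff_sumr2[of A k B] fps_mult_nth by (intro sum.neutral) auto
  then show ?thesis by simp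
qed

section \<open>The functional equation of the logarithm and its consequence\<close>

context lubin_tate_setting
begin

text \<open>The definition peels off the last power of u; the functional equation needs the first
  one peeled off, with u replaced by its Frobenius twists. As for continuants, both recursions
  hold.\<close>

lemma b_coeff_first:
  "b_coeff D u (Suc (Suc k)) = (u * b_coeff D (u ^ q) (Suc k) + b_coeff D (u ^ (q ^ 2)) k) / \<pi>"
proof (induction k rule: less_induct)
  case (less k)
  have e: "(u ^ q) ^ q ^ n = u ^ q ^ Suc n" "(u ^ q ^ 2) ^ q ^ n = u ^ q ^ Suc (Suc n)" for n
    by (simp_all add: power_mult[symmetric] power2_eq_square mult.assoc)
  consider "k = 0" | "k = 1" | j where "k = Suc (Suc j)" by (metis One_nat_def not0_implies_Suc)
  then show ?case
  proof cases
    case 1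
    then show ?thesis by (simp add: power2_eq_square)
  next
    case 2
    then show ?thesis using F.pi_nz e(1)[of 1]
      by (simp add: field_simps power2_eq_square)
  next
    case 3
    have "b_coeff D u (Suc (Suc k)) = (b_coeff D u (Suc k) * u ^ q ^ Suc k + b_coeff D u k) / \<pi>" by simp
    also have "b_coeff D u (Suc k) = (u * b_coeff D (u ^ q) k + b_coeff D (u ^ q ^ 2) (Suc j)) / \<pi>"
      using less[of "Suc j"] 3 by simp
    also have "b_coeff D u k = (u * b_coeff D (u ^ q) (Suc j) + b_coeff D (u ^ q ^ 2) j) / \<pi>"
      using less[of j] 3 by simp
    also have "((u * b_coeff D (u ^ q) k + b_coeff D (u ^ q ^ 2) (Suc j)) / \<pi> * u ^ q ^ Suc k +
        (u * b_coeff D (u ^ q) (Suc j) + b_coeff D (u ^ q ^ 2) j) / \<pi>) / \<pi> =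
       (u * ((b_coeff D (u ^ q) k * u ^ q ^ Suc k + b_coeff D (u ^ q) (Suc j)) / \<pi>)
        + (b_coeff D (u ^ q ^ 2) (Suc j) * u ^ q ^ Suc k + b_coeff D (u ^ q ^ 2) j) / \<pi>) / \<pi>"
      by (simp add: field_simps)
    also have "(b_coeff D (u ^ q) k * u ^ q ^ Suc k + b_coeff D (u ^ q) (Suc j)) / \<pi> = b_coeff D (u ^ q) (Suc k)"
      unfolding 3 b_coeff.simps(3) e by simp
    also have "(b_coeff D (u ^ q ^ 2) (Suc j) * u ^ q ^ Suc k + b_coeff D (u ^ q ^ 2) j) / \<pi> = b_coeff D (u ^ q ^ 2) k"
      unfolding 3 b_coeff.simps(3) e by simp
    finally show ?thesis .
  qed
qed

lemma b_coeff_PR: "(\<lambda>e. \<pi> ^ k * b_coeff D (e 0) k) \<in> PR"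
proof (induction k rule: less_induct)
  case (less k)
  consider "k = 0" | "k = 1" | j where "k = Suc (Suc j)" by (metis One_nat_def not0_implies_Suc)
  then show ?case
  proof cases
    case 1
    then show ?thesis using PR_1 by simp
  next
    case 2
    then show ?thesis using poly_ring.coord[of 0] by simp
  next
    case 3
    have eq: "\<pi> ^ k * b_coeff D (e 0) k =
      (\<pi> ^ Suc j * b_coeff D (e 0) (Suc j)) * e 0 ^ q ^ Suc j + \<pi> * (\<pi> ^ j * b_coeff D (e 0) j)" for e
      unfolding 3 b_coeff.simps(3) by (simp add: field_simps)
    show ?thesis unfolding eq
      by (intro poly_ring.add poly_ring.mult[OF less] poly_ring.mult[OF PR_pi less] PR_power[OF poly_ring.coord])
        (use 3 in simp_all)
  qed
qed

lemma power_q_inj: "q ^ k = q ^ l \<longleftrightarrow> k = l"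
  using q_ge_3 by simp

lemma lt_log_nth_power: "lt_log D u $ (q ^ k) = b_coeff D u k"
  by (auto simp: lt_log_def power_q_inj)

lemma lt_log_nth_0: "(\<And>k. n \<noteq> q ^ k) \<Longrightarrow> lt_log D u $ n = 0"
  by (auto simp: lt_log_def)

lemma lt_log_low [simp]: "lt_log D u $ 0 = 0" "lt_log D u $ Suc 0 = 1"
  using lt_log_nth_0[of 0 u] lt_log_nth_power[of u 0] q_ge_3 by auto

text \<open>The coefficient form, above degree 1, of f_u(X) = X + (u/pi) f_(u^q)(X^q) + (1/pi)
  f_(u^(q^2))(X^(q^2)).\<close>

lemma lt_log_funeq:
  assumes "1 < m"
  shows "lt_log D u $ m = u / \<pi> * (if q dvd m then lt_log D (u ^ q) $ (m div q) else 0)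
     + (if q ^ 2 dvd m then lt_log D (u ^ q ^ 2) $ (m div q ^ 2) else 0) / \<pi>"
proof (cases "\<exists>k. m = q ^ k")
  case True
  then obtain k where k: "m = q ^ k" by blast
  then have "k \<noteq> 0" using assms by (metis less_irrefl power_0)
  then consider "k = 1" | j where "k = Suc (Suc j)" by (metis One_nat_def not0_implies_Suc)
  then show ?thesis
  proof cases
    case 1
    have "\<not> q ^ 2 dvd q" using q_ge_3 by (auto simp: power2_eq_square dest!: dvd_imp_le)
    then show ?thesis using k 1 lt_log_nth_power[of u 1] lt_log_low(2)[of "u ^ q"] q_ge_3 by simp
  next
    case 2
    have "m = q * q ^ Suc j" "m = q ^ 2 * q ^ j" using k 2 by (simp_all add: power2_eq_square)
    then have "q dvd m" "m div q = q ^ Suc j" "q ^ 2 dvd m" "m div q ^ 2 = q ^ j"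
      using q_ge_3 by (metis dvd_triv_left nonzero_mult_div_cancel_left power_eq_0_iff not_numeral_le_zero)+
    then show ?thesis
      using b_coeff_first[of u j] by (simp add: k 2 lt_log_nth_power[of _ "Suc j"] lt_log_nth_power[of _ "Suc (Suc j)"]
        lt_log_nth_power[of _ j] add_divide_distrib del: power_Suc b_coeff.simps)
  qed
next
  case False
  have "m div q \<noteq> q ^ j" if "q dvd m" for j
    using False that by (metis dvd_mult_div_cancel power_Suc)
  moreover have "m div q ^ 2 \<noteq> q ^ j" if "q ^ 2 dvd m" for j
    using False that by (metis dvd_mult_div_cancel power_add)
  ultimately show ?thesis using False by (auto simp: lt_log_nth_0)
qed

lemma lt_log_sum:
  assumes "\<And>i. m < i \<Longrightarrow> g i = 0" "m < N"
  shows "(\<Sum>i=0..m. lt_log D u $ i * g i) = (\<Sum>k<N. b_coeff D u k * g (q ^ k))"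
proof -
  have lt: "k < q ^ k" for k using q_ge_3 by (intro power_gt_expt) auto
  have "(\<Sum>k<N. b_coeff D u k * g (q ^ k)) = (\<Sum>i\<in>(\<lambda>k. q ^ k) ` {..<N}. lt_log D u $ i * g i)"
    by (subst sum.reindex) (auto simp: inj_on_def power_q_inj lt_log_nth_power)
  also have "\<dots> = (\<Sum>i=0..m. lt_log D u $ i * g i)"
  proof (rule sum.mono_neutral_cong)
    show "lt_log D u $ i * g i = 0" if "i \<in> {0..m} - (\<lambda>k. q ^ k) ` {..<N}" for i
    proof -
      have "i \<noteq> q ^ k" for k
      proof (cases "k < N")
        case False
        then show ?thesis using lt[of k] that assms(2) by auto
      qed (use that in auto)
      then show ?thesis by (simp add: lt_log_nth_0)
    qed
  qed (use assms(1) in auto)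
  finally show ?thesis ..
qed

lemma lt_log_compose_nth:
  assumes "A $ 0 = 0" "m < N"
  shows "(lt_log D u oo A) $ m = (\<Sum>k<N. b_coeff D u k * (A ^ q ^ k) $ m)"
  unfolding fps_compose_nth
  using startsby_zero_power_prefix[OF assms(1)] assms(2) by (intro lt_log_sum[where g = "\<lambda>i. (A ^ i) $ m"]) auto

lemma lt_log_compose_X_power:
  assumes "A $ 0 = 0" "d dvd m \<Longrightarrow> m div d < N"
  shows "(\<Sum>k<N. b_coeff D u k * (A ^ q ^ k oo fps_X ^ d) $ m) =
    (if d dvd m then (lt_log D u oo A) $ (m div d) else 0)"
  using assms by (auto simp: fps_nth_compose_X_power lt_log_compose_nth)

definition lin_log :: "'c \<Rightarrow> 'c \<Rightarrow> (nat \<Rightarrow> 'c) \<Rightarrow> 'c fps" where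
  "lin_log a b e = fps_const a * (lt_log D (e 0) oo fps_const (e 1) * fps_X)
     + fps_const b * (lt_log D (e 0) oo fps_const (e 2) * fps_X)"

text \<open>The series f^(-1)(a f(XT) + b f(YT)). It is addition for a = b = 1 and multiplication by
  a for b = 0, so one integrality proof covers both.\<close>

definition lin_ser :: "'c \<Rightarrow> 'c \<Rightarrow> (nat \<Rightarrow> 'c) \<Rightarrow> 'c fps" where
  "lin_ser a b e = fps_inv (lt_log D (e 0)) oo lin_log a b e"

lemma lin_log_nth: "lin_log a b e $ n = lt_log D (e 0) $ n * (a * e 1 ^ n + b * e 2 ^ n)"
  by (simp add: lin_log_def) (simp add: algebra_simps)

lemma fps_inv_0 [simp]: "fps_inv (lt_log D u) $ 0 = 0"
  by (simp add: fps_inv_def)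

lemma lin_ser_0 [simp]: "lin_ser a b e $ 0 = 0"
  by (simp add: lin_ser_def)

lemma lt_log_lin_ser: "lt_log D (e 0) oo lin_ser a b e = lin_log a b e"
proof -
  have 0: "lin_log a b e $ 0 = 0" by (simp add: lin_log_nth)
  show ?thesis unfolding lin_ser_def by (subst fps_compose_assoc) (use 0 in \<open>simp_all add: fps_inv_right\<close>)
qed

text \<open>Hazewinkel's functional equation lemma.  Modulo integral polynomials, the powers of the truncation T
  of the series may be replaced by powers of its Frobenius twists, and the functional equation of
  \<^const>\<open>lt_log\<close> makes what remains cancel.\<close>

lemma lin_ser_PR:
  assumes a: "a \<in> \<O>" and b: "b \<in> \<O>"
  shows "(\<lambda>e. lin_ser a b e $ m) \<in> PR"
proof (induction m rule: less_induct)
  case (less m)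
  show ?case
  proof (cases m)
    case 0
    then show ?thesis using PR_0 by simp
  next
    case (Suc m')
    define W where "W = lin_ser a b"
    \<comment> \<open>A truncation, so that the induction hypothesis makes all its coefficients
      integral and \<open>PS_frobenius\<close> applies.\<close>
    define T where "T = (\<lambda>e. fps_cutoff m (W e))"
    define \<psi>2 where "\<psi>2 = (\<lambda>e. \<psi> (\<psi> e))"
    have W0: "W e $ 0 = 0" "T e $ 0 = 0" for e by (simp_all add: W_def T_def)
    have TW: "T e $ n = W e $ n" if "n < m" for e n using that by (simp add: T_def)
    have "(\<lambda>e. T e $ n) = (if n < m then (\<lambda>e. W e $ n) else (\<lambda>_. 0))" for n by (auto simp: T_def)
    then have T: "T \<in> PS 0" using less PR_0 by (auto simp: PS_0_iff W_def)
    have \<psi>0: "\<psi> e 0 = e 0 ^ q" "\<psi>2 e 0 = e 0 ^ q ^ 2" for e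
      by (simp_all add: \<psi>_def \<psi>2_def power2_eq_square power_mult)
    have T2: "(\<lambda>e. T (\<psi> e)) \<in> PS 0" "(\<lambda>e. T (\<psi>2 e)) \<in> PS 0"
      using PS_\<psi>[OF T] PS_\<psi>[OF PS_\<psi>[OF T]] by (simp_all add: \<psi>2_def)
    have X0: "(fps_X ^ q :: 'c fps) $ 0 = 0" "(fps_X ^ q ^ 2 :: 'c fps) $ 0 = 0" using q_ge_3 by simp_all
    \<comment> \<open>D1 and D2 at k are divisible by pi^(k+1), which absorbs the denominator pi^k
      of b_k and the 1/pi of the functional equation.\<close>
    define D1 where "D1 = (\<lambda>k e. T e ^ q ^ Suc k - (T (\<psi> e) ^ q ^ k oo fps_X ^ q))"
    define D2 where "D2 = (\<lambda>k e. T e ^ q ^ Suc (Suc k) - (T (\<psi>2 e) ^ q ^ k oo fps_X ^ q ^ 2))"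
    have fr: "(\<lambda>e. T e ^ q - (T (\<psi> e) oo fps_X ^ q)) \<in> PS 1"
      by (rule PS_frobenius[OF T, of m]) (simp add: T_def)
    have D1: "D1 k \<in> PS (Suc k)" for k
      using PS_cong_power_iter[OF PS_power[OF T] PS_compose_X_power[OF T2(1)] fr, of k] q_ge_3
      by (simp add: D1_def power_mult[symmetric] fps_compose_power[OF X0(1)] mult.commute)
    have "(\<lambda>e. (T e ^ q) ^ q - (T (\<psi> e) oo fps_X ^ q) ^ q) \<in> PS 1"
      using PS_cong_power_iter[OF PS_power[OF T] PS_compose_X_power[OF T2(1)] fr, of 1] q_ge_3
      by (auto intro: PS_mono)
    moreover have "(\<lambda>e. ((T (\<psi> e) ^ q - (T (\<psi>2 e) oo fps_X ^ q)) oo fps_X ^ q)) \<in> PS 1"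
      using PS_compose_X_power[OF PS_frobenius[OF T2(1), of m], of q] q_ge_3 by (simp add: T_def \<psi>2_def)
    moreover have "(fps_X ^ q oo fps_X ^ q :: 'c fps) = fps_X ^ q ^ 2"
      by (simp add: fps_X_power_compose[OF X0(1)] power_mult[symmetric] power2_eq_square)
    then have "(T e ^ q) ^ q - (T (\<psi>2 e) oo fps_X ^ q ^ 2) = ((T e ^ q) ^ q - (T (\<psi> e) oo fps_X ^ q) ^ q)
       + ((T (\<psi> e) ^ q - (T (\<psi>2 e) oo fps_X ^ q)) oo fps_X ^ q)" for e
      using fps_compose_assoc[OF X0(1) X0(1), of "T (\<psi>2 e)"]
      by (simp add: fps_compose_sub_distrib fps_compose_power[OF X0(1)])
    ultimately have fr2: "(\<lambda>e. (T e ^ q) ^ q - (T (\<psi>2 e) oo fps_X ^ q ^ 2)) \<in> PS 1"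
      by (simp only:) (rule PS_add)
    have D2: "D2 k \<in> PS (Suc k)" for k
      using PS_cong_power_iter[OF PS_power[OF PS_power[OF T]] PS_compose_X_power[OF T2(2)] fr2, of k] q_ge_3
      by (simp add: D2_def power_mult[symmetric] fps_compose_power[OF X0(2)] mult.commute mult.left_commute)
    define B where "B = (\<lambda>e. e 0 * (\<Sum>k<m. \<pi> ^ k * b_coeff D (\<psi> e 0) k * (D1 k e $ m / \<pi> ^ Suc k))
       + (\<Sum>k<m'. \<pi> ^ k * b_coeff D (\<psi>2 e 0) k * (D2 k e $ m / \<pi> ^ Suc k)))"
    have b1: "(\<lambda>e. \<pi> ^ k * b_coeff D (\<psi> e 0) k) \<in> PR" "(\<lambda>e. \<pi> ^ k * b_coeff D (\<psi>2 e 0) k) \<in> PR" for k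
      using PR_frobenius[OF b_coeff_PR[of k]] PR_frobenius[of "\<lambda>e. \<pi> ^ k * b_coeff D (\<psi> e 0) k"] by (simp_all add: \<psi>2_def)
    have "(\<lambda>e. D1 k e $ m / \<pi> ^ Suc k) \<in> PR" "(\<lambda>e. D2 k e $ m / \<pi> ^ Suc k) \<in> PR" for k
      using D1[of k] D2[of k] by (auto simp: PS_def)
    then have B: "B \<in> PR"
      unfolding B_def by (intro poly_ring.add poly_ring.mult poly_ring.coord PR_sum b1)
    define H where "H = lin_log a b"
    \<comment> \<open>The defect of the functional equation for a f(XT) + b f(YT): the linear form
      aX + bY in degree 1, and 0 in higher degrees, as a and b are unchanged by the Frobenius
      twist.\<close>
    define L where "L = (\<lambda>e. H e $ m - e 0 / \<pi> * (if q dvd m then H (\<psi> e) $ (m div q) else 0)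
       - (if q ^ 2 dvd m then H (\<psi>2 e) $ (m div q ^ 2) else 0) / \<pi>)"
    have sum1: "(\<Sum>k<m. b_coeff D (\<psi> e 0) k * (T (\<psi> e) ^ q ^ k oo fps_X ^ q) $ m)
       = (if q dvd m then H (\<psi> e) $ (m div q) else 0)" for e
    proof -
      have lt: "m div q < m" using Suc q_ge_3 by simp
      have "(lt_log D (\<psi> e 0) oo T (\<psi> e)) $ (m div q) = (lt_log D (\<psi> e 0) oo W (\<psi> e)) $ (m div q)"
        unfolding fps_compose_nth using fps_power_agree[OF TW lt] by simp
      then show ?thesis
        using lt_log_compose_X_power[OF W0(2), of q m m "\<psi> e 0" "\<psi> e"] lt by (simp add: W_def H_def lt_log_lin_ser)
    qed
    have sum2: "(\<Sum>k<m'. b_coeff D (\<psi>2 e 0) k * (T (\<psi>2 e) ^ q ^ k oo fps_X ^ q ^ 2) $ m)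
       = (if q ^ 2 dvd m then H (\<psi>2 e) $ (m div q ^ 2) else 0)" for e
    proof -
      have q2: "9 \<le> q ^ 2" using nq(1,2) by simp
      have lt: "m div q ^ 2 < m" using Suc q2 by simp
      have lt': "m div q ^ 2 < m'" if "q ^ 2 dvd m"
      proof -
        have "9 \<le> m" using dvd_imp_le[OF that] Suc q2 by linarith
        moreover have "m div q ^ 2 \<le> m div 9" by (rule div_le_mono2) (use q2 in auto)
        ultimately show ?thesis using Suc by linarith
      qed
      have "(lt_log D (\<psi>2 e 0) oo T (\<psi>2 e)) $ (m div q ^ 2) = (lt_log D (\<psi>2 e 0) oo W (\<psi>2 e)) $ (m div q ^ 2)"
        unfolding fps_compose_nth using fps_power_agree[OF TW lt] by simp
      then show ?thesis
        using lt_log_compose_X_power[OF W0(2) lt', of "\<psi>2 e 0" "\<psi>2 e"] by (simp add: W_def H_def lt_log_lin_ser)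
    qed
    have main: "W e $ m = L e - B e" for e
    proof -
      \<comment> \<open>In f composed with W only the term k = 0 sees the coefficient of degree m;
        higher powers of W depend on the truncation.\<close>
      have TWk: "(W e ^ q ^ Suc k) $ m = (T e ^ q ^ Suc k) $ m" for k
      proof (rule fps_power_agree')
        have "2 \<le> q * 1" using q_ge_3 by simp
        also have "\<dots> \<le> q * q ^ k" using q_ge_3 by (intro mult_le_mono2) simp
        finally show "2 \<le> q ^ Suc k" by simp
      qed (simp_all add: TW W0)
      have "H e $ m = (\<Sum>k<Suc m. b_coeff D (e 0) k * (W e ^ q ^ k) $ m)"
        using lt_log_compose_nth[OF W0(1), of m "Suc m" "e 0" e] by (simp add: W_def H_def lt_log_lin_ser)
      also have "\<dots> = W e $ m + (\<Sum>k<m. b_coeff D (e 0) (Suc k) * (T e ^ q ^ Suc k) $ m)"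
        by (simp only: sum.lessThan_Suc_shift TWk) simp
      also have "(\<Sum>k<m. b_coeff D (e 0) (Suc k) * (T e ^ q ^ Suc k) $ m) =
          e 0 / \<pi> * (\<Sum>k<m. b_coeff D (\<psi> e 0) k * (T e ^ q ^ Suc k) $ m)
          + (\<Sum>k<m'. b_coeff D (\<psi>2 e 0) k * (T e ^ q ^ Suc (Suc k)) $ m) / \<pi>"
      proof -
        define t where "t = (\<lambda>k. (T e ^ q ^ Suc k) $ m)"
        have "b_coeff D (e 0) (Suc (Suc k)) * t (Suc k) =
            e 0 / \<pi> * (b_coeff D (\<psi> e 0) (Suc k) * t (Suc k)) + b_coeff D (\<psi>2 e 0) k * t (Suc k) / \<pi>" for k
          unfolding b_coeff_first \<psi>0 by (simp only: add_divide_distrib distrib_right times_divide_eq_left mult.assoc)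
        then have "(\<Sum>k<Suc m'. b_coeff D (e 0) (Suc k) * t k) =
            e 0 / \<pi> * (\<Sum>k<Suc m'. b_coeff D (\<psi> e 0) k * t k) + (\<Sum>k<m'. b_coeff D (\<psi>2 e 0) k * t (Suc k)) / \<pi>"
          unfolding sum.lessThan_Suc_shift
          by (simp only: sum.distrib sum_distrib_left distrib_left sum_divide_distrib b_coeff.simps(1,2) mult_1_left add.assoc)
        then show ?thesis by (simp only: t_def Suc)
      qed
      also have "(\<Sum>k<m. b_coeff D (\<psi> e 0) k * (T e ^ q ^ Suc k) $ m) =
         (if q dvd m then H (\<psi> e) $ (m div q) else 0) + \<pi> * (\<Sum>k<m. \<pi> ^ k * b_coeff D (\<psi> e 0) k * (D1 k e $ m / \<pi> ^ Suc k))"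
        unfolding sum1[symmetric]
        by (simp del: power_Suc add: D1_def sum_distrib_left sum.distrib[symmetric] algebra_simps)
          (simp add: field_simps)
      also have "(\<Sum>k<m'. b_coeff D (\<psi>2 e 0) k * (T e ^ q ^ Suc (Suc k)) $ m) =
         (if q ^ 2 dvd m then H (\<psi>2 e) $ (m div q ^ 2) else 0) + \<pi> * (\<Sum>k<m'. \<pi> ^ k * b_coeff D (\<psi>2 e 0) k * (D2 k e $ m / \<pi> ^ Suc k))"
        unfolding sum2[symmetric]
        by (simp del: power_Suc add: D2_def sum_distrib_left sum.distrib[symmetric] algebra_simps)
          (simp add: field_simps)
      finally show ?thesis by (simp add: L_def B_def field_simps)
    qed
    have L: "L \<in> PR"
    proof (cases "m = 1")
      case True
      have "\<not> q dvd 1" "\<not> q ^ 2 dvd 1" using q_ge_3 by auto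
      then have "L = (\<lambda>e. a * e 1 + b * e 2)" by (simp add: L_def True H_def lin_log_nth)
      then show ?thesis
        by (simp only:) (intro poly_ring.add poly_ring.mult poly_ring.const poly_ring.coord a b)
    next
      case False
      then have m: "1 < m" using Suc by simp
      have p: "(y ^ q) ^ (m div q) = y ^ m" if "q dvd m" for y :: 'c using that by (simp flip: power_mult)
      have p2: "((y ^ q) ^ q) ^ (m div q ^ 2) = y ^ m" if "q ^ 2 dvd m" for y :: 'c
        using that by (simp flip: power_mult power2_eq_square)
      have "L e = 0" for e
        using lt_log_funeq[OF m, of "e 0"] p p2
        by (simp add: L_def H_def lin_log_nth \<psi>0) (simp add: \<psi>2_def \<psi>_def field_simps)
      then have "L = (\<lambda>_. 0)" by blast
      then show ?thesis using PR_0 by simp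
    qed
    have "(\<lambda>e. W e $ m) = (\<lambda>e. L e - B e)" using main by blast
    then show ?thesis using PR_diff[OF L B] by (simp add: W_def)
  qed
qed

end

section \<open>Galois action on the Lubin--Tate curve\<close>

definition smap :: "('c::field \<Rightarrow> 'c) \<Rightarrow> 'c fps \<Rightarrow> 'c fps" where
  "smap w A = Abs_fps (\<lambda>n. w (A $ n))"

lemma smap_nth [simp]: "smap w A $ n = w (A $ n)" by (simp add: smap_def)

lemma aut_sum:
  assumes "field_aut (w :: 'c::field \<Rightarrow> 'c)"
  shows "w (sum f A) = (\<Sum>i\<in>A. w (f i))"
  by (induction A rule: infinite_finite_induct) (simp_all add: aut_simps[OF assms])

context
  fixes w :: "'c::field \<Rightarrow> 'c"
  assumes w: "field_aut w"
begin

lemma smap_add: "smap w (A + B) = smap w A + smap w B"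
  by (rule fps_ext) (simp add: aut_simps[OF w])

lemma smap_mult: "smap w (A * B) = smap w A * smap w B"
  by (rule fps_ext) (simp add: fps_mult_nth aut_sum[OF w] aut_simps[OF w])

lemma smap_power: "smap w (A ^ n) = smap w A ^ n"
proof (induction n)
  case 0
  show ?case by (rule fps_ext) (simp add: aut_simps[OF w])
qed (simp add: smap_mult)

lemma smap_compose: "smap w (A oo B) = smap w A oo smap w B"
proof (rule fps_ext)
  fix n
  have "w ((B ^ i) $ n) = (smap w B ^ i) $ n" for i by (metis smap_nth smap_power)
  then show "smap w (A oo B) $ n = (smap w A oo smap w B) $ n"
    by (simp add: fps_compose_nth aut_sum[OF w] aut_simps[OF w])
qed

lemma smap_const: "smap w (fps_const c) = fps_const (w c)"
  by (rule fps_ext) (simp add: aut_simps[OF w])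

lemma smap_X: "smap w fps_X = fps_X"
  by (rule fps_ext) (simp add: aut_simps[OF w])

lemma smap_fps_inv:
  assumes "A $ 0 = 0" "A $ 1 \<noteq> 0"
  shows "smap w (fps_inv A) = fps_inv (smap w A)"
proof -
  have 0: "smap w A $ 0 = 0" "smap w A $ 1 \<noteq> 0" using assms by (simp_all add: aut_simps[OF w])
  have i0: "fps_inv (smap w A) $ 0 = 0" by (simp add: fps_inv_def)
  have "smap w (fps_inv A) oo smap w A = fps_X"
    using fps_inv[OF assms] by (simp add: smap_X flip: smap_compose)
  then have "fps_inv (smap w A) = (smap w (fps_inv A) oo smap w A) oo fps_inv (smap w A)"
    using i0 by simp
  also have "\<dots> = smap w (fps_inv A) oo (smap w A oo fps_inv (smap w A))"
    using fps_compose_assoc[OF i0 0(1)] by simp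
  finally show ?thesis using fps_inv_right[OF 0] by simp
qed

end

context local_field_setting
begin

lemma vsum_converges:
  assumes "0 < \<epsilon>" "\<And>n. vge (\<delta> + real n * \<epsilon>) (s n)"
  shows "tends_to D (\<lambda>n. \<Sum>k<n. s k) (vsum D s)" "vge \<delta> (vsum D s)"
proof -
  have "cauchy_seq D (\<lambda>n. \<Sum>k<n. s k)"
    by (rule cauchy_seq_steps(1)[OF assms(1), of \<delta>]) (simp add: assms(2))
  then obtain l where l: "tends_to D (\<lambda>n. \<Sum>k<n. s k) l" using complete by blast
  then have "vsum D s = l" unfolding vsum_def using tends_to_unique by blast
  then show t: "tends_to D (\<lambda>n. \<Sum>k<n. s k) (vsum D s)" using l by simp
  then obtain N where N: "vge \<delta> ((\<Sum>k<N. s k) - vsum D s)" unfolding tends_to_iff by blast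
  have "vge \<delta> (s n)" for n using assms(2)[of n] by (rule vge_mono) (use assms(1) in simp)
  then have "vge \<delta> (\<Sum>k<N. s k)" by (intro vge_sum)
  from vge_diff[OF this N] show "vge \<delta> (vsum D s)" by simp
qed

lemma vsum_galois:
  assumes \<sigma>: "\<sigma> \<in> galois_C D L" and "0 < \<epsilon>" "\<And>n. vge (\<delta> + real n * \<epsilon>) (s n)"
  shows "\<sigma> (vsum D s) = vsum D (\<lambda>n. \<sigma> (s n))"
proof (rule tends_to_unique)
  note hom = aut_simps[OF galois_aut[OF \<sigma>]]
  show "tends_to D (\<lambda>n. \<Sum>k<n. \<sigma> (s k)) (\<sigma> (vsum D s))"
    using vsum_converges(1)[OF assms(2,3)] unfolding tends_to_iff
    by (simp add: galois_vge[OF \<sigma>] flip: aut_sum[OF galois_aut[OF \<sigma>]] hom(6))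
  show "tends_to D (\<lambda>n. \<Sum>k<n. \<sigma> (s k)) (vsum D (\<lambda>n. \<sigma> (s n)))"
    using assms by (intro vsum_converges(1)[of \<epsilon> \<delta>]) (simp_all add: galois_vge[OF \<sigma>])
qed

end

section \<open>Convergence and Galois equivariance of the formal operations\<close>

context lubin_tate_setting
begin

lemma teich_digit_ints: "a \<in> \<O> \<Longrightarrow> teich_digit D a k \<in> \<O>"
proof -
  assume a: "a \<in> \<O>"
  have t: "teich_lift D (redn D x) \<in> \<O>" "redn D (teich_lift D (redn D x)) = redn D x" if "x \<in> \<O>" for x
    using F.teich[of "redn D x"] F.redn_resfield[of x] that by (auto simp: ints_iff F.teich_def teich_lift_def)
  have r: "teich_rem D a k \<in> \<O>" for k
  proof (induction k)
    case (Suc k)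
    note h = t[OF Suc]
    have "vge 1 (teich_rem D a k - teich_lift D (redn D (teich_rem D a k)))"
      using h Suc by (intro F.vgt0_L F.L_diff) (auto simp: ints_iff redn_eq_iff[symmetric])
    then show ?case using h Suc by (simp add: ints_iff F.L_diff F.L_divide vge_divide_iff)
  qed (simp add: a)
  show "teich_digit D a k \<in> \<O>" unfolding teich_digit_def using t r by blast
qed

text \<open>The linear term gains 1 and the two higher powers gain at least r, so each application
  gains at least min 1 r.\<close>

lemma pi_mult_funpow:
  assumes X: "vge r X" and r: "0 < r" and u: "vge 0 u"
  shows "vge (r + real k * min 1 r) ((pi_mult D u ^^ k) X)"
proof (induction k)
  case (Suc k)
  define Y where "Y = (pi_mult D u ^^ k) X"
  define g where "g = r + real k * min 1 r"
  have Y: "vge g Y" using Suc by (simp add: Y_def g_def)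
  have g: "r \<le> g" using r by (simp add: g_def)
  have n: "2 * g \<le> real n * g" if "2 \<le> n" for n :: nat using that g r by (intro mult_right_mono) auto
  have "2 \<le> q ^ 2" using nq(1,2) by simp
  then have "vge (g + min 1 r) (\<pi> * Y)" "vge (g + min 1 r) (u * Y ^ q)" "vge (g + min 1 r) (Y ^ q ^ 2)"
    using Y g n[of q] n[of "q ^ 2"] q_ge_3 vge_rv[of \<pi>]
    by (auto intro: vge_mult[OF vge_rv Y] vge_mult[OF u vge_power[OF Y]] vge_mono[OF vge_power[OF Y]])
  then have "vge (g + min 1 r) (pi_mult D u Y)" unfolding pi_mult_def by (intro vge_add)
  moreover have "g + min 1 r = r + real (Suc k) * min 1 r" by (simp add: g_def algebra_simps)
  ultimately show ?case by (simp add: Y_def)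
qed (simp add: X)

definition env :: "'c \<Rightarrow> 'c \<Rightarrow> 'c \<Rightarrow> nat \<Rightarrow> 'c" where
  "env u X Y = (\<lambda>i. if i = 0 then u else if i = 1 then X else if i = 2 then Y else 0)"

lemma env [simp]: "env u X Y 0 = u" "env u X Y (Suc 0) = X" "env u X Y 2 = Y"
  by (simp_all add: env_def)

text \<open>Homogeneity: with t whichever of X, Y has smaller valuation, the coefficient of degree n
  is t^n times an integral polynomial at (u, X/t, Y/t).\<close>

lemma lin_ser_bound:
  assumes a: "a \<in> \<O>" and b: "b \<in> \<O>" and u: "vge 0 u" and X: "vgt 0 X" and Y: "vgt 0 Y"
  shows "\<exists>d>0. \<forall>n. vge (d + real n * d) (lin_ser a b (env u X Y) $ n)"
proof (cases "X = 0 \<and> Y = 0")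
  case True
  have "lin_log a b (env u X Y) = 0"
  proof (rule fps_ext)
    fix n show "lin_log a b (env u X Y) $ n = 0 $ n" by (cases n) (simp_all add: lin_log_nth True)
  qed
  then have "lin_ser a b (env u X Y) = 0" by (simp add: lin_ser_def)
  then show ?thesis by (intro exI[of _ 1]) simp
next
  case False
  have "\<exists>t. t \<noteq> 0 \<and> vgt 0 t \<and> vge (rv t) X \<and> vge (rv t) Y"
  proof (cases "Y = 0 \<or> X \<noteq> 0 \<and> rv X \<le> rv Y")
    case True
    then have "X \<noteq> 0" using False by blast
    then show ?thesis using X True by (intro exI[of _ X]) (auto simp: vge_iff)
  next
    case False
    then show ?thesis using Y by (intro exI[of _ Y]) (auto simp: vge_iff)
  qed
  then obtain t where t: "t \<noteq> 0" "vgt 0 t" "vge (rv t) X" "vge (rv t) Y" by blast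
  define e where "e = env u (X / t) (Y / t)"
  have int: "vge 0 (e i)" for i
    using u t by (auto simp: e_def env_def vge_divide_iff)
  have "lin_log a b (env u X Y) = lin_log a b e oo fps_const t * fps_X"
  proof (rule fps_ext)
    fix n
    have "t ^ n * (a * (X / t) ^ n + b * (Y / t) ^ n) = a * X ^ n + b * Y ^ n"
      using t(1) by (simp add: power_divide field_simps)
    then show "lin_log a b (env u X Y) $ n = (lin_log a b e oo fps_const t * fps_X) $ n"
      by (simp add: lin_log_nth e_def mult.left_commute[of "t ^ n"])
  qed
  moreover have "lin_log a b e $ 0 = 0" by (simp add: lin_log_nth)
  ultimately have "lin_ser a b (env u X Y) = lin_ser a b e oo fps_const t * fps_X"
    by (simp add: lin_ser_def e_def fps_compose_assoc)
  then have eq: "lin_ser a b (env u X Y) $ n = t ^ n * lin_ser a b e $ n" for n by simp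
  have v: "vge (real n * rv t) (lin_ser a b (env u X Y) $ n)" for n
    unfolding eq by (rule vge_mult[OF vge_power[OF vge_rv] PR_integral[OF lin_ser_PR[OF a b] int]]) simp
  have rt: "0 < rv t" using t(1,2) by (simp add: vgt_iff)
  \<comment> \<open>Halving fits the bound n v(t) for n >= 1 into the shape d + n d; the coefficient
    for n = 0 is 0.\<close>
  have "vge (rv t / 2 + real n * (rv t / 2)) (lin_ser a b (env u X Y) $ n)" for n
  proof (cases n)
    case (Suc k)
    show ?thesis using v[of n] by (rule vge_mono) (use Suc rt in \<open>simp add: field_simps\<close>)
  qed simp
  then show ?thesis using rt by (intro exI[of _ "rv t / 2"]) simp
qed

lemma formal_add_eq: "CHAR('c) = 0 \<Longrightarrow> formal_add D u X Y = vsum D (\<lambda>n. lin_ser 1 1 (env u X Y) $ n)"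
  by (simp add: formal_add_def lin_ser_def lin_log_def)

lemma formal_mult_eq: "CHAR('c) = 0 \<Longrightarrow> formal_mult D u a X = vsum D (\<lambda>n. lin_ser a 0 (env u X 0) $ n)"
proof -
  assume c: "CHAR('c) = 0"
  have "lin_log a 0 (env u X 0) = (fps_const a * lt_log D u) oo fps_const X * fps_X"
    by (intro fps_ext) (simp add: lin_log_nth)
  then have "lin_ser a 0 (env u X 0) = (fps_inv (lt_log D u) oo (fps_const a * lt_log D u)) oo fps_const X * fps_X"
    by (simp add: lin_ser_def fps_compose_assoc)
  then have "lin_ser a 0 (env u X 0) $ n = X ^ n * (fps_inv (lt_log D u) oo (fps_const a * lt_log D u)) $ n" for n
    by simp
  then show ?thesis using c by (simp add: formal_mult_def fps_val_def mult.commute[of "X ^ _"])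
qed

lemma digit_bound:
  assumes a: "a \<in> \<O>" and u: "vge 0 u" and X: "vge r X" and r: "0 < r"
  shows "vge (r + real k * min 1 r) (teich_digit D a k * (pi_mult D u ^^ k) X)"
  by (rule vge_mult[OF _ pi_mult_funpow[OF X r u], of 0]) (use teich_digit_ints[OF a] in \<open>simp_all add: ints_iff\<close>)

lemma ints_0_1: "0 \<in> \<O>" "1 \<in> \<O>" by (simp_all add: ints_iff)

lemma formal_mult_pos:
  assumes a: "a \<in> \<O>" and u: "vge 0 u" and X: "vgt 0 X"
  shows "vgt 0 (formal_mult D u a X)"
proof (cases "CHAR('c) = 0")
  case True
  obtain d where "0 < d" "\<And>n. vge (d + real n * d) (lin_ser a 0 (env u X 0) $ n)"
    using lin_ser_bound[OF a ints_0_1(1) u X vgt_0] by blast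
  then show ?thesis unfolding formal_mult_eq[OF True] using vsum_converges(2) vge_vgt by blast
next
  case False
  obtain r where "0 < r" "vge r X" using X by (rule vgt_obtain)
  then have "vge r (formal_mult D u a X)"
    using False vsum_converges(2)[OF _ digit_bound[OF a u \<open>vge r X\<close> \<open>0 < r\<close>]] by (simp add: formal_mult_def)
  then show ?thesis using \<open>0 < r\<close> by (rule vge_vgt)
qed

context
  fixes \<sigma> :: "'c \<Rightarrow> 'c"
  assumes \<sigma>: "\<sigma> \<in> galois_C D (base D)"
begin

lemmas hom = aut_simps[OF galois_aut[OF \<sigma>]]

lemma b_coeff_galois: "\<sigma> (b_coeff D u k) = b_coeff D (\<sigma> u) k"
  by (induction k rule: induct_nat_012) (simp_all add: hom galois_fix[OF \<sigma>])

lemma lt_log_galois: "smap \<sigma> (lt_log D u) = lt_log D (\<sigma> u)"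
  by (rule fps_ext) (simp add: lt_log_def b_coeff_galois hom)

lemma lin_ser_galois:
  "\<sigma> (lin_ser a b (env u X Y) $ n) = lin_ser (\<sigma> a) (\<sigma> b) (env (\<sigma> u) (\<sigma> X) (\<sigma> Y)) $ n"
proof -
  note s = galois_aut[OF \<sigma>]
  have "smap \<sigma> (lin_ser a b (env u X Y)) = lin_ser (\<sigma> a) (\<sigma> b) (env (\<sigma> u) (\<sigma> X) (\<sigma> Y))"
    by (simp add: lin_ser_def lin_log_def smap_compose[OF s] smap_add[OF s] smap_mult[OF s] smap_const[OF s]
        smap_X[OF s] smap_fps_inv[OF s] lt_log_galois)
  then show ?thesis by (metis smap_nth)
qed

text \<open>In characteristic 0 the bound on the coefficients makes the series converge, so that the
  isometry sigma may be applied term by term to \<open>vsum\<close>.\<close>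

lemma formal_add_galois:
  assumes "vge 0 u" "vgt 0 X" "vgt 0 Y"
  shows "\<sigma> (formal_add D u X Y) = formal_add D (\<sigma> u) (\<sigma> X) (\<sigma> Y)"
proof (cases "CHAR('c) = 0")
  case True
  obtain d where "0 < d" "\<And>n. vge (d + real n * d) (lin_ser 1 1 (env u X Y) $ n)"
    using lin_ser_bound[OF ints_0_1(2) ints_0_1(2) assms] by blast
  from vsum_galois[OF \<sigma> this] show ?thesis
    unfolding formal_add_eq[OF True] by (simp add: lin_ser_galois hom)
qed (simp add: formal_add_def hom)

lemma formal_mult_galois:
  assumes a: "a \<in> \<O>" and u: "vge 0 u" and X: "vgt 0 X"
  shows "\<sigma> (formal_mult D u a X) = formal_mult D (\<sigma> u) a (\<sigma> X)"
proof (cases "CHAR('c) = 0")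
  case True
  obtain d where "0 < d" "\<And>n. vge (d + real n * d) (lin_ser a 0 (env u X 0) $ n)"
    using lin_ser_bound[OF a ints_0_1(1) u X vgt_0] by blast
  from vsum_galois[OF \<sigma> this] show ?thesis
    using galois_fix[OF \<sigma>, of a] a unfolding formal_mult_eq[OF True] by (simp add: lin_ser_galois hom ints_iff)
next
  case False
  obtain r where r: "0 < r" "vge r X" using X by (rule vgt_obtain)
  have "\<sigma> (pi_mult D u Y) = pi_mult D (\<sigma> u) (\<sigma> Y)" for Y by (simp add: pi_mult_def hom galois_fix[OF \<sigma>])
  then have p: "\<sigma> ((pi_mult D u ^^ k) X) = (pi_mult D (\<sigma> u) ^^ k) (\<sigma> X)" for k by (induction k) simp_all
  have "\<sigma> (teich_digit D a k) = teich_digit D a k" for k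
    using galois_fix[OF \<sigma>] teich_digit_ints[OF a] by (simp add: ints_iff)
  then show ?thesis
    using False vsum_galois[OF \<sigma> _ digit_bound[OF a u r(2,1)]] r(1) by (simp add: formal_mult_def hom p)
qed

lemma pi_sq_ints: "\<pi> ^ 2 \<in> \<O>"
  using vge_power[OF vge_rv[of \<pi>], of 2] by (auto simp: ints_iff F.L_power elim: vge_mono)

lemma pi2_torsion_galois:
  assumes u: "vge 0 u"
  shows "\<sigma> X \<in> pi2_torsion D (\<sigma> u) \<longleftrightarrow> X \<in> pi2_torsion D u"
proof -
  have "vgt 0 X \<Longrightarrow> formal_mult D (\<sigma> u) (\<pi> ^ 2) (\<sigma> X) = 0 \<longleftrightarrow> formal_mult D u (\<pi> ^ 2) X = 0"
    using formal_mult_galois[OF pi_sq_ints u, of X] hom(10) by metis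
  then show ?thesis by (auto simp: pi2_torsion_def val_gt_0_iff galois_vgt[OF \<sigma>])
qed

lemma is_basis_galois:
  assumes u: "vge 0 u" and B: "is_basis D u X Y"
  shows "is_basis D (\<sigma> u) (\<sigma> X) (\<sigma> Y)"
proof -
  have XY: "X \<in> pi2_torsion D u" "Y \<in> pi2_torsion D u" using B by (auto simp: is_basis_def)
  then have pos: "vgt 0 X" "vgt 0 Y" by (auto simp: pi2_torsion_def val_gt_0_iff)
  have comb: "formal_add D (\<sigma> u) (formal_mult D (\<sigma> u) a (\<sigma> X)) (formal_mult D (\<sigma> u) b (\<sigma> Y))
     = \<sigma> (formal_add D u (formal_mult D u a X) (formal_mult D u b Y))" if "a \<in> \<O>" "b \<in> \<O>" for a b
    using that u pos by (simp add: formal_add_galois formal_mult_galois formal_mult_pos)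
  have "\<exists>a\<in>\<O>. \<exists>b\<in>\<O>. Z = formal_add D (\<sigma> u) (formal_mult D (\<sigma> u) a (\<sigma> X)) (formal_mult D (\<sigma> u) b (\<sigma> Y))"
    if Z: "Z \<in> pi2_torsion D (\<sigma> u)" for Z
  proof -
    obtain Z' where Z': "Z = \<sigma> Z'" using galois_aut[OF \<sigma>] by (metis field_aut_def bij_def surjD)
    then have "Z' \<in> pi2_torsion D u" using Z pi2_torsion_galois[OF u] by simp
    then obtain a b where "a \<in> \<O>" "b \<in> \<O>" "Z' = formal_add D u (formal_mult D u a X) (formal_mult D u b Y)"
      using B unfolding is_basis_def by blast
    then show ?thesis using Z' comb by metis
  qed
  moreover have "2 \<le> val D a \<and> 2 \<le> val D b"
    if ab: "a \<in> \<O>" "b \<in> \<O>" and z: "formal_add D (\<sigma> u) (formal_mult D (\<sigma> u) a (\<sigma> X)) (formal_mult D (\<sigma> u) b (\<sigma> Y)) = 0" for a b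
  proof -
    have "formal_add D u (formal_mult D u a X) (formal_mult D u b Y) = 0" using z comb[OF ab] hom(10) by metis
    then show ?thesis using B ab unfolding is_basis_def by blast
  qed
  ultimately show ?thesis
    using XY pi2_torsion_galois[OF u] unfolding is_basis_def by blast
qed

lemma Y22_galois:
  assumes "(X, Y, u) \<in> Y22 D" shows "(\<sigma> X, \<sigma> Y, \<sigma> u) \<in> Y22 D"
proof -
  have "val D (\<sigma> u) = val D u" using \<sigma> by (simp add: galois_C_def)
  moreover have "0 < val D u" "is_basis D u X Y" using assms by (auto simp: Y22_def lubin_tate_curve_def)
  moreover from this(1) have "vge 0 u" by (simp add: val_ge_0_iff[symmetric])
  ultimately show ?thesis using assms is_basis_galois by (simp add: Y22_def lubin_tate_curve_def)
qed

end

lemma Y22_invariant: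
  assumes \<sigma>: "\<sigma> \<in> galois_C D (base D)"
  shows "pt_act \<sigma> ` Y22 D = Y22 D"
proof -
  have sub: "pt_act \<rho> ` Y22 D \<subseteq> Y22 D" if "\<rho> \<in> galois_C D (base D)" for \<rho>
    using Y22_galois[OF galois_inv[OF that]] by (auto simp: pt_act_def)
  have "Y22 D = pt_act \<sigma> ` pt_act (inv_into UNIV \<sigma>) ` Y22 D"
    by (simp add: image_image pt_act_inv[OF \<sigma>])
  also have "\<dots> \<subseteq> pt_act \<sigma> ` Y22 D" by (intro image_mono sub galois_inv \<sigma>)
  finally show ?thesis using sub[OF \<sigma>] by blast
qed

end

section \<open>The action of inertia on components and reductions\<close>

lemma poly_funs_power: "f \<in> poly_funs \<Longrightarrow> (\<lambda>P. f P ^ n) \<in> poly_funs"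
proof (induction n)
  case 0
  show ?case using poly_funs.const[of 1] by simp
next
  case (Suc n)
  then show ?case using poly_funs.mult[of f "\<lambda>P. f P ^ n"] by simp
qed

lemma poly_funs_diff: "f \<in> poly_funs \<Longrightarrow> g \<in> poly_funs \<Longrightarrow> (\<lambda>P. f P - g P) \<in> poly_funs"
  using poly_funs.add[OF _ poly_funs.mult[OF poly_funs.const[of "- 1"]], of f g] by simp

lemma poly_funs_divide: "f \<in> poly_funs \<Longrightarrow> (\<lambda>P. f P / c) \<in> poly_funs"
  using poly_funs.mult[OF _ poly_funs.const[of "inverse c"], of f] by (simp add: divide_inverse)

lemma coordinates_poly: "a_co D i \<in> poly_funs" "z1_co D j \<in> poly_funs"
proof -
  have "x_co D = (\<lambda>P. (\<lambda>(X, Y, u). X) P / kap D)" "y_co D = (\<lambda>P. (\<lambda>(X, Y, u). Y) P / kap D)"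
    by (auto simp: x_co_def y_co_def)
  then have xy: "x_co D \<in> poly_funs" "y_co D \<in> poly_funs"
    by (simp_all only: poly_funs_divide poly_funs.coord1 poly_funs.coord2)
  show "z1_co D j \<in> poly_funs"
    unfolding z1_co_def[abs_def] by (intro poly_funs_divide poly_funs_diff xy poly_funs.const)
  show "a_co D i \<in> poly_funs"
    unfolding a_co_def[abs_def] Z1_co_def det_co_def
    by (intro poly_funs_divide poly_funs_diff poly_funs.mult poly_funs_power xy poly_funs.const)
qed

lemma (in local_field_setting) some_lift: "reduces_to D (SOME t. reduces_to D t c) c"
  by (rule someI_ex) (metis redn_lift reduces_to_iff)

section \<open>Assembling the action on components and on coordinate rings\<close>

context inertia_action
begin

lemma components_transfer:
  "bij_betw (\<lambda>S. pt_act \<sigma> ` S) (components D (Y22 D)) (components D (Y22 D))"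
  by (rule components_act[OF \<sigma>_galois Y22_invariant[OF \<sigma>_galois]])

lemma component_transfer:
  assumes i: "component_of_index D (\<zeta>, \<mu>) S"
  shows "component_of_index D (inverse \<zeta>F * \<zeta>, \<mu> - \<eta>F) (pt_act \<sigma> ` S)"
proof -
  have \<zeta>: "\<zeta> \<in> resfield D (base D)" "\<zeta> \<noteq> 0" "\<mu> \<in> resfield D (base D)" "S \<in> components D (Y22 D)"
    and red: "\<And>P. P \<in> S \<Longrightarrow> reduces_to D (det_co D P) \<zeta> \<and> reduces_to D (second_co D \<zeta> P) (\<mu> * \<zeta>)"
    using i by (auto simp: component_of_index_def)
  have "pt_act \<sigma> ` S \<in> components D (Y22 D)" using components_transfer \<zeta>(4) by (auto simp: bij_betw_def)
  moreover have "reduces_to D (det_co D (pt_act \<sigma> P)) (inverse \<zeta>F * \<zeta>) \<and>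
     reduces_to D (second_co D (inverse \<zeta>F * \<zeta>) (pt_act \<sigma> P)) ((\<mu> - \<eta>F) * (inverse \<zeta>F * \<zeta>))" if "P \<in> S" for P
    using index_transfer[OF \<zeta>(1)] red[OF that] by blast
  ultimately show ?thesis
    using \<zeta> teich_quotient(1)[OF \<zeta>(1)] F.resfield_diff[OF \<zeta>(3) action_gam0(3)] action_gam0(2)
    by (simp add: component_of_index_def)
qed

text \<open>Integrality puts the coordinate functions in the power-bounded ring on both affinoids.
  The uniform estimates of \<open>a_transfer\<close> and \<open>z1_transfer\<close> make the
  differences topologically nilpotent, which turns them into equalities of classes.\<close>

lemma affinoid_transfer:
  assumes i: "component_of_index D (\<zeta>, \<mu>) S" and j: "(x0, y0) \<in> S00 D (\<zeta>, \<mu>)"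
  defines "X \<equiv> X_affinoid D S (x0, y0)"
    and "X' \<equiv> X_affinoid D (pt_act \<sigma> ` S) (inverse \<zeta>E * x0, inverse \<zeta>E * y0)"
    and "i' \<equiv> (inverse \<zeta>F * \<zeta>, \<mu> - \<eta>F)" and "j' \<equiv> (inverse \<zeta>E * x0, inverse \<zeta>E * y0)"
  shows "pt_act \<sigma> ` X = X'"
    "red_class D X (a_co D (\<zeta>, \<mu>)) \<in> carrier (reduction_ring D X)"
    "red_class D X (z1_co D (x0, y0)) \<in> carrier (reduction_ring D X)"
    "red_class D X' (a_co D i') \<in> carrier (reduction_ring D X')"
    "red_class D X' (z1_co D j') \<in> carrier (reduction_ring D X')"
    "red_act \<sigma> X (red_class D X' (a_co D i')) =
       red_const D X (inverse (\<zeta>E ^ (q + 1))) \<otimes>\<^bsub>reduction_ring D X\<^esub>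
         (red_class D X (a_co D (\<zeta>, \<mu>)) \<oplus>\<^bsub>reduction_ring D X\<^esub> red_const D X (\<eta>E * \<zeta>))"
    "red_act \<sigma> X (red_class D X' (z1_co D j')) = red_class D X (z1_co D (x0, y0))"
proof -
  have y0: "y0 ^ nq = - 1" using j by (simp add: S00_def nq_eq)
  have \<zeta>: "\<zeta> \<in> resfield D (base D)" using i by (simp add: component_of_index_def)
  note i' = component_transfer[OF i, folded i'_def]
  have j': "j' \<in> S00 D i'" using S00_transfer[of \<zeta> \<mu>] j by (force simp: bij_betw_def j'_def i'_def)
  have "X \<subseteq> S" "X' \<subseteq> pt_act \<sigma> ` S" by (auto simp: X_def X'_def X_affinoid_def)
  then show im: "pt_act \<sigma> ` X = X'"
    using X_transfer[OF y0, of _ S x0] unfolding X_def X'_def by blast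
  have int: "vge 0 (a_co D (\<zeta>, \<mu>) P)" "vge 0 (z1_co D (x0, y0) P)" if "P \<in> X" for P
    using coordinates_integral[OF i j] that by (auto simp: X_def)
  have int': "vge 0 (a_co D i' P)" "vge 0 (z1_co D j' P)" if "P \<in> X'" for P
    using coordinates_integral[OF i'[unfolded i'_def] j'[unfolded i'_def j'_def]] that
    by (auto simp: X'_def i'_def j'_def)
  have pb: "(\<lambda>P\<in>X. a_co D (\<zeta>, \<mu>) P) \<in> power_bounded D X" "(\<lambda>P\<in>X. z1_co D (x0, y0) P) \<in> power_bounded D X"
    using int by (simp_all add: power_bounded_iff affinoid_poly coordinates_poly)
  have pb': "(\<lambda>P\<in>X'. a_co D i' P) \<in> power_bounded D X'" "(\<lambda>P\<in>X'. z1_co D j' P) \<in> power_bounded D X'"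
    using int' by (simp_all add: power_bounded_iff affinoid_poly coordinates_poly)
  show "red_class D X (a_co D (\<zeta>, \<mu>)) \<in> carrier (reduction_ring D X)"
    "red_class D X (z1_co D (x0, y0)) \<in> carrier (reduction_ring D X)"
    "red_class D X' (a_co D i') \<in> carrier (reduction_ring D X')"
    "red_class D X' (z1_co D j') \<in> carrier (reduction_ring D X')"
    by (intro red_class_carrier pb pb')+
  have act: "red_act \<sigma> X (red_class D X' f) = red_class D X (\<lambda>P. \<sigma> (f (pt_act \<sigma> P)))"
    and act_pb: "(\<lambda>P\<in>X. \<sigma> (f (pt_act \<sigma> P))) \<in> power_bounded D X"
    if "f \<in> poly_funs" "\<And>P. P \<in> X' \<Longrightarrow> vge 0 (f P)" for f
  proof -
    have "(\<lambda>P\<in>X'. f P) \<in> power_bounded D X'" using that by (simp add: power_bounded_iff affinoid_poly)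
    then show "red_act \<sigma> X (red_class D X' f) = red_class D X (\<lambda>P. \<sigma> (f (pt_act \<sigma> P)))"
      using red_act_iso(2)[OF \<sigma>_galois, where S = X and f = f] im by simp
    show "(\<lambda>P\<in>X. \<sigma> (f (pt_act \<sigma> P))) \<in> power_bounded D X"
      unfolding power_bounded_iff
    proof (intro conjI ballI affinoid_poly transport_poly[OF \<sigma>_galois] that(1))
      fix P assume P: "P \<in> X"
      then have "pt_act \<sigma> P \<in> X'" using im by blast
      then show "vge 0 ((\<lambda>P\<in>X. \<sigma> (f (pt_act \<sigma> P))) P)" using P that(2) by (simp add: \<sigma>_vge)
    qed
  qed
  define A where "A = (SOME t. reduces_to D t (inverse (\<zeta>E ^ (q + 1))))"
  define B where "B = (SOME t. reduces_to D t (\<eta>E * \<zeta>))"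
  have A: "reduces_to D A (inverse (\<zeta>E ^ (q + 1)))" and B: "reduces_to D B (\<eta>E * \<zeta>)"
    unfolding A_def B_def by (rule some_lift)+
  have cA: "(\<lambda>P\<in>X. A) \<in> power_bounded D X" and cB: "(\<lambda>P\<in>X. B) \<in> power_bounded D X"
    using A B by (auto intro!: const_pb simp: reduces_to_iff)
  have aB: "(\<lambda>P\<in>X. a_co D (\<zeta>, \<mu>) P + B) \<in> power_bounded D X"
    using int(1) B affinoid_poly[OF poly_funs.add[OF coordinates_poly(1) poly_funs.const[of B]]]
    by (auto simp: power_bounded_iff reduces_to_iff vge_add)
  have AaB: "(\<lambda>P\<in>X. A * (a_co D (\<zeta>, \<mu>) P + B)) \<in> power_bounded D X"
    using int(1) A B affinoid_poly[OF poly_funs.mult[OF poly_funs.const[of A] poly_funs.add[OF coordinates_poly(1) poly_funs.const[of B]]]]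
    by (auto simp: power_bounded_iff reduces_to_iff vge_add vge_mult_0)
  obtain e where "0 < e" "\<And>P. vge 0 (a_co D (\<zeta>, \<mu>) P) \<Longrightarrow>
      vge e (\<sigma> (a_co D i' (pt_act \<sigma> P)) - A * (a_co D (\<zeta>, \<mu>) P + B))"
    using a_transfer[OF \<zeta> A B] unfolding i'_def by blast
  then have "red_class D X (\<lambda>P. \<sigma> (a_co D i' (pt_act \<sigma> P))) = red_class D X (\<lambda>P. A * (a_co D (\<zeta>, \<mu>) P + B))"
    using int(1) by (intro red_class_cong[OF act_pb[OF coordinates_poly(1) int'(1)] AaB]) auto
  then show "red_act \<sigma> X (red_class D X' (a_co D i')) =
       red_const D X (inverse (\<zeta>E ^ (q + 1))) \<otimes>\<^bsub>reduction_ring D X\<^esub>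
         (red_class D X (a_co D (\<zeta>, \<mu>)) \<oplus>\<^bsub>reduction_ring D X\<^esub> red_const D X (\<eta>E * \<zeta>))"
    unfolding red_const_def A_def[symmetric] B_def[symmetric]
    by (simp only: act[OF coordinates_poly(1) int'(1)] red_class_add[OF pb(1) cB] red_class_mult[OF cA aB])
  obtain e where "0 < e" "\<And>P. vge 0 (z1_co D (x0, y0) P) \<Longrightarrow>
      vge e (\<sigma> (z1_co D j' (pt_act \<sigma> P)) - z1_co D (x0, y0) P)"
    using z1_transfer[OF y0, of x0] unfolding j'_def by blast
  then have "red_class D X (\<lambda>P. \<sigma> (z1_co D j' (pt_act \<sigma> P))) = red_class D X (z1_co D (x0, y0))"
    using int(2) by (intro red_class_cong[OF act_pb[OF coordinates_poly(2) int'(2)] pb(2)]) auto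
  then show "red_act \<sigma> X (red_class D X' (z1_co D j')) = red_class D X (z1_co D (x0, y0))"
    by (simp only: act[OF coordinates_poly(2) int'(2)])
qed

end

theorem corollary6p2:
  fixes D :: "('c::field, 'k::field) lt_data"
    and E :: "'c set"
    and rF rE :: "('c \<Rightarrow> 'c) \<Rightarrow> 'c"
    and \<sigma> :: "'c \<Rightarrow> 'c"
    and zeta_F lambda_F zeta_E lambda_E :: 'k
  assumes "lubin_tate_setting D"
    and "unramified_quadratic D E"
    and "reciprocity_map D (base D) rF"
    and "reciprocity_map D E rE"
    and "\<sigma> \<in> inertia D (base D)"
    and "unit_coords D (base D) (rF \<sigma>) = (zeta_F, lambda_F)"
    and "unit_coords D E (rE \<sigma>) = (zeta_E, lambda_E)"
  shows
    "bij_betw (\<lambda>S. pt_act \<sigma> ` S) (components D (Y22 D)) (components D (Y22 D)) \<and>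
     (\<forall>\<zeta> \<mu> S. component_of_index D (\<zeta>, \<mu>) S \<longrightarrow>
        component_of_index D (inverse zeta_F * \<zeta>, \<mu> - lambda_F) (pt_act \<sigma> ` S)) \<and>
     (\<forall>\<zeta>\<in>resfield D (base D) - {0}. \<forall>\<mu>\<in>resfield D (base D).
        bij_betw (\<lambda>(x0, y0). (inverse zeta_E * x0, inverse zeta_E * y0))
          (S00 D (\<zeta>, \<mu>)) (S00 D (inverse zeta_F * \<zeta>, \<mu> - lambda_F))) \<and>
     (\<forall>\<zeta> \<mu> S x0 y0. component_of_index D (\<zeta>, \<mu>) S \<and> (x0, y0) \<in> S00 D (\<zeta>, \<mu>) \<longrightarrow>
        (\<forall>P\<in>S. reduces_to D (x_co D P) x0 \<and> reduces_to D (y_co D P) y0 \<longrightarrow>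
           reduces_to D (x_co D (pt_act \<sigma> P)) (inverse zeta_E * x0) \<and>
           reduces_to D (y_co D (pt_act \<sigma> P)) (inverse zeta_E * y0))) \<and>
     (\<forall>\<zeta> \<mu> S x0 y0. component_of_index D (\<zeta>, \<mu>) S \<and> (x0, y0) \<in> S00 D (\<zeta>, \<mu>) \<longrightarrow>
       (let i = (\<zeta>, \<mu>); i' = (inverse zeta_F * \<zeta>, \<mu> - lambda_F);
            j = (x0, y0); j' = (inverse zeta_E * x0, inverse zeta_E * y0);
            X = X_affinoid D S j; X' = X_affinoid D (pt_act \<sigma> ` S) j';
            R = reduction_ring D X; R' = reduction_ring D X'
        in pt_act \<sigma> ` X = X' \<and>
           red_class D X (a_co D i) \<in> carrier R \<and> red_class D X (z1_co D j) \<in> carrier R \<and>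
           red_class D X' (a_co D i') \<in> carrier R' \<and> red_class D X' (z1_co D j') \<in> carrier R' \<and>
           red_act \<sigma> X \<in> ring_iso R' R \<and>
           (\<forall>P\<in>X. \<forall>r\<in>carrier R'.
              reduced_point D P (red_act \<sigma> X r) = reduced_point D (pt_act \<sigma> P) r) \<and>
           red_act \<sigma> X (red_class D X' (a_co D i')) =
             red_const D X (inverse (zeta_E ^ (resq D + 1))) \<otimes>\<^bsub>R\<^esub>
               (red_class D X (a_co D i) \<oplus>\<^bsub>R\<^esub> red_const D X (lambda_E * \<zeta>)) \<and>
           red_act \<sigma> X (red_class D X' (z1_co D j')) = red_class D X (z1_co D j)))"
proof -
  interpret lubin_tate_setting D by (rule assms(1))
  interpret inertia_action D E rF rE \<sigma> zeta_F lambda_F zeta_E lambda_E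
    by unfold_locales (rule assms)+
  show ?thesis
    unfolding Let_def
  proof (intro conjI allI ballI impI; (elim conjE)?)
    fix \<zeta> \<mu> S x0 y0
    assume i: "component_of_index D (\<zeta>, \<mu>) S" and j: "(x0, y0) \<in> S00 D (\<zeta>, \<mu>)"
    note t = affinoid_transfer[OF i j]
    show "red_act \<sigma> (X_affinoid D S (x0, y0)) \<in> ring_iso
        (reduction_ring D (X_affinoid D (pt_act \<sigma> ` S) (inverse zeta_E * x0, inverse zeta_E * y0)))
        (reduction_ring D (X_affinoid D S (x0, y0)))"
      using red_act_iso(1)[OF \<sigma>_galois, of "X_affinoid D S (x0, y0)"] unfolding t(1) .
    show "reduced_point D P (red_act \<sigma> (X_affinoid D S (x0, y0)) r) = reduced_point D (pt_act \<sigma> P) r"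
      if "P \<in> X_affinoid D S (x0, y0)"
        "r \<in> carrier (reduction_ring D (X_affinoid D (pt_act \<sigma> ` S) (inverse zeta_E * x0, inverse zeta_E * y0)))" for P r
      using reduced_point_act[OF \<sigma> that(1), of r] that(2) unfolding t(1) by blast
  qed (rule components_transfer component_transfer S00_transfer iffD2[OF xy_transfer(1)] iffD2[OF xy_transfer(2)]
      affinoid_transfer; assumption)+
qed

end
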